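(* Let $d\ge2$, $\varpi\in\mathrm{DC}_d$, $r_0>0$ and $r\in(0,r_0)$. There exists $\varepsilon_0=\varepsilon_0(\varpi,r_0,r)>0$ such that for every $V\in C^\omega_{r_0}(\mathbb{T}^d,\mathbb{R})$ with $|V|_{r_0}<\varepsilon_0$, the spectral gaps of the continuous operator $\mathcal{L}_{V,\varpi}$ satisfy $$|G_k(V)|\le\varepsilon_0^{\frac23}e^{-r|k|},\qquad\forall\,k\in\mathbb{Z}^d\setminus\{0\}.$$
   Context: $\mathbb{T}^d=(\mathbb{R}/\mathbb{Z})^d$. The continuous quasi-periodic Schr\"odinger operator on $L^2(\mathbb{R})$ is $(\mathcal{L}_{V,\varpi}y)(t)=-y''(t)+V(\varpi t)y(t)$. $C^\omega_{r_0}(\mathbb{T}^d,\mathbb{R})$ is the set of functions, real-valued on $\mathbb{T}^d$, with bounded analytic extension to $\{|\Im x|<r_0\}$ (each coordinate), and $|V|_{r_0}=\sup_{|\Im x|<r_0}|V(x)|$. $|k|=\sum_j|k_j|$. Gap labelling: let $N(E)$ be the integrated density of states of $\mathcal{L}_{V,\varpi}$, i.e. $N(E)=\lim_{L\to\infty}\frac1L\#\{\text{Dirichlet eigenvalues of }\mathcal{L}_{V,\varpi}\text{ on }[0,L]\text{ that are}\le E\}$. On each bounded component $G$ of the complement of the spectrum there is a unique $k\in\mathbb{Z}^d$ with $N|_G\equiv\langle k,\varpi\rangle$ (equivalently, the fibered rotation number equals $\langle k,\varpi\rangle/2$ in the normalization where an angle $2\pi$ counts as $1$, up to sign). $G_k(V)$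 is the open gap with label $k$, i.e. the interior of $\{E:N(E)=\langle k,\varpi\rangle\}$ for $\langle k,\varpi\rangle>0$ (empty, of length $0$, if the gap is collapsed or the label does not occur). $|G_k(V)|$ is its length. $\mathrm{DC}_d=\bigcup_{\gamma>0,\tau>d-1}\mathrm{DC}_d(\gamma,\tau)$, $\mathrm{DC}_d(\gamma,\tau)=\{x\in\mathbb{R}^d:\inf_{j\in\mathbb{Z}}|\langle n,x\rangle-j|>\gamma|n|^{-\tau}\ \forall n\in\mathbb{Z}^d\setminus\{0\}\}$. *)

theory Defs
  imports "HOL-Analysis.Analysis"
begin

text \<open>Functions on \<open>(R/Z)^d\<close> are \<open>Z^d\<close>-periodic functions on \<open>real ^ 'd\<close>, with \<open>d = CARD('d)\<close>.\<close>

definition l1_norm :: "int ^ 'd::finite \<Rightarrow> real" where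
  "l1_norm k = (\<Sum>j\<in>UNIV. \<bar>real_of_int (k $ j)\<bar>)"

definition int_inner :: "int ^ 'd::finite \<Rightarrow> real ^ 'd \<Rightarrow> real" where
  "int_inner k x = (\<Sum>j\<in>UNIV. real_of_int (k $ j) * x $ j)"

definition DC_const :: "real \<Rightarrow> real \<Rightarrow> (real ^ 'd::finite) set" where
  "DC_const \<gamma> \<tau> =
     {x. \<forall>n. n \<noteq> 0 \<longrightarrow> (INF j::int. \<bar>int_inner n x - real_of_int j\<bar>) > \<gamma> * l1_norm n powr (- \<tau>)}"

definition DC :: "(real ^ 'd::finite) set" where
  "DC = (\<Union>\<gamma>\<in>{0<..}. \<Union>\<tau>\<in>{real CARD('d) - 1<..}. DC_const \<gamma> \<tau>)"

definition strip :: "real \<Rightarrow> (complex ^ 'd::finite) set" where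
  "strip r = {z. \<forall>j. \<bar>Im (z $ j)\<bar> < r}"

text \<open>Analyticity in several complex variables: Frechet differentiability with a complex-linear
  derivative. The intended domain \<open>S\<close> is open.\<close>

definition analytic_several :: "(complex ^ 'd::finite \<Rightarrow> complex) \<Rightarrow> (complex ^ 'd) set \<Rightarrow> bool" where
  "analytic_several F S \<longleftrightarrow>
     (\<forall>z\<in>S. \<exists>D. (F has_derivative D) (at z) \<and> (\<forall>c v. D (c *s v) = c * D v))"

definition is_bounded_analytic_ext ::
    "real \<Rightarrow> (real ^ 'd::finite \<Rightarrow> real) \<Rightarrow> (complex ^ 'd \<Rightarrow> complex) \<Rightarrow> bool" where
  "is_bounded_analytic_ext r V F \<longleftrightarrow>
     analytic_several F (strip r) \<and>
     bounded (F ` strip r) \<and>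
     (\<forall>z\<in>strip r. \<forall>n::int ^ 'd. F (\<chi> j. z $ j + of_int (n $ j)) = F z) \<and>
     (\<forall>x. F (\<chi> j. complex_of_real (x $ j)) = complex_of_real (V x))"

definition C_omega :: "real \<Rightarrow> (real ^ 'd::finite \<Rightarrow> real) set" where
  "C_omega r = {V. (\<forall>x. \<forall>n::int ^ 'd. V (\<chi> j. x $ j + of_int (n $ j)) = V x) \<and>
                   (\<exists>F. is_bounded_analytic_ext r V F)}"

text \<open>For \<open>r > 0\<close> the extension is unique on \<open>strip r\<close>, so the choice does not affect the
  supremum.\<close>

definition strip_norm :: "real \<Rightarrow> (real ^ 'd::finite \<Rightarrow> real) \<Rightarrow> real" where
  "strip_norm r V = (SUP z\<in>strip r. cmod ((SOME F. is_bounded_analytic_ext r V F) z))"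

text \<open>\<open>E\<close> is an eigenvalue of \<open>y \<mapsto> - y'' + q y\<close> on \<open>[0, L]\<close> with \<open>y 0 = y L = 0\<close>. For continuous
  \<open>q\<close> every eigenfunction in the Sobolev domain is twice continuously differentiable, so
  classical derivatives (one-sided at the end points) suffice.\<close>

definition dirichlet_eigenvalue :: "(real \<Rightarrow> real) \<Rightarrow> real \<Rightarrow> real \<Rightarrow> bool" where
  "dirichlet_eigenvalue q L E \<longleftrightarrow>
     (\<exists>(y :: real \<Rightarrow> complex) y' y''.
        (\<forall>t\<in>{0..L}.
           (y has_vector_derivative y' t) (at t within {0..L}) \<and>
           (y' has_vector_derivative y'' t) (at t within {0..L}) \<and>
           - y'' t + complex_of_real (q t) * y t = complex_of_real E * y t) \<and>
        y 0 = 0 \<and> y L = 0 \<and> (\<exists>t\<in>{0..L}. y t \<noteq> 0))"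

definition qp_potential :: "(real ^ 'd::finite \<Rightarrow> real) \<Rightarrow> real ^ 'd \<Rightarrow> real \<Rightarrow> real" where
  "qp_potential V \<omega> t = V (t *\<^sub>R \<omega>)"

text \<open>Dirichlet eigenvalues on an interval are simple, so counting them as a set agrees with
  counting multiplicities.\<close>

definition IDS :: "(real ^ 'd::finite \<Rightarrow> real) \<Rightarrow> real ^ 'd \<Rightarrow> real \<Rightarrow> real" where
  "IDS V \<omega> E =
     Lim at_top (\<lambda>L::real. real (card {e. dirichlet_eigenvalue (qp_potential V \<omega>) L e \<and> e \<le> E}) / L)"

definition gap :: "(real ^ 'd::finite \<Rightarrow> real) \<Rightarrow> real ^ 'd \<Rightarrow> int ^ 'd \<Rightarrow> real set" where
  "gap V \<omega> k = (if int_inner k \<omega> > 0 then interior {E. IDS V \<omega> E = int_inner k \<omega>} else {})"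

end

theory Submission
  imports Defs "HOL-Complex_Analysis.Complex_Analysis" "HOL-Real_Asymp.Real_Asymp"
begin

text \<open>Energies with the same label \<open>k\<close> have the same rotation number, so it suffices to show that
  the rotation number increases strictly whenever the energy is raised by the claimed bound.
  The Schroedinger equation is written as a planar system whose polar angle carries the rotation
  number, and whose coefficients are a constant plus a small quasi-periodic part. Averaging removes
  the nonresonant Fourier modes of the perturbation; when the rotation number of the constant part
  is close to half a frequency \<open>\<langle>n, \<omega>\<rangle>\<close>, a rotation by that frequency brings it close to zero. These
  steps shrink the perturbation superexponentially, and stop once the label, shifted by the
  resonances met so far, is short compared with the reach of the averaging. Since the constant part
  then has to be elliptic or to vanish, the system has been conjugated, by maps of distortion
  \<open>\<Gamma>\<close>, to a rotation with an error \<open>e\<close> satisfying \<open>e \<Gamma> ^ 4 \<le> const * exp (- r \<bar>k\<bar>)\<close>. In these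
  coordinates raising the energy by \<open>40 \<kappa> e \<Gamma>\<close> speeds up the angle by more than the error. The
  integrated density of states is the rotation number divided by \<open>\<pi>\<close>, by Pruefer's oscillation
  theory.\<close>

text \<open>No spectral description of a gap is used: a gap enters only through the common rotation
  number of its energies, so a comparison of two energies suffices. The system is never reduced
  completely. The number of steps depends on the label, and the remaining error only has to lose
  against the speed-up caused by the energy. The power \<open>\<Gamma> ^ 4\<close> is the price of
  that comparison: the speed-up is a mean effect, seen through a bounded correction of the angle,
  whose drift costs three powers of \<Gamma> and has to stay below a term of order 1 / \<Gamma>.

  The obstacle is that one \<epsilon>0 must serve all energies, also those near 0, where the natural
  frequency sqrt E degenerates. The scale \<kappa> is therefore kept away from 0; the perturbation
  acquires a factor 1 / \<kappa>, which all steps carry along unchanged until it cancels against the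
  \<kappa> in the energy shift. The exponent 2/3 results from this balance: for \<epsilon>0 = exp (-
  4/3 l^2) the estimate yields exp (- 11/12 l^2), and 2/3 of 4/3 is 8/9 < 11/12.\<close>

no_notation fps_nth (infixl "$" 75)

section \<open>Absolutely convergent quasi-periodic expansions\<close>

lemma l1_norm_nonneg: "l1_norm k \<ge> 0"
  unfolding l1_norm_def by (intro sum_nonneg) auto

lemma l1_norm_triangle: "l1_norm (m + n) \<le> l1_norm m + l1_norm n"
  unfolding l1_norm_def sum.distrib[symmetric] by (intro sum_mono) auto

lemma l1_norm_minus [simp]: "l1_norm (- n) = l1_norm n"
  unfolding l1_norm_def by simp

lemma l1_norm_zero [simp]: "l1_norm 0 = 0"
  unfolding l1_norm_def by simp

lemma l1_norm_ge_1: assumes "n \<noteq> 0" shows "l1_norm n \<ge> 1"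
proof -
  obtain j where j: "n $ j \<noteq> 0" using assms by (auto simp: vec_eq_iff)
  hence "1 \<le> \<bar>real_of_int (n $ j)\<bar>" by linarith
  also have "\<dots> \<le> l1_norm n" unfolding l1_norm_def by (rule member_le_sum) auto
  finally show ?thesis .
qed

lemma l1_norm_diff: "l1_norm (m - n) \<le> l1_norm m + l1_norm n"
  using l1_norm_triangle[of m "- n"] by simp

lemma int_inner_add: "int_inner (m + n) x = int_inner m x + int_inner n x"
  unfolding int_inner_def by (simp add: sum.distrib algebra_simps)

lemma int_inner_minus [simp]: "int_inner (- n) x = - int_inner n x"
  unfolding int_inner_def by (simp add: sum_negf)

lemma int_inner_diff: "int_inner (m - n) x = int_inner m x - int_inner n x"
  unfolding int_inner_def by (simp add: sum_subtractf algebra_simps)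

lemma int_inner_zero [simp]: "int_inner 0 x = 0"
  unfolding int_inner_def by simp

text \<open>Frequencies may repeat in the expansion below. This makes products a mere reindexing and
  frequency cut-offs a restriction of the index set.\<close>

definition mode :: "real ^ 'd::finite \<Rightarrow> int ^ 'd \<Rightarrow> real \<Rightarrow> complex" where
  "mode \<omega> n t = cis (2 * pi * int_inner n \<omega> * t)"

text \<open>A weighted Wiener algebra with weight exp (\<rho> |n|), seen only along the orbit t
  \<omega>; the function on the torus is never formed. \<open>C\<close> is any upper bound of the
  norm, so constants can be enlarged freely, and \<open>S\<close> records which frequencies may
  occur.\<close>

definition wiener :: "real ^ 'd::finite \<Rightarrow> (int ^ 'd) set \<Rightarrow> real \<Rightarrow> real \<Rightarrow> (real \<Rightarrow> complex) \<Rightarrow> bool" where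
  "wiener \<omega> S \<rho> C f \<longleftrightarrow>
     (\<exists>(a :: nat \<Rightarrow> complex) n W. (\<forall>i. a i \<noteq> 0 \<longrightarrow> n i \<in> S) \<and>
        ((\<lambda>i. cmod (a i) * exp (\<rho> * l1_norm (n i))) has_sum W) UNIV \<and> W \<le> C \<and>
        (\<forall>t. ((\<lambda>i. a i * mode \<omega> (n i) t) has_sum f t) UNIV))"

lemma norm_mode [simp]: "cmod (mode \<omega> n t) = 1" by (simp add: mode_def)
lemma mode_add: "mode \<omega> (m + n) t = mode \<omega> m t * mode \<omega> n t"
  by (simp add: mode_def int_inner_add cis_mult algebra_simps)
lemma mode_zero [simp]: "mode \<omega> 0 t = 1" by (simp add: mode_def)
lemma cnj_mode: "cnj (mode \<omega> n t) = mode \<omega> (- n) t"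
  by (simp add: mode_def cis_cnj)
lemma mode_minus_mult [simp]: "mode \<omega> (- n) t * mode \<omega> n t = 1"
  by (simp flip: mode_add)

lemma mode_deriv:
  "(mode \<omega> n has_vector_derivative \<i> * of_real (2 * pi * int_inner n \<omega>) * mode \<omega> n t) (at t within A)"
proof -
  define k where "k = \<i> * complex_of_real (2 * pi * int_inner n \<omega>)"
  have "((\<lambda>z. exp (k * z)) has_field_derivative (k * exp (k * of_real t))) (at (of_real t))"
    by (auto intro!: derivative_eq_intros)
  from has_vector_derivative_real_field[OF this] show ?thesis
    by (simp add: mode_def[abs_def] cis_conv_exp k_def mult_ac)
qed

text \<open>Coefficients over a countable index type are moved to \<open>nat\<close> by
  \<open>to_nat\<close> and padded with zeros. Sums over \<open>unit\<close> or over pairs thus need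
  no enumeration of their own.\<close>

lemma wienerI:
  fixes a :: "'i::countable \<Rightarrow> complex"
  assumes "\<And>i. a i \<noteq> 0 \<Longrightarrow> n i \<in> S"
    and "((\<lambda>i. cmod (a i) * exp (\<rho> * l1_norm (n i))) has_sum W) UNIV" "W \<le> C"
    and "\<And>t. ((\<lambda>i. a i * mode \<omega> (n i) t) has_sum f t) UNIV"
  shows "wiener \<omega> S \<rho> C f"
proof -
  define a' where "a' j = (if j \<in> range (to_nat :: 'i \<Rightarrow> nat) then a (from_nat j) else 0)" for j
  define n' where "n' j = n (from_nat j)" for j
  have bij: "bij_betw (to_nat :: 'i \<Rightarrow> nat) UNIV (range (to_nat :: 'i \<Rightarrow> nat))"
    by (simp add: bij_betw_def)
  have 1: "((\<lambda>j. F (a' j) (n' j)) has_sum s) UNIV" if "((\<lambda>i. F (a i) (n i)) has_sum s) UNIV"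
      and "\<And>n. F 0 n = 0" for F s
  proof -
    have "((\<lambda>i. F (a' (to_nat (i::'i))) (n' (to_nat i))) has_sum s) UNIV"
      using that by (simp add: a'_def n'_def)
    hence "((\<lambda>j. F (a' j) (n' j)) has_sum s) (range (to_nat :: 'i \<Rightarrow> nat))"
      using has_sum_reindex_bij_betw[OF bij, of "\<lambda>j. F (a' j) (n' j)"] by simp
    thus ?thesis
      by (rule has_sum_cong_neutral[THEN iffD1, rotated -1]) (auto simp: a'_def that)
  qed
  show ?thesis unfolding wiener_def
  proof (intro exI conjI allI impI)
    show "a' i \<noteq> 0 \<Longrightarrow> n' i \<in> S" for i
      using assms(1) by (auto simp: a'_def n'_def split: if_splits)
    show "((\<lambda>i. cmod (a' i) * exp (\<rho> * l1_norm (n' i))) has_sum W) UNIV"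
      by (rule 1[OF assms(2)]) simp
    show "W \<le> C" by fact
    show "((\<lambda>i. a' i * mode \<omega> (n' i) t) has_sum f t) UNIV" for t
      by (rule 1[OF assms(4)]) simp
  qed
qed

lemma wienerE:
  assumes "wiener \<omega> S \<rho> C f"
  obtains a :: "nat \<Rightarrow> complex" and n W where "\<And>i. a i \<noteq> 0 \<Longrightarrow> n i \<in> S"
    "((\<lambda>i. cmod (a i) * exp (\<rho> * l1_norm (n i))) has_sum W) UNIV" "W \<le> C"
    "\<And>t. ((\<lambda>i. a i * mode \<omega> (n i) t) has_sum f t) UNIV"
  using assms unfolding wiener_def by blast

lemma wiener_nonneg: assumes "wiener \<omega> S \<rho> C f" shows "C \<ge> 0"
proof -
  obtain a :: "nat \<Rightarrow> complex" and n :: "nat \<Rightarrow> int ^ 'a" and W where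
    "((\<lambda>i. cmod (a i) * exp (\<rho> * l1_norm (n i))) has_sum W) UNIV" "W \<le> C"
    using assms unfolding wiener_def by blast
  moreover from this(1) have "W \<ge> 0" by (rule has_sum_nonneg) simp
  ultimately show ?thesis by simp
qed

lemma wiener_mono:
  assumes "wiener \<omega> S \<rho> C f" "S \<subseteq> S'" "C \<le> C'" "\<rho>' \<le> \<rho>"
  shows "wiener \<omega> S' \<rho>' C' f"
proof -
  obtain a :: "nat \<Rightarrow> complex" and n W where *: "\<And>i. a i \<noteq> 0 \<Longrightarrow> n i \<in> S"
    "((\<lambda>i. cmod (a i) * exp (\<rho> * l1_norm (n i))) has_sum W) UNIV" "W \<le> C"
    "\<And>t. ((\<lambda>i. a i * mode \<omega> (n i) t) has_sum f t) UNIV" by (rule wienerE[OF assms(1)]) (rule that)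
  have le: "cmod (a i) * exp (\<rho>' * l1_norm (n i)) \<le> cmod (a i) * exp (\<rho> * l1_norm (n i))" for i
    using assms(4) by (intro mult_left_mono) (auto intro: mult_right_mono l1_norm_nonneg)
  have "(\<lambda>i. cmod (a i) * exp (\<rho>' * l1_norm (n i))) summable_on UNIV"
    by (rule summable_on_comparison_test[OF has_sum_imp_summable[OF *(2)]]) (use le in auto)
  then obtain W' where W': "((\<lambda>i. cmod (a i) * exp (\<rho>' * l1_norm (n i))) has_sum W') UNIV"
    by (auto simp: summable_on_def)
  have "W' \<le> W" by (rule has_sum_mono[OF W' *(2)]) (use le in auto)
  thus ?thesis
    by (intro wienerI[of a n, OF _ W' _ *(4)]) (use *(1,3) assms in auto)
qed

text \<open>Narrowing the width from \<rho> to \<rho>' gains exp (- (\<rho> - \<rho>') N) on modes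
  of length at least \<open>N\<close>. The long modes, which averaging leaves alone, become small in
  this way.\<close>

lemma wiener_high:
  assumes "wiener \<omega> S \<rho> C f" "\<rho>' \<le> \<rho>" "\<And>n. n \<in> S \<Longrightarrow> l1_norm n \<ge> N"
  shows "wiener \<omega> S \<rho>' (C * exp (- ((\<rho> - \<rho>') * N))) f"
proof -
  obtain a :: "nat \<Rightarrow> complex" and n W where *: "\<And>i. a i \<noteq> 0 \<Longrightarrow> n i \<in> S"
    "((\<lambda>i. cmod (a i) * exp (\<rho> * l1_norm (n i))) has_sum W) UNIV" "W \<le> C"
    "\<And>t. ((\<lambda>i. a i * mode \<omega> (n i) t) has_sum f t) UNIV" by (rule wienerE[OF assms(1)]) (rule that)
  define q where "q = exp (- ((\<rho> - \<rho>') * N))"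
  have le: "cmod (a i) * exp (\<rho>' * l1_norm (n i)) \<le> cmod (a i) * exp (\<rho> * l1_norm (n i)) * q" for i
  proof (cases "a i = 0")
    case False
    hence "l1_norm (n i) \<ge> N" using *(1) assms by auto
    hence "(\<rho> - \<rho>') * N \<le> (\<rho> - \<rho>') * l1_norm (n i)"
      using assms(2) by (intro mult_left_mono) auto
    hence "exp (\<rho>' * l1_norm (n i)) \<le> exp (\<rho> * l1_norm (n i)) * q"
      unfolding q_def exp_add[symmetric] by (simp add: algebra_simps)
    thus ?thesis by (simp add: mult.assoc mult_left_mono)
  qed auto
  have s: "((\<lambda>i. cmod (a i) * exp (\<rho> * l1_norm (n i)) * q) has_sum (W * q)) UNIV"
    by (rule has_sum_cmult_left[OF *(2)])
  have "(\<lambda>i. cmod (a i) * exp (\<rho>' * l1_norm (n i))) summable_on UNIV"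
    by (rule summable_on_comparison_test[OF has_sum_imp_summable[OF s]]) (use le in auto)
  then obtain W' where W': "((\<lambda>i. cmod (a i) * exp (\<rho>' * l1_norm (n i))) has_sum W') UNIV"
    by (auto simp: summable_on_def)
  have "W' \<le> W * q" by (rule has_sum_mono[OF W' s]) (use le in auto)
  also have "\<dots> \<le> C * q" using *(3) by (simp add: q_def)
  finally show ?thesis
    by (intro wienerI[of a n, OF _ W' _ *(4)]) (use *(1) in \<open>auto simp: q_def\<close>)
qed

lemma wiener_cmult:
  assumes "wiener \<omega> S \<rho> C f"
  shows "wiener \<omega> S \<rho> (cmod c * C) (\<lambda>t. c * f t)"
proof -
  obtain a :: "nat \<Rightarrow> complex" and n W where *: "\<And>i. a i \<noteq> 0 \<Longrightarrow> n i \<in> S"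
    "((\<lambda>i. cmod (a i) * exp (\<rho> * l1_norm (n i))) has_sum W) UNIV" "W \<le> C"
    "\<And>t. ((\<lambda>i. a i * mode \<omega> (n i) t) has_sum f t) UNIV" by (rule wienerE[OF assms(1)]) (rule that)
  show ?thesis
  proof (rule wienerI[of "\<lambda>i. c * a i" n])
    show "c * a i \<noteq> 0 \<Longrightarrow> n i \<in> S" for i using *(1) by auto
    show "((\<lambda>i. cmod (c * a i) * exp (\<rho> * l1_norm (n i))) has_sum (cmod c * W)) UNIV"
      using has_sum_cmult_right[OF *(2), of "cmod c"] by (simp add: norm_mult mult.assoc)
    show "cmod c * W \<le> cmod c * C" using *(3) by (intro mult_left_mono) auto
    show "((\<lambda>i. c * a i * mode \<omega> (n i) t) has_sum c * f t) UNIV" for t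
      using has_sum_cmult_right[OF *(4), of c] by (simp add: mult.assoc)
  qed
qed

lemma wiener_const: "wiener \<omega> {0} \<rho> (cmod c) (\<lambda>_. c)"
proof (rule wienerI[of "\<lambda>_::unit. c" "\<lambda>_. 0"])
  show "((\<lambda>_::unit. cmod c * exp (\<rho> * l1_norm (0 :: int^'a))) has_sum cmod c) UNIV"
    by (rule has_sum_finiteI) (auto simp: UNIV_unit)
  show "((\<lambda>_::unit. c * mode \<omega> 0 t) has_sum c) UNIV" for t
    by (rule has_sum_finiteI) (auto simp: UNIV_unit)
qed auto

lemma wiener_mode: "wiener \<omega> {m} \<rho> (cmod c * exp (\<rho> * l1_norm m)) (\<lambda>t. c * mode \<omega> m t)"
proof (rule wienerI[of "\<lambda>_::unit. c" "\<lambda>_. m"])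
  show "((\<lambda>_::unit. cmod c * exp (\<rho> * l1_norm m)) has_sum cmod c * exp (\<rho> * l1_norm m)) UNIV"
    by (rule has_sum_finiteI) (auto simp: UNIV_unit)
  show "((\<lambda>_::unit. c * mode \<omega> m t) has_sum c * mode \<omega> m t) UNIV" for t
    by (rule has_sum_finiteI) (auto simp: UNIV_unit)
qed auto

lemma wiener_zero: "wiener \<omega> {} \<rho> 0 (\<lambda>_. 0)"
  by (rule wienerI[of "\<lambda>_::unit. 0" "\<lambda>_. 0"]) auto

lemma wiener_cnj:
  assumes "wiener \<omega> S \<rho> C f"
  shows "wiener \<omega> (uminus ` S) \<rho> C (\<lambda>t. cnj (f t))"
proof -
  obtain a :: "nat \<Rightarrow> complex" and n W where *: "\<And>i. a i \<noteq> 0 \<Longrightarrow> n i \<in> S"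
    "((\<lambda>i. cmod (a i) * exp (\<rho> * l1_norm (n i))) has_sum W) UNIV" "W \<le> C"
    "\<And>t. ((\<lambda>i. a i * mode \<omega> (n i) t) has_sum f t) UNIV" by (rule wienerE[OF assms(1)]) (rule that)
  show ?thesis
  proof (rule wienerI[of "\<lambda>i. cnj (a i)" "\<lambda>i. - n i"])
    show "cnj (a i) \<noteq> 0 \<Longrightarrow> - n i \<in> uminus ` S" for i using *(1) by auto
    show "((\<lambda>i. cmod (cnj (a i)) * exp (\<rho> * l1_norm (- n i))) has_sum W) UNIV"
      using *(2) by simp
    show "((\<lambda>i. cnj (a i) * mode \<omega> (- n i) t) has_sum cnj (f t)) UNIV" for t
      using has_sum_cnj_iff[THEN iffD2, OF *(4)] by (simp add: cnj_mode)
  qed (use * in auto)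
qed

text \<open>Multiplication by a mode costs exp (\<rho> |m|) by the triangle inequality for lengths.
  This is the price of removing a resonance later.\<close>

lemma wiener_shift:
  assumes "wiener \<omega> S \<rho> C f" "\<rho> \<ge> 0"
  shows "wiener \<omega> ((+) m ` S) \<rho> (C * exp (\<rho> * l1_norm m)) (\<lambda>t. mode \<omega> m t * f t)"
proof -
  obtain a :: "nat \<Rightarrow> complex" and n W where *: "\<And>i. a i \<noteq> 0 \<Longrightarrow> n i \<in> S"
    "((\<lambda>i. cmod (a i) * exp (\<rho> * l1_norm (n i))) has_sum W) UNIV" "W \<le> C"
    "\<And>t. ((\<lambda>i. a i * mode \<omega> (n i) t) has_sum f t) UNIV" by (rule wienerE[OF assms(1)]) (rule that)
  define q where "q = exp (\<rho> * l1_norm m)"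
  have le: "cmod (a i) * exp (\<rho> * l1_norm (m + n i)) \<le> cmod (a i) * exp (\<rho> * l1_norm (n i)) * q" for i
  proof -
    have "\<rho> * l1_norm (m + n i) \<le> \<rho> * (l1_norm m + l1_norm (n i))"
      by (intro mult_left_mono l1_norm_triangle assms)
    hence "exp (\<rho> * l1_norm (m + n i)) \<le> exp (\<rho> * l1_norm (n i)) * q"
      unfolding q_def exp_add[symmetric] by (simp add: algebra_simps)
    thus ?thesis by (simp add: mult.assoc mult_left_mono)
  qed
  have s: "((\<lambda>i. cmod (a i) * exp (\<rho> * l1_norm (n i)) * q) has_sum (W * q)) UNIV"
    by (rule has_sum_cmult_left[OF *(2)])
  have "(\<lambda>i. cmod (a i) * exp (\<rho> * l1_norm (m + n i))) summable_on UNIV"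
    by (rule summable_on_comparison_test[OF has_sum_imp_summable[OF s]]) (use le in auto)
  then obtain W' where W': "((\<lambda>i. cmod (a i) * exp (\<rho> * l1_norm (m + n i))) has_sum W') UNIV"
    by (auto simp: summable_on_def)
  have "W' \<le> W * q" by (rule has_sum_mono[OF W' s]) (use le in auto)
  also have "\<dots> \<le> C * q" using *(3) by (simp add: q_def)
  finally have "W' \<le> C * q" .
  show ?thesis
  proof (rule wienerI[of a "\<lambda>i. m + n i", OF _ W'])
    show "((\<lambda>i. a i * mode \<omega> (m + n i) t) has_sum mode \<omega> m t * f t) UNIV" for t
      using has_sum_cmult_right[OF *(4), of "mode \<omega> m t"] by (simp add: mode_add mult_ac)
  qed (use *(1) \<open>W' \<le> C * q\<close> in \<open>auto simp: q_def\<close>)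
qed

text \<open>Expansions of all summands are chosen simultaneously and merged into one family indexed
  by pairs; since frequencies may repeat, no terms have to be collected. Products, Neumann series
  and Fourier series in several variables are obtained from it.\<close>

lemma wiener_suminf:
  fixes F :: "'i::countable \<Rightarrow> real \<Rightarrow> complex"
  assumes "\<And>i. wiener \<omega> S \<rho> (C i) (F i)" "(C has_sum C0) UNIV" "\<rho> \<ge> 0"
    and "\<And>t. ((\<lambda>i. F i t) has_sum f t) UNIV"
  shows "wiener \<omega> S \<rho> C0 f"
proof -
  define P where "P i a n W \<longleftrightarrow> (\<forall>j. a j \<noteq> 0 \<longrightarrow> n j \<in> S) \<and>
        ((\<lambda>j. cmod (a j) * exp (\<rho> * l1_norm (n j))) has_sum W) UNIV \<and> W \<le> C i \<and>
        (\<forall>t. ((\<lambda>j. a j * mode \<omega> (n j) t) has_sum F i t) UNIV)" for i and a :: "nat \<Rightarrow> complex" and n W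
  have 0: "\<forall>i. \<exists>a n W. P i a n W" using assms(1) unfolding wiener_def P_def by (rule allI)
  obtain a where "\<forall>i. \<exists>n W. P i (a i) n W" using choice[OF 0] by (elim exE) (rule that)
  from choice[OF this] obtain n where "\<forall>i. \<exists>W. P i (a i) (n i) W" by (elim exE) (rule that)
  from choice[OF this] obtain W where P: "\<And>i. P i (a i) (n i) (W i)" by blast
  have *: "\<And>i j. a i j \<noteq> 0 \<Longrightarrow> n i j \<in> S"
    "\<And>i. ((\<lambda>j. cmod (a i j) * exp (\<rho> * l1_norm (n i j))) has_sum W i) UNIV" "\<And>i. W i \<le> C i"
    "\<And>i t. ((\<lambda>j. a i j * mode \<omega> (n i j) t) has_sum F i t) UNIV"
    using P unfolding P_def by blast+
  have W0: "W i \<ge> 0" for i by (rule has_sum_nonneg[OF *(2)]) simp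
  have "W summable_on UNIV"
    by (rule summable_on_comparison_test[OF has_sum_imp_summable[OF assms(2)]]) (use *(3) W0 in auto)
  then obtain W' where W': "(W has_sum W') UNIV" by (auto simp: summable_on_def)
  have "W' \<le> C0" by (rule has_sum_mono[OF W' assms(2)]) (use * in auto)
  define A where "A = (\<lambda>(i, j). a i j)"
  define M where "M = (\<lambda>(i, j). n i j)"
  have sm: "(\<lambda>p. cmod (A p) * exp (\<rho> * l1_norm (M p))) summable_on Sigma UNIV (\<lambda>_. UNIV)"
    by (rule summable_on_SigmaI[where g = W]) (use *(2) W' in \<open>auto simp: A_def M_def summable_on_def\<close>)
  have s1: "((\<lambda>p. cmod (A p) * exp (\<rho> * l1_norm (M p))) has_sum W') (Sigma UNIV (\<lambda>_. UNIV))"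
    by (rule has_sum_SigmaI[where g = W, OF _ W' sm]) (use *(2) in \<open>auto simp: A_def M_def\<close>)
  have s2: "((\<lambda>p. A p * mode \<omega> (M p) t) has_sum f t) (Sigma UNIV (\<lambda>_. UNIV))" for t
  proof (rule has_sum_SigmaI[where g = "\<lambda>i. F i t", OF _ assms(4)])
    show "(\<lambda>p. A p * mode \<omega> (M p) t) summable_on Sigma UNIV (\<lambda>_. UNIV)"
    proof (rule abs_summable_summable, rule summable_on_comparison_test[OF sm])
      show "cmod (A p * mode \<omega> (M p) t) \<le> cmod (A p) * exp (\<rho> * l1_norm (M p))" for p
        using mult_left_mono[of 1 "exp (\<rho> * l1_norm (M p))" "cmod (A p)"] assms(3)
        by (simp add: norm_mult l1_norm_nonneg)
    qed auto
  qed (use *(4) in \<open>auto simp: A_def M_def\<close>)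
  show ?thesis
    by (rule wienerI[of A M, OF _ _ \<open>W' \<le> C0\<close>]) (use s1 s2 *(1) in \<open>auto simp: A_def M_def\<close>)
qed

lemma wiener_add:
  assumes "wiener \<omega> S \<rho> C f" "wiener \<omega> S \<rho> D g" "\<rho> \<ge> 0"
  shows "wiener \<omega> S \<rho> (C + D) (\<lambda>t. f t + g t)"
  by (rule wiener_suminf[where C = "\<lambda>b. if b then C else D" and F = "\<lambda>b. if b then f else g"])
     (use assms in \<open>auto intro!: has_sum_finiteI simp: UNIV_bool\<close>)

lemma wiener_mult:
  assumes "wiener \<omega> S \<rho> C f" "wiener \<omega> T \<rho> D g" "\<rho> \<ge> 0"
  shows "wiener \<omega> UNIV \<rho> (C * D) (\<lambda>t. f t * g t)"
proof -
  obtain a :: "nat \<Rightarrow> complex" and n W where *: "\<And>i. a i \<noteq> 0 \<Longrightarrow> n i \<in> S"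
    "((\<lambda>i. cmod (a i) * exp (\<rho> * l1_norm (n i))) has_sum W) UNIV" "W \<le> C"
    "\<And>t. ((\<lambda>i. a i * mode \<omega> (n i) t) has_sum f t) UNIV" by (rule wienerE[OF assms(1)]) (rule that)
  have "wiener \<omega> UNIV \<rho> (W * D) (\<lambda>t. f t * g t)"
  proof (rule wiener_suminf[where C = "\<lambda>i. cmod (a i) * exp (\<rho> * l1_norm (n i)) * D"
        and F = "\<lambda>i t. a i * (mode \<omega> (n i) t * g t)"])
    show "wiener \<omega> UNIV \<rho> (cmod (a i) * exp (\<rho> * l1_norm (n i)) * D)
      (\<lambda>t. a i * (mode \<omega> (n i) t * g t))" for i
      using wiener_mono[OF wiener_cmult[OF wiener_shift[OF assms(2,3), of "n i"], of "a i"] subset_UNIV order.refl order.refl]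
      by (simp add: mult_ac)
    show "((\<lambda>i. cmod (a i) * exp (\<rho> * l1_norm (n i)) * D) has_sum W * D) UNIV"
      by (rule has_sum_cmult_left[OF *(2)])
    show "((\<lambda>i. a i * (mode \<omega> (n i) t * g t)) has_sum f t * g t) UNIV" for t
      using has_sum_cmult_left[OF *(4)[of t], of "g t"] by (simp add: mult.assoc)
  qed (use assms in auto)
  thus ?thesis
    by (rule wiener_mono) (use * wiener_nonneg[OF assms(2)] in \<open>auto intro: mult_right_mono\<close>)
qed

lemma wiener_bound:
  assumes "wiener \<omega> S \<rho> C f" "\<rho> \<ge> 0" shows "cmod (f t) \<le> C"
proof -
  obtain a :: "nat \<Rightarrow> complex" and n W where *: "\<And>i. a i \<noteq> 0 \<Longrightarrow> n i \<in> S"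
    "((\<lambda>i. cmod (a i) * exp (\<rho> * l1_norm (n i))) has_sum W) UNIV" "W \<le> C"
    "\<And>t. ((\<lambda>i. a i * mode \<omega> (n i) t) has_sum f t) UNIV" by (rule wienerE[OF assms(1)]) (rule that)
  have le: "cmod (a i * mode \<omega> (n i) t) \<le> cmod (a i) * exp (\<rho> * l1_norm (n i))" for i
    using mult_left_mono[of 1 "exp (\<rho> * l1_norm (n i))" "cmod (a i)"] assms(2)
    by (simp add: norm_mult l1_norm_nonneg)
  have "(\<lambda>i. cmod (a i * mode \<omega> (n i) t)) summable_on UNIV"
    by (rule summable_on_comparison_test[OF has_sum_imp_summable[OF *(2)]]) (use le in auto)
  then obtain s where s: "((\<lambda>i. cmod (a i * mode \<omega> (n i) t)) has_sum s) UNIV" by (auto simp: summable_on_def)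
  have "cmod (f t) \<le> s" by (rule norm_has_sum_bound[OF s *(4)])
  also have "s \<le> W" by (rule has_sum_mono[OF s *(2)]) (use le in auto)
  finally have "cmod (f t) \<le> W" .
  thus ?thesis using * by simp
qed

text \<open>The index set is split rather than the function, so the weights of the two parts add up
  to the old weight, and no constant is lost however often modes are re-sorted.\<close>

lemma wiener_split:
  assumes "wiener \<omega> S \<rho> C f"
  obtains f1 f2 C1 C2 where "wiener \<omega> (S \<inter> T) \<rho> C1 f1" "wiener \<omega> (S - T) \<rho> C2 f2"
    "C1 + C2 \<le> C" "\<And>t. f t = f1 t + f2 t"
proof -
  obtain a :: "nat \<Rightarrow> complex" and n W where *: "\<And>i. a i \<noteq> 0 \<Longrightarrow> n i \<in> S"
    "((\<lambda>i. cmod (a i) * exp (\<rho> * l1_norm (n i))) has_sum W) UNIV" "W \<le> C"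
    "\<And>t. ((\<lambda>i. a i * mode \<omega> (n i) t) has_sum f t) UNIV" by (rule wienerE[OF assms(1)]) (rule that)
  define I where "I = {i. n i \<in> T}"
  have ex: "\<exists>C' f'. wiener \<omega> U \<rho> C' f' \<and>
      ((\<lambda>i. cmod (a i) * exp (\<rho> * l1_norm (n i))) has_sum C') J \<and>
      (\<forall>t. ((\<lambda>i. a i * mode \<omega> (n i) t) has_sum f' t) J)"
    if "\<And>i. a i \<noteq> 0 \<Longrightarrow> i \<in> J \<Longrightarrow> n i \<in> U" for J U
  proof -
    obtain C' where C': "((\<lambda>i. cmod (a i) * exp (\<rho> * l1_norm (n i))) has_sum C') J"
      using summable_on_subset_banach[OF has_sum_imp_summable[OF *(2)], of J]
      by (auto simp: summable_on_def)
    have "\<forall>t. \<exists>y. ((\<lambda>i. a i * mode \<omega> (n i) t) has_sum y) J"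
      using summable_on_subset_banach[OF has_sum_imp_summable[OF *(4)], of J]
      by (auto simp: summable_on_def)
    then obtain f' where f': "\<And>t. ((\<lambda>i. a i * mode \<omega> (n i) t) has_sum f' t) J" by metis
    have ext: "(F has_sum s) UNIV" if "(G has_sum s) J" "\<And>i. i \<in> J \<Longrightarrow> F i = G i" "\<And>i. i \<notin> J \<Longrightarrow> F i = 0"
      for F G :: "nat \<Rightarrow> 'z::{topological_comm_monoid_add,t2_space}" and s
      using that(1) by (rule has_sum_cong_neutral[THEN iffD1, rotated -1]) (use that in auto)
    have "wiener \<omega> U \<rho> C' f'"
      by (rule wienerI[of "\<lambda>i. if i \<in> J then a i else 0" n _ _ C'])
         (use that in \<open>auto intro!: ext[OF C'] ext[OF f'] split: if_splits\<close>)
    thus ?thesis using C' f' by blast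
  qed
  obtain C1 f1 where 1: "wiener \<omega> (S \<inter> T) \<rho> C1 f1"
      "((\<lambda>i. cmod (a i) * exp (\<rho> * l1_norm (n i))) has_sum C1) I"
      "\<And>t. ((\<lambda>i. a i * mode \<omega> (n i) t) has_sum f1 t) I"
    using ex[of I "S \<inter> T"] *(1) by (auto simp: I_def)
  obtain C2 f2 where 2: "wiener \<omega> (S - T) \<rho> C2 f2"
      "((\<lambda>i. cmod (a i) * exp (\<rho> * l1_norm (n i))) has_sum C2) (-I)"
      "\<And>t. ((\<lambda>i. a i * mode \<omega> (n i) t) has_sum f2 t) (-I)"
    using ex[of "-I" "S - T"] *(1) by (auto simp: I_def)
  have U: "I \<union> - I = UNIV" by auto
  have "C1 + C2 = W"
    using has_sum_Un_disjoint[OF 1(2) 2(2)] *(2) by (auto simp: U intro: has_sum_unique)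
  moreover have "f t = f1 t + f2 t" for t
    using has_sum_Un_disjoint[OF 1(3)[of t] 2(3)[of t]] *(4)[of t] by (auto simp: U intro: has_sum_unique)
  ultimately show ?thesis using that[OF 1(1) 2(1)] *(3) by auto
qed

lemma wiener_single:
  assumes "wiener \<omega> {m} \<rho> C f" "\<rho> \<ge> 0"
  obtains c where "cmod c \<le> C" "\<And>t. f t = c * mode \<omega> m t"
proof -
  obtain a :: "nat \<Rightarrow> complex" and n W where *: "\<And>i. a i \<noteq> 0 \<Longrightarrow> n i \<in> {m}"
    "((\<lambda>i. cmod (a i) * exp (\<rho> * l1_norm (n i))) has_sum W) UNIV" "W \<le> C"
    "\<And>t. ((\<lambda>i. a i * mode \<omega> (n i) t) has_sum f t) UNIV" by (rule wienerE[OF assms(1)]) (rule that)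
  have eq: "a i * mode \<omega> (n i) t = a i * mode \<omega> m t" for i t
    using *(1)[of i] by (cases "a i = 0") auto
  have a: "(a has_sum f 0) UNIV" using *(4)[of 0] by (simp add: eq mode_def)
  have "f t = f 0 * mode \<omega> m t" for t
    using has_sum_cmult_left[OF a, of "mode \<omega> m t"] *(4)[of t] by (auto simp: eq intro: has_sum_unique)
  thus ?thesis using that wiener_bound[OF assms] by blast
qed

text \<open>The equation b' = i \<nu> b + g is solved mode by mode, dividing by i times the
  difference of the frequency and \<nu>. Divisors of size at least 1 / D enlarge the norm by at most
  \<open>D\<close>. The case \<nu> = 0 treats the rotational coefficient of a system, \<nu> = 2
  \<beta> the coefficient of the conjugate.\<close>

lemma wiener_solve:
  assumes "wiener \<omega> S \<rho> C g" "\<rho> \<ge> 0" "D > 0"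
    and div: "\<And>n. n \<in> S \<Longrightarrow> \<bar>2 * pi * int_inner n \<omega> - \<nu>\<bar> \<ge> 1 / D"
  obtains b where "wiener \<omega> S \<rho> (D * C) b"
    "\<And>t. (b has_vector_derivative (\<i> * of_real \<nu> * b t + g t)) (at t)"
proof -
  obtain a :: "nat \<Rightarrow> complex" and n W where *: "\<And>i. a i \<noteq> 0 \<Longrightarrow> n i \<in> S"
    "((\<lambda>i. cmod (a i) * exp (\<rho> * l1_norm (n i))) has_sum W) UNIV" "W \<le> C"
    "\<And>t. ((\<lambda>i. a i * mode \<omega> (n i) t) has_sum g t) UNIV" by (rule wienerE[OF assms(1)]) (rule that)
  define l where "l i = 2 * pi * int_inner (n i) \<omega>" for i
  define c where "c i = a i / (\<i> * of_real (l i - \<nu>))" for i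
  have nz: "\<bar>l i - \<nu>\<bar> \<ge> 1 / D" if "a i \<noteq> 0" for i using div[of "n i"] *(1)[OF that] by (simp add: l_def)
  have c: "cmod (c i) \<le> D * cmod (a i)" for i
  proof (cases "a i = 0")
    case False
    have "0 < 1 / D" using assms by simp
    hence pos: "0 < \<bar>l i - \<nu>\<bar>" using nz[OF False] by linarith
    have "cmod (c i) = cmod (a i) * (1 / \<bar>l i - \<nu>\<bar>)" by (simp add: c_def norm_mult norm_divide flip: of_real_diff)
    also have "1 / \<bar>l i - \<nu>\<bar> \<le> D" using nz[OF False] pos assms(3) by (simp add: field_simps)
    hence "cmod (a i) * (1 / \<bar>l i - \<nu>\<bar>) \<le> cmod (a i) * D" by (rule mult_left_mono) auto
    finally show ?thesis by (simp add: mult_ac)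
  qed (auto simp: c_def)
  have ci: "\<i> * of_real (l i) * c i = \<i> * of_real \<nu> * c i + a i" for i
  proof (cases "a i = 0")
    case False
    have "0 < 1 / D" using assms by simp
    hence "l i - \<nu> \<noteq> 0" using nz[OF False] by auto
    hence "complex_of_real (l i) - of_real \<nu> \<noteq> 0" by (metis of_real_diff of_real_eq_0_iff)
    thus ?thesis by (simp add: c_def field_simps)
  qed (auto simp: c_def)
  have e1: "exp (\<rho> * l1_norm (n i)) \<ge> 1" for i using assms(2) by (simp add: l1_norm_nonneg)
  have le: "cmod (c i) * exp (\<rho> * l1_norm (n i)) \<le> D * (cmod (a i) * exp (\<rho> * l1_norm (n i)))" for i
    using mult_right_mono[OF c, of "exp (\<rho> * l1_norm (n i))" i] by (simp add: mult_ac)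
  have s: "((\<lambda>i. D * (cmod (a i) * exp (\<rho> * l1_norm (n i)))) has_sum (D * W)) UNIV"
    by (rule has_sum_cmult_right[OF *(2)])
  have sumc: "(\<lambda>i. cmod (c i) * exp (\<rho> * l1_norm (n i))) summable_on UNIV"
    by (rule summable_on_comparison_test[OF has_sum_imp_summable[OF s]]) (use le in auto)
  then obtain W' where W': "((\<lambda>i. cmod (c i) * exp (\<rho> * l1_norm (n i))) has_sum W') UNIV"
    by (auto simp: summable_on_def)
  have "W' \<le> D * W" by (rule has_sum_mono[OF W' s]) (use le in auto)
  also have "\<dots> \<le> D * C" using *(3) assms by simp
  finally have W'C: "W' \<le> D * C" .
  have "(\<lambda>i. c i * mode \<omega> (n i) t) summable_on UNIV" for t
  proof (rule abs_summable_summable, rule summable_on_comparison_test[OF sumc])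
    show "cmod (c i * mode \<omega> (n i) t) \<le> cmod (c i) * exp (\<rho> * l1_norm (n i))" for i
      using mult_left_mono[OF e1, of "cmod (c i)" i] by (simp add: norm_mult)
  qed auto
  then obtain b where b: "\<And>t. ((\<lambda>i. c i * mode \<omega> (n i) t) has_sum b t) UNIV"
    unfolding summable_on_def by metis
  have Wb: "wiener \<omega> S \<rho> (D * C) b"
    by (rule wienerI[OF _ W' W'C b]) (use *(1) in \<open>auto simp: c_def\<close>)
  define d where "d i t = \<i> * of_real (l i) * c i * mode \<omega> (n i) t" for i t
  have dd: "((\<lambda>t. c i * mode \<omega> (n i) t) has_vector_derivative d i t) (at t)" for i t
    using has_vector_derivative_mult_right[OF mode_deriv, of "c i" \<omega> "n i" t] by (simp add: d_def l_def mult_ac)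
  have dsum: "((\<lambda>i. d i t) has_sum (\<i> * of_real \<nu> * b t + g t)) UNIV" for t
    using has_sum_add[OF has_sum_cmult_right[OF b, of "\<i> * of_real \<nu>" t] *(4)[of t]]
    unfolding d_def ci by (simp add: algebra_simps)
  \<comment> \<open>The frequencies \<open>l i\<close> are unbounded, so the derivatives are not
    estimated directly: by \<open>ci\<close> they equal \<nu> c + a up to a factor of modulus one,
    and both terms are summable. This is the majorant for the Weierstrass test.\<close>
  define K where "K i = (\<bar>\<nu>\<bar> * D + 1) * (cmod (a i) * exp (\<rho> * l1_norm (n i)))" for i
  have dK: "norm (d i t) \<le> K i" for i t
  proof -
    have "norm (d i t) = cmod (\<i> * of_real \<nu> * c i + a i)" unfolding d_def ci by (simp add: norm_mult)
    also have "\<dots> \<le> \<bar>\<nu>\<bar> * cmod (c i) + cmod (a i)"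
      by (rule order.trans[OF norm_triangle_ineq]) (simp add: norm_mult)
    also have "\<dots> \<le> \<bar>\<nu>\<bar> * (D * cmod (a i)) + cmod (a i)" using c by (intro add_mono mult_left_mono) auto
    also have "\<dots> = (\<bar>\<nu>\<bar> * D + 1) * (cmod (a i) * 1)" by (simp add: algebra_simps)
    also have "\<dots> \<le> K i" unfolding K_def using e1 assms(3) by (intro mult_left_mono) auto
    finally show ?thesis .
  qed
  have "summable K" unfolding K_def
    by (rule summable_mult) (use *(2) in \<open>auto dest: has_sum_imp_sums sums_summable\<close>)
  hence "uniform_limit UNIV (\<lambda>k t. \<Sum>i<k. d i t) (\<lambda>t. \<Sum>i. d i t) sequentially"
    by (intro Weierstrass_m_test[OF dK]) auto
  also have "(\<lambda>t. \<Sum>i. d i t) = (\<lambda>t. \<i> * of_real \<nu> * b t + g t)"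
    using dsum by (auto simp: fun_eq_iff intro!: sums_unique[symmetric] has_sum_imp_sums)
  finally have ul: "uniform_limit UNIV (\<lambda>k t. \<Sum>i<k. d i t) (\<lambda>t. \<i> * of_real \<nu> * b t + g t) sequentially" .
  have "\<exists>b'. \<forall>x\<in>UNIV. (\<lambda>i. c i * mode \<omega> (n i) x) sums b' x \<and>
      (b' has_derivative (\<lambda>h. h *\<^sub>R (\<i> * of_real \<nu> * b x + g x))) (at x within UNIV)"
  proof (rule has_derivative_series[where x = 0 and l = "b 0" and f' = "\<lambda>i t h. h *\<^sub>R d i t"])
    show "((\<lambda>t. c i * mode \<omega> (n i) t) has_derivative (\<lambda>h. h *\<^sub>R d i t)) (at t within UNIV)" for i t
      using dd by (simp add: has_vector_derivative_def)
    show "\<forall>\<^sub>F k in sequentially. \<forall>x\<in>UNIV. \<forall>h. norm ((\<Sum>i<k. h *\<^sub>R d i x) - h *\<^sub>R (\<i> * of_real \<nu> * b x + g x)) \<le> e * norm h"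
      if "e > 0" for e
      using uniform_limitD[OF ul that]
    proof eventually_elim
      case (elim k)
      show ?case
      proof (intro ballI allI)
        fix x h :: real
        have "(\<Sum>i<k. h *\<^sub>R d i x) - h *\<^sub>R (\<i> * of_real \<nu> * b x + g x) =
          h *\<^sub>R ((\<Sum>i<k. d i x) - (\<i> * of_real \<nu> * b x + g x))"
          by (simp only: scaleR_sum_right scaleR_diff_right)
        also have "norm \<dots> \<le> \<bar>h\<bar> * e" using elim by (simp only: norm_scaleR) (intro mult_left_mono, auto simp: dist_norm intro: less_imp_le)
        finally show "norm ((\<Sum>i<k. h *\<^sub>R d i x) - h *\<^sub>R (\<i> * of_real \<nu> * b x + g x)) \<le> e * norm h"
          by (simp add: mult_ac)
      qed
    qed
    show "(\<lambda>i. c i * mode \<omega> (n i) 0) sums b 0" using b by (rule has_sum_imp_sums)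
  qed auto
  then obtain b' where b': "\<And>x. (\<lambda>i. c i * mode \<omega> (n i) x) sums b' x"
    "\<And>x. (b' has_derivative (\<lambda>h. h *\<^sub>R (\<i> * of_real \<nu> * b x + g x))) (at x)" by auto
  have "b' = b" by (rule ext, rule sums_unique2[OF b'(1) has_sum_imp_sums[OF b]])
  hence "(b has_vector_derivative (\<i> * of_real \<nu> * b t + g t)) (at t)" for t
    using b'(2) by (simp add: has_vector_derivative_def)
  thus ?thesis using that[OF Wb] by blast
qed

lemma wiener_Re:
  assumes "wiener \<omega> S \<rho> C f" "\<rho> \<ge> 0" "uminus ` S \<subseteq> S"
  shows "wiener \<omega> S \<rho> C (\<lambda>t. of_real (Re (f t)))"
proof -
  have 1: "wiener \<omega> S \<rho> C (\<lambda>t. cnj (f t))" by (rule wiener_mono[OF wiener_cnj[OF assms(1)]]) (use assms in auto)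
  have "wiener \<omega> S \<rho> (cmod (1/2) * (C + C)) (\<lambda>t. 1/2 * (f t + cnj (f t)))"
    by (intro wiener_cmult wiener_add 1 assms)
  also have "(\<lambda>t. 1/2 * (f t + cnj (f t))) = (\<lambda>t. of_real (Re (f t)))"
    by (rule ext) (simp add: complex_eq_iff)
  finally show ?thesis by (simp add: norm_divide)
qed

lemma wiener_Im:
  assumes "wiener \<omega> S \<rho> C f" "\<rho> \<ge> 0" "uminus ` S \<subseteq> S"
  shows "wiener \<omega> S \<rho> C (\<lambda>t. of_real (Im (f t)))"
  using wiener_Re[OF wiener_cmult[OF assms(1), of "-\<i>"] assms(2,3)] by simp

lemma wiener_inverse:
  assumes "wiener \<omega> UNIV \<rho> C d" "\<rho> \<ge> 0" "C \<le> 1/2"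
  shows "wiener \<omega> UNIV \<rho> 2 (\<lambda>t. 1 / (1 + d t))"
proof -
  have pw: "wiener \<omega> UNIV \<rho> (C ^ k) (\<lambda>t. (- d t) ^ k)" for k
  proof (induction k)
    case 0 show ?case using wiener_mono[OF wiener_const[of \<omega> \<rho> 1]] by simp
  next
    case (Suc k)
    show ?case using wiener_mult[OF wiener_cmult[OF assms(1), of "-1"] Suc assms(2)] by simp
  qed
  have C: "0 \<le> C" using wiener_nonneg[OF assms(1)] .
  have "wiener \<omega> UNIV \<rho> (1 / (1 - C)) (\<lambda>t. 1 / (1 - (- d t)))"
  proof (rule wiener_suminf[OF pw _ assms(2)])
    show "((^) C has_sum 1 / (1 - C)) UNIV"
      by (rule sums_nonneg_imp_has_sum) (use C assms in \<open>auto intro: geometric_sums\<close>)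
    fix t
    have "cmod (- d t) < 1" using wiener_bound[OF assms(1,2), of t] assms(3) by simp
    thus "((\<lambda>k. (- d t) ^ k) has_sum 1 / (1 - (- d t))) UNIV"
      by (intro norm_summable_imp_has_sum geometric_sums) (auto simp: norm_power intro!: summable_geometric)
  qed
  moreover have "1 / (1 - C) \<le> 2" using C assms by (simp add: field_simps)
  ultimately show ?thesis by (auto intro: wiener_mono)
qed

section \<open>Conjugation of planar systems\<close>

text \<open>A pair \<open>(f, g)\<close> of coefficient functions stands for the traceless real-linear system
  \<open>z' = i f z + g cnj z\<close> on the plane, a pair \<open>(u, c)\<close> for the real-linear map
  \<open>z \<mapsto> u z + c cnj z\<close> with determinant \<open>\<bar>u\<bar>\<^sup>2 - \<bar>c\<bar>\<^sup>2\<close>. The polar angle of a solution obeys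
  \<open>\<phi>' = f + Im (g exp (- 2 i \<phi>))\<close>. The term with \<open>\<mu>\<close> records the effect of raising the
  energy, seen through the coordinate change \<open>(u, c)\<close> accumulated so far.\<close>

definition phase ::
  "(real \<Rightarrow> real) \<Rightarrow> (real \<Rightarrow> complex) \<Rightarrow> real \<Rightarrow> (real \<Rightarrow> complex) \<Rightarrow> (real \<Rightarrow> complex) \<Rightarrow> (real \<Rightarrow> real) \<Rightarrow> bool"
where
  "phase f g \<mu> u c \<phi> \<longleftrightarrow> (\<forall>t\<ge>0. (\<phi> has_real_derivative
      (f t + Im (g t * cis (- 2 * \<phi> t)) +
       \<mu> * (Im (u t * cis (\<phi> t) + c t * cis (- \<phi> t)))\<^sup>2 / ((cmod (u t))\<^sup>2 - (cmod (c t))\<^sup>2)))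
     (at t within {0..}))"

text \<open>For the map P = (v, b) and the systems A, A' the two equations say P' = A P - P A' +
  \<kappa> P. The scalar \<kappa> admits maps of varying determinant; it only rescales vectors and
  is invisible to angles. The transport of angles is part of the definition because a continuous
  choice of the new angle depends on the kind of map: near the old angle for maps close to the
  identity, off by \<sigma> t for a rotating frame.\<close>

definition conjugate ::
  "(real \<Rightarrow> real) \<Rightarrow> (real \<Rightarrow> complex) \<Rightarrow> (real \<Rightarrow> real) \<Rightarrow> (real \<Rightarrow> complex) \<Rightarrow>
   (real \<Rightarrow> complex) \<Rightarrow> (real \<Rightarrow> complex) \<Rightarrow> real \<Rightarrow> bool"
where
  "conjugate f g f' g' v b \<sigma> \<longleftrightarrow>
     (\<exists>\<kappa>. \<forall>t.
        (v has_vector_derivative (\<i> * of_real (f t) * v t + g t * cnj (b t)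
            - \<i> * of_real (f' t) * v t - b t * cnj (g' t) + of_real (\<kappa> t) * v t)) (at t) \<and>
        (b has_vector_derivative (\<i> * of_real (f t) * b t + g t * cnj (v t)
            - v t * g' t + \<i> * of_real (f' t) * b t + of_real (\<kappa> t) * b t)) (at t)) \<and>
     (\<forall>\<mu> u c \<phi>. phase f g \<mu> u c \<phi> \<longrightarrow>
        (\<exists>\<psi> C. phase f' g' \<mu> (\<lambda>t. u t * v t + c t * cnj (b t)) (\<lambda>t. u t * b t + c t * cnj (v t)) \<psi> \<and>
           (\<forall>t\<ge>0. \<bar>\<phi> t - \<psi> t - \<sigma> * t\<bar> \<le> C)))"

text \<open>Measures the distortion of the maps \<open>(v, b)\<close>: the ratio of their singular values is at
  most \<open>\<Gamma>\<close>.\<close>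

definition cond_le :: "(real \<Rightarrow> complex) \<Rightarrow> (real \<Rightarrow> complex) \<Rightarrow> real \<Rightarrow> bool" where
  "cond_le v b \<Gamma> \<longleftrightarrow> (\<forall>t. cmod (b t) < cmod (v t) \<and> cmod (v t) + cmod (b t) \<le> \<Gamma> * (cmod (v t) - cmod (b t)))"

lemma det_compose:
  "(cmod (u * v + c * cnj b))\<^sup>2 - (cmod (u * b + c * cnj v))\<^sup>2 =
   ((cmod u)\<^sup>2 - (cmod c)\<^sup>2) * ((cmod v)\<^sup>2 - (cmod b)\<^sup>2)"
  unfolding cmod_power2 by (simp add: algebra_simps power2_eq_square)

lemma cond_le_mono:
  assumes "cond_le v b \<Gamma>" "\<Gamma> \<le> \<Gamma>'" shows "cond_le v b \<Gamma>'"
  unfolding cond_le_def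
proof
  fix t
  have *: "cmod (b t) < cmod (v t)" "cmod (v t) + cmod (b t) \<le> \<Gamma> * (cmod (v t) - cmod (b t))"
    using assms(1) unfolding cond_le_def by auto
  have "\<Gamma> * (cmod (v t) - cmod (b t)) \<le> \<Gamma>' * (cmod (v t) - cmod (b t))"
    using * assms(2) by (intro mult_right_mono) auto
  with * show "cmod (b t) < cmod (v t) \<and> cmod (v t) + cmod (b t) \<le> \<Gamma>' * (cmod (v t) - cmod (b t))"
    by linarith
qed

text \<open>The singular values of a pair are |v| + |b| and |v| - |b|, so this is
  submultiplicativity of the condition number. Multiplying by V + B turns the claim into a
  comparison of the squared norm of the composition with its determinant, and the determinant is
  multiplicative by \<open>det_compose\<close>.\<close>

lemma cond_le_compose:
  assumes "cond_le v b \<Gamma>" "cond_le v' b' \<Gamma>'"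
  shows "cond_le (\<lambda>t. v t * v' t + b t * cnj (b' t)) (\<lambda>t. v t * b' t + b t * cnj (v' t)) (\<Gamma> * \<Gamma>')"
proof -
  have "cmod (v t * b' t + b t * cnj (v' t)) < cmod (v t * v' t + b t * cnj (b' t)) \<and>
     cmod (v t * v' t + b t * cnj (b' t)) + cmod (v t * b' t + b t * cnj (v' t))
     \<le> \<Gamma> * \<Gamma>' * (cmod (v t * v' t + b t * cnj (b' t)) - cmod (v t * b' t + b t * cnj (v' t)))" for t
  proof -
  define V where "V = cmod (v t * v' t + b t * cnj (b' t))"
  define B where "B = cmod (v t * b' t + b t * cnj (v' t))"
  define x y x' y' where "x = cmod (v t)" "y = cmod (b t)" "x' = cmod (v' t)" "y' = cmod (b' t)"
  note d = this
  have 1: "y < x" "x + y \<le> \<Gamma> * (x - y)" "y' < x'" "x' + y' \<le> \<Gamma>' * (x' - y')" "y \<ge> 0" "y' \<ge> 0"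
    using assms unfolding cond_le_def d by auto
  have det: "V\<^sup>2 - B\<^sup>2 = (x\<^sup>2 - y\<^sup>2) * (x'\<^sup>2 - y'\<^sup>2)"
    unfolding V_def B_def d by (rule det_compose)
  have pos: "(x\<^sup>2 - y\<^sup>2) * (x'\<^sup>2 - y'\<^sup>2) > 0"
    using 1 by (intro mult_pos_pos) (auto intro: power_strict_mono)
  have "B\<^sup>2 < V\<^sup>2" using det pos by linarith
  hence BV: "B < V" by (rule power2_less_imp_less) (simp add: V_def)
  have "V \<le> x * x' + y * y'" "B \<le> x * y' + y * x'"
    unfolding V_def B_def d by (auto intro!: norm_triangle_le simp: norm_mult)
  hence VB: "V + B \<le> (x + y) * (x' + y')" by (simp add: algebra_simps)
  have "0 < V + B" using BV norm_ge_zero[of "v t * b' t + b t * cnj (v' t)"] unfolding B_def[symmetric] by linarith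
  have nn: "0 \<le> x + y" "0 \<le> x' + y'" using 1 by linarith+
  have "(V + B) * (V + B) \<le> ((x + y) * (x' + y')) * ((x + y) * (x' + y'))"
    by (rule mult_mono[OF VB VB]) (use \<open>0 < V + B\<close> nn in auto)
  also have "\<dots> \<le> ((x + y) * (x' + y')) * ((\<Gamma> * (x - y)) * (\<Gamma>' * (x' - y')))"
    by (rule mult_left_mono[OF mult_mono[OF 1(2) 1(4)]])
       (rule order.trans[OF nn(1) 1(2)], rule nn(2), rule mult_nonneg_nonneg[OF nn])
  also have "\<dots> = \<Gamma> * \<Gamma>' * ((x\<^sup>2 - y\<^sup>2) * (x'\<^sup>2 - y'\<^sup>2))" by (simp add: algebra_simps power2_eq_square)
  also have "\<dots> = \<Gamma> * \<Gamma>' * (V - B) * (V + B)" unfolding det[symmetric] by (simp add: algebra_simps power2_eq_square)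
  finally have "(V + B) * (V + B) \<le> \<Gamma> * \<Gamma>' * (V - B) * (V + B)" .
  hence "V + B \<le> \<Gamma> * \<Gamma>' * (V - B)" using \<open>0 < V + B\<close> by (rule mult_right_le_imp_le)
  with BV show ?thesis unfolding V_def B_def by (rule conjI)
  qed
  thus ?thesis unfolding cond_le_def by blast
qed

lemma conjugate_intro:
  assumes "\<And>t. (v has_vector_derivative (\<i> * of_real (f t) * v t + g t * cnj (b t)
            - \<i> * of_real (f' t) * v t - b t * cnj (g' t) + of_real (\<kappa> t) * v t)) (at t)"
    and "\<And>t. (b has_vector_derivative (\<i> * of_real (f t) * b t + g t * cnj (v t)
            - v t * g' t + \<i> * of_real (f' t) * b t + of_real (\<kappa> t) * b t)) (at t)"
    and "\<And>\<mu> u c \<phi>. phase f g \<mu> u c \<phi> \<Longrightarrow>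
        \<exists>\<psi> C. phase f' g' \<mu> (\<lambda>t. u t * v t + c t * cnj (b t)) (\<lambda>t. u t * b t + c t * cnj (v t)) \<psi> \<and>
           (\<forall>t\<ge>0. \<bar>\<phi> t - \<psi> t - \<sigma> * t\<bar> \<le> C)"
  shows "conjugate f g f' g' v b \<sigma>"
  unfolding conjugate_def
proof (rule conjI)
  show "\<exists>\<kappa>. \<forall>t.
        (v has_vector_derivative (\<i> * of_real (f t) * v t + g t * cnj (b t)
            - \<i> * of_real (f' t) * v t - b t * cnj (g' t) + of_real (\<kappa> t) * v t)) (at t) \<and>
        (b has_vector_derivative (\<i> * of_real (f t) * b t + g t * cnj (v t)
            - v t * g' t + \<i> * of_real (f' t) * b t + of_real (\<kappa> t) * b t)) (at t)"
    by (rule exI[of _ \<kappa>]) (use assms(1,2) in blast)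
qed (use assms(3) in blast)

lemma conjugate_refl: "conjugate f g f g (\<lambda>_. 1) (\<lambda>_. 0) 0"
proof (rule conjugate_intro[where \<kappa> = "\<lambda>_. 0"])
  fix \<mu> u c \<phi> assume *: "phase f g \<mu> u c \<phi>"
  show "\<exists>\<psi> C. phase f g \<mu> (\<lambda>t. u t * 1 + c t * cnj 0) (\<lambda>t. u t * 0 + c t * cnj 1) \<psi> \<and>
           (\<forall>t\<ge>0. \<bar>\<phi> t - \<psi> t - 0 * t\<bar> \<le> C)"
    by (rule exI[of _ \<phi>], rule exI[of _ 0]) (use * in simp)
qed auto

lemma conjugate_trans:
  assumes "conjugate f g f1 g1 v b \<sigma>" "conjugate f1 g1 f2 g2 v' b' \<sigma>'"
  shows "conjugate f g f2 g2 (\<lambda>t. v t * v' t + b t * cnj (b' t)) (\<lambda>t. v t * b' t + b t * cnj (v' t)) (\<sigma> + \<sigma>')"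
  unfolding conjugate_def
proof (intro conjI allI impI)
  from assms(1) obtain \<kappa> where \<kappa>:
    "\<And>t. (v has_vector_derivative (\<i> * of_real (f t) * v t + g t * cnj (b t)
            - \<i> * of_real (f1 t) * v t - b t * cnj (g1 t) + of_real (\<kappa> t) * v t)) (at t)"
    "\<And>t. (b has_vector_derivative (\<i> * of_real (f t) * b t + g t * cnj (v t)
            - v t * g1 t + \<i> * of_real (f1 t) * b t + of_real (\<kappa> t) * b t)) (at t)"
    unfolding conjugate_def by blast
  from assms(2) obtain \<kappa>' where \<kappa>':
    "\<And>t. (v' has_vector_derivative (\<i> * of_real (f1 t) * v' t + g1 t * cnj (b' t)
            - \<i> * of_real (f2 t) * v' t - b' t * cnj (g2 t) + of_real (\<kappa>' t) * v' t)) (at t)"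
    "\<And>t. (b' has_vector_derivative (\<i> * of_real (f1 t) * b' t + g1 t * cnj (v' t)
            - v' t * g2 t + \<i> * of_real (f2 t) * b' t + of_real (\<kappa>' t) * b' t)) (at t)"
    unfolding conjugate_def by blast
  show "\<exists>\<kappa>. \<forall>t.
        ((\<lambda>t. v t * v' t + b t * cnj (b' t)) has_vector_derivative (\<i> * of_real (f t) * (v t * v' t + b t * cnj (b' t)) + g t * cnj (v t * b' t + b t * cnj (v' t))
            - \<i> * of_real (f2 t) * (v t * v' t + b t * cnj (b' t)) - (v t * b' t + b t * cnj (v' t)) * cnj (g2 t) + of_real (\<kappa> t) * (v t * v' t + b t * cnj (b' t)))) (at t) \<and>
        ((\<lambda>t. v t * b' t + b t * cnj (v' t)) has_vector_derivative (\<i> * of_real (f t) * (v t * b' t + b t * cnj (v' t)) + g t * cnj (v t * v' t + b t * cnj (b' t))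
            - (v t * v' t + b t * cnj (b' t)) * g2 t + \<i> * of_real (f2 t) * (v t * b' t + b t * cnj (v' t)) + of_real (\<kappa> t) * (v t * b' t + b t * cnj (v' t)))) (at t)"
  proof (intro exI[of _ "\<lambda>t. \<kappa> t + \<kappa>' t"] allI conjI, goal_cases)
    case (1 t)
    show ?case
      by (rule has_vector_derivative_eq_rhs,
          (rule has_vector_derivative_add has_vector_derivative_mult has_vector_derivative_cnj \<kappa> \<kappa>')+)
         (simp add: algebra_simps)
  next
    case (2 t)
    show ?case
      by (rule has_vector_derivative_eq_rhs,
          (rule has_vector_derivative_add has_vector_derivative_mult has_vector_derivative_cnj \<kappa> \<kappa>')+)
         (simp add: algebra_simps)
  qed
next
  fix \<mu> u c \<phi> assume "phase f g \<mu> u c \<phi>"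
  then obtain \<psi> C where \<psi>: "phase f1 g1 \<mu> (\<lambda>t. u t * v t + c t * cnj (b t)) (\<lambda>t. u t * b t + c t * cnj (v t)) \<psi>"
    "\<And>t. t \<ge> 0 \<Longrightarrow> \<bar>\<phi> t - \<psi> t - \<sigma> * t\<bar> \<le> C"
    using assms(1) unfolding conjugate_def by blast
  then obtain \<theta> C' where \<theta>: "phase f2 g2 \<mu> (\<lambda>t. (u t * v t + c t * cnj (b t)) * v' t + (u t * b t + c t * cnj (v t)) * cnj (b' t))
      (\<lambda>t. (u t * v t + c t * cnj (b t)) * b' t + (u t * b t + c t * cnj (v t)) * cnj (v' t)) \<theta>"
    "\<And>t. t \<ge> 0 \<Longrightarrow> \<bar>\<psi> t - \<theta> t - \<sigma>' * t\<bar> \<le> C'"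
    using assms(2) unfolding conjugate_def by blast
  show "\<exists>\<psi> C. phase f2 g2 \<mu> (\<lambda>t. u t * (v t * v' t + b t * cnj (b' t)) + c t * cnj (v t * b' t + b t * cnj (v' t)))
            (\<lambda>t. u t * (v t * b' t + b t * cnj (v' t)) + c t * cnj (v t * v' t + b t * cnj (b' t))) \<psi> \<and>
         (\<forall>t\<ge>0. \<bar>\<phi> t - \<psi> t - (\<sigma> + \<sigma>') * t\<bar> \<le> C)"
  proof (intro exI[of _ \<theta>] exI[of _ "C + C'"] conjI allI impI)
    show "phase f2 g2 \<mu> (\<lambda>t. u t * (v t * v' t + b t * cnj (b' t)) + c t * cnj (v t * b' t + b t * cnj (v' t)))
            (\<lambda>t. u t * (v t * b' t + b t * cnj (v' t)) + c t * cnj (v t * v' t + b t * cnj (b' t))) \<theta>"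
      using \<theta>(1) by (simp add: algebra_simps)
    show "\<bar>\<phi> t - \<theta> t - (\<sigma> + \<sigma>') * t\<bar> \<le> C + C'" if "t \<ge> 0" for t
    proof -
      have "\<phi> t - \<theta> t - (\<sigma> + \<sigma>') * t = (\<phi> t - \<psi> t - \<sigma> * t) + (\<psi> t - \<theta> t - \<sigma>' * t)"
        by (simp add: algebra_simps)
      thus ?thesis using \<psi>(2)[OF that] \<theta>(2)[OF that] by linarith
    qed
  qed
qed

text \<open>In a frame turning with speed \<sigma> the coefficient \<open>g\<close>, which
  multiplies \<open>cnj z\<close>, turns twice as fast. Hence \<sigma> = \<pi> \<langle>n,
  \<omega>\<rangle> shifts the frequencies of \<open>g\<close> by - n, which is why resonances sit
  at half frequencies.\<close>

lemma conjugate_rotate: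
  "conjugate f g (\<lambda>t. f t - \<sigma>) (\<lambda>t. g t * cis (- 2 * \<sigma> * t)) (\<lambda>t. cis (\<sigma> * t)) (\<lambda>_. 0) \<sigma>"
proof (rule conjugate_intro[where \<kappa> = "\<lambda>_. 0"])
  fix t
  have "((\<lambda>z. exp (\<i> * of_real \<sigma> * z)) has_field_derivative (\<i> * of_real \<sigma> * exp (\<i> * of_real \<sigma> * of_real t))) (at (of_real t))"
    by (auto intro!: derivative_eq_intros)
  from has_vector_derivative_real_field[OF this]
  have "((\<lambda>t. cis (\<sigma> * t)) has_vector_derivative (\<i> * of_real \<sigma> * cis (\<sigma> * t))) (at t)"
    by (simp add: cis_conv_exp mult_ac)
  thus "((\<lambda>t. cis (\<sigma> * t)) has_vector_derivative
          \<i> * complex_of_real (f t) * cis (\<sigma> * t) + g t * cnj 0 - \<i> * complex_of_real (f t - \<sigma>) * cis (\<sigma> * t) -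
          0 * cnj (g t * cis (- 2 * \<sigma> * t)) + complex_of_real 0 * cis (\<sigma> * t)) (at t)"
    by (simp add: algebra_simps)
  have "cnj (cis (\<sigma> * t)) = cis (\<sigma> * t) * cis (- 2 * \<sigma> * t)"
    unfolding cis_mult by (simp add: cis_cnj algebra_simps)
  thus "((\<lambda>_. 0) has_vector_derivative
          \<i> * complex_of_real (f t) * 0 + g t * cnj (cis (\<sigma> * t)) - cis (\<sigma> * t) * (g t * cis (- 2 * \<sigma> * t)) +
          \<i> * complex_of_real (f t - \<sigma>) * 0 + complex_of_real 0 * 0) (at t)"
    by simp
next
  fix \<mu> u c \<phi> assume *: "phase f g \<mu> u c \<phi>"
  show "\<exists>\<psi> C. phase (\<lambda>t. f t - \<sigma>) (\<lambda>t. g t * cis (- 2 * \<sigma> * t)) \<mu>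
            (\<lambda>t. u t * cis (\<sigma> * t) + c t * cnj 0) (\<lambda>t. u t * 0 + c t * cnj (cis (\<sigma> * t))) \<psi> \<and>
         (\<forall>t\<ge>0. \<bar>\<phi> t - \<psi> t - \<sigma> * t\<bar> \<le> C)"
  proof (intro exI[of _ "\<lambda>t. \<phi> t - \<sigma> * t"] exI[of _ 0] conjI)
    have e: "cis (\<sigma> * t) * cis (\<phi> t - \<sigma> * t) = cis (\<phi> t)" "cnj (cis (\<sigma> * t)) * cis (- (\<phi> t - \<sigma> * t)) = cis (- \<phi> t)"
        "cis (- 2 * \<sigma> * t) * cis (- 2 * (\<phi> t - \<sigma> * t)) = cis (- 2 * \<phi> t)" for t
      by (simp_all add: cis_cnj cis_mult algebra_simps)
    show "phase (\<lambda>t. f t - \<sigma>) (\<lambda>t. g t * cis (- 2 * \<sigma> * t)) \<mu>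
            (\<lambda>t. u t * cis (\<sigma> * t) + c t * cnj 0) (\<lambda>t. u t * 0 + c t * cnj (cis (\<sigma> * t))) (\<lambda>t. \<phi> t - \<sigma> * t)"
      unfolding phase_def
    proof (intro allI impI)
      fix t :: real assume "t \<ge> 0"
      with * have "(\<phi> has_real_derivative
        (f t + Im (g t * cis (- 2 * \<phi> t)) +
         \<mu> * (Im (u t * cis (\<phi> t) + c t * cis (- \<phi> t)))\<^sup>2 / ((cmod (u t))\<^sup>2 - (cmod (c t))\<^sup>2)))
       (at t within {0..})" unfolding phase_def by blast
      hence d: "((\<lambda>t. \<phi> t - \<sigma> * t) has_real_derivative
          f t - \<sigma> + Im (g t * cis (- 2 * \<phi> t)) +
          \<mu> * (Im (u t * cis (\<phi> t) + c t * cis (- \<phi> t)))\<^sup>2 / ((cmod (u t))\<^sup>2 - (cmod (c t))\<^sup>2))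
         (at t within {0..})" by (auto intro!: derivative_eq_intros)
      show "((\<lambda>t. \<phi> t - \<sigma> * t) has_real_derivative
          f t - \<sigma> + Im (g t * cis (- 2 * \<sigma> * t) * cis (- 2 * (\<phi> t - \<sigma> * t))) +
          \<mu> * (Im ((u t * cis (\<sigma> * t) + c t * cnj 0) * cis (\<phi> t - \<sigma> * t) +
                    (u t * 0 + c t * cnj (cis (\<sigma> * t))) * cis (- (\<phi> t - \<sigma> * t))))\<^sup>2 /
          ((cmod (u t * cis (\<sigma> * t) + c t * cnj 0))\<^sup>2 - (cmod (u t * 0 + c t * cnj (cis (\<sigma> * t))))\<^sup>2))
         (at t within {0..})"
        using d unfolding mult.assoc[of _ "cis _" "cis _"] mult.assoc[of _ "cnj (cis _)" "cis _"]
          complex_cnj_zero mult_zero_right add_0_right add_0_left e norm_mult norm_cis complex_mod_cnj mult_1_right .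
    qed
  qed auto
qed

text \<open>With E = exp (- 2 i \<phi>), pulling the vector exp (i \<phi>) back by (v, b) gives exp
  (i \<phi>) w up to division by the determinant. So the new angle is \<phi> + arg w, and the left
  side is |w|^2 times its derivative. The right side is what the new equation prescribes; \<kappa>
  has dropped out.\<close>

lemma phase_identity:
  fixes v b g g' E :: complex and f f' \<kappa> p n :: real
  assumes E: "cmod E = 1"
    and p: "p = f + Im (g * E) + n"
    and w: "w = cnj v - b * E"
    and v': "v' = \<i> * of_real f * v + g * cnj b - \<i> * of_real f' * v - b * cnj g' + of_real \<kappa> * v"
    and b': "b' = \<i> * of_real f * b + g * cnj v - v * g' + \<i> * of_real f' * b + of_real \<kappa> * b"
    and w': "w' = cnj v' - b' * E + 2 * \<i> * of_real p * b * E"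
  shows "p * (cmod w)\<^sup>2 + Im (w' * cnj w) = f' * (cmod w)\<^sup>2 + Im (g' * E * cnj w * cnj w)
           + n * ((cmod v)\<^sup>2 - (cmod b)\<^sup>2)"
proof -
  have EE: "E * cnj E = 1" using E by (simp add: complex_norm_square[symmetric])
  \<comment> \<open>The part of w' that contains neither f', g' nor \<kappa>. Its pairing with
    \<open>cnj w\<close>, computed through \<open>a1\<close>, \<open>a2\<close>, \<open>a3\<close>,
    cancels the old rate p except for the energy part n, which survives multiplied by the
    determinant D.\<close>
  define R where "R = - \<i> * of_real f * (cnj v + b * E) + cnj g * b - g * cnj v * E + 2 * \<i> * of_real p * b * E"
  have Ew: "E * cnj w = v * E - cnj b" using EE unfolding w by (simp add: algebra_simps)
  have "w' = R + \<i> * of_real f' * w + g' * (v * E - cnj b) + of_real \<kappa> * w"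
    unfolding w' v' b' R_def w by (simp add: algebra_simps)
  hence "w' * cnj w = (R + \<i> * of_real f' * w + g' * (E * cnj w) + of_real \<kappa> * w) * cnj w"
    unfolding Ew by simp
  hence "w' * cnj w = R * cnj w + \<i> * of_real f' * (w * cnj w) + g' * E * cnj w * cnj w + of_real \<kappa> * (w * cnj w)"
    by (simp add: algebra_simps)
  hence 1: "Im (w' * cnj w) = Im (R * cnj w) + f' * (cmod w)\<^sup>2 + Im (g' * E * cnj w * cnj w)"
    by (simp add: complex_norm_square[symmetric])
  define D where "D = (cmod v)\<^sup>2 - (cmod b)\<^sup>2"
  have vv: "v * cnj v = of_real ((cmod v)\<^sup>2)" "b * cnj b = of_real ((cmod b)\<^sup>2)" by (simp_all only: complex_norm_square)
  have z: "Re (z - cnj z) = 0" "Im (z + cnj z) = 0" for z :: complex by simp_all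
  have cw: "cnj w = v - cnj b * cnj E" unfolding w by simp
  have "(cnj v + b * E) * cnj w = v * cnj v - b * cnj b * (E * cnj E) + (b * E * v - cnj (b * E * v))"
    unfolding cw by (simp add: algebra_simps)
  hence a1: "Re ((cnj v + b * E) * cnj w) = D" unfolding EE vv D_def by (simp del: complex_cnj_mult times_complex.sel add: z)
  have "(cnj g * b - g * cnj v * E) * cnj w = (cnj g * b * v + cnj (cnj g * b * v) * (E * cnj E)) - cnj (g * E) * (b * cnj b) - g * E * (v * cnj v)"
    unfolding cw by (simp add: algebra_simps)
  moreover have "Im (A + cnj A * 1 - cnj x * of_real \<beta> - x * of_real \<alpha>) = - (\<alpha> - \<beta>) * Im x" for A x and \<alpha> \<beta> :: real
    by (simp add: algebra_simps)
  ultimately have a2: "Im ((cnj g * b - g * cnj v * E) * cnj w) = - D * Im (g * E)" unfolding EE vv D_def by metis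
  have "w * cnj w + 2 * (b * E * cnj w) = v * cnj v - b * cnj b * (E * cnj E) + (b * E * v - cnj (b * E * v))"
    unfolding cw unfolding w by (simp add: algebra_simps)
  hence "Re (w * cnj w + 2 * (b * E * cnj w)) = D" unfolding EE vv D_def by (simp del: complex_cnj_mult times_complex.sel add: z)
  hence a3: "(cmod w)\<^sup>2 + 2 * Re (b * E * cnj w) = D" by (simp add: complex_norm_square[symmetric])
  have "R * cnj w = - \<i> * of_real f * ((cnj v + b * E) * cnj w) + (cnj g * b - g * cnj v * E) * cnj w + 2 * \<i> * of_real p * (b * E * cnj w)"
    unfolding R_def by (simp add: algebra_simps)
  hence "Im (R * cnj w) = - f * Re ((cnj v + b * E) * cnj w) + Im ((cnj g * b - g * cnj v * E) * cnj w) + 2 * p * Re (b * E * cnj w)"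
    by simp
  also have "\<dots> = - f * D - D * Im (g * E) + p * (D - (cmod w)\<^sup>2)" proof -
    have "2 * Re (b * E * cnj w) = D - (cmod w)\<^sup>2" using a3 by linarith
    hence "p * (2 * Re (b * E * cnj w)) = p * (D - (cmod w)\<^sup>2)" by (rule arg_cong)
    thus ?thesis unfolding a1 a2 by linarith
  qed
  finally have 2: "Im (R * cnj w) = - f * D - D * Im (g * E) + p * (D - (cmod w)\<^sup>2)" .
  show ?thesis unfolding 1 2 D_def[symmetric] p by (simp add: algebra_simps)
qed

lemma has_real_derivative_Im_Ln:
  assumes "(w has_vector_derivative w') (at t within A)" "Re (w t) > 0"
  shows "((\<lambda>t. Im (Ln (w t))) has_real_derivative (Im (w' / w t))) (at t within A)"
proof -
  have "(Ln has_field_derivative inverse (w t)) (at (w t) within w ` A)"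
    by (rule has_field_derivative_at_within, rule has_field_derivative_Ln)
       (use assms(2) in \<open>auto simp: complex_nonpos_Reals_iff\<close>)
  from field_vector_diff_chain_within[OF assms(1) this]
  have "((\<lambda>t. Ln (w t)) has_vector_derivative (w' * inverse (w t))) (at t within A)" by (simp add: o_def)
  from has_derivative_Im[OF this[unfolded has_vector_derivative_def]] show ?thesis
    by (simp add: has_real_derivative_iff_has_vector_derivative has_vector_derivative_def divide_inverse)
qed

text \<open>For \<open>Re v > \<bar>b\<bar>\<close> the map \<open>(v, b)\<close> moves every vector by an angle less than \<open>\<pi> / 2\<close>, so the
  new angle can be chosen close to the old one.\<close>

lemma conjugateI:
  assumes Re: "\<And>t. cmod (b t) < Re (v t)"
    and v: "\<And>t. (v has_vector_derivative (\<i> * of_real (f t) * v t + g t * cnj (b t)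
            - \<i> * of_real (f' t) * v t - b t * cnj (g' t) + of_real (\<kappa> t) * v t)) (at t)"
    and b: "\<And>t. (b has_vector_derivative (\<i> * of_real (f t) * b t + g t * cnj (v t)
            - v t * g' t + \<i> * of_real (f' t) * b t + of_real (\<kappa> t) * b t)) (at t)"
  shows "conjugate f g f' g' v b 0"
proof (rule conjugate_intro[OF v b])
  fix \<mu> u c \<phi> assume ph: "phase f g \<mu> u c \<phi>"
  define E where "E t = cis (- 2 * \<phi> t)" for t
  define w where "w t = cnj (v t) - b t * E t" for t
  have Rew: "Re (w t) > 0" for t
  proof -
    have "Re (b t * E t) \<le> cmod (b t * E t)" by (rule complex_Re_le_cmod)
    also have "\<dots> = cmod (b t)" by (simp add: E_def norm_mult)
    finally show ?thesis using Re[of t] by (simp add: w_def)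
  qed
  define \<psi> where "\<psi> t = \<phi> t + Im (Ln (w t))" for t
  have Arg: "\<bar>Im (Ln (w t))\<bar> < pi / 2" for t
    using Re_Ln_pos_lt[of "w t"] Rew[of t] by (metis less_irrefl zero_complex.sel(1))
  show "\<exists>\<psi> C. phase f' g' \<mu> (\<lambda>t. u t * v t + c t * cnj (b t)) (\<lambda>t. u t * b t + c t * cnj (v t)) \<psi> \<and>
           (\<forall>t\<ge>0. \<bar>\<phi> t - \<psi> t - 0 * t\<bar> \<le> C)"
  proof (intro exI[of _ \<psi>] exI[of _ "pi / 2"] conjI allI impI)
    show "\<bar>\<phi> t - \<psi> t - 0 * t\<bar> \<le> pi / 2" for t using Arg[of t] by (simp add: \<psi>_def)
    show "phase f' g' \<mu> (\<lambda>t. u t * v t + c t * cnj (b t)) (\<lambda>t. u t * b t + c t * cnj (v t)) \<psi>"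
      unfolding phase_def
    proof (intro allI impI)
      fix t :: real assume t: "t \<ge> 0"
      define D1 where "D1 = (cmod (u t))\<^sup>2 - (cmod (c t))\<^sup>2"
      define D where "D = (cmod (v t))\<^sup>2 - (cmod (b t))\<^sup>2"
      define n where "n = \<mu> * (Im (u t * cis (\<phi> t) + c t * cis (- \<phi> t)))\<^sup>2 / D1"
      define p where "p = f t + Im (g t * E t) + n"
      define v' where "v' = \<i> * of_real (f t) * v t + g t * cnj (b t)
            - \<i> * of_real (f' t) * v t - b t * cnj (g' t) + of_real (\<kappa> t) * v t"
      define b' where "b' = \<i> * of_real (f t) * b t + g t * cnj (v t)
            - v t * g' t + \<i> * of_real (f' t) * b t + of_real (\<kappa> t) * b t"
      define w' where "w' = cnj v' - b' * E t + 2 * \<i> * of_real p * b t * E t"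
      have \<phi>': "(\<phi> has_real_derivative p) (at t within {0..})"
        using ph t unfolding phase_def p_def n_def D1_def E_def by blast
      have "((\<lambda>z. exp (\<i> * z)) has_field_derivative (\<i> * exp (\<i> * of_real x))) (at (of_real x))" for x
        by (auto intro!: derivative_eq_intros)
      from has_vector_derivative_real_field[OF this]
      have cis': "(cis has_vector_derivative (\<i> * cis x)) (at x within A)" for x A
        by (simp add: cis_conv_exp[abs_def])
      have "((\<lambda>t. - 2 * \<phi> t) has_vector_derivative (- 2 * p)) (at t within {0..})"
        using DERIV_cmult[OF \<phi>', of "-2"] by (simp add: has_real_derivative_iff_has_vector_derivative)
      from vector_diff_chain_within[OF this cis']
      have E': "(E has_vector_derivative (- 2 * \<i> * of_real p * E t)) (at t within {0..})"
        by (simp add: o_def E_def[abs_def] scaleR_conv_of_real mult_ac)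
      have wd: "(w has_vector_derivative w') (at t within {0..})"
      proof -
        have "(w has_vector_derivative (cnj v' - (b t * (- 2 * \<i> * of_real p * E t) + b' * E t))) (at t within {0..})"
          unfolding w_def[abs_def]
          by (intro has_vector_derivative_diff has_vector_derivative_mult has_vector_derivative_cnj E')
             (use v[of t] b[of t] in \<open>auto simp: v'_def b'_def intro: has_vector_derivative_at_within\<close>)
        thus ?thesis by (rule has_vector_derivative_eq_rhs) (simp add: w'_def)
      qed
      have \<psi>': "(\<psi> has_real_derivative (p + Im (w' / w t))) (at t within {0..})"
        unfolding \<psi>_def[abs_def]
        by (intro DERIV_add \<phi>' has_real_derivative_Im_Ln wd Rew)
      have w0: "w t \<noteq> 0" using Rew[of t] by auto
      define r where "r = cmod (w t)"
      have r: "r > 0" using w0 by (simp add: r_def)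
      have id: "p * r\<^sup>2 + Im (w' * cnj (w t)) = f' t * r\<^sup>2 + Im (g' t * E t * cnj (w t) * cnj (w t)) + n * D"
        unfolding D_def r_def
        by (rule phase_identity[OF _ p_def w_def v'_def b'_def w'_def]) (simp add: E_def)
      have pol: "w t = of_real r * cis (\<psi> t - \<phi> t)"
      proof -
        have "w t = exp (Ln (w t))" using w0 by simp
        also have "\<dots> = of_real r * cis (Im (Ln (w t)))"
          by (subst exp_eq_polar) (simp add: r_def w0)
        finally show ?thesis by (simp add: \<psi>_def)
      qed
      have c1: "cnj (w t) = of_real r * cis (\<phi> t - \<psi> t)" by (subst pol) (simp add: cis_cnj)
      have t1: "Im (w' / w t) = Im (w' * cnj (w t)) / r\<^sup>2"
      proof -
        have "w' / w t = (w' * cnj (w t)) / of_real (r\<^sup>2)"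
          by (simp add: r_def complex_norm_square field_simps w0 del: of_real_power)
        thus ?thesis by (simp only: Im_divide_of_real)
      qed
      have t2: "Im (g' t * E t * cnj (w t) * cnj (w t)) = r\<^sup>2 * Im (g' t * cis (- 2 * \<psi> t))"
      proof -
        have "E t * cis (\<phi> t - \<psi> t) * cis (\<phi> t - \<psi> t) = cis (- 2 * \<psi> t)"
          by (simp add: E_def cis_mult algebra_simps)
        moreover have "g' t * E t * cnj (w t) * cnj (w t) =
            of_real (r\<^sup>2) * (g' t * (E t * cis (\<phi> t - \<psi> t) * cis (\<phi> t - \<psi> t)))"
          unfolding c1 power2_eq_square of_real_mult by (simp only: mult_ac)
        ultimately have "g' t * E t * cnj (w t) * cnj (w t) = of_real (r\<^sup>2) * (g' t * cis (- 2 * \<psi> t))"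
          by simp
        moreover have "Im (of_real a * z) = a * Im z" for a z by simp
        ultimately show ?thesis by (simp only:)
      qed
      define Z where "Z = u t * cis (\<phi> t) + c t * cis (- \<phi> t)"
      define W where "W = (u t * v t + c t * cnj (b t)) * cis (\<psi> t) + (u t * b t + c t * cnj (v t)) * cis (- \<psi> t)"
      \<comment> \<open>\<open>Z\<close> is the accumulated map applied to the old direction,
        \<open>W\<close> the composed map applied to the new one. The new direction is D / r times
        the preimage of the old one, so W = (D / r) Z. Hence (Im)^2 over the determinant changes by
        exactly the factor D / r^2 that multiplies \<open>n\<close> in the new rate.\<close>
      have ZW: "of_real r * W = of_real D * Z"
      proof -
        have s1: "of_real r * cis (\<psi> t) = cnj (v t) * cis (\<phi> t) - b t * cis (- \<phi> t)"
        proof -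
          have "of_real r * cis (\<psi> t) = w t * cis (\<phi> t)" unfolding pol by (simp add: cis_mult mult.assoc)
          thus ?thesis by (simp add: w_def E_def algebra_simps cis_mult)
        qed
        from arg_cong[OF this, of cnj] have s2: "of_real r * cis (- \<psi> t) = v t * cis (- \<phi> t) - cnj (b t) * cis (\<phi> t)"
          by (simp add: cis_cnj)
        have "of_real r * W = (u t * v t + c t * cnj (b t)) * (of_real r * cis (\<psi> t)) + (u t * b t + c t * cnj (v t)) * (of_real r * cis (- \<psi> t))"
          unfolding W_def by (simp add: algebra_simps)
        also have "\<dots> = (v t * cnj (v t) - b t * cnj (b t)) * Z"
          unfolding s1 s2 Z_def by (simp add: algebra_simps)
        also have "v t * cnj (v t) - b t * cnj (b t) = of_real D"
          unfolding D_def by (simp only: of_real_diff complex_norm_square)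
        finally show ?thesis .
      qed
      have Dpos: "D > 0"
      proof -
        have "cmod (b t) < cmod (v t)" using Re[of t] complex_Re_le_cmod[of "v t"] by linarith
        thus ?thesis unfolding D_def by (simp add: power_strict_mono)
      qed
      have "r * Im W = D * Im Z" using arg_cong[OF ZW, of Im] by simp
      hence "r\<^sup>2 * (Im W)\<^sup>2 = D\<^sup>2 * (Im Z)\<^sup>2" by (metis power_mult_distrib)
      hence WZ: "(Im W)\<^sup>2 = D\<^sup>2 * (Im Z)\<^sup>2 / r\<^sup>2" using r by (simp add: field_simps)
      have n2: "n * D / r\<^sup>2 = \<mu> * (Im W)\<^sup>2 / (D1 * D)"
        unfolding WZ n_def Z_def[symmetric] using Dpos by (simp add: field_simps power2_eq_square)
      have "p + Im (w' / w t) = (p * r\<^sup>2 + Im (w' * cnj (w t))) / r\<^sup>2" unfolding t1 using r by (simp add: field_simps)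
      also have "\<dots> = f' t + Im (g' t * cis (- 2 * \<psi> t)) + n * D / r\<^sup>2"
        unfolding id t2 using r by (simp add: field_simps)
      finally have e: "p + Im (w' / w t) = f' t + Im (g' t * cis (- 2 * \<psi> t)) + \<mu> * (Im W)\<^sup>2 / (D1 * D)" unfolding n2 .
      show "(\<psi> has_real_derivative
          f' t + Im (g' t * cis (- 2 * \<psi> t)) +
          \<mu> * (Im ((u t * v t + c t * cnj (b t)) * cis (\<psi> t) + (u t * b t + c t * cnj (v t)) * cis (- \<psi> t)))\<^sup>2 /
          ((cmod (u t * v t + c t * cnj (b t)))\<^sup>2 - (cmod (u t * b t + c t * cnj (v t)))\<^sup>2))
         (at t within {0..})"
        using \<psi>' unfolding det_compose D1_def[symmetric] D_def[symmetric] W_def[symmetric] e .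
    qed
  qed
qed

section \<open>Averaging\<close>

lemma wiener_eqI:
  assumes "wiener \<omega> S \<rho> C f" "\<And>t. f t = g t" "C \<le> C'"
  shows "wiener \<omega> S \<rho> C' g"
proof -
  have "f = g" using assms(2) by (rule ext)
  thus ?thesis using wiener_mono[OF assms(1) order.refl assms(3) order.refl] by simp
qed

lemma wiener_UNIV: "wiener \<omega> S \<rho> C f \<Longrightarrow> wiener \<omega> UNIV \<rho> C f"
  by (erule wiener_mono) auto

text \<open>The map P = (1 + i q, b) with q' = fn and b' = 2 i \<beta> b + gn cancels the removable
  parts fn, gn to first order. It is D \<nu> close to the identity, so the new error is D \<nu>
  times the full size of the coefficients. The retained parts fS, gS stay fixed, and the error is
  sorted again into removable and other modes. The sets N1 and N2 differ because \<open>f\<close>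
  meets the divisors 2 \<pi> \<langle>n, \<omega>\<rangle> and \<open>g\<close> the divisors 2 \<pi>
  \<langle>n, \<omega>\<rangle> - 2 \<beta>.\<close>

lemma averaging_step:
  fixes fS fo fn :: "real \<Rightarrow> real" and gS go gn :: "real \<Rightarrow> complex"
  assumes \<rho>: "\<rho> \<ge> 0" and D: "D > 0"
    and S: "wiener \<omega> UNIV \<rho> s (\<lambda>t. of_real (fS t))" "wiener \<omega> UNIV \<rho> s gS"
    and o: "wiener \<omega> (- N1) \<rho> \<eta> (\<lambda>t. of_real (fo t))" "wiener \<omega> (- N2) \<rho> \<eta> go"
    and n: "wiener \<omega> N1 \<rho> \<nu> (\<lambda>t. of_real (fn t))" "wiener \<omega> N2 \<rho> \<nu> gn"
    and sym: "uminus ` N1 = N1"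
    and div: "\<And>n. n \<in> N1 \<Longrightarrow> \<bar>2 * pi * int_inner n \<omega>\<bar> \<ge> 1 / D"
             "\<And>n. n \<in> N2 \<Longrightarrow> \<bar>2 * pi * int_inner n \<omega> - 2 * \<beta>\<bar> \<ge> 1 / D"
    and small: "D * \<nu> \<le> 1 / 8"
    and e: "10 * (D * \<nu>) * (s + \<eta> + \<nu>) \<le> e"
  obtains fo' go' fn' gn' v b where
    "wiener \<omega> (- N1) \<rho> (\<eta> + e) (\<lambda>t. of_real (fo' t))" "wiener \<omega> (- N2) \<rho> (\<eta> + e) go'"
    "wiener \<omega> N1 \<rho> e (\<lambda>t. of_real (fn' t))" "wiener \<omega> N2 \<rho> e gn'"
    "cond_le v b (1 + 8 * (D * \<nu>))"
    "conjugate (\<lambda>t. \<beta> + fS t + fo t + fn t) (\<lambda>t. gS t + go t + gn t)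
       (\<lambda>t. \<beta> + fS t + fo' t + fn' t) (\<lambda>t. gS t + go' t + gn' t) v b 0"
proof -
  define y \<Lambda> where "y = D * \<nu>" and "\<Lambda> = s + \<eta> + \<nu>"
  have nn: "0 \<le> s" "0 \<le> \<eta>" "0 \<le> \<nu>" using wiener_nonneg S o n by blast+
  have y: "0 \<le> y" "y \<le> 1 / 8" using nn D small by (auto simp: y_def)
  have \<Lambda>: "0 \<le> \<Lambda>" using nn by (simp add: \<Lambda>_def)
  obtain q0 where q0: "wiener \<omega> N1 \<rho> (D * \<nu>) q0"
    "\<And>t. (q0 has_vector_derivative (\<i> * of_real 0 * q0 t + of_real (fn t))) (at t)"
    by (rule wiener_solve[OF n(1) \<rho> D, of 0]) (use div(1) in auto)
  define q where "q t = Re (q0 t)" for t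
  have qW: "wiener \<omega> N1 \<rho> (D * \<nu>) (\<lambda>t. of_real (q t))"
    unfolding q_def by (rule wiener_Re[OF q0(1) \<rho>]) (simp add: sym)
  have q': "((\<lambda>t. complex_of_real (q t)) has_vector_derivative of_real (fn t)) (at t)" for t
  proof -
    have "(q0 has_derivative (\<lambda>h. h *\<^sub>R complex_of_real (fn t))) (at t)"
      using q0(2)[of t] by (simp add: has_vector_derivative_def)
    from bounded_linear.has_derivative[OF bounded_linear_Re this]
    have "((\<lambda>t. Re (q0 t)) has_vector_derivative fn t) (at t)"
      by (simp add: has_vector_derivative_def)
    thus ?thesis unfolding q_def by (rule bounded_linear.has_vector_derivative[OF bounded_linear_of_real])
  qed
  obtain b where b: "wiener \<omega> N2 \<rho> (D * \<nu>) b"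
    "\<And>t. (b has_vector_derivative (\<i> * of_real (2 * \<beta>) * b t + gn t)) (at t)"
    by (rule wiener_solve[OF n(2) \<rho> D, of "2 * \<beta>"]) (use div(2) in auto)
  define v where "v t = 1 + \<i> * of_real (q t)" for t
  define fK where "fK t = fS t + fo t" for t
  define ft where "ft t = fK t + fn t" for t
  define gK where "gK t = gS t + go t" for t
  define gt where "gt t = gK t + gn t" for t
  \<comment> \<open>For the system matrix A, L = A P - P' - P (i \<beta>), in which fn and gn have
    cancelled; R is the adjugate of P times L, and 1 + d is the determinant of P. Dividing R by 1 +
    d gives the new coefficients exactly, without expanding in P.\<close>
  define Lu where "Lu t = \<i> * of_real (fK t) + (- 1) * (of_real (ft t) * of_real (q t)) + gt t * cnj (b t)" for t
  define Lc where "Lc t = gK t + \<i> * (of_real (ft t) * b t) + (- \<i>) * (of_real (q t) * gt t)" for t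
  define Ru where "Ru t = Lu t + (- \<i>) * (of_real (q t) * Lu t) + (- 1) * (b t * cnj (Lc t))" for t
  define Rc where "Rc t = Lc t + (- \<i>) * (of_real (q t) * Lc t) + (- 1) * (b t * cnj (Lu t))" for t
  define d where "d t = of_real (q t) * of_real (q t) + (- 1) * (b t * cnj (b t))" for t
  define ef where "ef t = (Im (Ru t) - fK t - Re (d t) * fK t) / (1 + Re (d t))" for t
  define eg where "eg t = (Rc t - gK t - d t * gK t) / (1 + d t)" for t
  note wA = wiener_add[OF _ _ \<rho>] and wM = wiener_mult[OF _ _ \<rho>] and wC = wiener_cmult
  have bW: "wiener \<omega> UNIV \<rho> y b" "wiener \<omega> UNIV \<rho> y (\<lambda>t. cnj (b t))"
       "wiener \<omega> UNIV \<rho> y (\<lambda>t. of_real (q t))"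
    unfolding y_def using b(1) wiener_cnj[OF b(1)] qW by (auto intro: wiener_UNIV)
  have K: "wiener \<omega> UNIV \<rho> \<Lambda> (\<lambda>t. of_real (fK t))" "wiener \<omega> UNIV \<rho> \<Lambda> gK"
    by (rule wiener_eqI[OF wA[OF S(1) wiener_UNIV[OF o(1)]]]; use nn in \<open>simp add: fK_def \<Lambda>_def\<close>)
       (rule wiener_eqI[OF wA[OF S(2) wiener_UNIV[OF o(2)]]]; use nn in \<open>simp add: gK_def \<Lambda>_def\<close>)
  have T: "wiener \<omega> UNIV \<rho> \<Lambda> (\<lambda>t. of_real (ft t))" "wiener \<omega> UNIV \<rho> \<Lambda> gt"
    by (rule wiener_eqI[OF wA[OF wA[OF S(1) wiener_UNIV[OF o(1)]] wiener_UNIV[OF n(1)]]]; simp add: fK_def ft_def \<Lambda>_def)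
       (rule wiener_eqI[OF wA[OF wA[OF S(2) wiener_UNIV[OF o(2)]] wiener_UNIV[OF n(2)]]]; simp add: gK_def gt_def \<Lambda>_def)
  have \<Lambda>y: "\<Lambda> * y \<le> \<Lambda> / 8" "0 \<le> \<Lambda> * y" using mult_left_mono[OF y(2) \<Lambda>] \<Lambda> y by auto
  have LW: "wiener \<omega> UNIV \<rho> (5/4 * \<Lambda>) Lu" "wiener \<omega> UNIV \<rho> (5/4 * \<Lambda>) Lc"
  proof -
    show "wiener \<omega> UNIV \<rho> (5/4 * \<Lambda>) Lu"
      by (rule wiener_eqI[OF wA[OF wA[OF wC[OF K(1), of \<i>] wC[OF wM[OF T(1) bW(3)], of "-1"]] wM[OF T(2) bW(2)]]])
         (use \<Lambda>y in \<open>simp_all add: Lu_def\<close>)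
    show "wiener \<omega> UNIV \<rho> (5/4 * \<Lambda>) Lc"
      by (rule wiener_eqI[OF wA[OF wA[OF K(2) wC[OF wM[OF T(1) bW(1)], of "\<i>"]] wC[OF wM[OF bW(3) T(2)], of "-\<i>"]]])
         (use \<Lambda>y in \<open>simp_all add: Lc_def mult.commute\<close>)
  qed
  have Lcnj: "wiener \<omega> UNIV \<rho> (5/4 * \<Lambda>) (\<lambda>t. cnj (Lu t))" "wiener \<omega> UNIV \<rho> (5/4 * \<Lambda>) (\<lambda>t. cnj (Lc t))"
    using wiener_cnj[OF LW(1)] wiener_cnj[OF LW(2)] by (auto intro: wiener_UNIV)
  have dW: "wiener \<omega> UNIV \<rho> (y / 4) d"
  proof (rule wiener_eqI[OF wA[OF wM[OF bW(3) bW(3)] wC[OF wM[OF bW(1) bW(2)], of "-1"]]])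
    have "y * y \<le> 1/8 * y" by (rule mult_right_mono) (use y in auto)
    thus "y * y + cmod (- 1) * (y * y) \<le> y / 4" by simp
  qed (simp add: d_def)
  have dreal: "Im (d t) = 0" for t by (simp add: d_def)
  hence dR: "d t = of_real (Re (d t))" for t by (simp add: complex_eq_iff)
  have y2: "y / 4 \<le> 1 / 2" using y by simp
  have dn: "1 + Re (d t) \<noteq> 0" for t
  proof -
    have "\<bar>Re (d t)\<bar> \<le> cmod (d t)" by (rule abs_Re_le_cmod)
    also have "\<dots> \<le> y / 4" by (rule wiener_bound[OF dW \<rho>])
    finally show ?thesis using y by linarith
  qed
  have inv: "wiener \<omega> UNIV \<rho> 2 (\<lambda>t. 1 / (1 + d t))" by (rule wiener_inverse[OF dW \<rho> y2])
  have Ksym: "(uminus :: int^'a \<Rightarrow> _) ` UNIV \<subseteq> UNIV" by simp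
  have eW: "wiener \<omega> UNIV \<rho> e (\<lambda>t. of_real (ef t))" "wiener \<omega> UNIV \<rho> e eg"
  proof -
    define P where "P t = (- 1) * (of_real (ft t) * of_real (q t)) + gt t * cnj (b t)
        + (- \<i>) * (of_real (q t) * Lu t) + (- 1) * (b t * cnj (Lc t))" for t
    \<comment> \<open>Two terms of size \<Lambda> y and two of size 5/4 \<Lambda> y. Adding the
      determinant correction \<Lambda> y / 4 and doubling for the inverse of 1 + d gives 19/2
      \<Lambda> y, whence the constant 10 in the hypothesis on \<open>e\<close>.\<close>
    have PW: "wiener \<omega> UNIV \<rho> (9/2 * (\<Lambda> * y)) P"
      by (rule wiener_eqI[OF wA[OF wA[OF wA[OF wC[OF wM[OF T(1) bW(3)], of "-1"] wM[OF T(2) bW(2)]]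
              wC[OF wM[OF bW(3) LW(1)], of "-\<i>"]] wC[OF wM[OF bW(1) Lcnj(2)], of "-1"]]])
         (simp_all add: P_def)
    have fe: "of_real (ef t) = (of_real (Im (P t)) + (- 1) * (d t * of_real (fK t))) * (1 / (1 + d t))" for t
    proof -
      have "Ru t = \<i> * of_real (fK t) + P t" by (simp add: Ru_def Lu_def P_def)
      hence "Im (P t) = Im (Ru t) - fK t" by simp
      thus ?thesis by (subst (1 2) dR) (simp add: ef_def)
    qed
    have "wiener \<omega> UNIV \<rho> ((9/2 * (\<Lambda> * y) + cmod (- 1) * (y / 4 * \<Lambda>)) * 2)
        (\<lambda>t. (of_real (Im (P t)) + (- 1) * (d t * of_real (fK t))) * (1 / (1 + d t)))"
      by (rule wM[OF wA[OF wiener_Im[OF PW \<rho> Ksym] wC[OF wM[OF dW K(1)], of "-1"]] inv])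
    thus "wiener \<omega> UNIV \<rho> e (\<lambda>t. of_real (ef t))"
      by (rule wiener_eqI) (use fe e \<Lambda>y in \<open>simp_all add: y_def[symmetric] \<Lambda>_def[symmetric] mult_ac\<close>)
    define Q where "Q t = \<i> * (of_real (ft t) * b t) + (- \<i>) * (of_real (q t) * gt t)
        + (- \<i>) * (of_real (q t) * Lc t) + (- 1) * (b t * cnj (Lu t))" for t
    have QW: "wiener \<omega> UNIV \<rho> (9/2 * (\<Lambda> * y)) Q"
      by (rule wiener_eqI[OF wA[OF wA[OF wA[OF wC[OF wM[OF T(1) bW(1)], of "\<i>"] wC[OF wM[OF bW(3) T(2)], of "-\<i>"]]
              wC[OF wM[OF bW(3) LW(2)], of "-\<i>"]] wC[OF wM[OF bW(1) Lcnj(1)], of "-1"]]])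
         (simp_all add: Q_def mult.commute)
    have ge: "eg t = (Q t + (- 1) * (d t * gK t)) * (1 / (1 + d t))" for t
      by (simp add: eg_def Q_def Rc_def Lc_def)
    have "wiener \<omega> UNIV \<rho> ((9/2 * (\<Lambda> * y) + cmod (- 1) * (y / 4 * \<Lambda>)) * 2)
        (\<lambda>t. (Q t + (- 1) * (d t * gK t)) * (1 / (1 + d t)))"
      by (rule wM[OF wA[OF QW wC[OF wM[OF dW K(2)], of "-1"]] inv])
    thus "wiener \<omega> UNIV \<rho> e eg"
      by (rule wiener_eqI) (use ge e \<Lambda>y in \<open>simp_all add: y_def[symmetric] \<Lambda>_def[symmetric] mult_ac\<close>)
  qed
  obtain f1 f2 C1 C2 where f12: "wiener \<omega> (UNIV \<inter> N1) \<rho> C1 f1" "wiener \<omega> (UNIV - N1) \<rho> C2 f2"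
    "C1 + C2 \<le> e" "\<And>t. of_real (ef t) = f1 t + f2 t" by (rule wiener_split[OF eW(1), of N1]) (rule that)
  obtain g1 g2 B1 B2 where g12: "wiener \<omega> (UNIV \<inter> N2) \<rho> B1 g1" "wiener \<omega> (UNIV - N2) \<rho> B2 g2"
    "B1 + B2 \<le> e" "\<And>t. eg t = g1 t + g2 t" by (rule wiener_split[OF eW(2), of N2]) (rule that)
  note CB = wiener_nonneg[OF f12(1)] wiener_nonneg[OF f12(2)] wiener_nonneg[OF g12(1)] wiener_nonneg[OF g12(2)]
  have symc: "uminus ` (- N1) \<subseteq> - N1"
  proof
    fix m assume "m \<in> uminus ` (- N1)"
    then obtain k where k: "m = - k" "k \<notin> N1" by auto
    have "m \<notin> N1"
    proof
      assume "m \<in> N1"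
      hence "- m \<in> uminus ` N1" by (rule imageI)
      thus False using k sym by simp
    qed
    thus "m \<in> - N1" by simp
  qed
  define fn' where "fn' t = Re (f1 t)" for t
  define fo' where "fo' t = fo t + Re (f2 t)" for t
  have W1: "wiener \<omega> N1 \<rho> e (\<lambda>t. of_real (fn' t))" unfolding fn'_def
    by (rule wiener_mono[OF wiener_Re[OF f12(1) \<rho>]]) (use sym CB f12(3) in auto)
  have f2R: "wiener \<omega> (- N1) \<rho> e (\<lambda>t. of_real (Re (f2 t)))"
    by (rule wiener_mono[OF wiener_Re[OF f12(2) \<rho>]]) (use symc CB f12(3) in \<open>auto simp: Compl_eq_Diff_UNIV\<close>)
  have W2: "wiener \<omega> (- N1) \<rho> (\<eta> + e) (\<lambda>t. of_real (fo' t))"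
    by (rule wiener_eqI[OF wA[OF o(1) f2R]]) (simp_all add: fo'_def)
  have W3: "wiener \<omega> N2 \<rho> e g1" by (rule wiener_mono[OF g12(1)]) (use CB g12(3) in auto)
  have g2W: "wiener \<omega> (- N2) \<rho> e g2" by (rule wiener_mono[OF g12(2)]) (use CB g12(3) in auto)
  have W4: "wiener \<omega> (- N2) \<rho> (\<eta> + e) (\<lambda>t. go t + g2 t)" by (rule wA[OF o(2) g2W])
  have bb: "cmod (b t) \<le> y" "\<bar>q t\<bar> \<le> y" for t
    using wiener_bound[OF bW(1) \<rho>, of t] wiener_bound[OF bW(3) \<rho>, of t] by auto
  have f'eq: "\<beta> + fS t + fo' t + fn' t = \<beta> + Im (Ru t) / (1 + Re (d t))" for t
  proof -
    have "ef t = Re (f1 t) + Re (f2 t)" using arg_cong[OF f12(4)[of t], of Re] by simp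
    hence "fS t + fo' t + fn' t = fK t + ef t" by (simp add: fo'_def fn'_def fK_def)
    also have "\<dots> = Im (Ru t) / (1 + Re (d t))" unfolding ef_def using dn[of t] by (simp add: field_simps)
    finally show ?thesis by simp
  qed
  have g'eq: "gS t + (go t + g2 t) + g1 t = Rc t / (1 + of_real (Re (d t)))" for t
  proof -
    have nz: "1 + d t \<noteq> 0"
    proof
      assume "1 + d t = 0"
      hence "Re (1 + d t) = 0" by (metis zero_complex.sel(1))
      thus False using dn[of t] by simp
    qed
    have "gS t + (go t + g2 t) + g1 t = gK t + eg t" by (simp add: gK_def g12(4))
    also have "\<dots> = Rc t / (1 + d t)" unfolding eg_def using nz by (simp add: field_simps)
    finally show ?thesis by (simp flip: dR)
  qed
  define R where "R t = complex_of_real (Re (d t))" for t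
  have R0: "1 + R t \<noteq> 0" for t
  proof -
    have "1 + R t = of_real (1 + Re (d t))" by (simp add: R_def)
    thus ?thesis using dn[of t] by (metis of_real_eq_0_iff)
  qed
  have Rd: "R t = of_real (q t) * of_real (q t) - b t * cnj (b t)" for t
    unfolding R_def dR[symmetric] unfolding d_def by (simp only: mult_minus_left mult_1_left diff_conv_add_uminus)
  have F1: "v t * Ru t + b t * cnj (Rc t) = (1 + R t) * Lu t" for t
    unfolding v_def Ru_def Rc_def Rd by (simp add: algebra_simps)
  have F2: "v t * Rc t + b t * cnj (Ru t) = (1 + R t) * Lc t" for t
    unfolding v_def Ru_def Rc_def Rd by (simp add: algebra_simps)
  have F1': "v t * (Ru t / (1 + R t)) + b t * cnj (Rc t / (1 + R t)) = Lu t" for t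
  proof -
    have "cnj (1 + R t) = 1 + R t" by (simp add: R_def)
    hence "v t * (Ru t / (1 + R t)) + b t * cnj (Rc t / (1 + R t)) = (v t * Ru t + b t * cnj (Rc t)) / (1 + R t)"
      by (simp add: add_divide_distrib)
    thus ?thesis unfolding F1 using R0 by simp
  qed
  have F2': "v t * (Rc t / (1 + R t)) + b t * cnj (Ru t / (1 + R t)) = Lc t" for t
  proof -
    have "cnj (1 + R t) = 1 + R t" by (simp add: R_def)
    hence "v t * (Rc t / (1 + R t)) + b t * cnj (Ru t / (1 + R t)) = (v t * Rc t + b t * cnj (Ru t)) / (1 + R t)"
      by (simp add: add_divide_distrib)
    thus ?thesis unfolding F2 using R0 by simp
  qed
  \<comment> \<open>The determinant of P varies, so the transformed matrix has a trace. Its real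
    diagonal part goes into the scalar \<kappa>, which angles ignore.\<close>
  define \<kappa> where "\<kappa> t = - (Re (Ru t) / (1 + Re (d t)))" for t
  have Rsplit: "Ru t / (1 + R t) = - of_real (\<kappa> t) + \<i> * of_real (Im (Ru t) / (1 + Re (d t)))" for t
  proof -
    have "1 + R t = of_real (1 + Re (d t))" by (simp add: R_def)
    thus ?thesis by (simp only:) (simp add: complex_eq_iff \<kappa>_def Re_divide_of_real Im_divide_of_real del: of_real_add)
  qed
  have v': "(v has_vector_derivative (\<i> * of_real (fn t))) (at t)" for t
    unfolding v_def[abs_def]
    by (rule has_vector_derivative_eq_rhs[OF has_vector_derivative_add[OF has_vector_derivative_const
          has_vector_derivative_mult_right[OF q']]]) simp
  have conj: "conjugate (\<lambda>t. \<beta> + fS t + fo t + fn t) (\<lambda>t. gS t + go t + gn t)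
       (\<lambda>t. \<beta> + fS t + fo' t + fn' t) (\<lambda>t. gS t + (go t + g2 t) + g1 t) v b 0"
    unfolding f'eq g'eq R_def[symmetric]
  proof (rule conjugateI[where \<kappa> = \<kappa>])
    show "cmod (b t) < Re (v t)" for t using bb(1)[of t] y by (simp add: v_def)
    fix t
    define f' where "f' = Im (Ru t) / (1 + Re (d t))"
    define X where "X = Ru t / (1 + R t)"
    define Z where "Z = Rc t / (1 + R t)"
    have X: "X = - of_real (\<kappa> t) + \<i> * of_real f'" "cnj X = - of_real (\<kappa> t) - \<i> * of_real f'"
      unfolding X_def Rsplit f'_def by simp_all
    have F: "v t * X + b t * cnj Z = Lu t" "v t * Z + b t * cnj X = Lc t"
      unfolding X_def Z_def by (rule F1' F2')+
    have eq1: "\<i> * of_real (fn t) = \<i> * of_real (\<beta> + fS t + fo t + fn t) * v t + (gS t + go t + gn t) * cnj (b t)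
         - \<i> * of_real (\<beta> + f') * v t - b t * cnj Z + of_real (\<kappa> t) * v t"
    proof -
      have "\<i> * of_real (\<beta> + fS t + fo t + fn t) * v t + (gS t + go t + gn t) * cnj (b t)
         - \<i> * of_real (\<beta> + f') * v t - b t * cnj Z + of_real (\<kappa> t) * v t
        = \<i> * of_real (ft t) * v t + gt t * cnj (b t) - (v t * X + b t * cnj Z)"
        unfolding X by (simp add: ft_def fK_def gt_def gK_def algebra_simps)
      also have "\<dots> = \<i> * of_real (fn t)" unfolding F by (simp add: Lu_def v_def ft_def algebra_simps)
      finally show ?thesis by simp
    qed
    show "(v has_vector_derivative
          \<i> * of_real (\<beta> + fS t + fo t + fn t) * v t + (gS t + go t + gn t) * cnj (b t) -
          \<i> * of_real (\<beta> + Im (Ru t) / (1 + Re (d t))) * v t - b t * cnj (Rc t / (1 + R t)) + of_real (\<kappa> t) * v t) (at t)"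
      using v'[of t] unfolding eq1 f'_def Z_def .
    have eq2: "\<i> * of_real (2 * \<beta>) * b t + gn t = \<i> * of_real (\<beta> + fS t + fo t + fn t) * b t + (gS t + go t + gn t) * cnj (v t)
         - v t * Z + \<i> * of_real (\<beta> + f') * b t + of_real (\<kappa> t) * b t"
    proof -
      have "\<i> * of_real (\<beta> + fS t + fo t + fn t) * b t + (gS t + go t + gn t) * cnj (v t)
         - v t * Z + \<i> * of_real (\<beta> + f') * b t + of_real (\<kappa> t) * b t
        = \<i> * of_real (2 * \<beta>) * b t + \<i> * of_real (ft t) * b t + gt t * cnj (v t) - (v t * Z + b t * cnj X)"
        unfolding X by (simp add: ft_def fK_def gt_def gK_def algebra_simps)
      also have "\<dots> = \<i> * of_real (2 * \<beta>) * b t + gn t" unfolding F by (simp add: Lc_def v_def gt_def algebra_simps)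
      finally show ?thesis by simp
    qed
    show "(b has_vector_derivative
          \<i> * of_real (\<beta> + fS t + fo t + fn t) * b t + (gS t + go t + gn t) * cnj (v t) -
          v t * (Rc t / (1 + R t)) + \<i> * of_real (\<beta> + Im (Ru t) / (1 + Re (d t))) * b t + of_real (\<kappa> t) * b t) (at t)"
      using b(2)[of t] unfolding eq2 f'_def Z_def .
  qed
  have cond: "cond_le v b (1 + 8 * (D * \<nu>))"
    unfolding cond_le_def y_def[symmetric]
  proof
    fix t
    have v1: "cmod (v t) \<ge> 1" using complex_Re_le_cmod[of "v t"] by (simp add: v_def)
    have b1: "cmod (b t) \<le> y * cmod (v t)"
      using bb(1)[of t] mult_left_mono[OF v1 y(1)] by simp
    have "cmod (b t) \<le> 1/8 * cmod (v t)"
      using b1 mult_right_mono[OF y(2), of "cmod (v t)"] by simp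
    moreover have "cmod (v t) + cmod (b t) \<le> (1 + 8 * y) * (cmod (v t) - cmod (b t))"
    proof -
      have "8 * y * cmod (b t) \<le> cmod (b t)" using mult_right_mono[OF y(2), of "cmod (b t)"] by simp
      thus ?thesis using b1 mult_nonneg_nonneg[OF y(1) norm_ge_zero[of "v t"]] by (simp add: algebra_simps)
    qed
    ultimately show "cmod (b t) < cmod (v t) \<and> cmod (v t) + cmod (b t) \<le> (1 + 8 * y) * (cmod (v t) - cmod (b t))"
      using v1 by linarith
  qed
  show ?thesis by (rule that[OF W2 W4 W1 W3 cond conj])
qed

text \<open>Each averaging step at least halves the removable part. The convergence is only
  geometric, because the retained part s and the other modes enter the error linearly and do not
  shrink. Since \<open>m\<close> is free, the caller can still push the removable rest below the
  tails of the long modes, while the product of the distortions stays bounded.\<close>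

lemma averaging:
  fixes fS f :: "real \<Rightarrow> real" and gS g :: "real \<Rightarrow> complex"
  assumes \<rho>: "\<rho> \<ge> 0" and D: "D > 0"
    and S: "wiener \<omega> UNIV \<rho> s (\<lambda>t. of_real (fS t))" "wiener \<omega> UNIV \<rho> s gS"
    and F: "wiener \<omega> UNIV \<rho> \<eta> (\<lambda>t. of_real (f t))" "wiener \<omega> UNIV \<rho> \<eta> g"
    and sym: "uminus ` N1 = N1"
    and div: "\<And>n. n \<in> N1 \<Longrightarrow> \<bar>2 * pi * int_inner n \<omega>\<bar> \<ge> 1 / D"
             "\<And>n. n \<in> N2 \<Longrightarrow> \<bar>2 * pi * int_inner n \<omega> - 2 * \<beta>\<bar> \<ge> 1 / D"
    and small: "20 * (D * (s + 3 * \<eta>)) \<le> 1"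
  obtains fo go fn gn v b where
    "wiener \<omega> (- N1) \<rho> (2 * \<eta>) (\<lambda>t. of_real (fo t))" "wiener \<omega> (- N2) \<rho> (2 * \<eta>) go"
    "wiener \<omega> N1 \<rho> ((1/2) ^ m * \<eta>) (\<lambda>t. of_real (fn t))" "wiener \<omega> N2 \<rho> ((1/2) ^ m * \<eta>) gn"
    "cond_le v b 3"
    "conjugate (\<lambda>t. \<beta> + fS t + f t) (\<lambda>t. gS t + g t)
       (\<lambda>t. \<beta> + fS t + fo t + fn t) (\<lambda>t. gS t + go t + gn t) v b 0"
proof -
  have nn: "0 \<le> s" "0 \<le> \<eta>" using wiener_nonneg S F by blast+
  have "0 \<le> D * s" "0 \<le> D * \<eta>" using nn D by auto
  moreover from this have "60 * (D * \<eta>) \<le> 1" using small by (simp add: algebra_simps)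
  ultimately have D\<eta>: "0 \<le> D * s" "0 \<le> D * \<eta>" "60 * (D * \<eta>) \<le> 1" by auto
  have symc: "uminus ` (- N1) \<subseteq> - N1"
  proof
    fix m assume "m \<in> uminus ` (- N1)"
    then obtain k where k: "m = - k" "k \<notin> N1" by auto
    have "m \<notin> N1"
    proof
      assume "m \<in> N1"
      hence "- m \<in> uminus ` N1" by (rule imageI)
      thus False using k sym by simp
    qed
    thus "m \<in> - N1" by simp
  qed
  have "\<exists>fo go fn gn v b. wiener \<omega> (- N1) \<rho> ((2 - (1/2) ^ m) * \<eta>) (\<lambda>t. of_real (fo t)) \<and>
     wiener \<omega> (- N2) \<rho> ((2 - (1/2) ^ m) * \<eta>) go \<and>
     wiener \<omega> N1 \<rho> ((1/2) ^ m * \<eta>) (\<lambda>t. of_real (fn t)) \<and> wiener \<omega> N2 \<rho> ((1/2) ^ m * \<eta>) gn \<and>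
     cond_le v b (exp (16 * (D * \<eta>) * (1 - (1/2) ^ m))) \<and>
     conjugate (\<lambda>t. \<beta> + fS t + f t) (\<lambda>t. gS t + g t)
       (\<lambda>t. \<beta> + fS t + fo t + fn t) (\<lambda>t. gS t + go t + gn t) v b 0"
  proof (induction m)
    case 0
    obtain f1 f2 C1 C2 where f12: "wiener \<omega> (UNIV \<inter> N1) \<rho> C1 f1" "wiener \<omega> (UNIV - N1) \<rho> C2 f2"
      "C1 + C2 \<le> \<eta>" "\<And>t. of_real (f t) = f1 t + f2 t" by (rule wiener_split[OF F(1), of N1]) (rule that)
    obtain g1 g2 B1 B2 where g12: "wiener \<omega> (UNIV \<inter> N2) \<rho> B1 g1" "wiener \<omega> (UNIV - N2) \<rho> B2 g2"
      "B1 + B2 \<le> \<eta>" "\<And>t. g t = g1 t + g2 t" by (rule wiener_split[OF F(2), of N2]) (rule that)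
    note CB = wiener_nonneg[OF f12(1)] wiener_nonneg[OF f12(2)] wiener_nonneg[OF g12(1)] wiener_nonneg[OF g12(2)]
    have W1: "wiener \<omega> N1 \<rho> \<eta> (\<lambda>t. of_real (Re (f1 t)))"
      by (rule wiener_mono[OF wiener_Re[OF f12(1) \<rho>]]) (use sym CB f12(3) in auto)
    have W2: "wiener \<omega> (- N1) \<rho> \<eta> (\<lambda>t. of_real (Re (f2 t)))"
      by (rule wiener_mono[OF wiener_Re[OF f12(2) \<rho>]]) (use symc CB f12(3) in \<open>auto simp: Compl_eq_Diff_UNIV\<close>)
    have W3: "wiener \<omega> N2 \<rho> \<eta> g1" by (rule wiener_mono[OF g12(1)]) (use CB g12(3) in auto)
    have W4: "wiener \<omega> (- N2) \<rho> \<eta> g2" by (rule wiener_mono[OF g12(2)]) (use CB g12(3) in auto)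
    have fe: "f t = Re (f2 t) + Re (f1 t)" for t using arg_cong[OF f12(4)[of t], of Re] by simp
    have "conjugate (\<lambda>t. \<beta> + fS t + f t) (\<lambda>t. gS t + g t)
       (\<lambda>t. \<beta> + fS t + Re (f2 t) + Re (f1 t)) (\<lambda>t. gS t + g2 t + g1 t) (\<lambda>_. 1) (\<lambda>_. 0) 0"
      using conjugate_refl[of "\<lambda>t. \<beta> + fS t + f t" "\<lambda>t. gS t + g t"] by (simp add: fe g12(4) add_ac)
    moreover have "cond_le (\<lambda>_. 1) (\<lambda>_. 0) (exp (16 * (D * \<eta>) * (1 - (1/2) ^ 0)))" by (simp add: cond_le_def)
    ultimately show ?case using W1 W2 W3 W4
      by (intro exI[of _ "\<lambda>t. Re (f2 t)"] exI[of _ g2] exI[of _ "\<lambda>t. Re (f1 t)"] exI[of _ g1]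
            exI[of _ "\<lambda>_. 1"] exI[of _ "\<lambda>_. 0"]) simp
  next
    case (Suc m)
    then obtain fo go fn gn v b where
      o: "wiener \<omega> (- N1) \<rho> ((2 - (1/2) ^ m) * \<eta>) (\<lambda>t. of_real (fo t))" "wiener \<omega> (- N2) \<rho> ((2 - (1/2) ^ m) * \<eta>) go" and
      n: "wiener \<omega> N1 \<rho> ((1/2) ^ m * \<eta>) (\<lambda>t. of_real (fn t))" "wiener \<omega> N2 \<rho> ((1/2) ^ m * \<eta>) gn" and
      c: "cond_le v b (exp (16 * (D * \<eta>) * (1 - (1/2) ^ m)))"
       "conjugate (\<lambda>t. \<beta> + fS t + f t) (\<lambda>t. gS t + g t)
       (\<lambda>t. \<beta> + fS t + fo t + fn t) (\<lambda>t. gS t + go t + gn t) v b 0" by blast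
    define p where "p = (1/2 :: real) ^ m"
    have p: "0 < p" "p \<le> 1" by (auto simp: p_def power_le_one)
    have p\<eta>: "p * (D * \<eta>) \<le> D * \<eta>" using mult_right_mono[OF p(2) D\<eta>(2)] by simp
    have sm: "D * (p * \<eta>) \<le> 1/8" using p\<eta> D\<eta> by (simp add: mult_ac)
    have e: "10 * (D * (p * \<eta>)) * (s + (2 - p) * \<eta> + p * \<eta>) \<le> p / 2 * \<eta>"
    proof -
      have "s + (2 - p) * \<eta> + p * \<eta> \<le> s + 3 * \<eta>" using nn by (simp add: algebra_simps)
      hence "D * (s + (2 - p) * \<eta> + p * \<eta>) \<le> D * (s + 3 * \<eta>)" by (rule mult_left_mono) (use D in simp)
      hence "20 * (D * (s + (2 - p) * \<eta> + p * \<eta>)) \<le> 1" using small by linarith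
      hence "(p / 2 * \<eta>) * (20 * (D * (s + (2 - p) * \<eta> + p * \<eta>))) \<le> (p / 2 * \<eta>) * 1"
        by (rule mult_left_mono) (use p nn in auto)
      thus ?thesis by (simp add: algebra_simps)
    qed
    obtain fo' go' fn' gn' v' b' where *:
      "wiener \<omega> (- N1) \<rho> ((2 - p) * \<eta> + p / 2 * \<eta>) (\<lambda>t. of_real (fo' t))" "wiener \<omega> (- N2) \<rho> ((2 - p) * \<eta> + p / 2 * \<eta>) go'"
      "wiener \<omega> N1 \<rho> (p / 2 * \<eta>) (\<lambda>t. of_real (fn' t))" "wiener \<omega> N2 \<rho> (p / 2 * \<eta>) gn'"
      "cond_le v' b' (1 + 8 * (D * (p * \<eta>)))"
      "conjugate (\<lambda>t. \<beta> + fS t + fo t + fn t) (\<lambda>t. gS t + go t + gn t)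
         (\<lambda>t. \<beta> + fS t + fo' t + fn' t) (\<lambda>t. gS t + go' t + gn' t) v' b' 0"
      by (rule averaging_step[OF \<rho> D S o[folded p_def] n[folded p_def] sym div sm e]) (assumption, assumption, rule that)
    have pp: "(2 - p) * \<eta> + p / 2 * \<eta> = (2 - (1/2) ^ Suc m) * \<eta>" "p / 2 = (1/2) ^ Suc m"
      by (simp_all add: p_def algebra_simps)
    define V where "V t = v t * v' t + b t * cnj (b' t)" for t
    define B where "B t = v t * b' t + b t * cnj (v' t)" for t
    have 1: "conjugate (\<lambda>t. \<beta> + fS t + f t) (\<lambda>t. gS t + g t)
         (\<lambda>t. \<beta> + fS t + fo' t + fn' t) (\<lambda>t. gS t + go' t + gn' t) V B 0"
      using conjugate_trans[OF c(2) *(6)] by (simp add: V_def[abs_def] B_def[abs_def])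
    have "cond_le V B (exp (16 * (D * \<eta>) * (1 - p)) * (1 + 8 * (D * (p * \<eta>))))"
      unfolding V_def[abs_def] B_def[abs_def] by (rule cond_le_compose[OF c(1)[folded p_def] *(5)])
    \<comment> \<open>The step at level p = 2^(-m) costs a factor at most exp (8 D \<eta> p). These
      exponents sum to 16 D \<eta> (1 - 2^(-m)), which stays below 1 because 60 D \<eta> \<le> 1;
      hence the uniform distortion bound 3.\<close>
    moreover have "exp (16 * (D * \<eta>) * (1 - p)) * (1 + 8 * (D * (p * \<eta>))) \<le> exp (16 * (D * \<eta>) * (1 - (1/2) ^ Suc m))"
    proof -
      have "exp (16 * (D * \<eta>) * (1 - p)) * (1 + 8 * (D * (p * \<eta>))) \<le> exp (16 * (D * \<eta>) * (1 - p)) * exp (8 * (D * (p * \<eta>)))"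
        by (intro mult_left_mono exp_ge_add_one_self) auto
      also have "\<dots> = exp (16 * (D * \<eta>) * (1 - p) + 8 * (D * (p * \<eta>)))" by (simp add: exp_add)
      also have "16 * (D * \<eta>) * (1 - p) + 8 * (D * (p * \<eta>)) = 16 * (D * \<eta>) * (1 - (1/2) ^ Suc m)"
        by (simp add: p_def algebra_simps)
      finally show ?thesis .
    qed
    ultimately have 2: "cond_le V B (exp (16 * (D * \<eta>) * (1 - (1/2) ^ Suc m)))" by (rule cond_le_mono)
    show ?case using *(1,2)[unfolded pp(1)] *(3,4)[unfolded pp(2)] 1 2 by blast
  qed
  then obtain fo go fn gn v b where
      o: "wiener \<omega> (- N1) \<rho> ((2 - (1/2) ^ m) * \<eta>) (\<lambda>t. of_real (fo t))" "wiener \<omega> (- N2) \<rho> ((2 - (1/2) ^ m) * \<eta>) go" and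
      n: "wiener \<omega> N1 \<rho> ((1/2) ^ m * \<eta>) (\<lambda>t. of_real (fn t))" "wiener \<omega> N2 \<rho> ((1/2) ^ m * \<eta>) gn" and
      c: "cond_le v b (exp (16 * (D * \<eta>) * (1 - (1/2) ^ m)))"
       "conjugate (\<lambda>t. \<beta> + fS t + f t) (\<lambda>t. gS t + g t)
       (\<lambda>t. \<beta> + fS t + fo t + fn t) (\<lambda>t. gS t + go t + gn t) v b 0" by blast
  have "(2 - (1/2) ^ m) * \<eta> \<le> 2 * \<eta>" using nn by (simp add: algebra_simps)
  note o' = o[THEN wiener_mono, OF order.refl this order.refl]
  have "16 * (D * \<eta>) * (1 - (1/2) ^ m) \<le> 16 * (D * \<eta>) * 1"
    by (rule mult_left_mono) (use D\<eta> in auto)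
  also have "\<dots> \<le> 1" using D\<eta> by linarith
  finally have "exp (16 * (D * \<eta>) * (1 - (1/2) ^ m)) \<le> 3" using exp_le by (meson exp_le_cancel_iff order_trans)
  from cond_le_mono[OF c(1) this] have c': "cond_le v b 3" .
  show ?thesis by (rule that[OF o'(1) o'(2) n c' c(2)])
qed

section \<open>Rotation numbers and normal forms\<close>

lemma lower_growth:
  fixes \<phi> :: "real \<Rightarrow> real"
  assumes d: "\<And>t. t \<ge> 0 \<Longrightarrow> (\<phi> has_real_derivative \<phi>' t) (at t within {0..})"
    and "\<And>t. t \<ge> 0 \<Longrightarrow> c \<le> \<phi>' t" "0 \<le> x" "x \<le> y"
  shows "\<phi> x + c * (y - x) \<le> \<phi> y"
proof -
  have "\<phi> x - c * x \<le> \<phi> y - c * y"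
  proof (rule DERIV_nonneg_imp_increasing_open[OF \<open>x \<le> y\<close>])
    fix t assume t: "x < t" "t < y"
    hence "(\<phi> has_real_derivative \<phi>' t) (at t)"
      using d[of t] assms(3) at_within_interior[of t "{0..}"] by simp
    hence "((\<lambda>t. \<phi> t - c * t) has_real_derivative (\<phi>' t - c)) (at t)"
      by (auto intro!: derivative_eq_intros)
    thus "\<exists>y. ((\<lambda>t. \<phi> t - c * t) has_real_derivative y) (at t) \<and> 0 \<le> y"
      using assms(2)[of t] t assms(3) by (intro exI[of _ "\<phi>' t - c"]) auto
  next
    have "continuous_on {0..} \<phi>"
      by (rule DERIV_continuous_on[where D = \<phi>']) (use d in auto)
    hence "continuous_on {x..y} \<phi>" by (rule continuous_on_subset) (use assms(3) in auto)
    thus "continuous_on {x..y} (\<lambda>t. \<phi> t - c * t)" by (intro continuous_intros)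
  qed
  thus ?thesis by (simp add: algebra_simps)
qed

lemma upper_growth:
  fixes \<phi> :: "real \<Rightarrow> real"
  assumes d: "\<And>t. t \<ge> 0 \<Longrightarrow> (\<phi> has_real_derivative \<phi>' t) (at t within {0..})"
    and "\<And>t. t \<ge> 0 \<Longrightarrow> \<phi>' t \<le> c" "0 \<le> x" "x \<le> y"
  shows "\<phi> y \<le> \<phi> x + c * (y - x)"
  using lower_growth[of "\<lambda>t. - \<phi> t" "\<lambda>t. - \<phi>' t" "- c" x y, OF DERIV_minus[OF d]] assms(2-)
  by simp

text \<open>At the last time up to which the curve is not below p it lies exactly on p, and the
  positive slope there carries it above p afterwards. A sign of the slope on the barrier itself is
  enough.\<close>

lemma barrier_below:
  fixes \<phi> :: "real \<Rightarrow> real"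
  assumes d: "\<And>t. t \<ge> 0 \<Longrightarrow> (\<phi> has_real_derivative \<phi>' t) (at t within {0..})"
    and p: "\<And>t. t \<ge> 0 \<Longrightarrow> \<phi> t = p \<Longrightarrow> \<phi>' t > 0"
    and "p \<le> \<phi> 0" "t \<ge> 0"
  shows "p \<le> \<phi> t"
proof (rule ccontr)
  assume "\<not> p \<le> \<phi> t"
  hence lt: "\<phi> t < p" by simp
  have cont: "continuous_on {0..} \<phi>"
    by (rule DERIV_continuous_on[where D = \<phi>']) (use d in auto)
  hence cont': "continuous_on {0..t} \<phi>" by (rule continuous_on_subset) auto
  define S where "S = {0..t} \<inter> \<phi> -` {p..}"
  have cl: "closed S" unfolding S_def
    by (rule continuous_closed_preimage[OF cont']) auto
  have S: "S \<noteq> {}" "bdd_above S" using assms(3,4) by (auto simp: S_def)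
  define s where "s = Sup S"
  have sS: "s \<in> S" unfolding s_def by (rule closed_contains_Sup[OF S cl])
  hence s: "0 \<le> s" "s \<le> t" "p \<le> \<phi> s" by (auto simp: S_def)
  have st: "s < t" using s lt by (cases "s = t") auto
  have after: "\<phi> x < p" if "s < x" "x \<le> t" for x
  proof (rule ccontr)
    assume "\<not> \<phi> x < p"
    hence "x \<in> S" using that s by (auto simp: S_def)
    hence "x \<le> s" unfolding s_def using S by (intro cSup_upper)
    thus False using that by simp
  qed
  have "\<phi> s = p"
  proof (rule ccontr)
    assume "\<phi> s \<noteq> p"
    hence gt: "p < \<phi> s" using s by simp
    have "continuous_on {s..t} \<phi>" by (rule continuous_on_subset[OF cont']) (use s in auto)
    then obtain x where "s \<le> x" "x \<le> t" "\<phi> x = (p + \<phi> s) / 2"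
      using IVT2'[of \<phi> t "(p + \<phi> s) / 2" s] gt lt st by auto
    thus False using after[of x] gt by (cases "x = s") auto
  qed
  hence "\<phi>' s > 0" using p s by blast
  from has_real_derivative_pos_inc_right[OF d[OF s(1)] this]
  obtain e where e: "e > 0" "\<And>h. 0 < h \<Longrightarrow> s + h \<in> {0..} \<Longrightarrow> h < e \<Longrightarrow> \<phi> s < \<phi> (s + h)" by blast
  define h where "h = min (e / 2) (t - s)"
  have "h > 0" "h < e" "h \<le> t - s" using e st by (auto simp: h_def)
  thus False using e(2)[of h] after[of "s + h"] s \<open>\<phi> s = p\<close> by auto
qed

lemma barrier_above:
  fixes \<phi> :: "real \<Rightarrow> real"
  assumes d: "\<And>t. t \<ge> 0 \<Longrightarrow> (\<phi> has_real_derivative \<phi>' t) (at t within {0..})"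
    and p: "\<And>t. t \<ge> 0 \<Longrightarrow> \<phi> t = p \<Longrightarrow> \<phi>' t < 0"
    and "\<phi> 0 \<le> p" "t \<ge> 0"
  shows "\<phi> t \<le> p"
  using barrier_below[of "\<lambda>t. - \<phi> t" "\<lambda>t. - \<phi>' t" "- p" t, OF DERIV_minus[OF d]] assms(2-)
  by simp

text \<open>One solution with mean angular speed \<open>r\<close>, in radians, so that label k
  corresponds to \<pi> \<langle>k, \<omega>\<rangle>. As \<open>conjugate\<close> transports one
  solution at a time, this form passes directly through conjugations.\<close>

definition has_rot :: "(real \<Rightarrow> real) \<Rightarrow> (real \<Rightarrow> complex) \<Rightarrow> real \<Rightarrow> bool" where
  "has_rot f g r \<longleftrightarrow> (\<exists>\<phi>. phase f g 0 (\<lambda>_. 1) (\<lambda>_. 0) \<phi> \<and> ((\<lambda>t. \<phi> t / t) \<longlongrightarrow> r) at_top)"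

lemma phase_0: "phase f g 0 u c \<phi> \<longleftrightarrow>
    (\<forall>t\<ge>0. (\<phi> has_real_derivative (f t + Im (g t * cis (- 2 * \<phi> t)))) (at t within {0..}))"
  unfolding phase_def by simp

lemma bounded_over_t: "(\<And>t. t \<ge> 0 \<Longrightarrow> \<bar>h t\<bar> \<le> C) \<Longrightarrow> ((\<lambda>t. h t / t) \<longlongrightarrow> (0::real)) at_top"
proof (rule Lim_null_comparison)
  assume *: "\<And>t. t \<ge> 0 \<Longrightarrow> \<bar>h t\<bar> \<le> C"
  show "\<forall>\<^sub>F t in at_top. norm (h t / t) \<le> C / t"
    using eventually_gt_at_top[of 0]
    by eventually_elim (use * in \<open>auto simp: divide_right_mono\<close>)
  show "((\<lambda>t. C / t) \<longlongrightarrow> 0) at_top"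
    by (rule tendsto_divide_0[OF tendsto_const]) (simp add: filterlim_at_top_imp_at_infinity filterlim_ident)
qed

lemma linear_over_t: "((\<lambda>t. c * t / t) \<longlongrightarrow> (c::real)) at_top"
  by (rule tendsto_eventually) (use eventually_gt_at_top[of 0] in \<open>eventually_elim; simp\<close>)

lemma rot_conjugate:
  assumes "conjugate f g f' g' v b \<sigma>" "has_rot f g r"
  shows "has_rot f' g' (r - \<sigma>)"
proof -
  from assms(2) obtain \<phi> where \<phi>: "phase f g 0 (\<lambda>_. 1) (\<lambda>_. 0) \<phi>" "((\<lambda>t. \<phi> t / t) \<longlongrightarrow> r) at_top"
    unfolding has_rot_def by blast
  from assms(1) \<phi>(1) obtain \<psi> C where \<psi>: "phase f' g' 0 (\<lambda>t. 1 * v t + 0 * cnj (b t)) (\<lambda>t. 1 * b t + 0 * cnj (v t)) \<psi>"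
    "\<And>t. t \<ge> 0 \<Longrightarrow> \<bar>\<phi> t - \<psi> t - \<sigma> * t\<bar> \<le> C"
    unfolding conjugate_def by blast
  have "((\<lambda>t. \<phi> t / t - \<sigma> * t / t - (\<phi> t - \<psi> t - \<sigma> * t) / t) \<longlongrightarrow> r - \<sigma> - 0) at_top"
    by (intro tendsto_diff \<phi>(2) linear_over_t bounded_over_t[OF \<psi>(2)])
  also have "(\<lambda>t. \<phi> t / t - \<sigma> * t / t - (\<phi> t - \<psi> t - \<sigma> * t) / t) = (\<lambda>t. \<psi> t / t)"
    by (simp add: fun_eq_iff diff_divide_distrib)
  finally show ?thesis using \<psi>(1) unfolding has_rot_def phase_0 by auto
qed

lemma rot_approx:
  assumes "has_rot f g r" "\<And>t. \<bar>f t - \<alpha>\<bar> \<le> d1" "\<And>t. cmod (g t) \<le> d2"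
  shows "\<bar>r - \<alpha>\<bar> \<le> d1 + d2"
proof -
  from assms(1) obtain \<phi> where \<phi>: "\<And>t. t \<ge> 0 \<Longrightarrow> (\<phi> has_real_derivative (f t + Im (g t * cis (- 2 * \<phi> t)))) (at t within {0..})"
     "((\<lambda>t. \<phi> t / t) \<longlongrightarrow> r) at_top"
    unfolding has_rot_def phase_0 by blast
  have b: "\<bar>f t + Im (g t * cis (- 2 * \<phi> t)) - \<alpha>\<bar> \<le> d1 + d2" for t
  proof -
    have "\<bar>Im (g t * cis (- 2 * \<phi> t))\<bar> \<le> cmod (g t * cis (- 2 * \<phi> t))" by (rule abs_Im_le_cmod)
    also have "\<dots> \<le> d2" using assms(3) by (simp add: norm_mult)
    finally show ?thesis using assms(2)[of t] by linarith
  qed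
  have low: "\<phi> 0 + (\<alpha> - (d1 + d2)) * (t - 0) \<le> \<phi> t" if "t \<ge> 0" for t
    by (rule lower_growth[OF \<phi>(1)]) (use b that in \<open>auto simp: abs_le_iff algebra_simps\<close>)
  have up: "\<phi> t \<le> \<phi> 0 + (\<alpha> + (d1 + d2)) * (t - 0)" if "t \<ge> 0" for t
    by (rule upper_growth[OF \<phi>(1)]) (use b that in \<open>auto simp: abs_le_iff algebra_simps\<close>)
  have c0: "((\<lambda>t. \<phi> 0 / t + c * t / t) \<longlongrightarrow> 0 + c) at_top" for c
    by (intro tendsto_add linear_over_t bounded_over_t[of "\<lambda>_. \<phi> 0" "\<bar>\<phi> 0\<bar>"]) auto
  have "0 + (\<alpha> - (d1 + d2)) \<le> r"
  proof (rule tendsto_le[OF _ \<phi>(2) c0])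
    show "\<forall>\<^sub>F t in at_top. \<phi> 0 / t + (\<alpha> - (d1 + d2)) * t / t \<le> \<phi> t / t"
      using eventually_gt_at_top[of 0]
    proof eventually_elim
      case (elim t)
      show ?case using low[of t] elim unfolding add_divide_distrib[symmetric] by (intro divide_right_mono) auto
    qed
  qed simp
  moreover have "r \<le> 0 + (\<alpha> + (d1 + d2))"
  proof (rule tendsto_le[OF _ c0 \<phi>(2)])
    show "\<forall>\<^sub>F t in at_top. \<phi> t / t \<le> \<phi> 0 / t + (\<alpha> + (d1 + d2)) * t / t"
      using eventually_gt_at_top[of 0]
    proof eventually_elim
      case (elim t)
      show ?case using up[of t] elim unfolding add_divide_distrib[symmetric] by (intro divide_right_mono) auto
    qed
  qed simp
  ultimately show ?thesis by linarith
qed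

text \<open>A dominant hyperbolic part traps the angle between two barriers.\<close>

lemma rot_hyperbolic:
  assumes "has_rot f g r" "\<And>t. \<bar>f t\<bar> \<le> d" "\<And>t. cmod (g t - a) \<le> d" "2 * d < cmod a"
  shows "r = 0"
proof -
  from assms(1) obtain \<phi> where \<phi>: "\<And>t. t \<ge> 0 \<Longrightarrow> (\<phi> has_real_derivative (f t + Im (g t * cis (- 2 * \<phi> t)))) (at t within {0..})"
     "((\<lambda>t. \<phi> t / t) \<longlongrightarrow> r) at_top"
    unfolding has_rot_def phase_0 by blast
  define \<theta> where "\<theta> = Arg a"
  have a: "a = of_real (cmod a) * cis \<theta>" by (simp add: \<theta>_def rcis_cmod_Arg flip: rcis_def)
  have der: "\<bar>f t + Im (g t * cis (- 2 * \<phi> t)) - cmod a * sin (\<theta> - 2 * \<phi> t)\<bar> \<le> 2 * d" for t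
  proof -
    have "a * cis (- 2 * \<phi> t) = of_real (cmod a) * cis (\<theta> - 2 * \<phi> t)"
      by (subst a) (simp add: cis_mult)
    hence "Im (a * cis (- 2 * \<phi> t)) = cmod a * sin (\<theta> - 2 * \<phi> t)" by simp
    moreover have "Im (g t * cis (- 2 * \<phi> t)) = Im (a * cis (- 2 * \<phi> t)) + Im ((g t - a) * cis (- 2 * \<phi> t))"
      by (simp add: algebra_simps)
    moreover have "\<bar>Im ((g t - a) * cis (- 2 * \<phi> t))\<bar> \<le> d"
      using abs_Im_le_cmod[of "(g t - a) * cis (- 2 * \<phi> t)"] assms(3)[of t] by (simp add: norm_mult)
    ultimately show ?thesis using assms(2)[of t] by linarith
  qed
  \<comment> \<open>At P = p + m \<pi> the driving sine is 1 and pushes the angle up, at P + 3 \<pi>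
    / 2 it is - 1 and pushes it down. The integer m selects the translate with P \<le> \<phi> 0 < P
    + \<pi>, so the angle starts between the two barriers.\<close>
  define p where "p = \<theta> / 2 - pi / 4"
  define m where "m = \<lfloor>(\<phi> 0 - p) / pi\<rfloor>"
  have m: "p + of_int m * pi \<le> \<phi> 0" "\<phi> 0 < p + of_int m * pi + pi"
  proof -
    have "of_int m \<le> (\<phi> 0 - p) / pi" "(\<phi> 0 - p) / pi < of_int m + 1" unfolding m_def by linarith+
    thus "p + of_int m * pi \<le> \<phi> 0" "\<phi> 0 < p + of_int m * pi + pi"
      using pi_gt_zero by (simp_all add: field_simps)
  qed
  define P where "P = p + of_int m * pi"
  have sP: "sin (\<theta> - 2 * P) = 1" "sin (\<theta> - 2 * (P + 3 * pi / 2)) = - 1"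
  proof -
    have "\<theta> - 2 * P = pi / 2 - 2 * pi * of_int m" by (simp add: P_def p_def algebra_simps)
    thus "sin (\<theta> - 2 * P) = 1" by (simp only: sin_diff cos_integer_2pi[OF Ints_of_int] sin_integer_2pi[OF Ints_of_int]) simp
    have "\<theta> - 2 * (P + 3 * pi / 2) = - (pi / 2) - 2 * pi * of_int (m + 1)" by (simp add: P_def p_def algebra_simps)
    thus "sin (\<theta> - 2 * (P + 3 * pi / 2)) = - 1"
      by (simp only: sin_diff cos_integer_2pi[OF Ints_of_int] sin_integer_2pi[OF Ints_of_int]) simp
  qed
  have "P \<le> \<phi> t" if "t \<ge> 0" for t
  proof (rule barrier_below[OF \<phi>(1)])
    fix t assume "\<phi> t = P"
    thus "0 < f t + Im (g t * cis (- 2 * \<phi> t))" using der[of t] sP assms(4) by (auto simp: abs_le_iff)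
  qed (use m that in \<open>auto simp: P_def\<close>)
  moreover have "\<phi> t \<le> P + 3 * pi / 2" if "t \<ge> 0" for t
  proof (rule barrier_above[OF \<phi>(1)])
    fix t assume e: "\<phi> t = P + 3 * pi / 2"
    show "f t + Im (g t * cis (- 2 * \<phi> t)) < 0" using der[of t] sP(2) assms(4) unfolding e by (auto simp: abs_le_iff)
  qed (use m that pi_gt_zero in \<open>auto simp: P_def\<close>)
  ultimately have "\<bar>\<phi> t\<bar> \<le> \<bar>P\<bar> + 3 * pi / 2" if "t \<ge> 0" for t
    using that by (fastforce simp: abs_le_iff)
  from bounded_over_t[OF this] \<phi>(2) show "r = 0" by (intro tendsto_unique[of at_top]) auto
qed

section \<open>Normal forms of systems with dominant constant part\<close>

lemma conjugate_const:
  assumes "cmod b < 1"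
  shows "conjugate f g (\<lambda>t. (f t * (1 + (cmod b)\<^sup>2) + 2 * Im (cnj b * g t)) / (1 - (cmod b)\<^sup>2))
     (\<lambda>t. (2 * \<i> * of_real (f t) * b + g t - b\<^sup>2 * cnj (g t)) / of_real (1 - (cmod b)\<^sup>2))
     (\<lambda>_. 1) (\<lambda>_. b) 0"
proof (rule conjugateI[where \<kappa> = "\<lambda>_. 0"])
  define d where "d = 1 - b * cnj b"
  have d: "of_real (1 - (cmod b)\<^sup>2) = d" unfolding d_def by (simp only: of_real_diff of_real_1 complex_norm_square)
  have "(cmod b)\<^sup>2 < 1" using assms by (simp add: power_less_one_iff abs_square_less_1)
  hence "1 - (cmod b)\<^sup>2 \<noteq> 0" by simp
  hence d0: "d \<noteq> 0" unfolding d[symmetric] of_real_eq_0_iff .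
  have s: "of_real (1 + (cmod b)\<^sup>2) = 1 + b * cnj b" by (simp only: of_real_add of_real_1 complex_norm_square)
  have cd: "cnj d = d" by (simp add: d_def mult.commute)
  have I: "of_real (2 * Im z) = - \<i> * (z - cnj z)" for z by (simp add: complex_eq_iff)
  fix t
  define X where "X = (f t * (1 + (cmod b)\<^sup>2) + 2 * Im (cnj b * g t)) / (1 - (cmod b)\<^sup>2)"
  define Y where "Y = (2 * \<i> * of_real (f t) * b + g t - b\<^sup>2 * cnj (g t)) / of_real (1 - (cmod b)\<^sup>2)"
  have X: "d * of_real X = of_real (f t) * (1 + b * cnj b) - \<i> * (cnj b * g t - b * cnj (g t))"
  proof -
    have "of_real X = (of_real (f t) * of_real (1 + (cmod b)\<^sup>2) + of_real (2 * Im (cnj b * g t))) / d"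
      unfolding X_def d[symmetric] by (simp only: of_real_add of_real_mult of_real_divide)
    thus ?thesis unfolding s I using d0 by simp
  qed
  have Y: "d * Y = 2 * \<i> * of_real (f t) * b + g t - b * b * cnj (g t)"
    unfolding Y_def d using d0 by (simp add: power2_eq_square)
  have Y': "d * cnj Y = - 2 * \<i> * of_real (f t) * cnj b + cnj (g t) - cnj b * cnj b * g t"
    using arg_cong[OF Y, of cnj] cd by simp
  have "d * (\<i> * of_real (f t) * 1 + g t * cnj b - \<i> * of_real X * 1 - b * cnj Y + of_real 0 * 1)
      = d * (\<i> * of_real (f t) + g t * cnj b) - \<i> * (d * of_real X) - b * (d * cnj Y)"
    by (simp add: algebra_simps)
  also have "\<dots> = 0" unfolding X Y' unfolding d_def by (simp add: algebra_simps)
  finally have e1: "\<i> * of_real (f t) * 1 + g t * cnj b - \<i> * of_real X * 1 - b * cnj Y + of_real 0 * 1 = 0"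
    using d0 by simp
  show "((\<lambda>_. 1) has_vector_derivative \<i> * of_real (f t) * 1 + g t * cnj b - \<i> * of_real X * 1 - b * cnj Y + of_real 0 * 1) (at t)"
    unfolding e1 by (rule has_vector_derivative_const)
  have "d * (\<i> * of_real (f t) * b + g t * cnj 1 - 1 * Y + \<i> * of_real X * b + of_real 0 * b)
      = d * (\<i> * of_real (f t) * b + g t) - d * Y + \<i> * (d * of_real X) * b"
    by (simp add: algebra_simps)
  also have "\<dots> = 0" unfolding X Y unfolding d_def by (simp add: algebra_simps)
  finally have e2: "\<i> * of_real (f t) * b + g t * cnj 1 - 1 * Y + \<i> * of_real X * b + of_real 0 * b = 0"
    using d0 by simp
  show "((\<lambda>_. b) has_vector_derivative \<i> * of_real (f t) * b + g t * cnj 1 - 1 * Y + \<i> * of_real X * b + of_real 0 * b) (at t)"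
    unfolding e2 by (rule has_vector_derivative_const)
qed (use assms in simp)

text \<open>A boost acts on \<open>(\<alpha>, \<bar>a\<bar>)\<close> as a hyperbolic rotation: the light-cone coordinates
  \<open>\<alpha> \<mp> \<bar>a\<bar>\<close> are multiplied by \<open>K\<close> and \<open>1 / K\<close>.\<close>

lemma boost:
  fixes \<alpha> s K :: real and a :: complex
  assumes \<rho>: "\<rho> \<ge> 0" and K: "K \<ge> 1" and s: "s = 1 \<or> s = - 1" and a: "a \<noteq> 0"
    and F: "wiener \<omega> UNIV \<rho> \<eta> (\<lambda>t. of_real (f t))" "wiener \<omega> UNIV \<rho> \<eta> g"
  obtains v b f' g' where
    "conjugate (\<lambda>t. \<alpha> + f t) (\<lambda>t. a + g t)
      (\<lambda>t. s * ((s * \<alpha> - cmod a) * K + (s * \<alpha> + cmod a) / K) / 2 + f' t)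
      (\<lambda>t. a / of_real (cmod a) * of_real (((s * \<alpha> + cmod a) / K - (s * \<alpha> - cmod a) * K) / 2) + g' t) v b 0"
    "cond_le v b K" "wiener \<omega> UNIV \<rho> (K * \<eta>) (\<lambda>t. of_real (f' t))" "wiener \<omega> UNIV \<rho> (K * \<eta>) g'"
proof -
  \<comment> \<open>The singular values of (1, b) with |b| = h are 1 + h and 1 - h; this h makes
    their ratio equal to K.\<close>
  define h where "h = (K - 1) / (K + 1)"
  define e where "e = a / of_real (cmod a)"
  \<comment> \<open>The phase of b is orthogonal to that of a, so that the boost acts in the plane
    of \<alpha> and |a| and keeps the phase of a. The sign s decides which light-cone coordinate is
    enlarged.\<close>
  define b where "b = \<i> * of_real (s * h) * e"
  have h: "0 \<le> h" "h < 1" using K by (auto simp: h_def field_simps)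
  have ce: "cmod e = 1" using a by (simp add: e_def norm_divide)
  have ss: "s * s = 1" "\<bar>s\<bar> = 1" using s by auto
  have cb: "cmod b = h" using h ss ce by (simp add: b_def norm_mult abs_mult)
  have ae: "a = of_real (cmod a) * e" using a by (simp add: e_def)
  define H where "H = 1 - h\<^sup>2"
  have K1: "K + 1 \<noteq> 0" "K \<noteq> 0" using K by auto
  have hK: "h * (K + 1) = K - 1" using K1 by (simp add: h_def)
  have "H * (K + 1)\<^sup>2 = (K + 1)\<^sup>2 - (h * (K + 1))\<^sup>2" unfolding H_def power_mult_distrib by (simp add: left_diff_distrib)
  hence HK: "H * (K + 1)\<^sup>2 = 4 * K" unfolding hK by (simp add: power2_eq_square algebra_simps)
  have K2: "(K + 1)\<^sup>2 > 0" using K by simp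
  have Hpos: "H > 0" using HK K K2 by (metis mult_pos_pos zero_less_mult_pos2 less_le_trans zero_less_one zero_less_numeral)
  have r1: "(1 + h\<^sup>2) / H = (K + 1 / K) / 2"
  proof -
    have "(1 + h\<^sup>2) * (K + 1)\<^sup>2 = (K + 1)\<^sup>2 + (h * (K + 1))\<^sup>2" unfolding power_mult_distrib by (simp add: distrib_right)
    hence e: "(1 + h\<^sup>2) * (K + 1)\<^sup>2 = 2 * (K\<^sup>2 + 1)" unfolding hK by (simp add: power2_eq_square algebra_simps)
    have "(1 + h\<^sup>2) / H = ((1 + h\<^sup>2) * (K + 1)\<^sup>2) / (H * (K + 1)\<^sup>2)" using K2 by simp
    also have "\<dots> = (K + 1 / K) / 2" unfolding e HK using K1 by (simp add: field_simps power2_eq_square)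
    finally show ?thesis .
  qed
  have r2: "2 * h / H = (K - 1 / K) / 2"
  proof -
    have "2 * h * (K + 1)\<^sup>2 = 2 * (h * (K + 1)) * (K + 1)" by (simp add: power2_eq_square)
    hence e: "2 * h * (K + 1)\<^sup>2 = 2 * (K\<^sup>2 - 1)" unfolding hK by (simp add: power2_eq_square algebra_simps)
    have "2 * h / H = (2 * h * (K + 1)\<^sup>2) / (H * (K + 1)\<^sup>2)" using K2 by simp
    also have "\<dots> = (K - 1 / K) / 2" unfolding e HK using K1 by (simp add: field_simps power2_eq_square)
    finally show ?thesis .
  qed
  have r12: "(1 + h\<^sup>2 + 2 * h) / H = K" using r1 r2 by (simp add: add_divide_distrib)
  have conj: "conjugate (\<lambda>t. \<alpha> + f t) (\<lambda>t. a + g t)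
     (\<lambda>t. ((\<alpha> + f t) * (1 + h\<^sup>2) + 2 * Im (cnj b * (a + g t))) / H)
     (\<lambda>t. (2 * \<i> * of_real (\<alpha> + f t) * b + (a + g t) - b\<^sup>2 * cnj (a + g t)) / of_real H)
     (\<lambda>_. 1) (\<lambda>_. b) 0"
    using conjugate_const[of b "\<lambda>t. \<alpha> + f t" "\<lambda>t. a + g t"] h unfolding cb H_def by simp
  define f' where "f' t = (f t * (1 + h\<^sup>2) + 2 * Im (cnj b * g t)) / H" for t
  define g' where "g' t = (2 * \<i> * of_real (f t) * b + g t - b\<^sup>2 * cnj (g t)) / of_real H" for t
  have ee: "e * cnj e = 1" using ce by (simp add: complex_norm_square[symmetric])
  have ba: "Im (cnj b * a) = - s * h * cmod a"
  proof -
    have "cnj b * a = - \<i> * of_real (s * h * cmod a) * (e * cnj e)"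
      unfolding b_def by (subst ae) (simp add: mult_ac)
    thus ?thesis unfolding ee by simp
  qed
  have fe: "((\<alpha> + f t) * (1 + h\<^sup>2) + 2 * Im (cnj b * (a + g t))) / H =
     s * ((s * \<alpha> - cmod a) * K + (s * \<alpha> + cmod a) / K) / 2 + f' t" for t
  proof -
    have "((\<alpha> + f t) * (1 + h\<^sup>2) + 2 * Im (cnj b * (a + g t))) / H =
       \<alpha> * ((1 + h\<^sup>2) / H) - s * cmod a * (2 * h / H) + f' t"
      unfolding f'_def distrib_left[of "cnj b"] plus_complex.sel ba by (simp add: add_divide_distrib diff_divide_distrib algebra_simps)
    also have "\<alpha> * ((1 + h\<^sup>2) / H) - s * cmod a * (2 * h / H) = (s * s) * \<alpha> * ((K + 1 / K) / 2) - s * cmod a * ((K - 1 / K) / 2)"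
      unfolding r1 r2 ss(1) by simp
    also have "\<dots> = s * ((s * \<alpha> - cmod a) * K + (s * \<alpha> + cmod a) / K) / 2" using K1 by (simp add: field_simps)
    finally show ?thesis .
  qed
  have ge: "(2 * \<i> * of_real (\<alpha> + f t) * b + (a + g t) - b\<^sup>2 * cnj (a + g t)) / of_real H =
     a / of_real (cmod a) * of_real (((s * \<alpha> + cmod a) / K - (s * \<alpha> - cmod a) * K) / 2) + g' t" for t
  proof -
    have b2: "b\<^sup>2 * cnj a = - of_real (h\<^sup>2 * cmod a) * e"
    proof -
      have "b\<^sup>2 * cnj a = - of_real ((s * s) * h\<^sup>2 * cmod a) * e * (e * cnj e)"
        unfolding b_def by (subst ae) (simp add: power2_eq_square mult_ac)
      thus ?thesis unfolding ee ss by simp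
    qed
    have ib: "2 * \<i> * of_real \<alpha> * b = - of_real (s * \<alpha> * (2 * h)) * e" by (simp add: b_def)
    have "2 * \<i> * of_real (\<alpha> + f t) * b + (a + g t) - b\<^sup>2 * cnj (a + g t) =
       (2 * \<i> * of_real \<alpha> * b + a - b\<^sup>2 * cnj a) + (2 * \<i> * of_real (f t) * b + g t - b\<^sup>2 * cnj (g t))"
      by (simp add: algebra_simps)
    also have "2 * \<i> * of_real \<alpha> * b + a - b\<^sup>2 * cnj a = of_real (cmod a * (1 + h\<^sup>2) - s * \<alpha> * (2 * h)) * e"
    proof -
      have "2 * \<i> * of_real \<alpha> * b + a - b\<^sup>2 * cnj a =
          - of_real (s * \<alpha> * (2 * h)) * e + of_real (cmod a) * e - (- of_real (h\<^sup>2 * cmod a) * e)"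
        by (simp only: b2 ib ae[symmetric])
      thus ?thesis by (simp add: algebra_simps)
    qed
    finally have L: "2 * \<i> * of_real (\<alpha> + f t) * b + (a + g t) - b\<^sup>2 * cnj (a + g t) =
        of_real (cmod a * (1 + h\<^sup>2) - s * \<alpha> * (2 * h)) * e + (2 * \<i> * of_real (f t) * b + g t - b\<^sup>2 * cnj (g t))" .
    have "(2 * \<i> * of_real (\<alpha> + f t) * b + (a + g t) - b\<^sup>2 * cnj (a + g t)) / of_real H =
      of_real ((cmod a * (1 + h\<^sup>2) - s * \<alpha> * (2 * h)) / H) * e + g' t"
      unfolding L g'_def by (simp only: add_divide_distrib of_real_divide times_divide_eq_left)
    also have "(cmod a * (1 + h\<^sup>2) - s * \<alpha> * (2 * h)) / H = cmod a * ((1 + h\<^sup>2) / H) - s * \<alpha> * (2 * h / H)"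
      by (simp add: diff_divide_distrib)
    also have "\<dots> = ((s * \<alpha> + cmod a) / K - (s * \<alpha> - cmod a) * K) / 2" unfolding r1 r2 using K1 by (simp add: field_simps)
    finally show ?thesis by (simp add: e_def mult_ac)
  qed
  have \<eta>: "0 \<le> \<eta>" by (rule wiener_nonneg[OF F(2)])
  note wA = wiener_add[OF _ _ \<rho>] and wC = wiener_cmult
  have gc: "wiener \<omega> UNIV \<rho> \<eta> (\<lambda>t. cnj (g t))" using wiener_cnj[OF F(2)] by (rule wiener_UNIV)
  have Ksym: "(uminus :: int^'a \<Rightarrow> _) ` UNIV \<subseteq> UNIV" by simp
  have nrm: "(1 + h\<^sup>2) / H * \<eta> + 2 / H * (h * \<eta>) = K * \<eta>" "(2 * h / H * \<eta> + 1 / H * \<eta>) + h\<^sup>2 / H * \<eta> = K * \<eta>"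
    unfolding r12[symmetric] by (simp_all add: add_divide_distrib algebra_simps)
  have fd: "complex_of_real ((1 + h\<^sup>2) / H) * of_real (f t) + of_real (2 / H) * of_real (Im (cnj b * g t)) = of_real (f' t)" for t
  proof -
    have "(1 + h\<^sup>2) / H * f t + 2 / H * Im (cnj b * g t) = f' t" unfolding f'_def using Hpos by (simp add: field_simps)
    thus ?thesis by (simp only: of_real_add[symmetric] of_real_mult[symmetric])
  qed
  have gd: "2 * \<i> * b / of_real H * of_real (f t) + of_real (1 / H) * g t + - b\<^sup>2 / of_real H * cnj (g t) = g' t" for t
    using Hpos by (simp add: g'_def field_simps)
  have cn: "cmod (complex_of_real ((1 + h\<^sup>2) / H)) = (1 + h\<^sup>2) / H" "cmod (complex_of_real (2 / H)) = 2 / H"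
     "cmod (2 * \<i> * b / of_real H) = 2 * h / H" "cmod (complex_of_real (1 / H)) = 1 / H" "cmod (- b\<^sup>2 / of_real H) = h\<^sup>2 / H" "cmod (cnj b) = h"
    using Hpos h by (simp_all only: norm_of_real norm_divide norm_mult norm_power norm_minus_cancel cb norm_ii complex_mod_cnj) simp_all
  have W1: "wiener \<omega> UNIV \<rho> (K * \<eta>) (\<lambda>t. of_real (f' t))"
    by (rule wiener_eqI[OF wA[OF wC[OF F(1), of "of_real ((1 + h\<^sup>2) / H)"]
           wC[OF wiener_Im[OF wC[OF F(2), of "cnj b"] \<rho> Ksym], of "of_real (2 / H)"]]], rule fd)
       (simp only: cn nrm(1) order.refl)
  have W2: "wiener \<omega> UNIV \<rho> (K * \<eta>) g'"
    by (rule wiener_eqI[OF wA[OF wA[OF wC[OF F(1), of "2 * \<i> * b / of_real H"] wC[OF F(2), of "of_real (1 / H)"]]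
           wC[OF gc, of "- b\<^sup>2 / of_real H"]]], rule gd)
       (simp only: cn nrm(2) order.refl)
  have cond: "cond_le (\<lambda>_. 1) (\<lambda>_. b) K"
    unfolding cond_le_def cb
  proof (intro allI conjI)
    show "h < cmod 1" using h by simp
    show "cmod 1 + h \<le> K * (cmod 1 - h)" unfolding h_def using K1 K by (simp add: field_simps)
  qed
  show ?thesis by (rule that[OF conj[unfolded fe ge] cond W1 W2])
qed

text \<open>Put A = |\<alpha>| and x = |a|. A boost multiplies A - x by K and divides A + x by K. If
  A - x \<ge> \<xi>^2, the two can be made equal, which kills a'; if x - A \<ge> \<xi>^2, they can
  be made opposite, which kills \<alpha>'. In the nearly parabolic case between, the full boost K =
  2 / \<xi> makes both small. The threshold \<xi>^2 is what keeps K \<le> 2 / \<xi> in the other two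
  cases.\<close>

lemma normal_form:
  assumes \<rho>: "\<rho> \<ge> 0" and \<xi>: "0 < \<xi>" "\<xi> \<le> 1" and a: "cmod a \<le> 1"
    and F: "wiener \<omega> UNIV \<rho> \<eta> (\<lambda>t. of_real (f t))" "wiener \<omega> UNIV \<rho> \<eta> g"
  obtains v b \<alpha>' a' f' g' where
    "conjugate (\<lambda>t. \<alpha> + f t) (\<lambda>t. a + g t) (\<lambda>t. \<alpha>' + f' t) (\<lambda>t. a' + g' t) v b 0"
    "cond_le v b (2 / \<xi>)" "wiener \<omega> UNIV \<rho> (2 / \<xi> * \<eta>) (\<lambda>t. of_real (f' t))" "wiener \<omega> UNIV \<rho> (2 / \<xi> * \<eta>) g'"
    "a' = 0 \<or> \<bar>\<alpha>'\<bar> \<le> 2 * \<xi> \<and> cmod a' \<le> 2 * \<xi> \<or> \<alpha>' = 0 \<and> \<xi>\<^sup>2 \<le> cmod a'"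
proof (cases "a = 0")
  case True
  have "1 \<le> 2 / \<xi>" using \<xi> by simp
  moreover have "\<eta> \<ge> 0" by (rule wiener_nonneg[OF F(2)])
  ultimately have "\<eta> \<le> 2 / \<xi> * \<eta>" using mult_right_mono[of 1 "2 / \<xi>" \<eta>] by simp
  note W = F[THEN wiener_mono, OF order.refl this order.refl]
  have "cond_le (\<lambda>_. 1) (\<lambda>_. 0) (2 / \<xi>)" using \<open>1 \<le> 2 / \<xi>\<close> by (simp add: cond_le_def)
  from that[OF conjugate_refl this W] True show ?thesis by blast
next
  case False
  note result = that
  define x where "x = cmod a"
  have x: "0 < x" "x \<le> 1" using False a by (auto simp: x_def)
  define s :: real where "s = (if \<alpha> \<ge> 0 then 1 else - 1)"
  have s: "s = 1 \<or> s = - 1" by (simp add: s_def)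
  define A where "A = s * \<alpha>"
  have A: "A \<ge> 0" by (auto simp: A_def s_def)
  have \<eta>: "\<eta> \<ge> 0" by (rule wiener_nonneg[OF F(2)])
  have \<xi>2: "0 < \<xi>\<^sup>2" "\<xi>\<^sup>2 \<le> \<xi>" "\<xi>\<^sup>2 \<le> 1" using \<xi> by (auto simp: power2_eq_square mult_le_one mult_left_le)
  have main: thesis if K: "1 \<le> K" "K \<le> 2 / \<xi>"
    and form: "(A + x) / K = (A - x) * K \<or>
       \<bar>(A - x) * K\<bar> \<le> 2 * \<xi> \<and> \<bar>(A + x) / K\<bar> \<le> 2 * \<xi> \<or>
       (A - x) * K = - ((A + x) / K) \<and> \<xi>\<^sup>2 \<le> (A + x) / K" for K
  proof -
    obtain v b f' g' where *: "conjugate (\<lambda>t. \<alpha> + f t) (\<lambda>t. a + g t)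
        (\<lambda>t. s * ((s * \<alpha> - cmod a) * K + (s * \<alpha> + cmod a) / K) / 2 + f' t)
        (\<lambda>t. a / of_real (cmod a) * of_real (((s * \<alpha> + cmod a) / K - (s * \<alpha> - cmod a) * K) / 2) + g' t) v b 0"
      "cond_le v b K" "wiener \<omega> UNIV \<rho> (K * \<eta>) (\<lambda>t. of_real (f' t))" "wiener \<omega> UNIV \<rho> (K * \<eta>) g'"
      by (rule boost[OF \<rho> K(1) s False F]) (rule that)
    have K\<eta>: "K * \<eta> \<le> 2 / \<xi> * \<eta>" using K \<eta> by (intro mult_right_mono) auto
    define \<alpha>' where "\<alpha>' = s * ((A - x) * K + (A + x) / K) / 2"
    define y where "y = ((A + x) / K - (A - x) * K) / 2"
    define a' where "a' = a / of_real (cmod a) * of_real y"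
    have c1: "cmod a' = \<bar>y\<bar>" using False by (simp add: a'_def norm_mult norm_divide)
    have c2: "\<bar>\<alpha>'\<bar> = \<bar>(A - x) * K + (A + x) / K\<bar> / 2" using s by (auto simp: \<alpha>'_def)
    have lin: "\<bar>p\<bar> \<le> 2 * \<xi> \<and> \<bar>q\<bar> \<le> 2 * \<xi> \<Longrightarrow> \<bar>(q - p) / 2\<bar> \<le> 2 * \<xi>"
      "\<bar>p\<bar> \<le> 2 * \<xi> \<and> \<bar>q\<bar> \<le> 2 * \<xi> \<Longrightarrow> \<bar>p + q\<bar> / 2 \<le> 2 * \<xi>"
      "p = - q \<and> \<xi>\<^sup>2 \<le> q \<Longrightarrow> \<xi>\<^sup>2 \<le> \<bar>(q - p) / 2\<bar>" for p q :: real
      using \<xi>2 by (auto simp: abs_le_iff field_simps)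
    have "a' = 0 \<or> \<bar>\<alpha>'\<bar> \<le> 2 * \<xi> \<and> cmod a' \<le> 2 * \<xi> \<or> \<alpha>' = 0 \<and> \<xi>\<^sup>2 \<le> cmod a'"
      using form
    proof (elim disjE)
      assume "(A + x) / K = (A - x) * K"
      thus ?thesis by (simp add: a'_def y_def)
    next
      assume h: "\<bar>(A - x) * K\<bar> \<le> 2 * \<xi> \<and> \<bar>(A + x) / K\<bar> \<le> 2 * \<xi>"
      hence "\<bar>y\<bar> \<le> 2 * \<xi>" unfolding y_def by (rule lin(1))
      moreover have "\<bar>\<alpha>'\<bar> \<le> 2 * \<xi>" using h unfolding c2 by (rule lin(2))
      ultimately show ?thesis unfolding c1 by simp
    next
      assume h: "(A - x) * K = - ((A + x) / K) \<and> \<xi>\<^sup>2 \<le> (A + x) / K"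
      hence "\<alpha>' = 0" by (simp add: \<alpha>'_def)
      moreover have "\<xi>\<^sup>2 \<le> \<bar>y\<bar>" using h unfolding y_def by (rule lin(3))
      ultimately show ?thesis unfolding c1 by simp
    qed
    from result[OF *(1)[folded x_def A_def, folded \<alpha>'_def y_def, folded x_def] cond_le_mono[OF *(2) K(2)]
        wiener_mono[OF *(3) order.refl K\<eta> order.refl] wiener_mono[OF *(4) order.refl K\<eta> order.refl]] this
    show thesis unfolding a'_def x_def by blast
  qed
  have sq: "r * sqrt (p / r) = p / sqrt (p / r)" if "p > 0" "r > 0" for p r :: real
  proof -
    have "sqrt (p / r) * sqrt (p / r) = p / r" using that by (simp flip: power2_eq_square)
    hence "r * sqrt (p / r) * sqrt (p / r) = p" using that by (simp only: mult.assoc) simp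
    moreover have "sqrt (p / r) \<noteq> 0" using that by simp
    ultimately show ?thesis using nonzero_eq_divide_eq by blast
  qed
  have Kb: "sqrt q \<le> 2 / \<xi>" if "q \<le> 4 / \<xi>\<^sup>2" for q
  proof -
    have "sqrt q \<le> sqrt ((2 / \<xi>)\<^sup>2)" using that by (intro real_sqrt_le_mono) (simp add: power_divide)
    thus ?thesis using \<xi> by simp
  qed
  consider "A - x \<ge> \<xi>\<^sup>2" | "x - A \<ge> \<xi>\<^sup>2" | "\<bar>A - x\<bar> < \<xi>\<^sup>2" by linarith
  thus ?thesis
  proof cases
    case 1
    have pos: "A + x > 0" "A - x > 0" using 1 \<xi>2 x A by linarith+
    show ?thesis
    proof (rule main[of "sqrt ((A + x) / (A - x))"])
      show "1 \<le> sqrt ((A + x) / (A - x))" using pos x by (simp add: field_simps)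
      have "(A + x) / (A - x) = 1 + 2 * x / (A - x)" using pos by (simp add: field_simps)
      also have "\<dots> \<le> 1 + 2 * 1 / \<xi>\<^sup>2" using 1 x \<xi>2 by (intro add_left_mono frac_le) auto
      also have "1 \<le> 2 / \<xi>\<^sup>2" using \<xi>2 by simp
      hence "1 + 2 * 1 / \<xi>\<^sup>2 \<le> 4 / \<xi>\<^sup>2" by (simp add: field_simps)
      finally show "sqrt ((A + x) / (A - x)) \<le> 2 / \<xi>" by (rule Kb)
      show "(A + x) / sqrt ((A + x) / (A - x)) = (A - x) * sqrt ((A + x) / (A - x)) \<or>
         \<bar>(A - x) * sqrt ((A + x) / (A - x))\<bar> \<le> 2 * \<xi> \<and> \<bar>(A + x) / sqrt ((A + x) / (A - x))\<bar> \<le> 2 * \<xi> \<or>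
         (A - x) * sqrt ((A + x) / (A - x)) = - ((A + x) / sqrt ((A + x) / (A - x))) \<and>
         \<xi>\<^sup>2 \<le> (A + x) / sqrt ((A + x) / (A - x))"
        by (rule disjI1) (rule sq[OF pos, symmetric])
    qed
  next
    case 2
    have pos: "A + x > 0" "x - A > 0" using 2 \<xi>2 x A by linarith+
    define K where "K = sqrt ((A + x) / (x - A))"
    have eq: "(x - A) * K = (A + x) / K" unfolding K_def by (rule sq[OF pos])
    have K0: "K > 0" using pos by (simp add: K_def)
    show ?thesis
    proof (rule main[of K])
      show "1 \<le> K" using pos A by (simp add: K_def field_simps)
      have "A + x \<le> 4" using 2 x \<xi>2 by linarith
      hence "(A + x) / (x - A) \<le> 4 / \<xi>\<^sup>2" using 2 \<xi>2 by (intro frac_le) auto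
      thus "K \<le> 2 / \<xi>" unfolding K_def by (rule Kb)
      have "\<xi>\<^sup>2 * \<xi>\<^sup>2 \<le> (x - A) * (A + x)" using 2 A \<xi>2 pos by (intro mult_mono) linarith+
      also have "\<dots> = ((x - A) * K) * ((A + x) / K)" using K0 by simp
      also have "\<dots> = ((A + x) / K) * ((A + x) / K)" unfolding eq ..
      finally have "(\<xi>\<^sup>2)\<^sup>2 \<le> ((A + x) / K)\<^sup>2" by (simp only: power2_eq_square)
      hence "\<xi>\<^sup>2 \<le> (A + x) / K" by (rule power2_le_imp_le) (use pos K0 in simp)
      thus "(A + x) / K = (A - x) * K \<or> \<bar>(A - x) * K\<bar> \<le> 2 * \<xi> \<and> \<bar>(A + x) / K\<bar> \<le> 2 * \<xi> \<or>
         (A - x) * K = - ((A + x) / K) \<and> \<xi>\<^sup>2 \<le> (A + x) / K"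
        using eq by (simp add: left_diff_distrib)
    qed
  next
    case 3
    show ?thesis
    \<comment> \<open>The small coordinate grows to at most \<xi>^2 (2 / \<xi>) = 2 \<xi>, and the
      large one, at most 4, shrinks to at most 2 \<xi>.\<close>
    proof (rule main[of "2 / \<xi>"])
      show "1 \<le> 2 / \<xi>" using \<xi> by simp
      have "\<bar>(A - x) * (2 / \<xi>)\<bar> = \<bar>A - x\<bar> * (2 / \<xi>)" using \<xi> by (subst abs_mult) simp
      also have "\<dots> \<le> \<xi>\<^sup>2 * (2 / \<xi>)" using 3 \<xi> by (intro mult_right_mono) auto
      also have "\<dots> = 2 * \<xi>" using \<xi> by (simp add: power2_eq_square)
      finally have 1: "\<bar>(A - x) * (2 / \<xi>)\<bar> \<le> 2 * \<xi>" .
      have "A + x \<le> 4" using 3 x \<xi>2 by linarith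
      hence "(A + x) * \<xi> / 2 \<le> 4 * \<xi> / 2" using \<xi> by (intro divide_right_mono mult_right_mono) auto
      hence 2: "\<bar>(A + x) / (2 / \<xi>)\<bar> \<le> 2 * \<xi>" using A x \<xi> by simp
      show "(A + x) / (2 / \<xi>) = (A - x) * (2 / \<xi>) \<or> \<bar>(A - x) * (2 / \<xi>)\<bar> \<le> 2 * \<xi> \<and> \<bar>(A + x) / (2 / \<xi>)\<bar> \<le> 2 * \<xi> \<or>
         (A - x) * (2 / \<xi>) = - ((A + x) / (2 / \<xi>)) \<and> \<xi>\<^sup>2 \<le> (A + x) / (2 / \<xi>)"
        using 1 2 by blast
    qed simp
  qed
qed

section \<open>Averaging at one scale, without and with a resonance\<close>

lemma split_mean:
  assumes \<rho>: "0 \<le> \<rho>'" "\<rho>' \<le> \<rho>" and N: "\<And>n. n \<in> S \<Longrightarrow> n = m \<or> l1_norm n \<ge> N"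
    and F: "wiener \<omega> S \<rho> C g"
  obtains c h where "cmod c \<le> C" "\<And>t. g t = c * mode \<omega> m t + h t"
    "wiener \<omega> UNIV \<rho>' (C * exp (- ((\<rho> - \<rho>') * N))) h"
proof -
  obtain g1 g2 C1 C2 where *: "wiener \<omega> (S \<inter> {m}) \<rho> C1 g1" "wiener \<omega> (S - {m}) \<rho> C2 g2"
    "C1 + C2 \<le> C" "\<And>t. g t = g1 t + g2 t" by (rule wiener_split[OF F, of "{m}"]) (rule that)
  note nn = wiener_nonneg[OF *(1)] wiener_nonneg[OF *(2)]
  have 1: "wiener \<omega> {m} \<rho> C1 g1" by (rule wiener_mono[OF *(1)]) auto
  have "0 \<le> \<rho>" using \<rho> by simp
  from wiener_single[OF 1 this] obtain c where c: "cmod c \<le> C1" "\<And>t. g1 t = c * mode \<omega> m t" by blast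
  have "wiener \<omega> (S - {m}) \<rho>' (C2 * exp (- ((\<rho> - \<rho>') * N))) g2"
    by (rule wiener_high[OF *(2) \<rho>(2)]) (use N in auto)
  hence "wiener \<omega> UNIV \<rho>' (C * exp (- ((\<rho> - \<rho>') * N))) g2"
    by (rule wiener_mono) (use *(3) nn in auto)
  moreover have "cmod c \<le> C" using c *(3) nn by linarith
  ultimately show ?thesis using that c *(4) by simp
qed

lemma split_mean_real:
  assumes \<rho>: "0 \<le> \<rho>'" "\<rho>' \<le> \<rho>" and N: "\<And>n. n \<in> S \<Longrightarrow> n = 0 \<or> l1_norm n \<ge> N"
    and F: "wiener \<omega> S \<rho> C (\<lambda>t. of_real (f t))"
  obtains c h where "\<bar>c\<bar> \<le> C" "\<And>t. f t = c + h t"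
    "wiener \<omega> UNIV \<rho>' (C * exp (- ((\<rho> - \<rho>') * N))) (\<lambda>t. of_real (h t))"
proof -
  obtain c h where *: "cmod c \<le> C" "\<And>t. of_real (f t) = c * mode \<omega> 0 t + h t"
    "wiener \<omega> UNIV \<rho>' (C * exp (- ((\<rho> - \<rho>') * N))) h"
    by (rule split_mean[OF \<rho> N F]) (assumption, rule that)
  have 1: "f t = Re c + Re (h t)" for t using arg_cong[OF *(2)[of t], of Re] by simp
  have 2: "\<bar>Re c\<bar> \<le> C" using abs_Re_le_cmod[of c] *(1) by linarith
  have 3: "wiener \<omega> UNIV \<rho>' (C * exp (- ((\<rho> - \<rho>') * N))) (\<lambda>t. of_real (Re (h t)))"
    by (rule wiener_Re[OF *(3) \<rho>(1)]) simp
  show ?thesis by (rule that[OF 2 1 3])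
qed

text \<open>Nothing is retained here. Since 2 \<alpha> stays away from all short frequencies,
  including 0, \<open>g\<close> can lose all modes shorter than \<open>N\<close>, while
  \<open>f\<close> keeps its mean, which is absorbed in \<alpha>'. What is left are the tails, made
  small by the loss of width, and the rest of the geometric iteration.\<close>

lemma average_nonresonant:
  assumes \<rho>: "0 \<le> \<rho>'" "\<rho>' \<le> \<rho>" and \<xi>: "0 < \<xi>" "60 * \<eta> \<le> \<xi>"
    and div: "\<And>n. n \<noteq> 0 \<Longrightarrow> l1_norm n < N \<Longrightarrow> \<xi> \<le> \<bar>2 * pi * int_inner n \<omega>\<bar>"
      "\<And>n. l1_norm n < N \<Longrightarrow> \<xi> \<le> \<bar>2 * pi * int_inner n \<omega> - 2 * \<alpha>\<bar>"
    and F: "wiener \<omega> UNIV \<rho> \<eta> (\<lambda>t. of_real (f t))" "wiener \<omega> UNIV \<rho> \<eta> g"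
  obtains \<alpha>' f' g' v b where "conjugate (\<lambda>t. \<alpha> + f t) g (\<lambda>t. \<alpha>' + f' t) g' v b 0" "cond_le v b 3"
    "wiener \<omega> UNIV \<rho>' (2 * \<eta> * exp (- ((\<rho> - \<rho>') * N)) + (1/2) ^ m * \<eta>) (\<lambda>t. of_real (f' t))"
    "wiener \<omega> UNIV \<rho>' (2 * \<eta> * exp (- ((\<rho> - \<rho>') * N)) + (1/2) ^ m * \<eta>) g'"
proof -
  define N1 where "N1 = {n :: int^'a. n \<noteq> 0 \<and> l1_norm n < N}"
  define N2 where "N2 = {n :: int^'a. l1_norm n < N}"
  have sym: "uminus ` N1 = N1"
  proof -
    have "uminus ` N1 \<subseteq> N1" by (auto simp: N1_def)
    moreover have "x \<in> uminus ` N1" if "x \<in> N1" for x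
      using that by (intro image_eqI[of _ _ "- x"]) (auto simp: N1_def)
    ultimately show ?thesis by blast
  qed
  have \<rho>0: "0 \<le> \<rho>" using \<rho> by simp
  have \<eta>: "0 \<le> \<eta>" by (rule wiener_nonneg[OF F(2)])
  have zero: "wiener \<omega> UNIV \<rho> 0 (\<lambda>t. of_real 0)" "wiener \<omega> UNIV \<rho> 0 (\<lambda>t. 0)"
    using wiener_UNIV[OF wiener_zero] by simp_all
  obtain fo go fn gn v b where *: "wiener \<omega> (- N1) \<rho> (2 * \<eta>) (\<lambda>t. of_real (fo t))" "wiener \<omega> (- N2) \<rho> (2 * \<eta>) go"
    "wiener \<omega> N1 \<rho> ((1/2) ^ m * \<eta>) (\<lambda>t. of_real (fn t))" "wiener \<omega> N2 \<rho> ((1/2) ^ m * \<eta>) gn"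
    "cond_le v b 3"
    "conjugate (\<lambda>t. \<alpha> + 0 + f t) (\<lambda>t. 0 + g t)
       (\<lambda>t. \<alpha> + 0 + fo t + fn t) (\<lambda>t. 0 + go t + gn t) v b 0"
  proof (rule averaging[where D = "1 / \<xi>" and s = 0 and fS = "\<lambda>_. 0" and gS = "\<lambda>_. 0", OF \<rho>0 _ zero F sym])
    show "0 < 1 / \<xi>" using \<xi> by simp
    show "1 / (1 / \<xi>) \<le> \<bar>2 * pi * int_inner n \<omega>\<bar>" if "n \<in> N1" for n using div(1) that by (simp add: N1_def)
    show "1 / (1 / \<xi>) \<le> \<bar>2 * pi * int_inner n \<omega> - 2 * \<alpha>\<bar>" if "n \<in> N2" for n using div(2) that by (simp add: N2_def)
    show "20 * (1 / \<xi> * (0 + 3 * \<eta>)) \<le> 1" using \<xi> by (simp add: field_simps)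
  qed (rule that)
  obtain c h where c: "\<bar>c\<bar> \<le> 2 * \<eta>" "\<And>t. fo t = c + h t"
    "wiener \<omega> UNIV \<rho>' (2 * \<eta> * exp (- ((\<rho> - \<rho>') * N))) (\<lambda>t. of_real (h t))"
    by (rule split_mean_real[OF \<rho> _ *(1), of N]) (auto simp: N1_def intro: that)
  have go: "wiener \<omega> UNIV \<rho>' (2 * \<eta> * exp (- ((\<rho> - \<rho>') * N))) go"
    by (rule wiener_UNIV, rule wiener_high[OF *(2) \<rho>(2)]) (simp add: N2_def)
  have n': "wiener \<omega> UNIV \<rho>' ((1/2) ^ m * \<eta>) (\<lambda>t. of_real (fn t))" "wiener \<omega> UNIV \<rho>' ((1/2) ^ m * \<eta>) gn"
    using *(3,4) \<rho> by (auto intro: wiener_mono)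
  have 1: "conjugate (\<lambda>t. \<alpha> + f t) g (\<lambda>t. (\<alpha> + c) + (h t + fn t)) (\<lambda>t. go t + gn t) v b 0"
    using *(6) by (simp add: c(2) add_ac)
  have 2: "wiener \<omega> UNIV \<rho>' (2 * \<eta> * exp (- ((\<rho> - \<rho>') * N)) + (1/2) ^ m * \<eta>) (\<lambda>t. of_real (h t + fn t))"
    by (rule wiener_eqI[OF wiener_add[OF c(3) n'(1) \<rho>(1)]]) auto
  show ?thesis by (rule that[OF 1 *(5) 2 wiener_add[OF go n'(2) \<rho>(1)]])
qed

lemma average_resonant:
  assumes \<rho>: "0 \<le> \<rho>'" "\<rho>' \<le> \<rho>" and D: "D > 0" "20 * (D * (s + 3 * \<eta>)) \<le> 1"
    and div: "\<And>n. n \<noteq> 0 \<Longrightarrow> l1_norm n \<le> 2 * M \<Longrightarrow> 1 / D \<le> \<bar>2 * pi * int_inner n \<omega>\<bar>"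
    and k: "l1_norm k \<le> M" and \<beta>: "\<beta> = pi * int_inner k \<omega>"
    and S: "\<bar>\<sigma>\<bar> \<le> s" "cmod a \<le> s" "a = 0 \<or> k = 0"
    and F: "wiener \<omega> UNIV \<rho> \<eta> (\<lambda>t. of_real (f t))" "wiener \<omega> UNIV \<rho> \<eta> g"
    and e: "exp (\<rho>' * l1_norm k) * (2 * \<eta> * exp (- ((\<rho> - \<rho>') * M)) + (1/2) ^ m * \<eta>) \<le> e"
  obtains \<alpha>' a' f' g' v b where
    "conjugate (\<lambda>t. \<beta> + \<sigma> + f t) (\<lambda>t. a + g t) (\<lambda>t. \<alpha>' + f' t) (\<lambda>t. a' + g' t) v b \<beta>"
    "cond_le v b 3" "cmod a' \<le> s + 2 * \<eta>"
    "wiener \<omega> UNIV \<rho>' e (\<lambda>t. of_real (f' t))" "wiener \<omega> UNIV \<rho>' e g'"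
proof -
  define N1 where "N1 = {n :: int^'a. n \<noteq> 0 \<and> l1_norm n < M}"
  define N2 where "N2 = {n :: int^'a. n \<noteq> k \<and> l1_norm n < M}"
  have sym: "uminus ` N1 = N1"
  proof -
    have "uminus ` N1 \<subseteq> N1" by (auto simp: N1_def)
    moreover have "x \<in> uminus ` N1" if "x \<in> N1" for x
      using that by (intro image_eqI[of _ _ "- x"]) (auto simp: N1_def)
    ultimately show ?thesis by blast
  qed
  have \<rho>0: "0 \<le> \<rho>" using \<rho> by simp
  have \<eta>: "0 \<le> \<eta>" by (rule wiener_nonneg[OF F(2)])
  have zero: "wiener \<omega> UNIV \<rho> s (\<lambda>t. of_real \<sigma>)" "wiener \<omega> UNIV \<rho> s (\<lambda>t. a)"
    using wiener_const[of \<omega> \<rho> "of_real \<sigma>"] wiener_const[of \<omega> \<rho> a] S by (auto intro: wiener_mono)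
  have M0: "0 \<le> M" using k l1_norm_nonneg[of k] by linarith
  obtain fo go fn gn v b where *: "wiener \<omega> (- N1) \<rho> (2 * \<eta>) (\<lambda>t. of_real (fo t))" "wiener \<omega> (- N2) \<rho> (2 * \<eta>) go"
    "wiener \<omega> N1 \<rho> ((1/2) ^ m * \<eta>) (\<lambda>t. of_real (fn t))" "wiener \<omega> N2 \<rho> ((1/2) ^ m * \<eta>) gn"
    "cond_le v b 3"
    "conjugate (\<lambda>t. \<beta> + \<sigma> + f t) (\<lambda>t. a + g t)
       (\<lambda>t. \<beta> + \<sigma> + fo t + fn t) (\<lambda>t. a + go t + gn t) v b 0"
  proof (rule averaging[where D = D and s = s and fS = "\<lambda>_. \<sigma>" and gS = "\<lambda>_. a", OF \<rho>0 D(1) zero F sym _ _ D(2)])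
    show "1 / D \<le> \<bar>2 * pi * int_inner n \<omega>\<bar>" if "n \<in> N1" for n using div that M0 by (simp add: N1_def)
    show "1 / D \<le> \<bar>2 * pi * int_inner n \<omega> - 2 * \<beta>\<bar>" if "n \<in> N2" for n
      using div[of "n - k"] that k l1_norm_diff[of n k] by (simp add: N2_def \<beta> int_inner_diff algebra_simps)
  qed (rule that)
  obtain c h where c: "\<bar>c\<bar> \<le> 2 * \<eta>" "\<And>t. fo t = c + h t"
    "wiener \<omega> UNIV \<rho>' (2 * \<eta> * exp (- ((\<rho> - \<rho>') * M))) (\<lambda>t. of_real (h t))"
    by (rule split_mean_real[OF \<rho> _ *(1), of M]) (auto simp: N1_def intro: that)
  obtain d l where d: "cmod d \<le> 2 * \<eta>" "\<And>t. go t = d * mode \<omega> k t + l t"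
    "wiener \<omega> UNIV \<rho>' (2 * \<eta> * exp (- ((\<rho> - \<rho>') * M))) l"
    by (rule split_mean[OF \<rho> _ *(2), of k M]) (auto simp: N2_def intro: that)
  have n': "wiener \<omega> UNIV \<rho>' ((1/2) ^ m * \<eta>) (\<lambda>t. of_real (fn t))" "wiener \<omega> UNIV \<rho>' ((1/2) ^ m * \<eta>) gn"
    using *(3,4) \<rho> by (auto intro: wiener_mono)
  define E where "E = 2 * \<eta> * exp (- ((\<rho> - \<rho>') * M)) + (1/2) ^ m * \<eta>"
  have E: "0 \<le> E" using \<eta> by (simp add: E_def)
  have Ee: "exp (\<rho>' * l1_norm k) * E \<le> e" using e by (simp add: E_def)
  have "1 * E \<le> exp (\<rho>' * l1_norm k) * E" using E \<rho>(1) l1_norm_nonneg[of k] by (intro mult_right_mono) auto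
  hence Ee': "E \<le> e" using Ee by simp
  have lgW: "wiener \<omega> UNIV \<rho>' E (\<lambda>t. l t + gn t)" unfolding E_def by (rule wiener_add[OF d(3) n'(2) \<rho>(1)])
  have W1: "wiener \<omega> UNIV \<rho>' e (\<lambda>t. of_real (h t + fn t))"
    by (rule wiener_eqI[OF wiener_add[OF c(3) n'(1) \<rho>(1)]]) (use Ee' in \<open>auto simp: E_def\<close>)
  have W2: "wiener \<omega> UNIV \<rho>' e (\<lambda>t. mode \<omega> (- k) t * (l t + gn t))"
    by (rule wiener_mono[OF wiener_shift[OF lgW \<rho>(1), of "- k"]]) (use Ee in \<open>auto simp: mult.commute\<close>)
  have md: "mode \<omega> (- k) t = cis (- 2 * \<beta> * t)" for t by (simp add: mode_def \<beta> mult.assoc)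
  have ak: "a * mode \<omega> (- k) t = a" for t using S(3) by auto
  have f1: "(\<beta> + \<sigma> + fo t + fn t) - \<beta> = (\<sigma> + c) + (h t + fn t)" for t by (simp add: c(2))
  have g1: "(a + go t + gn t) * cis (- 2 * \<beta> * t) = (a + d) + mode \<omega> (- k) t * (l t + gn t)" for t
  proof -
    have "(a + go t + gn t) * mode \<omega> (- k) t = a * mode \<omega> (- k) t + d * (mode \<omega> (- k) t * mode \<omega> k t) + mode \<omega> (- k) t * (l t + gn t)"
      by (simp add: d(2) algebra_simps del: mode_minus_mult)
    thus ?thesis unfolding ak mode_minus_mult md[symmetric] by simp
  qed
  note cr = conjugate_trans[OF *(6) conjugate_rotate[of _ _ \<beta>], unfolded f1 g1 add_0_left]
  have cc: "cond_le (\<lambda>t. v t * cis (\<beta> * t) + b t * cnj 0) (\<lambda>t. v t * 0 + b t * cnj (cis (\<beta> * t))) (3 * 1)"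
    by (rule cond_le_compose[OF *(5)]) (simp add: cond_le_def)
  have cc': "cond_le (\<lambda>t. v t * cis (\<beta> * t) + b t * cnj 0) (\<lambda>t. v t * 0 + b t * cnj (cis (\<beta> * t))) 3"
    using cc by simp
  have ad: "cmod (a + d) \<le> s + 2 * \<eta>" using S(2) d(1) norm_triangle_ineq[of a d] by linarith
  show ?thesis by (rule that[OF cr cc' ad W1 W2])
qed

section \<open>The iteration\<close>

locale diophantine =
  fixes \<omega> :: "real ^ 'd::finite" and \<gamma> \<tau> R :: real
  assumes \<gamma>: "\<gamma> > 0" and \<tau>: "\<tau> > 0" and R: "R > 0"
    and dioph: "\<And>n. n \<noteq> 0 \<Longrightarrow> \<gamma> * l1_norm n powr (- \<tau>) \<le> \<bar>int_inner n \<omega>\<bar>"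
begin

text \<open>At scale \<open>l\<close> the perturbation has size \<open>exp (- l\<^sup>2)\<close>. Resonances are searched up to \<open>5 l\<^sup>3\<close>,
  while \<open>cutoff l\<close>, beyond every power of \<open>l\<close>, bounds the modes that can be averaged away
  next to a resonance; divisors below the cutoff exceed \<open>divisor l\<close>.\<close>

definition width :: "real \<Rightarrow> real" where "width l = exp (- (l\<^sup>2 / 40))"
definition divisor :: "real \<Rightarrow> real" where "divisor l = exp (- (l\<^sup>2 / 60))"
definition cutoff :: "real \<Rightarrow> real" where "cutoff l = exp (l\<^sup>2 / (80 * \<tau>))"

text \<open>The recurring term \<open>2 / width l * exp (- l\<^sup>2)\<close> bounds the
  perturbation after the normal form. The clauses express the hierarchy exp (- l^2), width^2, width,
  divisor, cutoff^(- \<tau>), whose exponents are 1, 1/20, 1/40, 1/60, 1/80 times - l^2. The last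
  clause pays the distortion \<open>(6 / width l) ^ 4\<close> of one step out of the factor exp (-
  3/4 (2 l)^2) of the next scale.\<close>

definition large :: "real \<Rightarrow> bool" where
  "large l \<longleftrightarrow> l \<ge> 1 \<and>
     divisor l \<le> 2 * pi * \<gamma> * (2 * cutoff l) powr (- \<tau>) \<and>
     60 * (2 / width l * exp (- l\<^sup>2)) \<le> width l \<and>
     20 * (1 / divisor l * (2 * width l + 3 * (2 / width l * exp (- l\<^sup>2)))) \<le> 1 \<and>
     20 * l ^ 3 \<le> cutoff l \<and> 20 * R * l ^ 4 \<le> cutoff l \<and>
     4 * (2 / width l * exp (- l\<^sup>2)) * exp (- (5 * l\<^sup>2)) \<le> exp (- (4 * l\<^sup>2)) \<and>
     exp ((R + 1) * (5 * l ^ 3)) * (4 * (2 / width l * exp (- l\<^sup>2)) * exp (- (1 / l * cutoff l))) \<le> exp (- (4 * l\<^sup>2)) \<and>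
     2 * (2 / width l * exp (- l\<^sup>2)) < (width l)\<^sup>2 \<and>
     4 * width l + 2 * (2 / width l * exp (- l\<^sup>2)) < divisor l / 2 \<and>
     width l + 4 * (2 / width l * exp (- l\<^sup>2)) \<le> divisor l \<and>
     2 * width l + 2 * (2 / width l * exp (- l\<^sup>2)) \<le> 1 \<and>
     4 * (2 / width l * exp (- l\<^sup>2)) * (6 / width l) ^ 4 \<le> exp (- (3 / 4 * l\<^sup>2)) \<and>
     (6 / width l) ^ 4 * exp (- (3 * l\<^sup>2)) \<le> exp (- (3 / 4 * l\<^sup>2))"

lemma eventually_large: "eventually large at_top"
proof -
  define c where "c = 1 / (80 * \<tau>)"
  have c: "c > 0" using \<tau> by (simp add: c_def)
  have cut: "cutoff l = exp (c * l\<^sup>2)" for l by (simp add: cutoff_def c_def)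
  define q where "q = 2 * pi * \<gamma> * 2 powr (- \<tau>)"
  have q: "q > 0" using \<gamma> by (simp add: q_def)
  have pw: "2 * pi * \<gamma> * (2 * cutoff l) powr (- \<tau>) = q * exp (- (l\<^sup>2 / 80))" for l
  proof -
    have "(2 * cutoff l) powr (- \<tau>) = 2 powr (- \<tau>) * cutoff l powr (- \<tau>)"
      by (rule powr_mult)
    also have "cutoff l powr (- \<tau>) = exp (- (l\<^sup>2 / 80))"
      using \<tau> by (simp add: cutoff_def powr_def)
    finally show ?thesis by (simp add: q_def)
  qed
  have e1: "eventually (\<lambda>l::real. exp (- (l\<^sup>2 / 60)) \<le> q * exp (- (l\<^sup>2 / 80))) at_top"
    using q by real_asymp
  have e2: "eventually (\<lambda>l::real. 60 * (2 / exp (- (l\<^sup>2 / 40)) * exp (- l\<^sup>2)) \<le> exp (- (l\<^sup>2 / 40))) at_top"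
    by real_asymp
  have e3: "eventually (\<lambda>l::real. 20 * (1 / exp (- (l\<^sup>2 / 60)) * (2 * exp (- (l\<^sup>2 / 40)) + 3 * (2 / exp (- (l\<^sup>2 / 40)) * exp (- l\<^sup>2)))) \<le> 1) at_top"
    by real_asymp
  have e4: "eventually (\<lambda>l::real. 20 * l ^ 3 \<le> exp (c * l\<^sup>2)) at_top" using c by real_asymp
  have e5: "eventually (\<lambda>l::real. 20 * R * l ^ 4 \<le> exp (c * l\<^sup>2)) at_top" using c R by real_asymp
  have e6: "eventually (\<lambda>l::real. 4 * (2 / exp (- (l\<^sup>2 / 40)) * exp (- l\<^sup>2)) * exp (- (5 * l\<^sup>2)) \<le> exp (- (4 * l\<^sup>2))) at_top"
    by real_asymp
  have e7: "eventually (\<lambda>l::real. exp ((R + 1) * (5 * l ^ 3)) * (4 * (2 / exp (- (l\<^sup>2 / 40)) * exp (- l\<^sup>2)) * exp (- (1 / l * exp (c * l\<^sup>2)))) \<le> exp (- (4 * l\<^sup>2))) at_top"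
    using c R by real_asymp
  have e8: "eventually (\<lambda>l::real. 2 * (2 / exp (- (l\<^sup>2 / 40)) * exp (- l\<^sup>2)) < (exp (- (l\<^sup>2 / 40)))\<^sup>2) at_top"
    by real_asymp
  have e9: "eventually (\<lambda>l::real. 4 * exp (- (l\<^sup>2 / 40)) + 2 * (2 / exp (- (l\<^sup>2 / 40)) * exp (- l\<^sup>2)) < exp (- (l\<^sup>2 / 60)) / 2) at_top"
    by real_asymp
  have e10: "eventually (\<lambda>l::real. exp (- (l\<^sup>2 / 40)) + 4 * (2 / exp (- (l\<^sup>2 / 40)) * exp (- l\<^sup>2)) \<le> exp (- (l\<^sup>2 / 60))) at_top"
    by real_asymp
  have e11: "eventually (\<lambda>l::real. 2 * exp (- (l\<^sup>2 / 40)) + 2 * (2 / exp (- (l\<^sup>2 / 40)) * exp (- l\<^sup>2)) \<le> 1) at_top"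
    by real_asymp
  have e12: "eventually (\<lambda>l::real. 4 * (2 / exp (- (l\<^sup>2 / 40)) * exp (- l\<^sup>2)) * (6 / exp (- (l\<^sup>2 / 40))) ^ 4 \<le> exp (- (3 / 4 * l\<^sup>2))) at_top"
    by real_asymp
  have e13: "eventually (\<lambda>l::real. (6 / exp (- (l\<^sup>2 / 40))) ^ 4 * exp (- (3 * l\<^sup>2)) \<le> exp (- (3 / 4 * l\<^sup>2))) at_top"
    by real_asymp
  show ?thesis
    using e1 e2 e3 e4 e5 e6 e7 e8 e9 e10 e11 e12 e13 eventually_ge_at_top[of 1]
    unfolding large_def pw cut[symmetric] width_def[symmetric] divisor_def[symmetric]
    by eventually_elim blast
qed

lemma large_divisor:
  assumes "large l" "n \<noteq> 0" "l1_norm n \<le> 2 * cutoff l"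
  shows "divisor l \<le> \<bar>2 * pi * int_inner n \<omega>\<bar>"
proof -
  have "divisor l \<le> 2 * pi * \<gamma> * (2 * cutoff l) powr (- \<tau>)" using assms(1) by (simp add: large_def)
  also have "(2 * cutoff l) powr (- \<tau>) \<le> l1_norm n powr (- \<tau>)"
    using l1_norm_ge_1[OF assms(2)] assms(3) \<tau> by (intro powr_mono2') auto
  hence "2 * pi * \<gamma> * (2 * cutoff l) powr (- \<tau>) \<le> 2 * pi * (\<gamma> * l1_norm n powr (- \<tau>))"
    using \<gamma> by simp
  also have "\<dots> \<le> 2 * pi * \<bar>int_inner n \<omega>\<bar>" using dioph[OF assms(2)] by (intro mult_left_mono) auto
  finally show ?thesis by (simp add: abs_mult)
qed

text \<open>\<open>k\<close> is the label that remains at scale \<open>l\<close>, and \<theta> an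
  amplitude factor handed through untouched. The rate R - 1 / l lies below the working width R + 2 /
  l, because resonances at later scales can shorten the label; exp (- 3/4 l^2) is what is left of
  exp (- l^2) once \<open>\<Gamma> ^ 4\<close> has been paid.\<close>

definition almost_reducible :: "real \<Rightarrow> (real \<Rightarrow> real) \<Rightarrow> (real \<Rightarrow> complex) \<Rightarrow> int ^ 'd \<Rightarrow> real \<Rightarrow> bool" where
  "almost_reducible l f g k \<theta> \<longleftrightarrow> (\<exists>v b \<sigma> \<alpha> e \<Gamma> f' g'. conjugate f g (\<lambda>t. \<alpha> + f' t) g' v b \<sigma> \<and>
     (\<forall>t. \<bar>f' t\<bar> \<le> e) \<and> (\<forall>t. cmod (g' t) \<le> e) \<and> 0 < e \<and> 1 \<le> \<Gamma> \<and> cond_le v b \<Gamma> \<and>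
     e * \<Gamma> ^ 4 \<le> \<theta> * exp (- (3 / 4 * l\<^sup>2)) * exp (- ((R - 1 / l) * l1_norm k)))"

lemma pow_half_le: assumes "(0::real) < e" obtains m :: nat where "(1 / 2) ^ m \<le> e"
  using real_arch_pow_inv[OF assms, of "1/2"] by (auto intro: less_imp_le)

text \<open>The label is short compared with the cutoff, so the rotation number \<pi> \<langle>k,
  \<omega>\<rangle> has at least the size divisor / 2. This rules out the hyperbolic and the
  near-zero outcome of the normal form. In the elliptic case \<alpha>' lies within 2 \<eta> of \<pi>
  \<langle>k, \<omega>\<rangle>; therefore no mode shorter than |k| is resonant, because n - k has
  length at most 2 |k|. Averaging all of them and giving up the whole width leaves an error of order
  exp (- \<rho> |k|), which is the source of the decay in the label.\<close>

lemma kam_final: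
  assumes l: "large l" and a: "cmod a \<le> 1" and \<theta>: "0 < \<theta>" "\<theta> \<le> 1"
    and k: "k \<noteq> 0" "2 * l1_norm k \<le> cutoff l"
    and F: "wiener \<omega> UNIV (R + 2 / l) (\<theta> * exp (- l\<^sup>2)) (\<lambda>t. of_real (f t))"
      "wiener \<omega> UNIV (R + 2 / l) (\<theta> * exp (- l\<^sup>2)) g"
    and rot: "has_rot (\<lambda>t. \<alpha> + f t) (\<lambda>t. a + g t) (pi * int_inner k \<omega>)"
  shows "almost_reducible l (\<lambda>t. \<alpha> + f t) (\<lambda>t. a + g t) k \<theta>"
proof -
  have L: "l \<ge> 1" using l by (simp add: large_def)
  define \<rho> where "\<rho> = R + 2 / l"
  have \<rho>: "\<rho> \<ge> 0" using R L by (simp add: \<rho>_def)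
  define \<xi> where "\<xi> = width l"
  have \<xi>: "0 < \<xi>" "\<xi> \<le> 1" by (auto simp: \<xi>_def width_def)
  define h where "h = 2 / \<xi> * exp (- l\<^sup>2)"
  define \<eta> where "\<eta> = 2 / \<xi> * (\<theta> * exp (- l\<^sup>2))"
  have h: "0 < h" using \<xi> by (simp add: h_def)
  have \<eta>h: "\<eta> = \<theta> * h" by (simp add: \<eta>_def h_def)
  have \<eta>: "0 < \<eta>" "\<eta> \<le> h" unfolding \<eta>h using \<theta> h by auto
  have G: "60 * h \<le> \<xi>" "2 * h < \<xi>\<^sup>2" "4 * \<xi> + 2 * h < divisor l / 2" "\<xi> + 4 * h \<le> divisor l"
     "4 * h * (6 / \<xi>) ^ 4 \<le> exp (- (3 / 4 * l\<^sup>2))"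
    using l unfolding large_def h_def \<xi>_def by auto
  have Lk: "divisor l \<le> \<bar>2 * pi * int_inner n \<omega>\<bar>" if "n \<noteq> 0" "l1_norm n \<le> 2 * l1_norm k" for n
    by (rule large_divisor[OF l that(1)]) (use that k l1_norm_nonneg[of k] in linarith)
  have kk: "divisor l / 2 \<le> \<bar>pi * int_inner k \<omega>\<bar>"
    using Lk[OF k(1)] l1_norm_nonneg[of k] by (simp add: abs_mult)
  obtain v b \<alpha>' a' f' g' where *:
    "conjugate (\<lambda>t. \<alpha> + f t) (\<lambda>t. a + g t) (\<lambda>t. \<alpha>' + f' t) (\<lambda>t. a' + g' t) v b 0"
    "cond_le v b (2 / \<xi>)" "wiener \<omega> UNIV \<rho> \<eta> (\<lambda>t. of_real (f' t))" "wiener \<omega> UNIV \<rho> \<eta> g'"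
    "a' = 0 \<or> \<bar>\<alpha>'\<bar> \<le> 2 * \<xi> \<and> cmod a' \<le> 2 * \<xi> \<or> \<alpha>' = 0 \<and> \<xi>\<^sup>2 \<le> cmod a'"
    by (rule normal_form[OF \<rho> \<xi> a F[folded \<rho>_def], folded \<eta>_def]) (rule that)
  have b: "\<bar>f' t\<bar> \<le> \<eta>" "cmod (g' t) \<le> \<eta>" for t
    using wiener_bound[OF *(3) \<rho>, of t] wiener_bound[OF *(4) \<rho>, of t] by auto
  have rot': "has_rot (\<lambda>t. \<alpha>' + f' t) (\<lambda>t. a' + g' t) (pi * int_inner k \<omega>)"
    using rot_conjugate[OF *(1) rot] by simp
  have d0: "divisor l > 0" by (simp add: divisor_def)
  have a': "a' = 0"
    using *(5)
  proof (elim disjE)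
    assume s: "\<bar>\<alpha>'\<bar> \<le> 2 * \<xi> \<and> cmod a' \<le> 2 * \<xi>"
    have "\<bar>pi * int_inner k \<omega> - 0\<bar> \<le> (2 * \<xi> + \<eta>) + (2 * \<xi> + \<eta>)"
    proof (rule rot_approx[OF rot'])
      show "\<bar>\<alpha>' + f' t - 0\<bar> \<le> 2 * \<xi> + \<eta>" for t using s b(1)[of t] by linarith
      show "cmod (a' + g' t) \<le> 2 * \<xi> + \<eta>" for t
        using s b(2)[of t] norm_triangle_ineq[of a' "g' t"] by linarith
    qed
    thus ?thesis using kk G(3) \<eta> by linarith
  next
    assume s: "\<alpha>' = 0 \<and> \<xi>\<^sup>2 \<le> cmod a'"
    have "pi * int_inner k \<omega> = 0"
      by (rule rot_hyperbolic[OF rot', of \<eta> a']) (use s b \<eta> G(2) in auto)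
    thus ?thesis using kk d0 by simp
  qed
  have ra: "\<bar>pi * int_inner k \<omega> - \<alpha>'\<bar> \<le> \<eta> + \<eta>"
    by (rule rot_approx[OF rot']) (use b a' in auto)
  have E0: "exp (- (\<rho> * l1_norm k)) > 0" by simp
  \<comment> \<open>So many averaging steps that the removable rest is no larger than the discarded
    tails.\<close>
  obtain m where m: "(1/2) ^ m \<le> 2 * exp (- (\<rho> * l1_norm k))" by (rule pow_half_le[of "2 * exp (- (\<rho> * l1_norm k))"]) auto
  have c2: "conjugate (\<lambda>t. \<alpha> + f t) (\<lambda>t. a + g t) (\<lambda>t. \<alpha>' + f' t) g' v b 0" using *(1) a' by simp
  obtain \<alpha>'' f'' g'' v' b' where **: "conjugate (\<lambda>t. \<alpha>' + f' t) g' (\<lambda>t. \<alpha>'' + f'' t) g'' v' b' 0" "cond_le v' b' 3"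
    "wiener \<omega> UNIV 0 (2 * \<eta> * exp (- ((\<rho> - 0) * l1_norm k)) + (1/2) ^ m * \<eta>) (\<lambda>t. of_real (f'' t))"
    "wiener \<omega> UNIV 0 (2 * \<eta> * exp (- ((\<rho> - 0) * l1_norm k)) + (1/2) ^ m * \<eta>) g''"
  proof (rule average_nonresonant[OF order.refl \<rho> \<xi>(1) _ _ _ *(3,4), of "l1_norm k" \<alpha>' m])
    show "60 * \<eta> \<le> \<xi>" using G(1) \<eta> by linarith
    show "\<xi> \<le> \<bar>2 * pi * int_inner n \<omega>\<bar>" if "n \<noteq> 0" "l1_norm n < l1_norm k" for n
      using Lk[OF that(1)] that(2) l1_norm_nonneg[of k] G(4) h by linarith
    show "\<xi> \<le> \<bar>2 * pi * int_inner n \<omega> - 2 * \<alpha>'\<bar>" if "l1_norm n < l1_norm k" for n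
    proof -
      have "n - k \<noteq> 0" using that by auto
      moreover have "l1_norm (n - k) \<le> 2 * l1_norm k" using that l1_norm_diff[of n k] by linarith
      ultimately have "divisor l \<le> \<bar>2 * pi * int_inner (n - k) \<omega>\<bar>" by (rule Lk)
      also have "2 * pi * int_inner (n - k) \<omega> = (2 * pi * int_inner n \<omega> - 2 * \<alpha>') - 2 * (pi * int_inner k \<omega> - \<alpha>')"
        by (simp add: int_inner_diff algebra_simps)
      finally have 1: "divisor l \<le> \<bar>(2 * pi * int_inner n \<omega> - 2 * \<alpha>') - 2 * (pi * int_inner k \<omega> - \<alpha>')\<bar>" .
      have "divisor l \<le> \<bar>P - 2 * Q\<bar> \<Longrightarrow> \<bar>Q\<bar> \<le> \<eta> + \<eta> \<Longrightarrow> \<xi> \<le> \<bar>P\<bar>" for P Q using G(4) \<eta> by linarith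
      from this[OF 1 ra] show ?thesis .
    qed
  qed (rule that)
  define e where "e = 4 * \<eta> * exp (- (\<rho> * l1_norm k))"
  have "(1/2) ^ m * \<eta> \<le> 2 * exp (- (\<rho> * l1_norm k)) * \<eta>" by (rule mult_right_mono[OF m]) (use \<eta> in simp)
  hence le: "2 * \<eta> * exp (- ((\<rho> - 0) * l1_norm k)) + (1/2) ^ m * \<eta> \<le> e" by (simp add: e_def mult_ac)
  have eb: "\<bar>f'' t\<bar> \<le> e" "cmod (g'' t) \<le> e" for t
    using wiener_bound[OF **(3) order.refl, of t] wiener_bound[OF **(4) order.refl, of t] le by auto
  have e0: "0 < e" using \<eta> by (simp add: e_def)
  have G1: "1 \<le> 2 / \<xi> * 3" using \<xi> by (simp add: field_simps)
  have fin: "e * (2 / \<xi> * 3) ^ 4 \<le> \<theta> * exp (- (3 / 4 * l\<^sup>2)) * exp (- ((R - 1 / l) * l1_norm k))"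
  proof -
    have "e * (2 / \<xi> * 3) ^ 4 = \<theta> * (4 * h * (6 / \<xi>) ^ 4) * exp (- (\<rho> * l1_norm k))"
      by (simp add: e_def \<eta>h)
    also have "\<dots> \<le> \<theta> * exp (- (3 / 4 * l\<^sup>2)) * exp (- (\<rho> * l1_norm k))"
      using G(5) \<theta> by (intro mult_right_mono mult_left_mono) auto
    also have "\<dots> \<le> \<theta> * exp (- (3 / 4 * l\<^sup>2)) * exp (- ((R - 1 / l) * l1_norm k))"
    proof (intro mult_left_mono)
      have "R - 1 / l \<le> \<rho>" using L unfolding \<rho>_def by (simp add: field_simps)
      hence "(R - 1 / l) * l1_norm k \<le> \<rho> * l1_norm k" by (rule mult_right_mono[OF _ l1_norm_nonneg])
      thus "exp (- (\<rho> * l1_norm k)) \<le> exp (- ((R - 1 / l) * l1_norm k))" by simp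
    qed (use \<theta> in auto)
    finally show ?thesis .
  qed
  show ?thesis unfolding almost_reducible_def
    using conjugate_trans[OF c2 **(1)] cond_le_compose[OF *(2) **(2)] eb e0 G1 fin by blast
qed

text \<open>The hyperbolic outcome is impossible, since the rotation number is not 0. The range N =
  5 l^3 is dictated by the loss of width 1 / l: the tails beyond N have size exp (- 5 l^2), below
  the target exp (- (2 l)^2). A resonance inside this range is rotated away, which can enlarge the
  rest by exp ((R + 1) N). In that case all modes up to the cutoff are averaged instead, and their
  tail exp (- cutoff / l) beats this factor.\<close>

lemma kam_step:
  assumes l: "large l" and a: "cmod a \<le> 1" and \<theta>: "0 < \<theta>" "\<theta> \<le> 1"
    and k: "cutoff l < 2 * l1_norm k"
    and F: "wiener \<omega> UNIV (R + 2 / l) (\<theta> * exp (- l\<^sup>2)) (\<lambda>t. of_real (f t))"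
      "wiener \<omega> UNIV (R + 2 / l) (\<theta> * exp (- l\<^sup>2)) g"
    and rot: "has_rot (\<lambda>t. \<alpha> + f t) (\<lambda>t. a + g t) (pi * int_inner k \<omega>)" "pi * int_inner k \<omega> \<noteq> 0"
  obtains \<alpha>' a' f' g' n v b \<sigma> where
    "conjugate (\<lambda>t. \<alpha> + f t) (\<lambda>t. a + g t) (\<lambda>t. \<alpha>' + f' t) (\<lambda>t. a' + g' t) v b \<sigma>"
    "cond_le v b (6 / width l)" "cmod a' \<le> 1" "l1_norm n \<le> 5 * l ^ 3"
    "wiener \<omega> UNIV (R + 2 / (2 * l)) (\<theta> * exp (- (2 * l)\<^sup>2)) (\<lambda>t. of_real (f' t))"
    "wiener \<omega> UNIV (R + 2 / (2 * l)) (\<theta> * exp (- (2 * l)\<^sup>2)) g'"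
    "has_rot (\<lambda>t. \<alpha>' + f' t) (\<lambda>t. a' + g' t) (pi * int_inner (k - n) \<omega>)"
proof -
  note result = that
  have L: "l \<ge> 1" using l by (simp add: large_def)
  define \<rho> \<rho>' where "\<rho> = R + 2 / l" and "\<rho>' = R + 2 / (2 * l)"
  have \<rho>: "0 \<le> \<rho>" "0 \<le> \<rho>'" "\<rho>' \<le> \<rho>" "\<rho> - \<rho>' = 1 / l" "\<rho>' \<le> R + 1" using R L by (auto simp: \<rho>_def \<rho>'_def field_simps)
  define \<xi> where "\<xi> = width l"
  have \<xi>: "0 < \<xi>" "\<xi> \<le> 1" by (auto simp: \<xi>_def width_def)
  define h where "h = 2 / \<xi> * exp (- l\<^sup>2)"
  define \<eta> where "\<eta> = 2 / \<xi> * (\<theta> * exp (- l\<^sup>2))"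
  have h: "0 < h" using \<xi> by (simp add: h_def)
  have \<eta>h: "\<eta> = \<theta> * h" by (simp add: \<eta>_def h_def)
  have \<eta>: "0 < \<eta>" "\<eta> \<le> h" unfolding \<eta>h using \<theta> h by auto
  define N where "N = 5 * l ^ 3"
  have N: "0 < N" using L by (simp add: N_def)
  have G: "60 * h \<le> \<xi>" "2 * h < \<xi>\<^sup>2" "20 * (1 / divisor l * (2 * \<xi> + 3 * h)) \<le> 1" "\<xi> + 4 * h \<le> divisor l"
     "4 * N \<le> cutoff l" "4 * h * exp (- (5 * l\<^sup>2)) \<le> exp (- (4 * l\<^sup>2))"
     "exp ((R + 1) * N) * (4 * h * exp (- (1 / l * cutoff l))) \<le> exp (- (4 * l\<^sup>2))"
     "2 * \<xi> + 2 * h \<le> 1"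
    using l unfolding large_def h_def \<xi>_def N_def by auto
  have d0: "divisor l > 0" by (simp add: divisor_def)
  obtain v b \<alpha>' a' f' g' where *:
    "conjugate (\<lambda>t. \<alpha> + f t) (\<lambda>t. a + g t) (\<lambda>t. \<alpha>' + f' t) (\<lambda>t. a' + g' t) v b 0"
    "cond_le v b (2 / \<xi>)" "wiener \<omega> UNIV \<rho> \<eta> (\<lambda>t. of_real (f' t))" "wiener \<omega> UNIV \<rho> \<eta> g'"
    "a' = 0 \<or> \<bar>\<alpha>'\<bar> \<le> 2 * \<xi> \<and> cmod a' \<le> 2 * \<xi> \<or> \<alpha>' = 0 \<and> \<xi>\<^sup>2 \<le> cmod a'"
    by (rule normal_form[OF \<rho>(1) \<xi> a F[folded \<rho>_def], folded \<eta>_def]) (rule that)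
  have b: "\<bar>f' t\<bar> \<le> \<eta>" "cmod (g' t) \<le> \<eta>" for t
    using wiener_bound[OF *(3) \<rho>(1), of t] wiener_bound[OF *(4) \<rho>(1), of t] by auto
  have rot': "has_rot (\<lambda>t. \<alpha>' + f' t) (\<lambda>t. a' + g' t) (pi * int_inner k \<omega>)"
    using rot_conjugate[OF *(1) rot(1)] by simp
  have nothyp: "\<not> (\<alpha>' = 0 \<and> \<xi>\<^sup>2 \<le> cmod a')"
  proof
    assume s: "\<alpha>' = 0 \<and> \<xi>\<^sup>2 \<le> cmod a'"
    have "pi * int_inner k \<omega> = 0"
      by (rule rot_hyperbolic[OF rot', of \<eta> a']) (use s b \<eta> G(2) in auto)
    thus False using rot(2) by simp
  qed
  define e where "e = \<theta> * exp (- (2 * l)\<^sup>2)"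
  have e: "e = \<theta> * exp (- (4 * l\<^sup>2))" by (simp add: e_def power_mult_distrib)
  have compose: thesis if "conjugate (\<lambda>t. \<alpha>' + f' t) (\<lambda>t. a' + g' t) (\<lambda>t. \<alpha>'' + f'' t) (\<lambda>t. a'' + g'' t) v' b' \<beta>"
    "cond_le v' b' 3" "cmod a'' \<le> 1" "l1_norm n \<le> N" "\<beta> = pi * int_inner n \<omega>"
    "wiener \<omega> UNIV \<rho>' e (\<lambda>t. of_real (f'' t))" "wiener \<omega> UNIV \<rho>' e g''" for \<alpha>'' a'' f'' g'' n v' b' \<beta>
  proof -
    define V B where "V t = v t * v' t + b t * cnj (b' t)" and "B t = v t * b' t + b t * cnj (v' t)" for t
    have c1: "conjugate (\<lambda>t. \<alpha> + f t) (\<lambda>t. a + g t) (\<lambda>t. \<alpha>'' + f'' t) (\<lambda>t. a'' + g'' t) V B (0 + \<beta>)"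
      unfolding V_def B_def by (rule conjugate_trans[OF *(1) that(1)])
    have "cond_le V B (2 / \<xi> * 3)" unfolding V_def B_def by (rule cond_le_compose[OF *(2) that(2)])
    hence c2: "cond_le V B (6 / width l)" by (simp add: \<xi>_def)
    have "has_rot (\<lambda>t. \<alpha>'' + f'' t) (\<lambda>t. a'' + g'' t) (pi * int_inner k \<omega> - (0 + \<beta>))" by (rule rot_conjugate[OF c1 rot(1)])
    hence c3: "has_rot (\<lambda>t. \<alpha>'' + f'' t) (\<lambda>t. a'' + g'' t) (pi * int_inner (k - n) \<omega>)"
      by (simp add: that(5) int_inner_diff algebra_simps)
    show thesis by (rule result[OF c1 c2 that(3) that(4)[unfolded N_def]
          that(6)[unfolded e_def \<rho>'_def] that(7)[unfolded e_def \<rho>'_def] c3])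
  qed
  \<comment> \<open>Covers two cases: a genuine resonance n with a' = 0, and the near-zero outcome
    of the normal form, which is a resonance with n = 0 and a possibly nonzero a'.\<close>
  have resonant: thesis if n: "l1_norm n \<le> N" and s: "\<bar>\<alpha>' - pi * int_inner n \<omega>\<bar> \<le> 2 * \<xi>" "cmod a' \<le> 2 * \<xi>" "a' = 0 \<or> n = 0" for n
  proof -
    have M: "l1_norm n \<le> cutoff l" using n G(5) N by linarith
    obtain m where m: "(1/2) ^ m \<le> 2 * exp (- (1 / l * cutoff l))" by (rule pow_half_le[of "2 * exp (- (1 / l * cutoff l))"]) auto
    have "(1/2) ^ m * \<eta> \<le> 2 * exp (- (1 / l * cutoff l)) * \<eta>" by (rule mult_right_mono[OF m]) (use \<eta> in simp)
    hence le: "2 * \<eta> * exp (- ((\<rho> - \<rho>') * cutoff l)) + (1/2) ^ m * \<eta> \<le> 4 * \<eta> * exp (- (1 / l * cutoff l))"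
      unfolding \<rho>(4) by (simp add: mult_ac)
    have ex: "exp (\<rho>' * l1_norm n) \<le> exp ((R + 1) * N)"
    proof -
      have "\<rho>' * l1_norm n \<le> (R + 1) * N" using \<rho> n l1_norm_nonneg[of n] R by (intro mult_mono) auto
      thus ?thesis by simp
    qed
    have "exp (\<rho>' * l1_norm n) * (2 * \<eta> * exp (- ((\<rho> - \<rho>') * cutoff l)) + (1/2) ^ m * \<eta>)
       \<le> exp ((R + 1) * N) * (4 * \<eta> * exp (- (1 / l * cutoff l)))"
      by (rule mult_mono[OF ex le]) (use \<eta> in auto)
    also have "\<dots> = \<theta> * (exp ((R + 1) * N) * (4 * h * exp (- (1 / l * cutoff l))))" by (simp add: \<eta>h)
    also have "\<dots> \<le> e" unfolding e using G(7) \<theta> by (intro mult_left_mono) auto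
    finally have E: "exp (\<rho>' * l1_norm n) * (2 * \<eta> * exp (- ((\<rho> - \<rho>') * cutoff l)) + (1/2) ^ m * \<eta>) \<le> e" .
    have D: "1 / divisor l > 0" "20 * (1 / divisor l * (2 * \<xi> + 3 * \<eta>)) \<le> 1"
    proof -
      have "1 / divisor l * (2 * \<xi> + 3 * \<eta>) \<le> 1 / divisor l * (2 * \<xi> + 3 * h)"
        using d0 \<eta> by (intro mult_left_mono) auto
      thus "20 * (1 / divisor l * (2 * \<xi> + 3 * \<eta>)) \<le> 1" using G(3) by linarith
    qed (use d0 in simp)
    define \<beta> where "\<beta> = pi * int_inner n \<omega>"
    obtain \<alpha>'' a'' f'' g'' v' b' where **:
      "conjugate (\<lambda>t. \<beta> + (\<alpha>' - \<beta>) + f' t) (\<lambda>t. a' + g' t) (\<lambda>t. \<alpha>'' + f'' t) (\<lambda>t. a'' + g'' t) v' b' \<beta>"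
      "cond_le v' b' 3" "cmod a'' \<le> 2 * \<xi> + 2 * \<eta>"
      "wiener \<omega> UNIV \<rho>' e (\<lambda>t. of_real (f'' t))" "wiener \<omega> UNIV \<rho>' e g''"
    proof (rule average_resonant[OF \<rho>(2,3) D _ M \<beta>_def _ s(2,3) *(3,4) E])
      show "1 / (1 / divisor l) \<le> \<bar>2 * pi * int_inner n \<omega>\<bar>" if "n \<noteq> 0" "l1_norm n \<le> 2 * cutoff l" for n
        using large_divisor[OF l that] by simp
      show "\<bar>\<alpha>' - \<beta>\<bar> \<le> 2 * \<xi>" using s(1) by (simp add: \<beta>_def)
    qed (rule that)
    have c: "conjugate (\<lambda>t. \<alpha>' + f' t) (\<lambda>t. a' + g' t) (\<lambda>t. \<alpha>'' + f'' t) (\<lambda>t. a'' + g'' t) v' b' \<beta>"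
      using **(1) by simp
    have a1: "cmod a'' \<le> 1" using **(3) G(8) \<eta> by linarith
    show thesis by (rule compose[OF c **(2) a1 n \<beta>_def **(4,5)])
  qed
  show thesis
  proof (cases "a' = 0")
    case False
    hence "\<bar>\<alpha>'\<bar> \<le> 2 * \<xi>" "cmod a' \<le> 2 * \<xi>" using *(5) nothyp by auto
    thus thesis using N by (intro resonant[of 0]) auto
  next
    case a': True
    show thesis
    proof (cases "\<exists>n. l1_norm n < N \<and> \<bar>2 * pi * int_inner n \<omega> - 2 * \<alpha>'\<bar> < \<xi>")
      case True
      then obtain n where n: "l1_norm n < N" "\<bar>2 * pi * int_inner n \<omega> - 2 * \<alpha>'\<bar> < \<xi>" by blast
      have "\<bar>\<alpha>' - pi * int_inner n \<omega>\<bar> \<le> 2 * \<xi>" using n(2) \<xi> by linarith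
      thus thesis by (intro resonant[of n]) (use n a' \<xi> in auto)
    next
      case False
      obtain m where m: "(1/2) ^ m \<le> 2 * exp (- (5 * l\<^sup>2))" by (rule pow_half_le[of "2 * exp (- (5 * l\<^sup>2))"]) auto
      have "(1/2) ^ m * \<eta> \<le> 2 * exp (- (5 * l\<^sup>2)) * \<eta>" by (rule mult_right_mono[OF m]) (use \<eta> in simp)
      moreover have "(\<rho> - \<rho>') * N = 5 * l\<^sup>2" unfolding \<rho>(4) N_def using L by (simp add: power2_eq_square power3_eq_cube)
      ultimately have "2 * \<eta> * exp (- ((\<rho> - \<rho>') * N)) + (1/2) ^ m * \<eta> \<le> 4 * \<eta> * exp (- (5 * l\<^sup>2))" by (simp add: mult_ac)
      also have "\<dots> = \<theta> * (4 * h * exp (- (5 * l\<^sup>2)))" by (simp add: \<eta>h)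
      also have "\<dots> \<le> e" unfolding e using G(6) \<theta> by (intro mult_left_mono) auto
      finally have E: "2 * \<eta> * exp (- ((\<rho> - \<rho>') * N)) + (1/2) ^ m * \<eta> \<le> e" .
      obtain \<alpha>'' f'' g'' v' b' where **: "conjugate (\<lambda>t. \<alpha>' + f' t) g' (\<lambda>t. \<alpha>'' + f'' t) g'' v' b' 0" "cond_le v' b' 3"
        "wiener \<omega> UNIV \<rho>' (2 * \<eta> * exp (- ((\<rho> - \<rho>') * N)) + (1/2) ^ m * \<eta>) (\<lambda>t. of_real (f'' t))"
        "wiener \<omega> UNIV \<rho>' (2 * \<eta> * exp (- ((\<rho> - \<rho>') * N)) + (1/2) ^ m * \<eta>) g''"
      proof (rule average_nonresonant[OF \<rho>(2,3) \<xi>(1) _ _ _ *(3,4), of N \<alpha>' m])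
        show "60 * \<eta> \<le> \<xi>" using G(1) \<eta> by linarith
        show "\<xi> \<le> \<bar>2 * pi * int_inner n \<omega>\<bar>" if "n \<noteq> 0" "l1_norm n < N" for n
        proof -
          have "divisor l \<le> \<bar>2 * pi * int_inner n \<omega>\<bar>" by (rule large_divisor[OF l that(1)]) (use that G(5) N in linarith)
          thus ?thesis using G(4) h by linarith
        qed
        show "\<xi> \<le> \<bar>2 * pi * int_inner n \<omega> - 2 * \<alpha>'\<bar>" if "l1_norm n < N" for n
          using False that by force
      qed (rule that)
      have c: "conjugate (\<lambda>t. \<alpha>' + f' t) (\<lambda>t. a' + g' t) (\<lambda>t. \<alpha>'' + f'' t) (\<lambda>t. 0 + g'' t) v' b' 0"
        using **(1) a' by simp
      show thesis
        by (rule compose[OF c **(2), of 0]) (use N wiener_mono[OF **(3) order.refl E order.refl] wiener_mono[OF **(4) order.refl E order.refl] in auto)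
    qed
  qed
qed

text \<open>The scale doubles in each step and the label at most doubles, because the resonance
  removed is shorter than the label; for the same reason the label stays nonzero. The condition 2^i
  |k| \<le> cutoff (2^i l) / 2 is thus inherited with i lowered by one, and for i = 0 it is the
  hypothesis of \<open>kam_final\<close>. The induction runs over the number of steps still allowed,
  with scale and system arbitrary.\<close>

lemma kam:
  assumes l0: "\<And>l. l \<ge> l0 \<Longrightarrow> large l" and l: "l \<ge> l0" "l \<ge> 1"
    and a: "cmod a \<le> 1" and \<theta>: "0 < \<theta>" "\<theta> \<le> 1"
    and k: "k \<noteq> 0"
    and F: "wiener \<omega> UNIV (R + 2 / l) (\<theta> * exp (- l\<^sup>2)) (\<lambda>t. of_real (f t))"
      "wiener \<omega> UNIV (R + 2 / l) (\<theta> * exp (- l\<^sup>2)) g"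
    and rot: "has_rot (\<lambda>t. \<alpha> + f t) (\<lambda>t. a + g t) (pi * int_inner k \<omega>)"
  shows "almost_reducible l (\<lambda>t. \<alpha> + f t) (\<lambda>t. a + g t) k \<theta>"
proof -
  have main: "almost_reducible l (\<lambda>t. \<alpha> + f t) (\<lambda>t. a + g t) k \<theta>"
    if "l \<ge> l0" "l \<ge> 1" "cmod a \<le> 1" "k \<noteq> 0" "2 ^ i * l1_norm k \<le> cutoff (2 ^ i * l) / 2"
      "wiener \<omega> UNIV (R + 2 / l) (\<theta> * exp (- l\<^sup>2)) (\<lambda>t. of_real (f t))"
      "wiener \<omega> UNIV (R + 2 / l) (\<theta> * exp (- l\<^sup>2)) g"
      "has_rot (\<lambda>t. \<alpha> + f t) (\<lambda>t. a + g t) (pi * int_inner k \<omega>)" for i l a k f g \<alpha>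
    using that
  proof (induction i arbitrary: l a k f g \<alpha>)
    case 0
    thus ?case by (intro kam_final l0 \<theta>) auto
  next
    case (Suc i)
    have lg: "large l" by (rule l0[OF Suc.prems(1)])
    show ?case
    proof (cases "2 * l1_norm k \<le> cutoff l")
      case True
      thus ?thesis by (intro kam_final lg \<theta> Suc.prems) auto
    next
      case False
      have k0: "pi * int_inner k \<omega> \<noteq> 0"
      proof -
        have "0 < \<gamma> * l1_norm k powr (- \<tau>)" using \<gamma> l1_norm_ge_1[OF Suc.prems(4)] by simp
        also have "\<dots> \<le> \<bar>int_inner k \<omega>\<bar>" by (rule dioph[OF Suc.prems(4)])
        finally show ?thesis by simp
      qed
      obtain \<alpha>' a' f' g' n v b \<sigma> where *:
        "conjugate (\<lambda>t. \<alpha> + f t) (\<lambda>t. a + g t) (\<lambda>t. \<alpha>' + f' t) (\<lambda>t. a' + g' t) v b \<sigma>"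
        "cond_le v b (6 / width l)" "cmod a' \<le> 1" "l1_norm n \<le> 5 * l ^ 3"
        "wiener \<omega> UNIV (R + 2 / (2 * l)) (\<theta> * exp (- (2 * l)\<^sup>2)) (\<lambda>t. of_real (f' t))"
        "wiener \<omega> UNIV (R + 2 / (2 * l)) (\<theta> * exp (- (2 * l)\<^sup>2)) g'"
        "has_rot (\<lambda>t. \<alpha>' + f' t) (\<lambda>t. a' + g' t) (pi * int_inner (k - n) \<omega>)"
        by (rule kam_step[OF lg Suc.prems(3) \<theta> _ Suc.prems(6,7,8) k0]) (use False in simp, rule that)
      have G: "20 * l ^ 3 \<le> cutoff l" "20 * R * l ^ 4 \<le> cutoff l" "(6 / width l) ^ 4 * exp (- (3 * l\<^sup>2)) \<le> exp (- (3 / 4 * l\<^sup>2))"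
        using lg by (auto simp: large_def)
      have l1: "l \<ge> 1" by (rule Suc.prems(2))
      have "0 < l ^ 3" using l1 by simp
      have n1: "l1_norm n < l1_norm k" "l1_norm n \<le> l1_norm k" using *(4) G(1) False \<open>0 < l ^ 3\<close> by linarith+
      have kn: "k - n \<noteq> 0" using n1 by auto
      have tri: "l1_norm (k - n) \<le> 2 * l1_norm k" "l1_norm k - 5 * l ^ 3 \<le> l1_norm (k - n)"
        using l1_norm_diff[of k n] l1_norm_triangle[of "k - n" n] n1 *(4) by simp_all
      have "2 ^ i * l1_norm (k - n) \<le> 2 ^ i * (2 * l1_norm k)" using tri by (intro mult_left_mono) auto
      also have "\<dots> \<le> cutoff (2 ^ i * (2 * l)) / 2" using Suc.prems(5) by (simp add: mult_ac)
      finally have ind: "almost_reducible (2 * l) (\<lambda>t. \<alpha>' + f' t) (\<lambda>t. a' + g' t) (k - n) \<theta>"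
        by (intro Suc.IH *(3,5,6,7) kn) (use Suc.prems(1) l1 in auto)
      then obtain v' b' \<sigma>' \<alpha>'' e \<Gamma> f'' g'' where **: "conjugate (\<lambda>t. \<alpha>' + f' t) (\<lambda>t. a' + g' t) (\<lambda>t. \<alpha>'' + f'' t) g'' v' b' \<sigma>'"
        "\<And>t. \<bar>f'' t\<bar> \<le> e" "\<And>t. cmod (g'' t) \<le> e" "0 < e" "1 \<le> \<Gamma>" "cond_le v' b' \<Gamma>"
        "e * \<Gamma> ^ 4 \<le> \<theta> * exp (- (3 / 4 * (2 * l)\<^sup>2)) * exp (- ((R - 1 / (2 * l)) * l1_norm (k - n)))"
        unfolding almost_reducible_def by blast
      have w: "0 < width l" "width l \<le> 1" by (auto simp: width_def)
      have G6: "1 \<le> 6 / width l * \<Gamma>"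
        using mult_mono[of 1 "6 / width l" 1 \<Gamma>] w **(5) by simp
      \<comment> \<open>The label may have become shorter by 5 l^3. As |k| exceeds half the cutoff,
        R 5 l^3 is at most |k| / (2 l), which is covered by the drop of the rate from R - 1 / (2 l)
        to R - 1 / l. If the rate at the next scale is negative, the opposite bound |k - n| \<le> 2
        |k| is the relevant one.\<close>
      have ex: "exp (- ((R - 1 / (2 * l)) * l1_norm (k - n))) \<le> exp (- ((R - 1 / l) * l1_norm k))"
      proof (cases "R - 1 / (2 * l) \<ge> 0")
        case True
        have "20 * R * l ^ 4 < 2 * l1_norm k" using G(2) False by linarith
        hence "R * (5 * l ^ 3) * (2 * l) \<le> l1_norm k" using l1_norm_nonneg[of k] by (simp add: power_numeral_reduce mult_ac)
        hence Rk: "R * (5 * l ^ 3) \<le> l1_norm k / (2 * l)" using l1 by (simp add: pos_le_divide_eq)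
        define w where "w = 1 / (2 * l)"
        have w: "1 / l = 2 * w" "l1_norm k / (2 * l) = l1_norm k * w" "0 \<le> w * (5 * l ^ 3)" using l1 by (auto simp: w_def)
        have "(R - 1 / l) * l1_norm k \<le> (R - 1 / (2 * l)) * (l1_norm k - 5 * l ^ 3)"
          using Rk w(3) unfolding w(1,2) w_def[symmetric] by (simp add: algebra_simps)
        also have "\<dots> \<le> (R - 1 / (2 * l)) * l1_norm (k - n)" by (rule mult_left_mono[OF tri(2) True])
        finally show ?thesis by simp
      next
        case neg: False
        have "1 / (2 * l) * 2 = 1 / l" using l1 by simp
        hence "(R - 1 / l) \<le> 2 * (R - 1 / (2 * l))" using R by simp
        hence "(R - 1 / l) * l1_norm k \<le> 2 * (R - 1 / (2 * l)) * l1_norm k" by (rule mult_right_mono[OF _ l1_norm_nonneg])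
        also have "\<dots> = (R - 1 / (2 * l)) * (2 * l1_norm k)" by simp
        also have "\<dots> \<le> (R - 1 / (2 * l)) * l1_norm (k - n)" by (rule mult_left_mono_neg[OF tri(1)]) (use neg in simp)
        finally show ?thesis by simp
      qed
      have fin: "e * (6 / width l * \<Gamma>) ^ 4 \<le> \<theta> * exp (- (3 / 4 * l\<^sup>2)) * exp (- ((R - 1 / l) * l1_norm k))"
      proof -
        have "e * (6 / width l * \<Gamma>) ^ 4 = (6 / width l) ^ 4 * (e * \<Gamma> ^ 4)" by (simp only: power_mult_distrib mult_ac)
        also have "\<dots> \<le> (6 / width l) ^ 4 * (\<theta> * exp (- (3 / 4 * (2 * l)\<^sup>2)) * exp (- ((R - 1 / (2 * l)) * l1_norm (k - n))))"
          by (rule mult_left_mono[OF **(7)]) simp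
        also have "\<dots> = \<theta> * ((6 / width l) ^ 4 * exp (- (3 * l\<^sup>2))) * exp (- ((R - 1 / (2 * l)) * l1_norm (k - n)))"
          by (simp add: power_mult_distrib)
        also have "\<dots> \<le> \<theta> * exp (- (3 / 4 * l\<^sup>2)) * exp (- ((R - 1 / l) * l1_norm k))"
          using G(3) ex \<theta> by (intro mult_mono mult_left_mono) auto
        finally show ?thesis .
      qed
      show ?thesis unfolding almost_reducible_def
        using conjugate_trans[OF *(1) **(1)] cond_le_compose[OF *(2) **(6)] **(2,3,4) G6 fin by blast
    qed
  qed
  \<comment> \<open>The cutoff grows like the exponential of the squared scale, so doubling scales
    overtake labels that at most double.\<close>
  have "\<forall>\<^sub>F x in at_top. x * l1_norm k \<le> cutoff (x * l) / 2"
  proof -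
    define c where "c = l\<^sup>2 / (80 * \<tau>)"
    have c: "c > 0" using \<tau> l by (simp add: c_def)
    have k0: "l1_norm k > 0" using l1_norm_ge_1[OF k] by simp
    have "\<forall>\<^sub>F x in at_top. x * l1_norm k \<le> exp (c * x\<^sup>2) / 2" using c k0 by real_asymp
    thus ?thesis by eventually_elim (simp add: cutoff_def c_def power_mult_distrib mult_ac)
  qed
  moreover have "filterlim (\<lambda>i. (2::real) ^ i) at_top sequentially" by real_asymp
  ultimately have "\<forall>\<^sub>F i in sequentially. 2 ^ i * l1_norm k \<le> cutoff (2 ^ i * l) / 2"
    unfolding filterlim_iff by blast
  then obtain i where "2 ^ i * l1_norm k \<le> cutoff (2 ^ i * l) / 2" by (auto simp: eventually_sequentially)
  from main[OF l a k this F rot] show ?thesis .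
qed

end

section \<open>Dependence of the angle on the energy\<close>

text \<open>\<open>w\<close> is the unit vector of the new angle mapped back to the original
  coordinates. Up to a real factor it must follow the original system at the raised energy, which
  adds - \<mu> Im w in the real direction. The identity computes that factor.\<close>

lemma growth_identity:
  fixes v b g g' e :: complex and f f' p n \<kappa> \<mu> D :: real
  assumes e: "cmod e = 1" and D: "D = (cmod v)\<^sup>2 - (cmod b)\<^sup>2" "D \<noteq> 0"
    and w: "w = v * e + b * cnj e"
    and n: "n = \<mu> * (Im w)\<^sup>2 / D" and p: "p = f' + Im (g' * (cnj e * cnj e)) + n"
    and v': "v' = \<i> * of_real f * v + g * cnj b - \<i> * of_real f' * v - b * cnj g' + of_real \<kappa> * v"
    and b': "b' = \<i> * of_real f * b + g * cnj v - v * g' + \<i> * of_real f' * b + of_real \<kappa> * b"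
    and \<nu>: "\<nu> = - \<mu> * Im w * Re ((cnj v - b) * cnj e) / D"
  shows "v' * e + b' * cnj e + \<i> * of_real p * (v * e - b * cnj e) =
     \<i> * of_real f * w + g * cnj w - of_real (\<mu> * Im w) + of_real (\<kappa> - Re (g' * (cnj e * cnj e)) - \<nu>) * w"
proof -
  have ee: "e * cnj e = 1" using e by (simp add: complex_norm_square[symmetric])
  define G where "G = g' * (cnj e * cnj e)"
  define X where "X = v * e"
  define Y where "Y = b * cnj e"
  \<comment> \<open>c e / D is the preimage of 1, the direction of the energy term, under the map
    (v, b); \<open>cXY\<close> states this. Relative to e, its imaginary part turns the angle and
    produces \<open>n\<close>, its real part only rescales and produces \<nu>.\<close>
  define c where "c = (cnj v - b) * cnj e"
  define m where "m = - (\<mu> * Im w)"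
  have g'e: "g' * cnj e = G * e" "cnj g' * e = cnj G * cnj e"
  proof -
    have "G * e = g' * cnj e * (e * cnj e)" by (simp add: G_def mult_ac)
    thus "g' * cnj e = G * e" by (simp add: ee)
    from arg_cong[OF this, of cnj] show "cnj g' * e = cnj G * cnj e" by simp
  qed
  have wXY: "w = X + Y" by (simp add: w X_def Y_def)
  have Imc: "Im c = - Im w" by (simp add: c_def w algebra_simps)
  have Dc: "of_real D = v * cnj v - b * cnj b" unfolding D(1) by (simp only: of_real_diff complex_norm_square)
  have cXY: "c * X + cnj c * Y = of_real D"
  proof -
    have "c * X + cnj c * Y = (v * cnj v - b * v) * (e * cnj e) + (v * b - b * cnj b) * (e * cnj e)"
      by (simp add: c_def X_def Y_def algebra_simps)
    thus ?thesis unfolding ee Dc by (simp add: algebra_simps)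
  qed
  have "\<i> * of_real (Im c) * (X - Y) + of_real (Re c) * (X + Y) = c * X + cnj c * Y"
    by (subst (3 4) complex_eq) (simp add: algebra_simps)
  hence "of_real m * (\<i> * of_real (Im c) * (X - Y) + of_real (Re c) * (X + Y)) / of_real D = of_real m * of_real D / of_real D"
    unfolding cXY by simp
  also have "\<dots> = of_real m" using D(2) by simp
  finally have "of_real m * (\<i> * of_real (Im c) * (X - Y) + of_real (Re c) * (X + Y)) / of_real D = of_real m" .
  moreover have "n = m * Im c / D" by (simp add: n m_def Imc power2_eq_square)
  moreover have "\<nu> = m * Re c / D" by (simp add: \<nu> m_def c_def)
  ultimately have key: "\<i> * of_real n * (X - Y) + of_real \<nu> * (X + Y) = of_real m"
  proof -
    assume *: "of_real m * (\<i> * of_real (Im c) * (X - Y) + of_real (Re c) * (X + Y)) / of_real D = of_real m"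
      "n = m * Im c / D" "\<nu> = m * Re c / D"
    have "\<i> * of_real n * (X - Y) + of_real \<nu> * (X + Y)
       = of_real m * (\<i> * of_real (Im c) * (X - Y) + of_real (Re c) * (X + Y)) / of_real D"
      unfolding *(2,3) using D(2) by (simp add: field_simps)
    thus ?thesis unfolding *(1) .
  qed
  have vb: "v' * e + b' * cnj e = \<i> * of_real f * w + g * cnj w - \<i> * of_real f' * (X - Y) - G * X - cnj G * Y + of_real \<kappa> * w"
  proof -
    have "v' * e + b' * cnj e = \<i> * of_real f * w + g * (cnj b * e + cnj v * cnj e) - \<i> * of_real f' * (X - Y)
        - b * (cnj g' * e) - v * (g' * cnj e) + of_real \<kappa> * w"
      unfolding v' b' w X_def Y_def by (simp add: algebra_simps)
    also have "cnj b * e + cnj v * cnj e = cnj w" by (simp add: w)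
    finally show ?thesis unfolding g'e X_def Y_def by (simp add: algebra_simps)
  qed
  have GG: "\<i> * of_real (Im G) * (X - Y) - G * X - cnj G * Y = - of_real (Re G) * (X + Y)"
    by (subst (2 3) complex_eq) (simp add: algebra_simps)
  have "v' * e + b' * cnj e + \<i> * of_real p * (X - Y) = \<i> * of_real f * w + g * cnj w + of_real \<kappa> * w
      + (\<i> * of_real (Im G) * (X - Y) - G * X - cnj G * Y) + \<i> * of_real n * (X - Y)"
    unfolding vb p G_def[symmetric] by (simp add: algebra_simps)
  also have "\<dots> = \<i> * of_real f * w + g * cnj w + of_real \<kappa> * w - of_real (Re G) * (X + Y) + (of_real m - of_real \<nu> * (X + Y))"
    unfolding GG key[symmetric] by (simp add: algebra_simps)
  finally show ?thesis unfolding G_def[symmetric] wXY[symmetric] X_def[symmetric] Y_def[symmetric] m_def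
    by (simp add: algebra_simps)
qed

text \<open>\<open>schr_f\<close> and \<open>schr_g\<close> encode \<open>- y'' + q y = E y\<close> through \<open>z = y' + i k y\<close>.\<close>

definition schr_f :: "(real \<Rightarrow> real) \<Rightarrow> real \<Rightarrow> real \<Rightarrow> real \<Rightarrow> real" where
  "schr_f q k E t = (k\<^sup>2 + E - q t) / (2 * k)"

definition schr_g :: "(real \<Rightarrow> real) \<Rightarrow> real \<Rightarrow> real \<Rightarrow> real \<Rightarrow> complex" where
  "schr_g q k E t = \<i> * of_real ((k\<^sup>2 - E + q t) / (2 * k))"

lemma schr_angle:
  assumes "k \<noteq> 0"
  shows "schr_f q k E t + Im (schr_g q k E t * cis (- 2 * x)) = k * (cos x)\<^sup>2 + (E - q t) / k * (sin x)\<^sup>2"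
proof -
  have c: "cos (2 * x) = (cos x)\<^sup>2 - (sin x)\<^sup>2" "1 = (cos x)\<^sup>2 + (sin x)\<^sup>2" by (simp_all add: cos_double)
  have "schr_f q k E t + Im (schr_g q k E t * cis (- 2 * x)) =
      (k\<^sup>2 * (1 + cos (2 * x)) + (E - q t) * (1 - cos (2 * x))) / (2 * k)"
    using assms by (simp add: schr_f_def schr_g_def add_divide_distrib diff_divide_distrib algebra_simps)
  also have "1 + cos (2 * x) = 2 * (cos x)\<^sup>2" "1 - cos (2 * x) = 2 * (sin x)\<^sup>2" using c by linarith+
  hence "(k\<^sup>2 * (1 + cos (2 * x)) + (E - q t) * (1 - cos (2 * x))) / (2 * k) = k * (cos x)\<^sup>2 + (E - q t) / k * (sin x)\<^sup>2"
    using assms by (simp only:) (simp add: field_simps power2_eq_square)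
  finally show ?thesis .
qed

text \<open>In the angle equation the energy enters through (E / k) sin^2, so raising it by k \<mu>
  adds exactly the \<mu> term of \<open>phase\<close> for the identity map u = 1, c = 0. From here
  on \<open>conjugate\<close> transports the effect of the energy.\<close>

lemma schr_energy_shift:
  assumes "k \<noteq> 0"
  shows "phase (schr_f q k (E + k * \<mu>)) (schr_g q k (E + k * \<mu>)) 0 (\<lambda>_. 1) (\<lambda>_. 0) \<phi> \<longleftrightarrow>
         phase (schr_f q k E) (schr_g q k E) \<mu> (\<lambda>_. 1) (\<lambda>_. 0) \<phi>"
proof -
  have "k * (cos x)\<^sup>2 + (E + k * \<mu> - q t) / k * (sin x)\<^sup>2 =
        k * (cos x)\<^sup>2 + (E - q t) / k * (sin x)\<^sup>2 + \<mu> * (sin x)\<^sup>2" for x t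
    using assms by (simp add: field_simps)
  note e = this
  show ?thesis unfolding phase_def schr_angle[OF assms] e by (simp add: add.assoc)
qed

lemma schr_system:
  assumes "k \<noteq> 0"
  shows "\<i> * of_real (schr_f q k E t) * w + schr_g q k E t * cnj w =
    Complex ((q t - E) / k * Im w) (k * Re w)"
  using assms by (simp add: complex_eq_iff schr_f_def schr_g_def field_simps power2_eq_square)

text \<open>The function \<open>B = Im w Re w / D\<close> is bounded, and its derivative converts \<open>(Im w)\<^sup>2\<close> into
  \<open>\<bar>w\<bar>\<^sup>2\<close>; hence raising the energy speeds the angle up in the mean although the driving term
  vanishes whenever \<open>Im w = 0\<close>.\<close>

lemma rotation_growth:
  assumes conj: "conjugate (schr_f q k E) (schr_g q k E) (\<lambda>t. \<alpha> + f' t) g' v b \<sigma>"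
    and small: "\<And>t. \<bar>f' t\<bar> \<le> e" "\<And>t. cmod (g' t) \<le> e" "0 < e"
    and cond: "cond_le v b \<Gamma>" "1 \<le> \<Gamma>" and k: "0 < k" "82 * (e * \<Gamma> ^ 4) \<le> k"
    and q: "\<And>t. E - q t \<le> 2 * k\<^sup>2"
    and rot: "has_rot (schr_f q k E) (schr_g q k E) r"
      "has_rot (schr_f q k (E + k * (40 * e * \<Gamma>))) (schr_g q k (E + k * (40 * e * \<Gamma>))) r'"
  shows "r < r'"
proof -
  \<comment> \<open>The constant 40 makes the mean gain \<mu> / (8 \<Gamma>) equal to 5 e. Of this,
    2 e are lost to f' and g' at the raised energy and 2 e in locating \<open>r\<close> at the lower
    one; e remains.\<close>
  define \<mu> where "\<mu> = 40 * e * \<Gamma>"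
  have k0: "k \<noteq> 0" using k by simp
  have \<Gamma>p: "\<Gamma> ^ i \<ge> 1" for i using cond(2) by (rule one_le_power)
  have pos: "0 < \<mu>" "0 < \<Gamma>" using small(3) cond(2) by (auto simp: \<mu>_def)
  have \<mu>k: "\<mu> \<le> k"
  proof -
    have "e * (\<Gamma> * 1) \<le> e * (\<Gamma> * \<Gamma> ^ 3)" using small(3) pos \<Gamma>p[of 3] by (intro mult_left_mono) auto
    also have "\<Gamma> * \<Gamma> ^ 3 = \<Gamma> ^ 4" by (simp add: power_numeral_reduce)
    finally have "e * \<Gamma> \<le> e * \<Gamma> ^ 4" by simp
    moreover have "0 \<le> e * \<Gamma> ^ 4" using small(3) pos by simp
    ultimately show ?thesis using k(2) by (simp add: \<mu>_def)
  qed
  have "\<bar>(r - \<sigma>) - \<alpha>\<bar> \<le> e + e"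
    by (rule rot_approx[OF rot_conjugate[OF conj rot(1)]]) (use small in auto)
  hence r: "r - \<sigma> \<le> \<alpha> + 2 * e" by linarith
  from rot(2) obtain \<phi> where \<phi>: "phase (schr_f q k E) (schr_g q k E) \<mu> (\<lambda>_. 1) (\<lambda>_. 0) \<phi>" "((\<lambda>t. \<phi> t / t) \<longlongrightarrow> r') at_top"
    unfolding has_rot_def \<mu>_def[symmetric] schr_energy_shift[OF k0] by blast
  from conj \<phi>(1) obtain \<psi> C where "phase (\<lambda>t. \<alpha> + f' t) g' \<mu> (\<lambda>t. 1 * v t + 0 * cnj (b t)) (\<lambda>t. 1 * b t + 0 * cnj (v t)) \<psi>"
    and C: "\<And>t. t \<ge> 0 \<Longrightarrow> \<bar>\<phi> t - \<psi> t - \<sigma> * t\<bar> \<le> C"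
    unfolding conjugate_def by blast
  hence \<psi>: "phase (\<lambda>t. \<alpha> + f' t) g' \<mu> v b \<psi>" by simp
  from conj obtain \<kappa> where v': "\<And>t. (v has_vector_derivative (\<i> * of_real (schr_f q k E t) * v t + schr_g q k E t * cnj (b t)
            - \<i> * of_real (\<alpha> + f' t) * v t - b t * cnj (g' t) + of_real (\<kappa> t) * v t)) (at t)"
    and b': "\<And>t. (b has_vector_derivative (\<i> * of_real (schr_f q k E t) * b t + schr_g q k E t * cnj (v t)
            - v t * g' t + \<i> * of_real (\<alpha> + f' t) * b t + of_real (\<kappa> t) * b t)) (at t)"
    unfolding conjugate_def by blast
  define w where "w t = v t * cis (\<psi> t) + b t * cis (- \<psi> t)" for t
  define D where "D t = (cmod (v t))\<^sup>2 - (cmod (b t))\<^sup>2" for t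
  have D: "D t > 0" for t using cond(1) unfolding cond_le_def D_def by (simp add: power_strict_mono)
  have upper: "(cmod (v t) + cmod (b t))\<^sup>2 \<le> \<Gamma> * D t" "D t \<le> \<Gamma> * (cmod (v t) - cmod (b t))\<^sup>2" for t
  proof -
    have c: "cmod (b t) < cmod (v t)" "cmod (v t) + cmod (b t) \<le> \<Gamma> * (cmod (v t) - cmod (b t))"
      using cond(1) unfolding cond_le_def by auto
    have D2: "D t = (cmod (v t) - cmod (b t)) * (cmod (v t) + cmod (b t))" by (simp add: D_def power2_eq_square algebra_simps)
    have "(cmod (v t) + cmod (b t)) * (cmod (v t) + cmod (b t)) \<le> \<Gamma> * (cmod (v t) - cmod (b t)) * (cmod (v t) + cmod (b t))"
      by (rule mult_right_mono[OF c(2)]) simp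
    thus "(cmod (v t) + cmod (b t))\<^sup>2 \<le> \<Gamma> * D t" unfolding D2 by (simp add: power2_eq_square mult.assoc)
    have "(cmod (v t) - cmod (b t)) * (cmod (v t) + cmod (b t)) \<le> (cmod (v t) - cmod (b t)) * (\<Gamma> * (cmod (v t) - cmod (b t)))"
      by (rule mult_left_mono[OF c(2)]) (use c in simp)
    thus "D t \<le> \<Gamma> * (cmod (v t) - cmod (b t))\<^sup>2" unfolding D2 by (simp add: power2_eq_square mult_ac)
  qed
  have wup: "cmod (w t) \<le> cmod (v t) + cmod (b t)" "cmod (v t) - cmod (b t) \<le> cmod (w t)" for t
  proof -
    show "cmod (w t) \<le> cmod (v t) + cmod (b t)" unfolding w_def
      by (rule order.trans[OF norm_triangle_ineq]) (simp add: norm_mult)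
    have "cmod (v t * cis (\<psi> t)) - cmod (b t * cis (- \<psi> t)) \<le> cmod (w t)" unfolding w_def by (rule norm_diff_ineq)
    thus "cmod (v t) - cmod (b t) \<le> cmod (w t)" by (simp add: norm_mult)
  qed
  have w\<Gamma>: "(cmod (w t))\<^sup>2 \<le> \<Gamma> * D t" "D t \<le> \<Gamma> * (cmod (w t))\<^sup>2" for t
  proof -
    have "(cmod (w t))\<^sup>2 \<le> (cmod (v t) + cmod (b t))\<^sup>2" using wup by (intro power_mono) auto
    thus "(cmod (w t))\<^sup>2 \<le> \<Gamma> * D t" using upper(1)[of t] by linarith
    have "cmod (b t) < cmod (v t)" using cond(1) unfolding cond_le_def by auto
    hence "(cmod (v t) - cmod (b t))\<^sup>2 \<le> (cmod (w t))\<^sup>2" using wup(2)[of t] by (intro power_mono) auto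
    hence "\<Gamma> * (cmod (v t) - cmod (b t))\<^sup>2 \<le> \<Gamma> * (cmod (w t))\<^sup>2" using pos by simp
    thus "D t \<le> \<Gamma> * (cmod (w t))\<^sup>2" using upper(2)[of t] by linarith
  qed
  define n where "n t = \<mu> * (Im (w t))\<^sup>2 / D t" for t
  define p where "p t = \<alpha> + f' t + Im (g' t * cis (- 2 * \<psi> t)) + n t" for t
  have \<psi>': "(\<psi> has_real_derivative p t) (at t within {0..})" if "t \<ge> 0" for t
    using \<psi> that unfolding phase_def p_def n_def w_def D_def by blast
  define \<nu> where "\<nu> t = - \<mu> * Im (w t) * Re ((cnj (v t) - b t) * cis (- \<psi> t)) / D t" for t
  define \<rho> where "\<rho> t = Re (g' t * cis (- 2 * \<psi> t)) + \<nu> t" for t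
  define B where "B t = Im (w t) * Re (w t) / D t" for t
  \<comment> \<open>The growth \<kappa> cancels in B, because it enters w once and D, which is
    quadratic, twice. The remaining real rescaling \<rho> of w appears as - 2 \<rho> B.\<close>
  define B' where "B' t = k * (Re (w t))\<^sup>2 / D t + ((q t - E) / k - \<mu>) * (Im (w t))\<^sup>2 / D t - 2 * \<rho> t * B t" for t
  have Bder: "(B has_real_derivative B' t) (at t within {0..})" if t: "t \<ge> 0" for t
  proof -
    define F where "F = \<i> * of_real (schr_f q k E t) * w t + schr_g q k E t * cnj (w t)"
    define v1 where "v1 = \<i> * of_real (schr_f q k E t) * v t + schr_g q k E t * cnj (b t)
            - \<i> * of_real (\<alpha> + f' t) * v t - b t * cnj (g' t) + of_real (\<kappa> t) * v t"
    define b1 where "b1 = \<i> * of_real (schr_f q k E t) * b t + schr_g q k E t * cnj (v t)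
            - v t * g' t + \<i> * of_real (\<alpha> + f' t) * b t + of_real (\<kappa> t) * b t"
    define x where "x = cis (\<psi> t)"
    have cx: "cis (- \<psi> t) = cnj x" "cis (- 2 * \<psi> t) = cnj x * cnj x" "cmod x = 1"
      by (simp_all add: x_def cis_cnj cis_mult)
    have "((\<lambda>z. exp (\<i> * z)) has_field_derivative (\<i> * exp (\<i> * of_real y))) (at (of_real y))" for y
      by (auto intro!: derivative_eq_intros)
    from has_vector_derivative_real_field[OF this]
    have cis': "(cis has_vector_derivative (\<i> * cis y)) (at y within A)" for y A
      by (simp add: cis_conv_exp[abs_def])
    have vd: "(v has_vector_derivative v1) (at t within {0..})" "(b has_vector_derivative b1) (at t within {0..})"
      using v'[of t] b'[of t] unfolding v1_def b1_def by (auto intro: has_vector_derivative_at_within)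
    have p1: "(\<psi> has_vector_derivative p t) (at t within {0..})"
      using \<psi>'[OF t] by (simp add: has_real_derivative_iff_has_vector_derivative)
    have p2: "((\<lambda>t. - \<psi> t) has_vector_derivative - p t) (at t within {0..})"
      using has_vector_derivative_minus[OF p1] .
    have x': "((\<lambda>t. cis (\<psi> t)) has_vector_derivative (\<i> * of_real (p t) * x)) (at t within {0..})"
      using vector_diff_chain_within[OF p1 cis'] by (simp add: o_def x_def scaleR_conv_of_real mult_ac)
    have y': "((\<lambda>t. cis (- \<psi> t)) has_vector_derivative (- \<i> * of_real (p t) * cnj x)) (at t within {0..})"
      using vector_diff_chain_within[OF p2 cis'] by (simp add: o_def cx scaleR_conv_of_real mult_ac)
    have "(w has_vector_derivative (v t * (\<i> * of_real (p t) * x) + v1 * x + (b t * (- \<i> * of_real (p t) * cnj x) + b1 * cnj x)))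
        (at t within {0..})"
      unfolding w_def[abs_def] x_def[symmetric]
      using has_vector_derivative_add[OF has_vector_derivative_mult[OF vd(1) x'] has_vector_derivative_mult[OF vd(2) y']]
      by (simp add: x_def[symmetric] cx)
    moreover have wx: "w t = v t * x + b t * cnj x" by (simp add: w_def cx x_def[symmetric])
    have "v1 * x + b1 * cnj x + \<i> * of_real (p t) * (v t * x - b t * cnj x) =
       \<i> * of_real (schr_f q k E t) * w t + schr_g q k E t * cnj (w t) - of_real (\<mu> * Im (w t))
       + of_real (\<kappa> t - Re (g' t * (cnj x * cnj x)) - \<nu> t) * w t"
    proof (rule growth_identity[OF cx(3) D_def _ wx n_def _ v1_def b1_def])
      show "D t \<noteq> 0" using D[of t] by simp
      show "p t = \<alpha> + f' t + Im (g' t * (cnj x * cnj x)) + n t" by (simp only: p_def cx(2))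
      show "\<nu> t = - \<mu> * Im (w t) * Re ((cnj (v t) - b t) * cnj x) / D t" by (simp only: \<nu>_def cx(1))
    qed
    hence "v t * (\<i> * of_real (p t) * x) + v1 * x + (b t * (- \<i> * of_real (p t) * cnj x) + b1 * cnj x)
       = F - of_real (\<mu> * Im (w t)) + of_real (\<kappa> t - \<rho> t) * w t"
      unfolding F_def \<rho>_def cx(2) by (simp add: algebra_simps)
    ultimately have wd: "(w has_vector_derivative (F - of_real (\<mu> * Im (w t)) + of_real (\<kappa> t - \<rho> t) * w t)) (at t within {0..})"
      by simp
    have FF: "Re F = (q t - E) / k * Im (w t)" "Im F = k * Re (w t)" unfolding F_def schr_system[OF k0] by simp_all
    from wd have wd': "(w has_derivative (\<lambda>h. h *\<^sub>R (F - of_real (\<mu> * Im (w t)) + of_real (\<kappa> t - \<rho> t) * w t))) (at t within {0..})"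
      by (simp add: has_vector_derivative_def)
    have Red: "((\<lambda>t. Re (w t)) has_real_derivative ((q t - E) / k * Im (w t) - \<mu> * Im (w t) + (\<kappa> t - \<rho> t) * Re (w t))) (at t within {0..})"
      using has_derivative_Re[OF wd'] FF by (simp add: has_real_derivative_iff_has_vector_derivative has_vector_derivative_def)
    have Imd: "((\<lambda>t. Im (w t)) has_real_derivative (k * Re (w t) + (\<kappa> t - \<rho> t) * Im (w t))) (at t within {0..})"
      using has_derivative_Im[OF wd'] FF by (simp add: has_real_derivative_iff_has_vector_derivative has_vector_derivative_def)
    have Dd: "(D has_real_derivative 2 * \<kappa> t * D t) (at t within {0..})"
    proof -
      have "((\<lambda>t. v t * cnj (v t) - b t * cnj (b t)) has_vector_derivative
          (v t * cnj v1 + v1 * cnj (v t) - (b t * cnj b1 + b1 * cnj (b t)))) (at t within {0..})"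
        by (intro has_vector_derivative_diff has_vector_derivative_mult has_vector_derivative_cnj vd)
      also have "v t * cnj v1 + v1 * cnj (v t) - (b t * cnj b1 + b1 * cnj (b t)) =
          of_real (2 * \<kappa> t) * (v t * cnj (v t) - b t * cnj (b t))"
        unfolding v1_def b1_def by (simp add: algebra_simps)
      finally have *: "((\<lambda>t. v t * cnj (v t) - b t * cnj (b t)) has_vector_derivative
          of_real (2 * \<kappa> t) * (v t * cnj (v t) - b t * cnj (b t))) (at t within {0..})" .
      have "v t * cnj (v t) - b t * cnj (b t) = of_real (D t)" for t
        unfolding D_def by (simp only: of_real_diff complex_norm_square)
      from *[unfolded this] have "((\<lambda>t. complex_of_real (D t)) has_vector_derivative of_real (2 * \<kappa> t * D t)) (at t within {0..})"
        by simp
      from has_derivative_Re[OF this[unfolded has_vector_derivative_def]]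
      show ?thesis by (simp add: has_real_derivative_iff_has_vector_derivative has_vector_derivative_def)
    qed
    define a c d where "a = Im (w t)" and "c = Re (w t)" and "d = D t"
    have d0: "d \<noteq> 0" using D[of t] by (simp add: d_def)
    have "(B has_real_derivative
       (((k * c + (\<kappa> t - \<rho> t) * a) * c + ((q t - E) / k * a - \<mu> * a + (\<kappa> t - \<rho> t) * c) * a) * d - a * c * (2 * \<kappa> t * d)) / (d * d)) (at t within {0..})"
      unfolding B_def[abs_def] a_def c_def d_def
      by (rule DERIV_divide[OF DERIV_mult[OF Imd Red] Dd]) (use D[of t] in auto)
    also have "(((k * c + (\<kappa> t - \<rho> t) * a) * c + ((q t - E) / k * a - \<mu> * a + (\<kappa> t - \<rho> t) * c) * a) * d - a * c * (2 * \<kappa> t * d)) / (d * d)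
       = B' t"
      unfolding B'_def B_def a_def[symmetric] c_def[symmetric] d_def[symmetric] using d0 k0
      by (simp add: field_simps power2_eq_square)
    finally show ?thesis .
  qed
  \<comment> \<open>Chosen so that c (3 k + \<mu>) (Im w)^2 / D is \<open>n\<close>. The 3 k
    consists of 2 k from the lower bound of (q - E) / k and one k from completing (Re w)^2 to |w|^2;
    \<mu> \<le> k then gives c k \<ge> \<mu> / 4.\<close>
  define c where "c = \<mu> / (3 * k + \<mu>)"
  have c: "0 < c" "\<mu> / 4 \<le> c * k" using pos k \<mu>k by (auto simp: c_def field_simps)
  have cB: "\<bar>B t\<bar> \<le> \<Gamma> / 2" for t
  proof -
    have "2 * \<bar>Im (w t) * Re (w t)\<bar> \<le> (cmod (w t))\<^sup>2"
      unfolding cmod_power2 abs_mult using sum_squares_bound[of "\<bar>Im (w t)\<bar>" "\<bar>Re (w t)\<bar>"] by simp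
    also have "\<dots> \<le> \<Gamma> * D t" by (rule w\<Gamma>)
    finally show ?thesis using D[of t] by (simp add: B_def abs_divide field_simps)
  qed
  have \<rho>b: "\<bar>\<rho> t\<bar> \<le> 41 * e * \<Gamma>\<^sup>2" for t
  proof -
    have "\<bar>Re (g' t * cis (- 2 * \<psi> t))\<bar> \<le> e"
      using abs_Re_le_cmod[of "g' t * cis (- 2 * \<psi> t)"] small(2)[of t] by (simp add: norm_mult)
    moreover have "\<bar>\<nu> t\<bar> \<le> \<mu> * \<Gamma>"
    proof -
      have "\<bar>Re ((cnj (v t) - b t) * cis (- \<psi> t))\<bar> \<le> cmod ((cnj (v t) - b t) * cis (- \<psi> t))" by (rule abs_Re_le_cmod)
      also have "\<dots> \<le> cmod (v t) + cmod (b t)" using norm_triangle_ineq4[of "cnj (v t)" "b t"] by (simp add: norm_mult)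
      finally have 1: "\<bar>Re ((cnj (v t) - b t) * cis (- \<psi> t))\<bar> \<le> cmod (v t) + cmod (b t)" .
      have "\<bar>Im (w t)\<bar> \<le> cmod (v t) + cmod (b t)" using abs_Im_le_cmod[of "w t"] wup(1)[of t] by linarith
      hence "\<bar>Im (w t)\<bar> * \<bar>Re ((cnj (v t) - b t) * cis (- \<psi> t))\<bar> \<le> (cmod (v t) + cmod (b t)) * (cmod (v t) + cmod (b t))"
        using 1 by (intro mult_mono) auto
      also have "\<dots> \<le> \<Gamma> * D t" using upper(1)[of t] by (simp add: power2_eq_square)
      finally have "\<mu> * (\<bar>Im (w t)\<bar> * \<bar>Re ((cnj (v t) - b t) * cis (- \<psi> t))\<bar>) \<le> \<mu> * (\<Gamma> * D t)" using pos by simp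
      hence "\<mu> * (\<bar>Im (w t)\<bar> * \<bar>Re ((cnj (v t) - b t) * cis (- \<psi> t))\<bar>) / D t \<le> \<mu> * \<Gamma>" using D[of t] by (simp add: field_simps)
      moreover have "\<bar>\<nu> t\<bar> = \<mu> * (\<bar>Im (w t)\<bar> * \<bar>Re ((cnj (v t) - b t) * cis (- \<psi> t))\<bar>) / D t"
        using pos D[of t] by (simp add: \<nu>_def abs_mult abs_divide)
      ultimately show ?thesis by simp
    qed
    ultimately have "\<bar>\<rho> t\<bar> \<le> e + \<mu> * \<Gamma>" unfolding \<rho>_def by linarith
    moreover have "e * 1 \<le> e * \<Gamma>\<^sup>2" using small(3) \<Gamma>p[of 2] by (intro mult_left_mono) auto
    ultimately show ?thesis by (simp add: \<mu>_def power2_eq_square)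
  qed
  \<comment> \<open>This fixes the power in the hypothesis on \<open>e\<close>: \<rho> costs
    \<Gamma>^2 and B costs \<Gamma>, and the product must not exceed half of k / \<Gamma>, the lower
    bound of k |w|^2 / D.\<close>
  have rB: "2 * \<bar>\<rho> t * B t\<bar> \<le> k / (2 * \<Gamma>)" for t
  proof -
    have "\<bar>\<rho> t\<bar> * \<bar>B t\<bar> \<le> (41 * e * \<Gamma>\<^sup>2) * (\<Gamma> / 2)" using \<rho>b cB by (intro mult_mono) (use small(3) in auto)
    hence "2 * \<bar>\<rho> t * B t\<bar> \<le> 41 * e * \<Gamma> ^ 3" by (simp add: abs_mult power2_eq_square power3_eq_cube)
    also have "41 * e * \<Gamma> ^ 3 = 82 * (e * \<Gamma> ^ 4) / (2 * \<Gamma>)" using pos by (simp add: field_simps power_numeral_reduce)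
    also have "\<dots> \<le> k / (2 * \<Gamma>)" using k(2) pos by (intro divide_right_mono) auto
    finally show ?thesis .
  qed
  have nB: "\<mu> / (8 * \<Gamma>) - c * B' t \<le> n t" for t
  proof -
    have s: "(cmod (w t))\<^sup>2 / D t \<ge> 1 / \<Gamma>" using w\<Gamma>(2)[of t] D[of t] pos by (simp add: field_simps)
    have n0: "0 \<le> (Im (w t))\<^sup>2 / D t" using D[of t] by simp
    have "(q t - E) / k \<ge> - 2 * k" using q[of t] k(1) by (simp add: field_simps power2_eq_square)
    hence "((q t - E) / k - \<mu>) * ((Im (w t))\<^sup>2 / D t) \<ge> (- 2 * k - \<mu>) * ((Im (w t))\<^sup>2 / D t)"
      using n0 by (intro mult_right_mono) auto
    moreover have "- (2 * \<rho> t * B t) \<ge> - (k / (2 * \<Gamma>))" using rB[of t] by (simp add: abs_le_iff)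
    ultimately have "B' t \<ge> k * ((Re (w t))\<^sup>2 / D t) + (- 2 * k - \<mu>) * ((Im (w t))\<^sup>2 / D t) - k / (2 * \<Gamma>)"
      unfolding B'_def by simp
    also have "k * ((Re (w t))\<^sup>2 / D t) + (- 2 * k - \<mu>) * ((Im (w t))\<^sup>2 / D t) =
       k * ((cmod (w t))\<^sup>2 / D t) - (3 * k + \<mu>) * ((Im (w t))\<^sup>2 / D t)"
    proof -
      have "k * X + (- 2 * k - \<mu>) * Y = k * (X + Y) - (3 * k + \<mu>) * Y" for X Y by (simp add: algebra_simps)
      thus ?thesis unfolding cmod_power2 add_divide_distrib .
    qed
    finally have "(3 * k + \<mu>) * ((Im (w t))\<^sup>2 / D t) \<ge> k * ((cmod (w t))\<^sup>2 / D t) - k / (2 * \<Gamma>) - B' t" by linarith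
    moreover have "k * ((cmod (w t))\<^sup>2 / D t) \<ge> k * (1 / \<Gamma>)" using s k(1) by (intro mult_left_mono) auto
    ultimately have "(3 * k + \<mu>) * ((Im (w t))\<^sup>2 / D t) \<ge> k / (2 * \<Gamma>) - B' t" by (simp add: field_simps)
    hence "c * (k / (2 * \<Gamma>) - B' t) \<le> c * ((3 * k + \<mu>) * ((Im (w t))\<^sup>2 / D t))"
      by (rule mult_left_mono) (use c in simp)
    also have "\<dots> = n t" using pos k by (simp add: c_def n_def)
    finally have "c * k / (2 * \<Gamma>) - c * B' t \<le> n t" by (simp add: right_diff_distrib)
    moreover have "\<mu> / (8 * \<Gamma>) \<le> c * k / (2 * \<Gamma>)" using c(2) pos by (simp add: field_simps)
    ultimately show ?thesis by linarith
  qed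
  have \<mu>8: "\<mu> / (8 * \<Gamma>) = 5 * e" using pos by (simp add: \<mu>_def)
  define \<Psi> where "\<Psi> t = \<psi> t + c * B t" for t
  have "(\<Psi> has_real_derivative (p t + c * B' t)) (at t within {0..})" if "t \<ge> 0" for t
    unfolding \<Psi>_def[abs_def] by (intro DERIV_add DERIV_cmult \<psi>' Bder that)
  moreover have "\<alpha> + 3 * e \<le> p t + c * B' t" for t
  proof -
    have "\<bar>Im (g' t * cis (- 2 * \<psi> t))\<bar> \<le> e"
      using abs_Im_le_cmod[of "g' t * cis (- 2 * \<psi> t)"] small(2)[of t] by (simp add: norm_mult)
    thus ?thesis using nB[of t] small(1)[of t] unfolding \<mu>8 p_def by linarith
  qed
  ultimately have \<Psi>: "\<Psi> 0 + (\<alpha> + 3 * e) * (t - 0) \<le> \<Psi> t" if "t \<ge> 0" for t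
    by (rule lower_growth) (use that in auto)
  have cb: "\<bar>c * B t\<bar> \<le> c * (\<Gamma> / 2)" for t using cB[of t] c by (simp add: abs_mult)
  have "\<alpha> + 3 * e \<le> r' - \<sigma>"
  proof -
    have "((\<lambda>t. (\<Psi> 0 - c * (\<Gamma> / 2) - C) / t + (\<alpha> + 3 * e + \<sigma>) * t / t) \<longlongrightarrow> 0 + (\<alpha> + 3 * e + \<sigma>)) at_top"
      by (intro tendsto_add linear_over_t bounded_over_t[of "\<lambda>_. \<Psi> 0 - c * (\<Gamma> / 2) - C" "\<bar>\<Psi> 0 - c * (\<Gamma> / 2) - C\<bar>"]) auto
    moreover have "\<forall>\<^sub>F t in at_top. (\<Psi> 0 - c * (\<Gamma> / 2) - C) / t + (\<alpha> + 3 * e + \<sigma>) * t / t \<le> \<phi> t / t"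
      using eventually_gt_at_top[of 0]
    proof eventually_elim
      case (elim t)
      have "\<Psi> 0 - c * (\<Gamma> / 2) - C + (\<alpha> + 3 * e + \<sigma>) * t \<le> \<phi> t"
      proof -
        have "(\<alpha> + 3 * e + \<sigma>) * t = (\<alpha> + 3 * e) * (t - 0) + \<sigma> * t" by (simp add: algebra_simps)
        moreover have "\<Psi> t = \<psi> t + c * B t" by (simp add: \<Psi>_def)
        moreover have "\<bar>\<phi> t - \<psi> t - \<sigma> * t\<bar> \<le> C" "\<Psi> 0 + (\<alpha> + 3 * e) * (t - 0) \<le> \<Psi> t" using C \<Psi> elim by auto
        ultimately show ?thesis using cb[of t] by linarith
      qed
      thus ?case using elim unfolding add_divide_distrib[symmetric] by (intro divide_right_mono) auto
    qed
    ultimately have "0 + (\<alpha> + 3 * e + \<sigma>) \<le> r'" by (intro tendsto_le[OF _ \<phi>(2)]) auto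
    thus ?thesis by simp
  qed
  thus ?thesis using r small(3) by linarith
qed

section \<open>The Pruefer angle\<close>

lemma integral_deriv_half_line:
  fixes g :: "real \<Rightarrow> real"
  assumes "continuous_on {0..} g" "t \<ge> 0"
  shows "((\<lambda>x. integral {0..x} g) has_real_derivative g t) (at t within {0..})"
proof -
  have "continuous_on {0..t + 1} g" by (rule continuous_on_subset[OF assms(1)]) auto
  hence "((\<lambda>x. integral {0..x} g) has_real_derivative g t) (at t within {0..t + 1})"
    by (rule integral_has_real_derivative) (use assms(2) in auto)
  also have "at t within {0..t + 1} = at t within {0..}"
    by (rule at_within_nhd[of t "{..<t + 1}"]) auto
  finally show ?thesis .
qed

text \<open>Picard iteration on the whole half-line: in the norm weighted by \<open>exp (- c t)\<close> with
  \<open>c > K\<close> the integral operator is a contraction.\<close>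

lemma ode_exists:
  fixes F :: "real \<Rightarrow> real \<Rightarrow> real"
  assumes cont: "continuous_on ({0..} \<times> UNIV) (\<lambda>(t, x). F t x)"
    and lip: "\<And>t x y. t \<ge> 0 \<Longrightarrow> \<bar>F t x - F t y\<bar> \<le> K * \<bar>x - y\<bar>"
    and bnd: "\<And>t x. t \<ge> 0 \<Longrightarrow> \<bar>F t x\<bar> \<le> M"
  obtains \<phi> where "\<phi> 0 = x0" "\<And>t. t \<ge> 0 \<Longrightarrow> (\<phi> has_real_derivative F t (\<phi> t)) (at t within {0..})"
proof -
  have K: "K \<ge> 0" using lip[of 0 0 1] by simp
  have M: "M \<ge> 0" using bnd[of 0 0] by simp
  have bnd': "- M \<le> F t x" "F t x \<le> M" if "t \<ge> 0" for t x using bnd[OF that, of x] by linarith+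
  define c where "c = K + 1"
  have c: "c > 0" "K / c < 1" "0 \<le> K / c" using K by (auto simp: c_def)
  \<comment> \<open>The Picard operator in the unknown w = exp (- c t) \<phi>. Solutions grow at
    most linearly, so w is bounded, and the weighted norm becomes the supremum norm of bounded
    continuous functions.\<close>
  define G where "G w t = exp (- c * t) * (x0 + integral {0..t} (\<lambda>s. F s (exp (c * s) * w s)))" for w t
  have contF: "continuous_on {0..} (\<lambda>s. F s (exp (c * s) * w s))" if "continuous_on UNIV w" for w
  proof -
    have "continuous_on {0..} ((\<lambda>(t, x). F t x) \<circ> (\<lambda>s. (s, exp (c * s) * w s)))"
      by (rule continuous_on_compose)
         (auto intro!: continuous_intros continuous_on_subset[OF that] continuous_on_subset[OF cont])
    thus ?thesis by (simp add: o_def)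
  qed
  have der: "((\<lambda>x. integral {0..x} (\<lambda>s. F s (exp (c * s) * w s))) has_real_derivative F t (exp (c * t) * w t)) (at t within {0..})"
    if "continuous_on UNIV w" "t \<ge> 0" for w t
    by (rule integral_deriv_half_line[OF contF[OF that(1)] that(2)])
  have Gcont: "continuous_on {0..} (G w)" if "continuous_on UNIV w" for w
    unfolding G_def[abs_def]
    by (intro continuous_intros DERIV_continuous_on[OF der[OF that]]) auto
  have Gb: "\<bar>G w t\<bar> \<le> \<bar>x0\<bar> + M / c" if w: "continuous_on UNIV w" and t: "t \<ge> 0" for w t
  proof -
    define I where "I x = integral {0..x} (\<lambda>s. F s (exp (c * s) * w s))" for x
    have I0: "I 0 = 0" by (simp add: I_def)
    have "I 0 + (- M) * (t - 0) \<le> I t"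
      by (rule lower_growth[OF der[OF w, folded I_def]]) (use bnd' t in auto)
    moreover have "I t \<le> I 0 + M * (t - 0)"
      by (rule upper_growth[OF der[OF w, folded I_def]]) (use bnd' t in auto)
    ultimately have I: "\<bar>I t\<bar> \<le> M * t" using I0 by auto
    have e: "exp (- c * t) \<le> 1" "exp (- c * t) * (c * t) \<le> 1"
    proof -
      show "exp (- c * t) \<le> 1" using c t by simp
      have "c * t \<le> exp (c * t)" using exp_ge_add_one_self[of "c * t"] by linarith
      hence "exp (- c * t) * (c * t) \<le> exp (- c * t) * exp (c * t)" by (intro mult_left_mono) auto
      thus "exp (- c * t) * (c * t) \<le> 1" by (simp flip: exp_add)
    qed
    have "\<bar>G w t\<bar> \<le> exp (- c * t) * (\<bar>x0\<bar> + M * t)"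
      unfolding G_def I_def[symmetric] abs_mult using I by (auto intro!: mult_left_mono order.trans[OF abs_triangle_ineq])
    also have "\<dots> = exp (- c * t) * \<bar>x0\<bar> + M / c * (exp (- c * t) * (c * t))" using c by (simp add: field_simps)
    also have "\<dots> \<le> 1 * \<bar>x0\<bar> + M / c * 1" using e M c by (intro add_mono mult_right_mono mult_left_mono) auto
    finally show ?thesis by simp
  qed
  have "(\<lambda>t. G w (max 0 t)) \<in> bcontfun" if w: "continuous_on UNIV w" for w
  proof -
    have "continuous_on UNIV (G w \<circ> (\<lambda>t. max 0 t))"
      by (rule continuous_on_compose) (auto intro!: continuous_intros continuous_on_subset[OF Gcont[OF w]])
    moreover have "bounded (range (\<lambda>t. G w (max 0 t)))"
      by (rule boundedI[of _ "\<bar>x0\<bar> + M / c"]) (use Gb[OF w] in auto)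
    ultimately show ?thesis by (simp add: bcontfun_def o_def)
  qed
  note in_b = this
  define T where "T w = Bcontfun (\<lambda>t. G (apply_bcontfun w) (max 0 t))" for w :: "real \<Rightarrow>\<^sub>C real"
  have cw: "continuous_on UNIV (apply_bcontfun w)" for w :: "real \<Rightarrow>\<^sub>C real" by simp
  have Tw: "apply_bcontfun (T w) t = G (apply_bcontfun w) (max 0 t)" for w t
    unfolding T_def by (subst Bcontfun_inverse[OF in_b[OF cw]]) simp
  have diff: "G w1 t - G w2 t \<le> K / c * d"
    if w: "continuous_on UNIV w1" "continuous_on UNIV w2" and d: "\<And>s. \<bar>w1 s - w2 s\<bar> \<le> d" and t: "t \<ge> 0" for w1 w2 d t
  proof -
    \<comment> \<open>The difference of the integrals minus its expected bound: the Lipschitz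
      condition makes the derivative nonpositive. The resulting estimate is one-sided and is used
      twice, with w1 and w2 exchanged.\<close>
    define I where "I x = integral {0..x} (\<lambda>s. F s (exp (c * s) * w1 s)) - integral {0..x} (\<lambda>s. F s (exp (c * s) * w2 s)) - K * d / c * exp (c * x)" for x
    have d0: "d \<ge> 0" using d[of 0] by simp
    have "I t \<le> I 0 + 0 * (t - 0)"
    proof (rule upper_growth)
      show "(I has_real_derivative (F x (exp (c * x) * w1 x) - F x (exp (c * x) * w2 x) - K * d * exp (c * x))) (at x within {0..})" if "x \<ge> 0" for x
        unfolding I_def[abs_def]
        by (rule derivative_eq_intros der w that refl)+ (use c in auto)
      fix x :: real assume x: "x \<ge> 0"
      have "F x (exp (c * x) * w1 x) - F x (exp (c * x) * w2 x) \<le> K * \<bar>exp (c * x) * w1 x - exp (c * x) * w2 x\<bar>"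
        using lip[OF x, of "exp (c * x) * w1 x" "exp (c * x) * w2 x"] by linarith
      also have "\<dots> = K * (exp (c * x) * \<bar>w1 x - w2 x\<bar>)" by (simp add: abs_mult flip: right_diff_distrib)
      also have "\<dots> \<le> K * (exp (c * x) * d)" using d K by (intro mult_left_mono) auto
      finally show "F x (exp (c * x) * w1 x) - F x (exp (c * x) * w2 x) - K * d * exp (c * x) \<le> 0" by (simp add: mult_ac)
    qed (use t in auto)
    hence "integral {0..t} (\<lambda>s. F s (exp (c * s) * w1 s)) - integral {0..t} (\<lambda>s. F s (exp (c * s) * w2 s)) \<le> K * d / c * exp (c * t)"
    proof -
      have "0 \<le> K * d / c" using K d0 c by simp
      moreover have "X - Y \<le> Z" if "X - Y - Z \<le> 0 - 0 - P + 0" "0 \<le> P" for X Y Z P :: real using that by linarith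
      ultimately show ?thesis using \<open>I t \<le> I 0 + 0 * (t - 0)\<close> by (simp add: I_def)
    qed
    hence "exp (- c * t) * (integral {0..t} (\<lambda>s. F s (exp (c * s) * w1 s)) - integral {0..t} (\<lambda>s. F s (exp (c * s) * w2 s)))
       \<le> exp (- c * t) * (K * d / c * exp (c * t))" by (intro mult_left_mono) auto
    also have "\<dots> = K / c * d * (exp (- c * t) * exp (c * t))" by simp
    also have "exp (- c * t) * exp (c * t) = 1" by (simp flip: exp_add)
    finally show ?thesis by (simp add: G_def right_diff_distrib distrib_left)
  qed
  have "\<exists>!w. T w = w"
  proof (rule banach_fix_type[OF c(3,2)], intro allI)
    fix w1 w2 :: "real \<Rightarrow>\<^sub>C real"
    show "dist (T w1) (T w2) \<le> K / c * dist w1 w2"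
    proof (rule dist_bound)
      fix t
      have d: "\<bar>apply_bcontfun w1 s - apply_bcontfun w2 s\<bar> \<le> dist w1 w2" for s
        unfolding dist_real_def[symmetric] by (rule dist_bounded)
      have d': "\<bar>apply_bcontfun w2 s - apply_bcontfun w1 s\<bar> \<le> dist w1 w2" for s
        using d[of s] by (simp add: abs_minus_commute)
      show "dist (apply_bcontfun (T w1) t) (apply_bcontfun (T w2) t) \<le> K / c * dist w1 w2"
        unfolding Tw dist_real_def
        using diff[OF cw cw d, of "max 0 t"] diff[OF cw cw d', of "max 0 t"] by (simp add: abs_le_iff)
    qed
  qed
  then obtain w where w: "T w = w" by blast
  define \<phi> where "\<phi> t = x0 + integral {0..t} (\<lambda>s. F s (exp (c * s) * apply_bcontfun w s))" for t
  have "exp (c * t) * apply_bcontfun w t = \<phi> t" if "t \<ge> 0" for t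
  proof -
    have "apply_bcontfun w t = G (apply_bcontfun w) t" using Tw[of w t] w that by simp
    also have "\<dots> = exp (- c * t) * \<phi> t" by (simp add: G_def \<phi>_def)
    finally have "exp (c * t) * apply_bcontfun w t = (exp (c * t) * exp (- c * t)) * \<phi> t" by simp
    thus ?thesis by (simp flip: exp_add)
  qed
  moreover have "(\<phi> has_real_derivative F t (exp (c * t) * apply_bcontfun w t)) (at t within {0..})" if "t \<ge> 0" for t
    unfolding \<phi>_def[abs_def] using DERIV_add[OF DERIV_const der[OF cw that]] by simp
  ultimately have "(\<phi> has_real_derivative F t (\<phi> t)) (at t within {0..})" if "t \<ge> 0" for t
    using that by simp
  moreover have "\<phi> 0 = x0" by (simp add: \<phi>_def)
  ultimately show ?thesis using that by blast
qed

text \<open>The strict inequality \<epsilon> < \<eta> turns \<eta> t exp (K t) into a strict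
  barrier: at a contact its slope exceeds that of D. The differential inequality is demanded only
  where D \<ge> 0, since contacts occur there, and there a Lipschitz bound of the right side is
  one-sided.\<close>

lemma gronwall_less:
  fixes D :: "real \<Rightarrow> real"
  assumes d: "\<And>t. t \<ge> 0 \<Longrightarrow> (D has_real_derivative D' t) (at t within {0..})"
    and le: "\<And>t. t \<ge> 0 \<Longrightarrow> D t \<ge> 0 \<Longrightarrow> D' t \<le> K * D t + \<epsilon>"
    and "D 0 \<le> 0" "0 \<le> \<epsilon>" "\<epsilon> < \<eta>" "t \<ge> 0" and K: "K \<ge> 0"
  shows "D t \<le> \<eta> * t * exp (K * t)"
proof -
  have "D t - \<eta> * t * exp (K * t) \<le> 0"
  proof (rule barrier_above[where t = t and \<phi>' = "\<lambda>t. D' t - (\<eta> * exp (K * t) + \<eta> * t * (K * exp (K * t)))"])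
    show "((\<lambda>t. D t - \<eta> * t * exp (K * t)) has_real_derivative D' t - (\<eta> * exp (K * t) + \<eta> * t * (K * exp (K * t)))) (at t within {0..})" if "t \<ge> 0" for t
      by (rule derivative_eq_intros d that refl)+ (simp add: algebra_simps)
    fix t assume t: "t \<ge> 0" "D t - \<eta> * t * exp (K * t) = 0"
    have "D t \<ge> 0" using t assms by simp
    from le[OF t(1) this] have 1: "D' t \<le> K * D t + \<epsilon>" .
    show "D' t - (\<eta> * exp (K * t) + \<eta> * t * (K * exp (K * t))) < 0"
    proof -
      have "1 \<le> exp (K * t)" using t K by simp
      hence "\<eta> * 1 \<le> \<eta> * exp (K * t)" using assms by (intro mult_left_mono) auto
      moreover have "K * D t = \<eta> * t * (K * exp (K * t))" using t by (simp add: algebra_simps)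
      ultimately show ?thesis using 1 assms by linarith
    qed
  qed (use assms in auto)
  thus ?thesis by simp
qed

lemma sin_squared_lipschitz: "\<bar>(sin x)\<^sup>2 - (sin y)\<^sup>2\<bar> \<le> \<bar>x - y\<bar>" for x y :: real
proof -
  have "sin (x + y) * sin (x - y) = (sin x)\<^sup>2 * (cos y)\<^sup>2 - (cos x)\<^sup>2 * (sin y)\<^sup>2"
    unfolding sin_add sin_diff by (simp add: power2_eq_square algebra_simps)
  also have "\<dots> = (sin x)\<^sup>2 - (sin y)\<^sup>2"
    unfolding cos_squared_eq by (simp add: algebra_simps)
  finally have *: "sin (x + y) * sin (x - y) = (sin x)\<^sup>2 - (sin y)\<^sup>2" .
  have "\<bar>(sin x)\<^sup>2 - (sin y)\<^sup>2\<bar> = \<bar>sin (x + y)\<bar> * \<bar>sin (x - y)\<bar>" by (simp only: *[symmetric] abs_mult)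
  also have "\<dots> \<le> 1 * \<bar>x - y\<bar>" by (intro mult_mono abs_sin_x_le_abs_x) auto
  finally show ?thesis by simp
qed

text \<open>\<theta> E is the angle of y' + i y for the solution with y 0 = 0, that is y = r sin
  \<theta> and y' = r cos \<theta>. Writing cos^2 + (E - q) sin^2 as 1 + (E - q - 1) sin^2 leaves a
  single coefficient, whose bound serves for the size and for the Lipschitz constant of the
  rate.\<close>

locale pruefer =
  fixes q :: "real \<Rightarrow> real" and Q :: real and \<theta> :: "real \<Rightarrow> real \<Rightarrow> real"
  assumes q_cont: "continuous_on UNIV q" and q_bound: "\<And>t. \<bar>q t\<bar> \<le> Q"
    and \<theta>_0: "\<And>E. \<theta> E 0 = 0"
    and \<theta>_deriv: "\<And>E t. t \<ge> 0 \<Longrightarrow> (\<theta> E has_real_derivative 1 + (E - q t - 1) * (sin (\<theta> E t))\<^sup>2) (at t within {0..})"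

lemma pruefer_exists:
  assumes "continuous_on UNIV q" "\<And>t. \<bar>q t\<bar> \<le> Q"
  shows "\<exists>\<theta>. pruefer q Q \<theta>"
proof -
  have "\<forall>E. \<exists>\<phi>. \<phi> 0 = 0 \<and> (\<forall>t\<ge>0. (\<phi> has_real_derivative 1 + (E - q t - 1) * (sin (\<phi> t))\<^sup>2) (at t within {0..}))"
  proof
    fix E
    have b: "\<bar>E - q t - 1\<bar> \<le> \<bar>E\<bar> + Q + 1" for t using assms(2)[of t] by linarith
    obtain \<phi> where "\<phi> 0 = 0" "\<And>t. t \<ge> 0 \<Longrightarrow> (\<phi> has_real_derivative 1 + (E - q t - 1) * (sin (\<phi> t))\<^sup>2) (at t within {0..})"
    proof (rule ode_exists[of "\<lambda>t x. 1 + (E - q t - 1) * (sin x)\<^sup>2" "\<bar>E\<bar> + Q + 1" "1 + (\<bar>E\<bar> + Q + 1)" 0])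
      have "continuous_on ({0..} \<times> UNIV) (\<lambda>x::real\<times>real. q (fst x))"
        by (rule continuous_on_compose2[OF assms(1)]) (auto intro!: continuous_intros)
      thus "continuous_on ({0..} \<times> UNIV) (\<lambda>(t, x). 1 + (E - q t - 1) * (sin x)\<^sup>2)"
        unfolding case_prod_beta by (intro continuous_intros)
      show "\<bar>1 + (E - q t - 1) * (sin x)\<^sup>2 - (1 + (E - q t - 1) * (sin y)\<^sup>2)\<bar> \<le> (\<bar>E\<bar> + Q + 1) * \<bar>x - y\<bar>" for t x y
      proof -
        have "\<bar>1 + (E - q t - 1) * (sin x)\<^sup>2 - (1 + (E - q t - 1) * (sin y)\<^sup>2)\<bar> = \<bar>E - q t - 1\<bar> * \<bar>(sin x)\<^sup>2 - (sin y)\<^sup>2\<bar>"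
          by (simp flip: abs_mult right_diff_distrib)
        also have "\<dots> \<le> (\<bar>E\<bar> + Q + 1) * \<bar>x - y\<bar>" using b[of t] by (intro mult_mono sin_squared_lipschitz) auto
        finally show ?thesis .
      qed
      show "\<bar>1 + (E - q t - 1) * (sin x)\<^sup>2\<bar> \<le> 1 + (\<bar>E\<bar> + Q + 1)" for t x
      proof -
        have "\<bar>(E - q t - 1) * (sin x)\<^sup>2\<bar> \<le> (\<bar>E\<bar> + Q + 1) * 1"
          unfolding abs_mult using b[of t] by (intro mult_mono) (auto simp: abs_square_le_1)
        moreover have "\<bar>1 + X\<bar> \<le> 1 + Z" if "\<bar>X\<bar> \<le> Z * 1" for X Z :: real using that by linarith
        ultimately show ?thesis by blast
      qed
    qed blast
    thus "\<exists>\<phi>. \<phi> 0 = 0 \<and> (\<forall>t\<ge>0. (\<phi> has_real_derivative 1 + (E - q t - 1) * (sin (\<phi> t))\<^sup>2) (at t within {0..}))" by blast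
  qed
  from choice[OF this] obtain \<theta> where "\<forall>E. \<theta> E 0 = 0 \<and> (\<forall>t\<ge>0. (\<theta> E has_real_derivative 1 + (E - q t - 1) * (sin (\<theta> E t))\<^sup>2) (at t within {0..}))"
    by blast
  thus ?thesis unfolding pruefer_def using assms by blast
qed

text \<open>The constant may depend on the tolerance; completeness turns this family of approximate
  limits into a limit.\<close>

lemma approx_constant_convergent:
  fixes h :: "real \<Rightarrow> real"
  assumes "\<And>e. e > 0 \<Longrightarrow> \<exists>\<rho>. \<forall>\<^sub>F t in at_top. \<bar>h t - \<rho>\<bar> \<le> e"
  shows "\<exists>L. (h \<longlongrightarrow> L) at_top"
proof -
  have seq: "\<forall>\<^sub>F n in sequentially. P (real n)" if "\<forall>\<^sub>F t in at_top. P t" for P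
    using that filterlim_real_sequentially by (auto simp: filterlim_iff)
  have "Cauchy (\<lambda>n. h (real n))"
  proof (rule CauchyI)
    fix e :: real assume e: "e > 0"
    obtain \<rho> where "\<forall>\<^sub>F t in at_top. \<bar>h t - \<rho>\<bar> \<le> e / 3" using assms[of "e / 3"] e by auto
    from seq[OF this] obtain M where M: "\<And>n. n \<ge> M \<Longrightarrow> \<bar>h (real n) - \<rho>\<bar> \<le> e / 3" by (auto simp: eventually_sequentially)
    have "norm (h (real m) - h (real n)) < e" if "m \<ge> M" "n \<ge> M" for m n
      using M[OF that(1)] M[OF that(2)] e unfolding real_norm_def by linarith
    thus "\<exists>M. \<forall>m\<ge>M. \<forall>n\<ge>M. norm (h (real m) - h (real n)) < e" by blast
  qed
  then obtain L where L: "(\<lambda>n. h (real n)) \<longlonglongrightarrow> L" using Cauchy_convergent convergent_def by blast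
  have "(h \<longlongrightarrow> L) at_top"
  proof (rule tendstoI)
    fix e :: real assume e: "e > 0"
    obtain \<rho> where \<rho>: "\<forall>\<^sub>F t in at_top. \<bar>h t - \<rho>\<bar> \<le> e / 3" using assms[of "e / 3"] e by auto
    have "((\<lambda>n. \<bar>h (real n) - \<rho>\<bar>) \<longlonglongrightarrow> \<bar>L - \<rho>\<bar>)" by (intro tendsto_intros L)
    hence "\<bar>L - \<rho>\<bar> \<le> e / 3" by (rule tendsto_upperbound) (use seq[OF \<rho>] in auto)
    from \<rho> show "\<forall>\<^sub>F t in at_top. dist (h t) L < e"
    proof eventually_elim
      case (elim t)
      show ?case unfolding dist_real_def using elim \<open>\<bar>L - \<rho>\<bar> \<le> e / 3\<close> e by linarith
    qed
  qed
  thus ?thesis by blast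
qed

context pruefer
begin

definition lip :: "real \<Rightarrow> real" where "lip E = \<bar>E\<bar> + Q + 1"

lemma Q_nonneg: "0 \<le> Q" using q_bound[of 0] by linarith

lemma lip_pos: "0 < lip E" using Q_nonneg by (simp add: lip_def)

lemma coeff_bound: "\<bar>E - q t - 1\<bar> \<le> lip E"
  using q_bound[of t] by (simp add: lip_def)

lemma rate_bound: "\<bar>1 + (E - q t - 1) * (sin x)\<^sup>2\<bar> \<le> 1 + lip E"
proof -
  have "\<bar>(E - q t - 1) * (sin x)\<^sup>2\<bar> \<le> lip E * 1"
    unfolding abs_mult using coeff_bound lip_pos[of E] by (intro mult_mono) (auto simp: abs_square_le_1)
  moreover have "\<bar>1 + X\<bar> \<le> 1 + Z" if "\<bar>X\<bar> \<le> Z * 1" for X Z :: real using that by linarith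
  ultimately show ?thesis by blast
qed

lemma rate_lip: "\<bar>(E - q t - 1) * (sin x)\<^sup>2 - (E - q t - 1) * (sin y)\<^sup>2\<bar> \<le> lip E * \<bar>x - y\<bar>"
proof -
  have "\<bar>(E - q t - 1) * (sin x)\<^sup>2 - (E - q t - 1) * (sin y)\<^sup>2\<bar> = \<bar>E - q t - 1\<bar> * \<bar>(sin x)\<^sup>2 - (sin y)\<^sup>2\<bar>"
    by (simp flip: abs_mult right_diff_distrib)
  also have "\<dots> \<le> lip E * \<bar>x - y\<bar>" using coeff_bound lip_pos[of E] by (intro mult_mono sin_squared_lipschitz) auto
  finally show ?thesis .
qed

lemma phase_iff: "phase (schr_f q 1 E) (schr_g q 1 E) 0 (\<lambda>_. 1) (\<lambda>_. 0) \<phi> \<longleftrightarrow>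
   (\<forall>t\<ge>0. (\<phi> has_real_derivative 1 + (E - q t - 1) * (sin (\<phi> t))\<^sup>2) (at t within {0..}))"
proof -
  have "1 * (cos x)\<^sup>2 + (E - q t) / 1 * (sin x)\<^sup>2 = 1 + (E - q t - 1) * (sin x)\<^sup>2" for x t
    by (simp add: cos_squared_eq algebra_simps)
  note e = this
  show ?thesis unfolding phase_0 schr_angle[OF one_neq_zero] e ..
qed

lemma \<theta>_continuous: "continuous_on {0..} (\<theta> E)"
  by (rule DERIV_continuous_on[OF \<theta>_deriv]) auto

lemma \<theta>_lipschitz: assumes "0 \<le> s" "s \<le> t" shows "\<bar>\<theta> E t - \<theta> E s\<bar> \<le> (1 + lip E) * (t - s)"
proof -
  have "- (1 + lip E) \<le> 1 + (E - q t - 1) * (sin x)\<^sup>2 \<and> 1 + (E - q t - 1) * (sin x)\<^sup>2 \<le> 1 + lip E" for t x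
    using rate_bound[of E t x] by (simp add: abs_le_iff)
  hence "\<theta> E s + - (1 + lip E) * (t - s) \<le> \<theta> E t" "\<theta> E t \<le> \<theta> E s + (1 + lip E) * (t - s)"
    by (auto intro!: lower_growth[OF \<theta>_deriv] upper_growth[OF \<theta>_deriv] assms)
  thus ?thesis by (simp add: abs_le_iff algebra_simps)
qed

lemma \<theta>_energy_lipschitz:
  assumes "t \<ge> 0" "\<bar>E - E'\<bar> < \<eta>"
  shows "\<theta> E t - \<theta> E' t \<le> \<eta> * t * exp (lip E * t)"
proof (rule gronwall_less[where \<epsilon> = "\<bar>E - E'\<bar>"])
  show "((\<lambda>t. \<theta> E t - \<theta> E' t) has_real_derivative
     (1 + (E - q t - 1) * (sin (\<theta> E t))\<^sup>2) - (1 + (E' - q t - 1) * (sin (\<theta> E' t))\<^sup>2)) (at t within {0..})" if "t \<ge> 0" for t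
    by (intro DERIV_diff \<theta>_deriv that)
  fix t assume t: "t \<ge> 0" "0 \<le> \<theta> E t - \<theta> E' t"
  have "(E - q t - 1) * (sin (\<theta> E t))\<^sup>2 - (E - q t - 1) * (sin (\<theta> E' t))\<^sup>2 \<le> lip E * (\<theta> E t - \<theta> E' t)"
    using rate_lip[of E t "\<theta> E t" "\<theta> E' t"] t by (simp add: abs_le_iff)
  moreover have "(E - E') * (sin (\<theta> E' t))\<^sup>2 \<le> \<bar>E - E'\<bar> * 1"
    by (intro mult_mono) (auto simp: abs_square_le_1)
  ultimately show "1 + (E - q t - 1) * (sin (\<theta> E t))\<^sup>2 - (1 + (E' - q t - 1) * (sin (\<theta> E' t))\<^sup>2)
       \<le> lip E * (\<theta> E t - \<theta> E' t) + \<bar>E - E'\<bar>"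
    by (simp add: algebra_simps)
qed (use assms \<theta>_0 lip_pos[of E] in auto)

lemma \<theta>_energy_continuous: assumes "L \<ge> 0" shows "continuous_on UNIV (\<lambda>E. \<theta> E L)"
  unfolding continuous_on_def
proof
  fix E
  have b: "\<bar>\<theta> x L - \<theta> E L\<bar> \<le> 2 * \<bar>x - E\<bar> * L * exp ((lip E + 1) * L)" if "x \<noteq> E" "\<bar>x - E\<bar> < 1" for x
  proof -
    have l: "lip x \<le> lip E + 1" using that by (simp add: lip_def)
    have "\<theta> x L - \<theta> E L \<le> (2 * \<bar>x - E\<bar>) * L * exp (lip x * L)"
      by (rule \<theta>_energy_lipschitz) (use assms that in auto)
    also have "\<dots> \<le> (2 * \<bar>x - E\<bar>) * L * exp ((lip E + 1) * L)"
      using l assms by (intro mult_left_mono) (auto intro: mult_right_mono)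
    finally have 1: "\<theta> x L - \<theta> E L \<le> (2 * \<bar>x - E\<bar>) * L * exp ((lip E + 1) * L)" .
    have "\<theta> E L - \<theta> x L \<le> (2 * \<bar>x - E\<bar>) * L * exp (lip E * L)"
      by (rule \<theta>_energy_lipschitz) (use assms that abs_minus_commute[of E x] in auto)
    also have "\<dots> \<le> (2 * \<bar>x - E\<bar>) * L * exp ((lip E + 1) * L)"
      using assms by (intro mult_left_mono) (auto intro: mult_right_mono)
    finally show ?thesis using 1 by (simp add: abs_le_iff)
  qed
  have "((\<lambda>x. \<theta> x L - \<theta> E L) \<longlongrightarrow> 0) (at E)"
  proof (rule Lim_null_comparison)
    have "\<forall>\<^sub>F x in at E. dist x E < 1 \<and> x \<noteq> E" unfolding eventually_at by (rule exI[of _ 1]) auto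
    thus "\<forall>\<^sub>F x in at E. norm (\<theta> x L - \<theta> E L) \<le> 2 * \<bar>x - E\<bar> * L * exp ((lip E + 1) * L)"
      by eventually_elim (use b in \<open>auto simp: dist_real_def\<close>)
    have "((\<lambda>x. 2 * \<bar>x - E\<bar> * L * exp ((lip E + 1) * L)) \<longlongrightarrow> 2 * \<bar>E - E\<bar> * L * exp ((lip E + 1) * L)) (at E)"
      by (intro tendsto_intros)
    thus "((\<lambda>x. 2 * \<bar>x - E\<bar> * L * exp ((lip E + 1) * L)) \<longlongrightarrow> 0) (at E)" by simp
  qed
  thus "((\<lambda>E. \<theta> E L) \<longlongrightarrow> \<theta> E L) (at E within UNIV)" by (simp add: Lim_null[symmetric])
qed

text \<open>Gronwall with vanishing inhomogeneity bounds the difference by \<eta> t exp (lip E t)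
  for every \<eta> > 0, and \<eta> tends to 0.\<close>

lemma \<theta>_mono: assumes "E \<le> E'" "t \<ge> 0" shows "\<theta> E t \<le> \<theta> E' t"
proof -
  have "\<theta> E t - \<theta> E' t \<le> \<eta> * t * exp (lip E * t)" if "\<eta> > 0" for \<eta>
  proof (rule gronwall_less[where \<epsilon> = 0])
    show "((\<lambda>t. \<theta> E t - \<theta> E' t) has_real_derivative
       (1 + (E - q t - 1) * (sin (\<theta> E t))\<^sup>2) - (1 + (E' - q t - 1) * (sin (\<theta> E' t))\<^sup>2)) (at t within {0..})" if "t \<ge> 0" for t
      by (intro DERIV_diff \<theta>_deriv that)
    fix t assume t: "t \<ge> 0" "0 \<le> \<theta> E t - \<theta> E' t"
    have "(E - q t - 1) * (sin (\<theta> E t))\<^sup>2 - (E - q t - 1) * (sin (\<theta> E' t))\<^sup>2 \<le> lip E * (\<theta> E t - \<theta> E' t)"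
      using rate_lip[of E t "\<theta> E t" "\<theta> E' t"] t by (simp add: abs_le_iff)
    moreover have "(E - E') * (sin (\<theta> E' t))\<^sup>2 \<le> 0" using assms(1) by (intro mult_nonpos_nonneg) auto
    ultimately show "1 + (E - q t - 1) * (sin (\<theta> E t))\<^sup>2 - (1 + (E' - q t - 1) * (sin (\<theta> E' t))\<^sup>2)
         \<le> lip E * (\<theta> E t - \<theta> E' t) + 0"
      by (simp add: algebra_simps)
  qed (use assms \<theta>_0 lip_pos[of E] that in auto)
  moreover have "((\<lambda>\<eta>. \<eta> * t * exp (lip E * t)) \<longlongrightarrow> 0 * t * exp (lip E * t)) (at_right 0)"
    by (intro tendsto_intros)
  moreover have "\<forall>\<^sub>F \<eta> in at_right (0::real). \<eta> > 0" by (simp add: eventually_at_right_less)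
  ultimately have "\<theta> E t - \<theta> E' t \<le> 0 * t * exp (lip E * t)"
    by (intro tendsto_lowerbound[where F = "at_right (0::real)" and f = "\<lambda>\<eta>. \<eta> * t * exp (lip E * t)"])
       (auto elim: eventually_mono)
  thus ?thesis by simp
qed

lemma \<theta>_pos: assumes "t > 0" shows "0 < \<theta> E t"
proof -
  have nn: "0 \<le> \<theta> E t" if "t \<ge> 0" for t
    by (rule barrier_below[OF \<theta>_deriv]) (use that \<theta>_0 in auto)
  show ?thesis
  proof (rule ccontr)
    assume "\<not> 0 < \<theta> E t"
    hence z: "\<theta> E t = 0" using nn[of t] assms by simp
    have "(\<theta> E has_real_derivative 1) (at t within {0..})" using \<theta>_deriv[of t E] z assms by simp
    from has_real_derivative_pos_inc_left[OF this]
    obtain d where d: "d > 0" "\<And>h. 0 < h \<Longrightarrow> t - h \<in> {0..} \<Longrightarrow> h < d \<Longrightarrow> \<theta> E (t - h) < \<theta> E t" by auto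
    define h where "h = min (d / 2) t"
    have "0 < h" "h < d" "t - h \<ge> 0" using d assms by (auto simp: h_def)
    thus False using d(2)[of h] nn[of "t - h"] z by auto
  qed
qed

lemma \<theta>_small: assumes "T > 0" obtains s where "0 < s" "s \<le> T" "\<theta> E s < pi"
proof
  define s where "s = min T (1 / (1 + lip E))"
  show "0 < s" "s \<le> T" using assms lip_pos[of E] by (auto simp: s_def)
  have "\<theta> E s \<le> (1 + lip E) * s" using \<theta>_lipschitz[of 0 s E] \<open>0 < s\<close> \<theta>_0 by (simp add: abs_le_iff)
  also have "\<dots> \<le> (1 + lip E) * (1 / (1 + lip E))" using lip_pos[of E] by (intro mult_left_mono) (auto simp: s_def)
  also have "\<dots> = 1" using lip_pos[of E] by simp
  finally show "\<theta> E s < pi" using pi_gt3 by linarith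
qed

text \<open>If the angles agreed at t, their difference times exp (K s), which is nonnegative and
  nondecreasing, would vanish on all of [0, t]. At an early time with 0 < \<theta> < \<pi>, however,
  its derivative would be (E' - E) sin^2 > 0.\<close>

lemma \<theta>_strict: assumes "E < E'" "t > 0" shows "\<theta> E t < \<theta> E' t"
proof (rule ccontr)
  define K where "K = lip E"
  define u where "u s = \<theta> E' s - \<theta> E s" for s
  define u' where "u' s = (1 + (E' - q s - 1) * (sin (\<theta> E' s))\<^sup>2) - (1 + (E - q s - 1) * (sin (\<theta> E s))\<^sup>2)" for s
  have u': "(u has_real_derivative u' s) (at s within {0..})" if "s \<ge> 0" for s
    unfolding u_def[abs_def] u'_def by (intro DERIV_diff \<theta>_deriv that)
  have u0: "u s \<ge> 0" if "s \<ge> 0" for s using \<theta>_mono[of E E' s] assms that by (simp add: u_def)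
  have ge: "0 \<le> u' s + K * u s" if "s \<ge> 0" for s
  proof -
    have "(E - q s - 1) * (sin (\<theta> E s))\<^sup>2 - (E - q s - 1) * (sin (\<theta> E' s))\<^sup>2 \<le> K * u s"
      using rate_lip[of E s "\<theta> E s" "\<theta> E' s"] u0[OF that] by (simp add: abs_le_iff K_def u_def abs_minus_commute)
    moreover have "(E' - E) * (sin (\<theta> E' s))\<^sup>2 \<ge> 0" using assms by simp
    ultimately show ?thesis by (simp add: u'_def algebra_simps)
  qed
  assume "\<not> \<theta> E t < \<theta> E' t"
  hence ut: "u t = 0" using u0[of t] assms by (simp add: u_def)
  have z: "u s = 0" if "0 \<le> s" "s \<le> t" for s
  proof -
    have "u s * exp (K * s) + 0 * (t - s) \<le> u t * exp (K * t)"
    proof (rule lower_growth)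
      show "((\<lambda>s. u s * exp (K * s)) has_real_derivative (u' s + K * u s) * exp (K * s)) (at s within {0..})" if "s \<ge> 0" for s
        by (rule derivative_eq_intros u' that refl)+ (simp add: algebra_simps)
      show "0 \<le> (u' s + K * u s) * exp (K * s)" if "s \<ge> 0" for s using ge[OF that] by simp
    qed (use that in auto)
    hence "u s * exp (K * s) \<le> 0" using ut by simp
    hence "u s \<le> 0" by (simp add: mult_le_0_iff)
    thus ?thesis using u0[of s] that by simp
  qed
  obtain s where s: "0 < s" "s \<le> t / 2" "\<theta> E' s < pi" using \<theta>_small[of "t / 2" E'] assms by auto
  have "(u has_real_derivative u' s) (at s)" using u'[of s] s at_within_interior[of s "{0..}"] by simp
  hence "u' s = 0"
  proof (rule DERIV_local_const)
    show "0 < s" by fact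
    show "\<forall>y. \<bar>s - y\<bar> < s \<longrightarrow> u s = u y" using z s by (auto simp: abs_less_iff)
  qed
  moreover have "\<theta> E' s = \<theta> E s" using z[of s] s by (simp add: u_def)
  ultimately have "(E' - E) * (sin (\<theta> E' s))\<^sup>2 = 0" by (simp add: u'_def algebra_simps)
  moreover have "sin (\<theta> E' s) > 0" by (rule sin_gt_zero) (use \<theta>_pos s in auto)
  ultimately show False using assms by simp
qed

text \<open>On the line \<pi> / 2 the rate is E - q < 0, so the angle cannot cross it. This supplies
  the low end for counting eigenvalues and makes the rotation number vanish at low energies.\<close>

lemma \<theta>_low: assumes "\<And>t. E < q t" "t \<ge> 0" shows "\<theta> E t \<le> pi / 2"
proof (rule barrier_above[where p = "pi / 2", OF \<theta>_deriv])
  show "1 + (E - q t - 1) * (sin (\<theta> E t))\<^sup>2 < 0" if "\<theta> E t = pi / 2" for t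
    using assms(1)[of t] by (simp add: that)
qed (use assms \<theta>_0 in auto)

section \<open>Dirichlet eigenvalues as crossings of the Pruefer angle\<close>

lemma amplitude:
  obtains r where "\<And>t. r t > 0" "\<And>t. t \<ge> 0 \<Longrightarrow> (r has_real_derivative r t * ((1 + q t - E) * sin (\<theta> E t) * cos (\<theta> E t))) (at t within {0..})"
proof
  define g where "g t = (1 + q t - E) * sin (\<theta> E t) * cos (\<theta> E t)" for t
  have g: "continuous_on {0..} g" unfolding g_def
    by (intro continuous_intros \<theta>_continuous continuous_on_subset[OF q_cont]) auto
  define r where "r t = exp (integral {0..t} g)" for t
  show "r t > 0" for t by (simp add: r_def)
  show "(r has_real_derivative r t * ((1 + q t - E) * sin (\<theta> E t) * cos (\<theta> E t))) (at t within {0..})" if "t \<ge> 0" for t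
    unfolding r_def[abs_def] g_def[symmetric]
    by (rule derivative_eq_intros integral_deriv_half_line[OF g that] refl)+
qed

text \<open>If the angle hits a multiple of \<pi> at L, then r sin \<theta> is an eigenfunction.
  Conversely an eigenfunction, complex-valued and with one-sided derivatives at the ends, is shown
  to be a constant multiple of r sin \<theta>.\<close>

lemma dirichlet_iff:
  assumes L: "L > 0"
  shows "dirichlet_eigenvalue q L E \<longleftrightarrow> sin (\<theta> E L) = 0"
proof -
  obtain r where r0: "\<And>t. r t > 0" and
    r: "\<And>t. t \<ge> 0 \<Longrightarrow> (r has_real_derivative r t * ((1 + q t - E) * sin (\<theta> E t) * cos (\<theta> E t))) (at t within {0..})"
    by (rule amplitude[of E]) (rule that)
  define \<theta>' where "\<theta>' t = 1 + (E - q t - 1) * (sin (\<theta> E t))\<^sup>2" for t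
  have \<theta>': "(\<theta> E has_real_derivative \<theta>' t) (at t within {0..})" if "t \<ge> 0" for t
    unfolding \<theta>'_def by (rule \<theta>_deriv[OF that])
  have sc: "(cos x)\<^sup>2 = 1 - (sin x)\<^sup>2" for x :: real by (simp add: cos_squared_eq)
  have rs: "((\<lambda>t. r t * sin (\<theta> E t)) has_real_derivative r t * cos (\<theta> E t)) (at t within {0..})" if "t \<ge> 0" for t
  proof -
    have "((\<lambda>t. r t * sin (\<theta> E t)) has_real_derivative r t * ((1 + q t - E) * sin (\<theta> E t) * cos (\<theta> E t)) * sin (\<theta> E t) + (cos (\<theta> E t) * \<theta>' t) * r t) (at t within {0..})"
      by (intro DERIV_mult r that DERIV_chain2[OF DERIV_sin] \<theta>')
    also have "r t * ((1 + q t - E) * sin (\<theta> E t) * cos (\<theta> E t)) * sin (\<theta> E t) + (cos (\<theta> E t) * \<theta>' t) * r t = r t * cos (\<theta> E t)"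
      by (simp add: \<theta>'_def power2_eq_square algebra_simps)
    finally show ?thesis .
  qed
  have rc: "((\<lambda>t. r t * cos (\<theta> E t)) has_real_derivative (q t - E) * (r t * sin (\<theta> E t))) (at t within {0..})" if "t \<ge> 0" for t
  proof -
    have "((\<lambda>t. r t * cos (\<theta> E t)) has_real_derivative r t * ((1 + q t - E) * sin (\<theta> E t) * cos (\<theta> E t)) * cos (\<theta> E t) + (- sin (\<theta> E t) * \<theta>' t) * r t) (at t within {0..})"
      by (intro DERIV_mult r that DERIV_chain2[OF DERIV_cos] \<theta>')
    also have "r t * ((1 + q t - E) * sin (\<theta> E t) * cos (\<theta> E t)) * cos (\<theta> E t) + (- sin (\<theta> E t) * \<theta>' t) * r t
       = r t * sin (\<theta> E t) * ((1 + q t - E) * (cos (\<theta> E t))\<^sup>2 - \<theta>' t)"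
      by (simp add: power2_eq_square algebra_simps)
    also have "\<dots> = (q t - E) * (r t * sin (\<theta> E t))"
      unfolding sc \<theta>'_def by (simp add: algebra_simps)
    finally show ?thesis .
  qed
  have sub: "(f has_field_derivative d) (at t within {0..}) \<Longrightarrow> (f has_field_derivative d) (at t within {0..L})" for f :: "real \<Rightarrow> real" and d t
    by (rule DERIV_subset) auto
  have ofr: "((\<lambda>t. complex_of_real (f t)) has_vector_derivative of_real d) (at t within {0..L})"
    if "(f has_real_derivative d) (at t within {0..})" for f d t
    using sub[OF that] bounded_linear.has_vector_derivative[OF bounded_linear_of_real]
    by (auto simp: has_real_derivative_iff_has_vector_derivative)
  show ?thesis
  proof
    assume s: "sin (\<theta> E L) = 0"
    show "dirichlet_eigenvalue q L E" unfolding dirichlet_eigenvalue_def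
    proof (intro exI conjI ballI)
      fix t assume "t \<in> {0..L}"
      hence t: "t \<ge> 0" by simp
      show "((\<lambda>t. complex_of_real (r t * sin (\<theta> E t))) has_vector_derivative complex_of_real (r t * cos (\<theta> E t))) (at t within {0..L})"
        by (rule ofr[OF rs[OF t]])
      show "((\<lambda>t. complex_of_real (r t * cos (\<theta> E t))) has_vector_derivative complex_of_real ((q t - E) * (r t * sin (\<theta> E t)))) (at t within {0..L})"
        by (rule ofr[OF rc[OF t]])
      show "- complex_of_real ((q t - E) * (r t * sin (\<theta> E t))) + complex_of_real (q t) * complex_of_real (r t * sin (\<theta> E t)) = complex_of_real E * complex_of_real (r t * sin (\<theta> E t))"
        by (simp add: algebra_simps)
    next
      show "complex_of_real (r 0 * sin (\<theta> E 0)) = 0" by (simp add: \<theta>_0)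
      show "complex_of_real (r L * sin (\<theta> E L)) = 0" by (simp add: s)
      obtain x where x: "0 < x" "x \<le> L" "\<theta> E x < pi" by (rule \<theta>_small[OF L])
      have "sin (\<theta> E x) > 0" by (rule sin_gt_zero) (use \<theta>_pos x in auto)
      thus "\<exists>t\<in>{0..L}. complex_of_real (r t * sin (\<theta> E t)) \<noteq> 0"
        using x r0[of x] by (intro bexI[of _ x]) auto
    qed
  next
    assume "dirichlet_eigenvalue q L E"
    then obtain y y' y'' where y: "\<And>t. t \<in> {0..L} \<Longrightarrow> (y has_vector_derivative y' t) (at t within {0..L})"
      "\<And>t. t \<in> {0..L} \<Longrightarrow> (y' has_vector_derivative y'' t) (at t within {0..L})"
      "\<And>t. t \<in> {0..L} \<Longrightarrow> - y'' t + complex_of_real (q t) * y t = complex_of_real E * y t"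
      "y 0 = 0" "y L = 0" "\<exists>t\<in>{0..L}. y t \<noteq> 0"
      unfolding dirichlet_eigenvalue_def by blast
    have y'': "y'' t = of_real (q t - E) * y t" if "t \<in> {0..L}" for t
      using y(3)[OF that] by (simp add: algebra_simps)
    \<comment> \<open>The Wronskian of y with the Pruefer solution r sin \<theta>. Both vanish at 0,
      so it is identically 0 and (y, y') is parallel to (sin \<theta>, cos \<theta>).\<close>
    define W where "W t = y t * of_real (r t * cos (\<theta> E t)) - y' t * of_real (r t * sin (\<theta> E t))" for t
    have W: "(W has_vector_derivative 0) (at t within {0..L})" if t: "t \<in> {0..L}" for t
    proof -
      have t0: "t \<ge> 0" using t by simp
      have "(W has_vector_derivative (y t * of_real ((q t - E) * (r t * sin (\<theta> E t))) + y' t * of_real (r t * cos (\<theta> E t))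
          - (y' t * of_real (r t * cos (\<theta> E t)) + y'' t * of_real (r t * sin (\<theta> E t))))) (at t within {0..L})"
        unfolding W_def[abs_def]
        by (intro has_vector_derivative_diff has_vector_derivative_mult y t ofr rs rc t0)
      thus ?thesis by (rule has_vector_derivative_eq_rhs) (simp add: y''[OF t])
    qed
    obtain C where "\<And>t. t \<in> {0..L} \<Longrightarrow> W t = C"
      by (rule has_vector_derivative_zero_constant[OF _ W]) auto
    hence "W t = W 0" if "t \<in> {0..L}" for t using that L by simp
    hence W0: "W t = 0" if "t \<in> {0..L}" for t using that by (simp add: W_def y(4) \<theta>_0)
    define N where "N t = y t * of_real (sin (\<theta> E t)) + y' t * of_real (cos (\<theta> E t))" for t
    have rel: "y t * of_real (cos (\<theta> E t)) = y' t * of_real (sin (\<theta> E t))" if "t \<in> {0..L}" for t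
      using W0[OF that] r0[of t] by (simp add: W_def mult.left_commute)
    have one: "of_real (sin x) * of_real (sin x) + of_real (cos x) * of_real (cos x) = (1::complex)" for x
      unfolding of_real_mult[symmetric] of_real_add[symmetric] by (simp flip: power2_eq_square)
    have yN: "y t = N t * of_real (sin (\<theta> E t))" "y' t = N t * of_real (cos (\<theta> E t))" if "t \<in> {0..L}" for t
    proof -
      have "N t * of_real (sin (\<theta> E t)) = y t * (of_real (sin (\<theta> E t)) * of_real (sin (\<theta> E t))) + (y' t * of_real (sin (\<theta> E t))) * of_real (cos (\<theta> E t))"
        by (simp add: N_def algebra_simps)
      also have "\<dots> = y t * (of_real (sin (\<theta> E t)) * of_real (sin (\<theta> E t)) + of_real (cos (\<theta> E t)) * of_real (cos (\<theta> E t)))"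
        unfolding rel[OF that, symmetric] by (simp add: algebra_simps)
      finally show "y t = N t * of_real (sin (\<theta> E t))" by (simp add: one)
      have "N t * of_real (cos (\<theta> E t)) = (y t * of_real (cos (\<theta> E t))) * of_real (sin (\<theta> E t)) + y' t * (of_real (cos (\<theta> E t)) * of_real (cos (\<theta> E t)))"
        by (simp add: N_def algebra_simps)
      also have "\<dots> = y' t * (of_real (sin (\<theta> E t)) * of_real (sin (\<theta> E t)) + of_real (cos (\<theta> E t)) * of_real (cos (\<theta> E t)))"
        unfolding rel[OF that] by (simp add: algebra_simps)
      finally show "y' t = N t * of_real (cos (\<theta> E t))" by (simp add: one)
    qed
    define g where "g t = (1 + q t - E) * sin (\<theta> E t) * cos (\<theta> E t)" for t
    have inv: "((\<lambda>t. inverse (r t)) has_real_derivative - (g t * inverse (r t))) (at t within {0..})" if "t \<ge> 0" for t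
      by (rule DERIV_cong[OF DERIV_inverse_fun[OF r[OF that]]]) (use r0[of t] in \<open>auto simp: g_def field_simps\<close>)
    \<comment> \<open>The factor of proportionality N obeys the same linear equation as the
      amplitude r, so N / r is constant.\<close>
    have Nr: "((\<lambda>t. N t * of_real (inverse (r t))) has_vector_derivative 0) (at t within {0..L})" if t: "t \<in> {0..L}" for t
    proof -
      have t0: "t \<ge> 0" using t by simp
      have ds: "((\<lambda>t. complex_of_real (sin (\<theta> E t))) has_vector_derivative of_real (cos (\<theta> E t) * \<theta>' t)) (at t within {0..L})"
        by (rule ofr, rule DERIV_chain2[OF DERIV_sin \<theta>'[OF t0]])
      have dc: "((\<lambda>t. complex_of_real (cos (\<theta> E t))) has_vector_derivative of_real (- sin (\<theta> E t) * \<theta>' t)) (at t within {0..L})"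
        by (rule ofr, rule DERIV_chain2[OF DERIV_cos \<theta>'[OF t0]])
      have "(N has_vector_derivative (y t * of_real (cos (\<theta> E t) * \<theta>' t) + y' t * of_real (sin (\<theta> E t))
           + (y' t * of_real (- sin (\<theta> E t) * \<theta>' t) + y'' t * of_real (cos (\<theta> E t))))) (at t within {0..L})"
        unfolding N_def[abs_def]
        by (intro has_vector_derivative_add has_vector_derivative_mult y t ds dc)
      also have "y t * of_real (cos (\<theta> E t) * \<theta>' t) + y' t * of_real (sin (\<theta> E t))
           + (y' t * of_real (- sin (\<theta> E t) * \<theta>' t) + y'' t * of_real (cos (\<theta> E t))) = N t * of_real (g t)"
        unfolding y''[OF t] yN[OF t] g_def by (simp add: algebra_simps)
      finally have N': "(N has_vector_derivative N t * of_real (g t)) (at t within {0..L})" .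
      have "((\<lambda>t. N t * of_real (inverse (r t))) has_vector_derivative
         N t * of_real (- (g t * inverse (r t))) + N t * of_real (g t) * of_real (inverse (r t))) (at t within {0..L})"
        by (intro has_vector_derivative_mult N' ofr inv t0)
      thus ?thesis by (rule has_vector_derivative_eq_rhs) simp
    qed
    obtain C where C: "\<And>t. t \<in> {0..L} \<Longrightarrow> N t * of_real (inverse (r t)) = C"
      by (rule has_vector_derivative_zero_constant[OF _ Nr]) auto
    show "sin (\<theta> E L) = 0"
    proof (rule ccontr)
      assume s: "sin (\<theta> E L) \<noteq> 0"
      have "N L = 0" using yN(1)[of L] y(5) s L by simp
      hence "C = 0" using C[of L] L by simp
      hence "N t = 0" if "t \<in> {0..L}" for t using C[OF that] r0[of t] by simp
      hence "y t = 0" if "t \<in> {0..L}" for t using yN(1)[OF that] that by simp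
      thus False using y(6) by blast
    qed
  qed
qed

text \<open>As a function of the energy, \<theta> at L is continuous, strictly increasing and at
  most \<pi> / 2 at very low energies. It therefore takes each value m \<pi> with 1 \<le> m \<le> n
  exactly once up to E, and these crossings are the eigenvalues.\<close>

lemma eigenvalue_count:
  assumes L: "L > 0"
  shows "card {e. dirichlet_eigenvalue q L e \<and> e \<le> E} = nat \<lfloor>\<theta> E L / pi\<rfloor>"
proof -
  define n where "n = nat \<lfloor>\<theta> E L / pi\<rfloor>"
  have pos: "0 < \<theta> e L" for e using \<theta>_pos[OF L] .
  have n: "real m * pi \<le> \<theta> E L \<longleftrightarrow> m \<le> n" for m
  proof -
    have "m \<le> n \<longleftrightarrow> int m \<le> \<lfloor>\<theta> E L / pi\<rfloor>" unfolding n_def using pos[of E] by (simp add: le_nat_iff)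
    also have "\<dots> \<longleftrightarrow> real m \<le> \<theta> E L / pi" by (simp add: le_floor_iff)
    finally show ?thesis by (simp add: pos_le_divide_eq)
  qed
  have "\<exists>e\<le>E. \<theta> e L = real m * pi" if m: "m \<in> {1..n}" for m
  proof -
    \<comment> \<open>The value - Q - 1 lies strictly below the potential, so
      \<open>\<theta>_low\<close> applies; the minimum with E gives an interval for the intermediate
      value theorem.\<close>
    define e0 where "e0 = min E (- Q - 1)"
    have "e0 < q t" for t using q_bound[of t] by (simp add: e0_def abs_le_iff min_less_iff_disj)
    hence "\<theta> e0 L \<le> pi / 2" using L by (intro \<theta>_low) auto
    also have "\<dots> \<le> real m * pi" using m by simp
    finally have 1: "\<theta> e0 L \<le> real m * pi" .
    have 2: "real m * pi \<le> \<theta> E L" using n m by simp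
    have "\<exists>x\<ge>e0. x \<le> E \<and> \<theta> x L = real m * pi"
      by (rule IVT'[of "\<lambda>e. \<theta> e L" e0 "real m * pi" E, OF 1 2]) (use L in \<open>auto simp: e0_def intro: continuous_on_subset[OF \<theta>_energy_continuous]\<close>)
    thus ?thesis by blast
  qed
  hence "\<forall>m\<in>{1..n}. \<exists>e. e \<le> E \<and> \<theta> e L = real m * pi" by blast
  from bchoice[OF this] obtain g where g: "\<And>m. m \<in> {1..n} \<Longrightarrow> g m \<le> E \<and> \<theta> (g m) L = real m * pi" by blast
  have inj: "e = e'" if "\<theta> e L = \<theta> e' L" for e e'
    using \<theta>_strict[OF _ L, of e e'] \<theta>_strict[OF _ L, of e' e] that by (cases e e' rule: linorder_cases) auto
  have "{e. dirichlet_eigenvalue q L e \<and> e \<le> E} = g ` {1..n}"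
  proof (intro equalityI subsetI)
    fix e assume "e \<in> {e. dirichlet_eigenvalue q L e \<and> e \<le> E}"
    hence e: "sin (\<theta> e L) = 0" "e \<le> E" using dirichlet_iff[OF L] by auto
    from e(1) obtain i :: int where i: "\<theta> e L = of_int i * pi" by (auto simp: sin_zero_iff_int2)
    have "i > 0" using pos[of e] i by (simp add: zero_less_mult_iff)
    define m where "m = nat i"
    have m: "\<theta> e L = real m * pi" "m \<ge> 1" using i \<open>i > 0\<close> by (auto simp: m_def)
    have "real m * pi \<le> \<theta> E L" using \<theta>_mono[OF e(2), of L] L m by simp
    hence mn: "m \<in> {1..n}" using n m by simp
    have "e = g m" by (rule inj) (use g[OF mn] m in simp)
    thus "e \<in> g ` {1..n}" using mn by blast
  next
    fix e assume "e \<in> g ` {1..n}"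
    thus "e \<in> {e. dirichlet_eigenvalue q L e \<and> e \<le> E}" using g dirichlet_iff[OF L] by (auto simp: sin_npi)
  qed
  moreover have "inj_on g {1..n}"
  proof (rule inj_onI)
    fix x y assume xy: "x \<in> {1..n}" "y \<in> {1..n}" "g x = g y"
    have "real x * pi = \<theta> (g x) L" using g[OF xy(1)] by presburger
    also have "\<dots> = real y * pi" unfolding xy(3) using g[OF xy(2)] by presburger
    finally show "x = y" by simp
  qed
  ultimately show ?thesis by (simp add: card_image n_def)
qed

lemma eigenvalue_density:
  assumes "((\<lambda>t. \<theta> E t / t) \<longlongrightarrow> r) at_top"
  shows "((\<lambda>L. real (card {e. dirichlet_eigenvalue q L e \<and> e \<le> E}) / L) \<longlongrightarrow> r / pi) at_top"
proof -
  define h where "h t = real (nat \<lfloor>\<theta> E t / pi\<rfloor>) - \<theta> E t / pi" for t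
  have h: "\<bar>h t\<bar> \<le> 1" if "t \<ge> 0" for t
  proof -
    have "0 \<le> \<theta> E t" using \<theta>_pos[of t E] \<theta>_0[of E] that by (cases "t = 0") auto
    hence "0 \<le> \<theta> E t / pi" by simp
    hence "real (nat \<lfloor>\<theta> E t / pi\<rfloor>) = of_int \<lfloor>\<theta> E t / pi\<rfloor>" by simp
    thus ?thesis unfolding h_def by linarith
  qed
  have "((\<lambda>t. \<theta> E t / t / pi + h t / t) \<longlongrightarrow> r / pi + 0) at_top"
    by (intro tendsto_add tendsto_divide assms bounded_over_t[OF h] tendsto_const) auto
  moreover have "\<forall>\<^sub>F t in at_top. \<theta> E t / t / pi + h t / t = real (card {e. dirichlet_eigenvalue q t e \<and> e \<le> E}) / t"
    using eventually_gt_at_top[of 0]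
    by eventually_elim (simp add: eigenvalue_count h_def diff_divide_distrib)
  ultimately show ?thesis by (simp add: tendsto_cong)
qed

section \<open>Existence of the rotation number from almost periodicity\<close>

lemma block_comparison:
  assumes close: "\<And>t. t \<ge> 0 \<Longrightarrow> \<bar>q (s + t) - q (s' + t)\<bar> \<le> \<epsilon>"
    and "0 \<le> s" "0 \<le> s'" "0 < \<epsilon>" "0 \<le> L" "2 * \<epsilon> * L * exp (lip E * L) \<le> 1"
  shows "\<theta> E (s + L) - \<theta> E s \<le> \<theta> E (s' + L) - \<theta> E s' + (pi + 1)"
proof -
  \<comment> \<open>The least multiple of \<pi> that lifts the second angle to the first at the
    start; it overshoots by at most \<pi>. The rate has period \<pi> in the angle, so the lifted
    curve obeys the same equation. Over the block Gronwall adds at most 1, whence the loss \<pi> +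
    1.\<close>
  define m where "m = \<lceil>(\<theta> E s - \<theta> E s') / pi\<rceil>"
  have m1: "\<theta> E s \<le> \<theta> E s' + of_int m * pi"
  proof -
    have "(\<theta> E s - \<theta> E s') / pi \<le> of_int m" unfolding m_def by (rule le_of_int_ceiling)
    thus ?thesis by (simp add: pos_divide_le_eq)
  qed
  have m2: "\<theta> E s' + of_int m * pi \<le> \<theta> E s + pi"
  proof -
    have "of_int m \<le> (\<theta> E s - \<theta> E s') / pi + 1" unfolding m_def by (rule of_int_ceiling_le_add_one)
    hence "of_int m * pi \<le> ((\<theta> E s - \<theta> E s') / pi + 1) * pi" by (intro mult_right_mono) auto
    thus ?thesis by (simp add: distrib_right)
  qed
  have per: "(sin (x + of_int m * pi))\<^sup>2 = (sin x)\<^sup>2" for x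
  proof -
    have s: "sin (of_int m * pi) = 0" by (auto simp: sin_zero_iff_int2)
    have "(cos (of_int m * pi))\<^sup>2 = 1" unfolding cos_squared_eq s by simp
    thus ?thesis unfolding sin_add s by (simp add: power_mult_distrib)
  qed
  define D where "D t = \<theta> E (s + t) - (\<theta> E (s' + t) + of_int m * pi)" for t
  define rate where "rate u x = 1 + (E - q u - 1) * (sin x)\<^sup>2" for u x
  have sh: "((\<lambda>t. \<theta> E (u + t)) has_real_derivative rate (u + t) (\<theta> E (u + t))) (at t within {0..})"
    if "u \<ge> 0" "t \<ge> 0" for u t
  proof -
    have "((\<lambda>t. u + t) has_real_derivative 1) (at t within {0..})"
      by (rule derivative_eq_intros refl)+ simp
    moreover have "(\<theta> E has_real_derivative rate (u + t) (\<theta> E (u + t))) (at (u + t) within (\<lambda>t. u + t) ` {0..})"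
      unfolding rate_def by (rule DERIV_subset[OF \<theta>_deriv]) (use that in auto)
    ultimately show ?thesis using DERIV_image_chain[of "\<theta> E" _ "\<lambda>t. u + t" t "{0..}" 1] by (simp add: o_def)
  qed
  have "D L \<le> 2 * \<epsilon> * L * exp (lip E * L)"
  proof (rule gronwall_less[where \<epsilon> = \<epsilon> and t = L])
    show "(D has_real_derivative rate (s + t) (\<theta> E (s + t)) - (rate (s' + t) (\<theta> E (s' + t)) + 0)) (at t within {0..})" if "t \<ge> 0" for t
      unfolding D_def[abs_def] using assms that by (intro DERIV_diff DERIV_add DERIV_const sh) auto
    fix t assume t: "t \<ge> 0" "D t \<ge> 0"
    define x where "x = \<theta> E (s + t)"
    define y where "y = \<theta> E (s' + t) + of_int m * pi"
    have Dt: "D t = x - y" by (simp add: D_def x_def y_def)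
    have "(E - q (s + t) - 1) * (sin x)\<^sup>2 - (E - q (s + t) - 1) * (sin y)\<^sup>2 \<le> lip E * (x - y)"
      using rate_lip[of E "s + t" x y] t Dt by (simp add: abs_le_iff)
    moreover have "(q (s' + t) - q (s + t)) * (sin y)\<^sup>2 \<le> \<epsilon> * 1"
      using close[OF t(1)] assms(4) by (intro mult_mono) (auto simp: abs_le_iff abs_square_le_1)
    moreover have "(sin (\<theta> E (s' + t)))\<^sup>2 = (sin y)\<^sup>2" by (simp add: y_def per)
    ultimately show "rate (s + t) (\<theta> E (s + t)) - (rate (s' + t) (\<theta> E (s' + t)) + 0) \<le> lip E * D t + \<epsilon>"
      unfolding Dt rate_def x_def[symmetric] by (simp add: algebra_simps)
  qed (use m1 assms lip_pos[of E] in \<open>auto simp: D_def\<close>)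
  hence "D L \<le> 1" using assms by linarith
  thus ?thesis using m2 by (simp add: D_def)
qed

text \<open>The angles are realigned modulo \<pi> at the start of every block, so the exponential
  factor of one block never compounds; each block costs only the constant \<pi> + 1.\<close>

lemma blocks_comparison:
  assumes close: "\<And>t. t \<ge> 0 \<Longrightarrow> \<bar>q (s + t) - q (s' + t)\<bar> \<le> \<epsilon>"
    and "0 \<le> s" "0 \<le> s'" "0 < \<epsilon>" "0 \<le> L" "2 * \<epsilon> * L * exp (lip E * L) \<le> 1"
  shows "\<theta> E (s + real m * L) - \<theta> E s \<le> \<theta> E (s' + real m * L) - \<theta> E s' + real m * (pi + 1)"
proof (induction m)
  case (Suc m)
  have "\<bar>q (s + real m * L + t) - q (s' + real m * L + t)\<bar> \<le> \<epsilon>" if "t \<ge> 0" for t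
    using close[of "real m * L + t"] that assms(5) by (simp add: add.assoc)
  from block_comparison[OF this _ _ assms(4-6)]
  have "\<theta> E (s + real m * L + L) - \<theta> E (s + real m * L) \<le> \<theta> E (s' + real m * L + L) - \<theta> E (s' + real m * L) + (pi + 1)"
    using assms by simp
  with Suc show ?case by (simp add: algebra_simps)
qed simp

text \<open>The block length L makes the cost \<pi> + 1 per block equal to e / 2 per unit of time,
  and L determines the tolerance \<epsilon> for translates. A bounded s' can then replace any s, and
  T is taken so long that passing from s' to 0, which costs 2 C l, is at most e T / 2.\<close>

lemma almost_additive:
  assumes ap: "\<And>\<epsilon>. \<epsilon> > 0 \<Longrightarrow> \<exists>l\<ge>0. \<forall>s\<ge>0. \<exists>s'. 0 \<le> s' \<and> s' \<le> l \<and> (\<forall>t\<ge>0. \<bar>q (s + t) - q (s' + t)\<bar> \<le> \<epsilon>)"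
    and e: "e > 0"
  obtains T where "T > 0" "\<And>s. s \<ge> 0 \<Longrightarrow> \<bar>\<theta> E (s + T) - \<theta> E s - \<theta> E T\<bar> \<le> e * T"
proof -
  define C where "C = 1 + lip E"
  have C: "C > 0" using lip_pos[of E] by (simp add: C_def)
  define L where "L = 2 * (pi + 1) / e"
  have L: "L > 0" using e pi_gt_zero by (simp add: L_def add_pos_pos)
  define \<epsilon> where "\<epsilon> = 1 / (2 * L * exp (lip E * L))"
  have \<epsilon>: "\<epsilon> > 0" "2 * \<epsilon> * L * exp (lip E * L) \<le> 1" using L by (auto simp: \<epsilon>_def)
  obtain l where l: "l \<ge> 0" "\<And>s. s \<ge> 0 \<Longrightarrow> \<exists>s'. 0 \<le> s' \<and> s' \<le> l \<and> (\<forall>t\<ge>0. \<bar>q (s + t) - q (s' + t)\<bar> \<le> \<epsilon>)"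
    using ap[OF \<epsilon>(1)] by blast
  obtain m :: nat where m: "4 * C * l / (e * L) + 1 \<le> real m" using real_arch_simple by blast
  have m0: "real m > 0" using m l C e L by (smt (verit) divide_nonneg_pos mult_nonneg_nonneg mult_pos_pos)
  define T where "T = real m * L"
  have T: "T > 0" using m0 L by (simp add: T_def)
  have "4 * C * l / (e * L) \<le> real m" using m by linarith
  hence "4 * C * l \<le> real m * (e * L)" using e L by (simp add: pos_divide_le_eq)
  hence Cl: "2 * (C * l) \<le> e * T / 2" by (simp add: T_def mult_ac)
  have mp: "real m * (pi + 1) = e * T / 2" using e by (simp add: T_def L_def)
  show ?thesis
  proof (rule that[OF T])
    fix s :: real assume s: "s \<ge> 0"
    then obtain s' where s': "0 \<le> s'" "s' \<le> l" "\<And>t. t \<ge> 0 \<Longrightarrow> \<bar>q (s + t) - q (s' + t)\<bar> \<le> \<epsilon>" using l(2) by blast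
    have 1: "\<theta> E (s + T) - \<theta> E s \<le> \<theta> E (s' + T) - \<theta> E s' + e * T / 2"
      unfolding T_def mp[symmetric, unfolded T_def] by (rule blocks_comparison[OF s'(3) s s'(1) \<epsilon>(1) less_imp_le[OF L] \<epsilon>(2)])
    have "\<And>t. t \<ge> 0 \<Longrightarrow> \<bar>q (s' + t) - q (s + t)\<bar> \<le> \<epsilon>" using s'(3) by (simp add: abs_minus_commute)
    hence 2: "\<theta> E (s' + T) - \<theta> E s' \<le> \<theta> E (s + T) - \<theta> E s + e * T / 2"
      unfolding T_def mp[symmetric, unfolded T_def] by (rule blocks_comparison[OF _ s'(1) s \<epsilon>(1) less_imp_le[OF L] \<epsilon>(2)])
    have "\<bar>\<theta> E (s' + T) - \<theta> E T\<bar> \<le> C * (s' + T - T)" unfolding C_def using s' T by (intro \<theta>_lipschitz) auto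
    moreover have "\<bar>\<theta> E s' - \<theta> E 0\<bar> \<le> C * (s' - 0)" unfolding C_def using s' by (intro \<theta>_lipschitz) auto
    moreover have "C * s' \<le> C * l" using s' C by (intro mult_left_mono) auto
    ultimately have "\<bar>\<theta> E (s' + T) - \<theta> E T\<bar> \<le> C * l" "\<bar>\<theta> E s'\<bar> \<le> C * l" using \<theta>_0 by auto
    with 1 2 Cl show "\<bar>\<theta> E (s + T) - \<theta> E s - \<theta> E T\<bar> \<le> e * T" by linarith
  qed
qed

lemma almost_linear:
  assumes ap: "\<And>\<epsilon>. \<epsilon> > 0 \<Longrightarrow> \<exists>l\<ge>0. \<forall>s\<ge>0. \<exists>s'. 0 \<le> s' \<and> s' \<le> l \<and> (\<forall>t\<ge>0. \<bar>q (s + t) - q (s' + t)\<bar> \<le> \<epsilon>)"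
    and e: "e > 0"
  obtains \<rho> where "\<forall>\<^sub>F t in at_top. \<bar>\<theta> E t / t - \<rho>\<bar> \<le> e"
proof -
  obtain T where T: "T > 0" "\<And>s. s \<ge> 0 \<Longrightarrow> \<bar>\<theta> E (s + T) - \<theta> E s - \<theta> E T\<bar> \<le> e / 2 * T"
    by (rule almost_additive[OF ap, of "e / 2" E]) (use e that in auto)
  have n: "\<bar>\<theta> E (real n * T) - real n * \<theta> E T\<bar> \<le> real n * (e / 2 * T)" for n
  proof (induction n)
    case 0 thus ?case by (simp add: \<theta>_0)
  next
    case (Suc n)
    have "\<bar>\<theta> E (real n * T + T) - \<theta> E (real n * T) - \<theta> E T\<bar> \<le> e / 2 * T" using T by (intro T(2)) auto
    moreover have S: "real (Suc n) * x = real n * x + x" for x by (simp add: algebra_simps)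
    moreover have "\<bar>X - (N + B)\<bar> \<le> v + u" if "\<bar>X - A - B\<bar> \<le> u" "\<bar>A - N\<bar> \<le> v" for X A B N u v :: real
      using that by linarith
    ultimately show ?case using Suc unfolding S by blast
  qed
  define C where "C = 1 + lip E"
  have C: "C > 0" using lip_pos[of E] by (simp add: C_def)
  define \<rho> where "\<rho> = \<theta> E T / T"
  define B where "B = C * T + \<bar>\<theta> E T\<bar>"
  have B: "\<bar>\<theta> E t - \<rho> * t\<bar> \<le> e / 2 * t + B" if t: "t \<ge> 0" for t
  proof -
    define n where "n = nat \<lfloor>t / T\<rfloor>"
    have n1: "real n \<le> t / T" "t / T < real n + 1" using t T by (auto simp: n_def)
    have nT: "real n * T \<le> t" "t - real n * T \<le> T"
    proof -
      show "real n * T \<le> t" using n1(1) T(1) by (simp add: pos_le_divide_eq)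
      have "t < (real n + 1) * T" using n1(2) T(1) by (simp add: pos_divide_less_eq)
      thus "t - real n * T \<le> T" by (simp add: distrib_right)
    qed
    have "\<bar>\<theta> E t - \<theta> E (real n * T)\<bar> \<le> C * (t - real n * T)" unfolding C_def using T nT by (intro \<theta>_lipschitz) auto
    also have "\<dots> \<le> C * T" using C nT by (intro mult_left_mono) auto
    finally have 1: "\<bar>\<theta> E t - \<theta> E (real n * T)\<bar> \<le> C * T" .
    have "real n * \<theta> E T - \<rho> * t = \<theta> E T * (real n - t / T)" using T by (simp add: \<rho>_def field_simps)
    hence "\<bar>real n * \<theta> E T - \<rho> * t\<bar> = \<bar>\<theta> E T\<bar> * \<bar>real n - t / T\<bar>" by (simp only: abs_mult)
    also have "\<dots> \<le> \<bar>\<theta> E T\<bar> * 1" using n1 by (intro mult_left_mono) auto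
    finally have 2: "\<bar>real n * \<theta> E T - \<rho> * t\<bar> \<le> \<bar>\<theta> E T\<bar>" by simp
    have "real n * (e / 2 * T) \<le> e / 2 * t" using nT e mult_left_mono[of "real n * T" t "e / 2"] by (simp add: mult_ac)
    thus ?thesis using n[of n] 1 2 unfolding B_def by linarith
  qed
  have "\<forall>\<^sub>F t in at_top. \<bar>\<theta> E t / t - \<rho>\<bar> \<le> e"
    using eventually_gt_at_top[of 0] eventually_ge_at_top[of "2 * B / e"]
  proof eventually_elim
    case (elim t)
    have "2 * B \<le> t * e" using elim e by (simp add: pos_divide_le_eq)
    hence "\<bar>\<theta> E t - \<rho> * t\<bar> \<le> e * t" using B[of t] elim by (simp add: mult_ac)
    moreover have "\<theta> E t / t - \<rho> = (\<theta> E t - \<rho> * t) / t" using elim by (simp add: field_simps)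
    ultimately show ?case using elim by (simp add: pos_divide_le_eq)
  qed
  thus ?thesis by (rule that)
qed

lemma limit_exists:
  assumes ap: "\<And>\<epsilon>. \<epsilon> > 0 \<Longrightarrow> \<exists>l\<ge>0. \<forall>s\<ge>0. \<exists>s'. 0 \<le> s' \<and> s' \<le> l \<and> (\<forall>t\<ge>0. \<bar>q (s + t) - q (s' + t)\<bar> \<le> \<epsilon>)"
  shows "\<exists>\<rho>. ((\<lambda>t. \<theta> E t / t) \<longlongrightarrow> \<rho>) at_top"
proof (rule approx_constant_convergent)
  fix e :: real assume e: "e > 0"
  obtain \<rho> where "\<forall>\<^sub>F t in at_top. \<bar>\<theta> E t / t - \<rho>\<bar> \<le> e"
    by (rule almost_linear[OF ap e, of E]) (assumption, rule that)
  thus "\<exists>\<rho>. \<forall>\<^sub>F t in at_top. \<bar>\<theta> E t / t - \<rho>\<bar> \<le> e" by blast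
qed

end

section \<open>Fourier expansion of analytic potentials\<close>

text \<open>By Morera: the integral over a triangle is exchanged with the parameter integral, by
  Fubini for continuous integrands, and vanishes for every parameter.\<close>

lemma holomorphic_parameter_integral:
  fixes h :: "complex \<Rightarrow> real \<Rightarrow> complex"
  assumes cont: "continuous_on (S \<times> {0..1}) (\<lambda>(w, u). h w u)" and S: "open S"
    and hol: "\<And>u. u \<in> {0..1} \<Longrightarrow> (\<lambda>w. h w u) holomorphic_on S"
  shows "(\<lambda>w. integral {0..1} (h w)) holomorphic_on S"
proof -
  have "continuous_on S (\<lambda>w. integral (cbox 0 1) (h w))"
    by (rule integral_continuous_on_param) (use cont in simp)
  hence c: "continuous_on S (\<lambda>w. integral {0..1} (h w))" by simp
  have "(\<lambda>w. integral {0..1} (h w)) analytic_on S"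
  proof (rule Morera_triangle[OF c S], intro impI)
    fix a b c :: complex assume sub: "convex hull {a, b, c} \<subseteq> S"
    have seg: "closed_segment a b \<subseteq> S" "closed_segment b c \<subseteq> S" "closed_segment c a \<subseteq> S"
      using sub by (auto simp: segment_convex_hull intro!: order.trans[OF hull_mono sub])
    have L: "contour_integral (linepath p r) (\<lambda>w. integral {0..1} (h w))
        = integral {0..1} (\<lambda>u. contour_integral (linepath p r) (\<lambda>w. h w u))
      \<and> (\<lambda>u. contour_integral (linepath p r) (\<lambda>w. h w u)) integrable_on {0..1}"
      if pr: "closed_segment p r \<subseteq> S" for p r
    proof -
      define k where "k x u = h (linepath p r x) u * (r - p)" for x u :: real
      have lp: "linepath p r x \<in> S" if "x \<in> {0..1}" for x
        using pr that by (auto simp: linepath_in_path)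
      have "continuous_on ({0..1} \<times> {0..1}) (\<lambda>z. (\<lambda>(w, u). h w u) (linepath p r (fst z), snd z))"
        by (rule continuous_on_compose2[OF cont])
           (use lp in \<open>auto intro!: continuous_intros simp: linepath_def\<close>)
      hence k: "continuous_on ({0..1} \<times> {0..1}) (\<lambda>(x, u). k x u)"
        unfolding k_def case_prod_beta by (intro continuous_intros) simp
      have k': "continuous_on ({0..1} \<times> {0..1}) (\<lambda>(u, x). k x u)"
      proof -
        have "continuous_on ({0..1} \<times> {0..1}) (\<lambda>z. (\<lambda>(x, u). k x u) (snd z, fst z))"
          by (rule continuous_on_compose2[OF k]) (auto intro!: continuous_intros)
        thus ?thesis by (simp add: case_prod_beta)
      qed
      have ci: "contour_integral (linepath p r) g = integral {0..1} (\<lambda>x. g (linepath p r x) * (r - p))" for g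
        by (simp add: contour_integral_integral)
      have "contour_integral (linepath p r) (\<lambda>w. integral {0..1} (h w)) = integral {0..1} (\<lambda>x. integral {0..1} (k x))"
        unfolding ci k_def by simp
      also have "\<dots> = integral {0..1} (\<lambda>u. integral {0..1} (\<lambda>x. k x u))"
        using integral_swap_continuous[of 0 0 1 1 k] k by (simp add: cbox_Pair_eq)
      also have "\<dots> = integral {0..1} (\<lambda>u. contour_integral (linepath p r) (\<lambda>w. h w u))"
        unfolding ci k_def by simp
      finally have 1: "contour_integral (linepath p r) (\<lambda>w. integral {0..1} (h w))
        = integral {0..1} (\<lambda>u. contour_integral (linepath p r) (\<lambda>w. h w u))" .
      have "continuous_on {0..1} (\<lambda>u. integral (cbox 0 1) (\<lambda>x. k x u))"
        by (rule integral_continuous_on_param) (use k' in simp)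
      hence "(\<lambda>u. integral {0..1} (\<lambda>x. k x u)) integrable_on {0..1}"
        by (intro integrable_continuous_real) simp
      thus ?thesis using 1 unfolding ci[abs_def] k_def by simp
    qed
    note L1 = L[OF seg(1)] and L2 = L[OF seg(2)] and L3 = L[OF seg(3)]
    have zero: "contour_integral (linepath a b) (\<lambda>w. h w u) + contour_integral (linepath b c) (\<lambda>w. h w u)
       + contour_integral (linepath c a) (\<lambda>w. h w u) = 0" if "u \<in> {0..1}" for u
    proof -
      have "(\<lambda>w. h w u) holomorphic_on convex hull {a, b, c}" by (rule holomorphic_on_subset[OF hol[OF that] sub])
      from Cauchy_theorem_triangle[OF this]
      have *: "((\<lambda>w. h w u) has_contour_integral 0) (linepath a b +++ linepath b c +++ linepath c a)" .
      hence i: "(\<lambda>w. h w u) contour_integrable_on (linepath a b +++ linepath b c +++ linepath c a)"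
        by (rule has_contour_integral_integrable)
      have "contour_integral (linepath a b +++ linepath b c +++ linepath c a) (\<lambda>w. h w u) = 0"
        using * by (rule contour_integral_unique)
      thus ?thesis using i by (simp add: add.assoc)
    qed
    have "contour_integral (linepath a b) (\<lambda>w. integral {0..1} (h w)) + contour_integral (linepath b c) (\<lambda>w. integral {0..1} (h w))
        + contour_integral (linepath c a) (\<lambda>w. integral {0..1} (h w))
      = integral {0..1} (\<lambda>u. contour_integral (linepath a b) (\<lambda>w. h w u) + contour_integral (linepath b c) (\<lambda>w. h w u)
       + contour_integral (linepath c a) (\<lambda>w. h w u))"
      using L1 L2 L3 by (simp add: integral_add integrable_add)
    also have "\<dots> = integral {0..1} (\<lambda>u::real. 0)" by (rule Henstock_Kurzweil_Integration.integral_cong) (rule zero)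
    finally show "contour_integral (linepath a b) (\<lambda>w. integral {0..1} (h w)) + contour_integral (linepath b c) (\<lambda>w. integral {0..1} (h w))
        + contour_integral (linepath c a) (\<lambda>w. integral {0..1} (h w)) = 0" by simp
  qed
  thus ?thesis by (rule analytic_imp_holomorphic)
qed

lemma integral_periodic:
  fixes h :: "real \<Rightarrow> 'a::banach"
  assumes per: "\<And>u. h (u + 1) = h u" and c: "continuous_on UNIV h"
  shows "integral {a..a + 1} h = integral {0..1} h"
proof -
  have shift: "integral {p + of_int n..r + of_int n} h = integral {p..r} h" for p r and n :: int
  proof -
    interpret periodic_fun_simple h 1 by unfold_locales (rule per)
    have "h \<circ> (+) (of_int n) = h" using plus_of_int[of _ n] by (auto simp: o_def fun_eq_iff add.commute)
    thus ?thesis using integral_shift_Icc_real[of p r h "of_int n"] by simp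
  qed
  have int: "h integrable_on {p..r}" for p r
    by (intro integrable_continuous_real continuous_on_subset[OF c]) auto
  define n where "n = \<lfloor>a\<rfloor>"
  have n: "of_int n \<le> a" "a \<le> of_int n + 1" by (auto simp: n_def)
  have "integral {a..a + 1} h = integral {a..of_int n + 1} h + integral {of_int n + 1..a + 1} h"
    by (rule Henstock_Kurzweil_Integration.integral_combine[symmetric]) (use n int in auto)
  also have "integral {of_int n + 1..a + 1} h = integral {of_int n..a} h" using shift[of "of_int n" 1 a] by simp
  also have "integral {a..of_int n + 1} h + integral {of_int n..a} h = integral {of_int n..of_int n + 1} h"
    using Henstock_Kurzweil_Integration.integral_combine[of "of_int n" a "of_int n + 1" h] n int by (simp add: add.commute)
  also have "\<dots> = integral {0..1} h" using shift[of 0 n 1] by (simp add: add.commute)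
  finally show ?thesis .
qed

lemma contour_integral_horizontal:
  "contour_integral (linepath (Complex p y) (Complex (p + 1) y)) f = integral {p..p + 1} (\<lambda>u. f (Complex u y))"
proof -
  have "linepath (Complex p y) (Complex (p + 1) y) t = Complex (p + t) y" for t
    by (simp add: linepath_def complex_eq_iff algebra_simps)
  moreover have "Complex (p + 1) y - Complex p y = 1" by (simp add: complex_eq_iff)
  ultimately have "contour_integral (linepath (Complex p y) (Complex (p + 1) y)) f = integral {0..1} (\<lambda>t. f (Complex (p + t) y))"
    by (simp add: contour_integral_integral)
  also have "\<dots> = integral {0 + p..1 + p} (\<lambda>u. f (Complex u y))"
    using integral_shift_Icc_real[of 0 1 "\<lambda>u. f (Complex u y)" p] by (simp add: o_def)
  finally show ?thesis by (simp add: add.commute)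
qed

text \<open>The residue of \<open>f w / (1 - exp (- 2 \<pi> \<i> (w - x)))\<close> at \<open>x\<close> is \<open>f x / (2 \<pi> \<i>)\<close>, and the vertical
  sides of a rectangle of width one around \<open>x\<close> cancel by periodicity.\<close>

lemma cauchy_periodic:
  fixes f :: "complex \<Rightarrow> complex" and x :: real
  assumes hol: "f holomorphic_on {w. \<bar>Im w\<bar> < R}"
    and per: "\<And>w. \<bar>Im w\<bar> < R \<Longrightarrow> f (w + 1) = f w"
    and s: "0 < s" "s < R"
  defines "\<Phi> \<equiv> (\<lambda>w. f w / (1 - exp (- 2 * pi * \<i> * (w - of_real x))))"
  shows "f (of_real x) = integral {0..1} (\<lambda>u. \<Phi> (Complex u (- s))) - integral {0..1} (\<lambda>u. \<Phi> (Complex u s))"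
proof -
  define g where "g u = 1 - exp (- 2 * pi * \<i> * u)" for u :: complex
  \<comment> \<open>The quotient g u / u with its removable singularity filled in by 2 \<pi> i.
    Dividing f by it writes the kernel as G / (w - x) with G holomorphic, to which Cauchy's formula
    applies.\<close>
  define k where "k u = (if u = 0 then deriv g 0 else (g u - g 0) / (u - 0))" for u
  have dg: "deriv g 0 = 2 * pi * \<i>"
    unfolding g_def[abs_def] by (rule DERIV_imp_deriv) (auto intro!: derivative_eq_intros)
  have kh: "k holomorphic_on UNIV" unfolding k_def[abs_def]
    by (rule pole_lemma_open) (auto simp: g_def[abs_def] intro!: holomorphic_intros)
  have g0: "g u = 0 \<longleftrightarrow> Im u = 0 \<and> (\<exists>n::int. Re u = of_int n)" for u
  proof -
    have "g u = 0 \<longleftrightarrow> exp (- 2 * pi * \<i> * u) = 1" by (auto simp: g_def)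
    also have "\<dots> \<longleftrightarrow> Im u = 0 \<and> (\<exists>n::int. Re u = of_int (- n))"
    proof -
      have "2 * pi * (- Re u) = 2 * pi * of_int n \<longleftrightarrow> Re u = of_int (- n)" for n :: int
        by (simp only: mult_cancel_left) (auto simp: minus_equation_iff)
      thus ?thesis unfolding exp_eq_1 by (auto simp: algebra_simps)
    qed
    also have "(\<exists>n::int. Re u = of_int (- n)) \<longleftrightarrow> (\<exists>n::int. Re u = of_int n)"
      by (metis minus_minus)
    finally show ?thesis .
  qed
  have k0: "k u \<noteq> 0" if "\<bar>Re u\<bar> < 1" for u
  proof (cases "u = 0")
    case True thus ?thesis by (simp add: k_def dg)
  next
    case False
    have "g u \<noteq> 0"
    proof
      assume "g u = 0"
      then obtain n :: int where n: "Im u = 0" "Re u = of_int n" unfolding g0 by blast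
      hence "n = 0" using that by simp
      thus False using n False by (simp add: complex_eq_iff)
    qed
    thus ?thesis using False by (simp add: k_def g_def)
  qed
  \<comment> \<open>The width |Re w - x| < 1 keeps out the other zeros of the denominator, which
    differ from x by integers, and still contains the rectangle of half-width 1/2.\<close>
  define S where "S = {w. \<bar>Im w\<bar> < R \<and> \<bar>Re w - x\<bar> < 1}"
  have S_eq: "S = {w. Im w < R} \<inter> {w. Im w > - R} \<inter> {w. Re w < x + 1} \<inter> {w. Re w > x - 1}" by (auto simp: S_def)
  have "convex S" unfolding S_eq
    by (intro convex_Int convex_halfspace_Im_lt convex_halfspace_Im_gt convex_halfspace_Re_lt convex_halfspace_Re_gt)
  have "open S" unfolding S_eq
    by (intro open_Int open_halfspace_Im_lt open_halfspace_Im_gt open_halfspace_Re_lt open_halfspace_Re_gt)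
  define G where "G w = f w / k (w - of_real x)" for w
  have G: "G holomorphic_on S" unfolding G_def[abs_def]
  proof (intro holomorphic_intros)
    show "f holomorphic_on S" by (rule holomorphic_on_subset[OF hol]) (auto simp: S_def)
    have "(k \<circ> (\<lambda>w. w - of_real x)) holomorphic_on S"
      by (intro holomorphic_on_compose holomorphic_intros holomorphic_on_subset[OF kh]) auto
    thus "(\<lambda>w. k (w - of_real x)) holomorphic_on S" by (simp add: o_def)
    show "k (w - of_real x) \<noteq> 0" if "w \<in> S" for w using that by (intro k0) (auto simp: S_def)
  qed
  define a where "a = Complex (x - 1/2) (- s)"
  define b where "b = Complex (x + 1/2) s"
  define P where "P = rectpath a b"
  have inbox: "of_real x \<in> box a b" using s by (auto simp: a_def b_def in_box_complex_iff)
  have ab: "Re a \<le> Re b" "Im a \<le> Im b" using s by (auto simp: a_def b_def)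
  have cb: "cbox a b \<subseteq> S" using s by (auto simp: a_def b_def S_def in_cbox_complex_iff)
  have PS: "path_image P \<subseteq> S - {of_real x}"
    using path_image_rectpath_cbox_minus_box[OF ab] inbox cb by (auto simp: P_def)
  have "((\<lambda>w. G w / (w - of_real x)) has_contour_integral (2 * pi * \<i> * winding_number P (of_real x) * G (of_real x))) P"
    by (rule Cauchy_integral_formula_convex_simple[OF \<open>convex S\<close> G])
       (use PS inbox cb \<open>open S\<close> box_subset_cbox[of a b] in \<open>auto simp: P_def interior_open\<close>)
  moreover have "winding_number P (of_real x) = 1" unfolding P_def by (rule winding_number_rectpath[OF inbox])
  moreover have "2 * pi * \<i> * 1 * G (of_real x) = f (of_real x)" by (simp add: G_def k_def dg)
  ultimately have "((\<lambda>w. G w / (w - of_real x)) has_contour_integral f (of_real x)) P" by simp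
  hence P: "(\<Phi> has_contour_integral f (of_real x)) P"
  proof (rule has_contour_integral_eq)
    fix w assume "w \<in> path_image P"
    hence "w \<noteq> of_real x" using PS by auto
    thus "G w / (w - of_real x) = \<Phi> w" by (simp add: G_def k_def \<Phi>_def g_def)
  qed
  have \<Phi>per: "\<Phi> (w + 1) = \<Phi> w" if "\<bar>Im w\<bar> < R" for w
  proof -
    have "exp (- 2 * pi * \<i> * (w + 1 - of_real x)) = exp (- 2 * pi * \<i> * (w - of_real x)) * exp (- (2 * pi * \<i>))"
      by (simp flip: exp_add add: algebra_simps)
    also have "exp (- (2 * pi * \<i>)) = 1" by (simp add: exp_minus)
    finally show ?thesis by (simp add: \<Phi>_def per[OF that])
  qed
  have \<Phi>cont: "continuous_on {w. \<bar>Im w\<bar> < R \<and> Im w \<noteq> 0} \<Phi>" unfolding \<Phi>_def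
  proof (intro continuous_intros)
    show "continuous_on {w. \<bar>Im w\<bar> < R \<and> Im w \<noteq> 0} f"
      by (rule continuous_on_subset[OF holomorphic_on_imp_continuous_on[OF hol]]) auto
    show "\<forall>w\<in>{w. \<bar>Im w\<bar> < R \<and> Im w \<noteq> 0}. 1 - exp (- 2 * pi * \<i> * (w - of_real x)) \<noteq> 0"
    proof
      fix w assume "w \<in> {w. \<bar>Im w\<bar> < R \<and> Im w \<noteq> 0}"
      hence "g (w - of_real x) \<noteq> 0" unfolding g0 by simp
      thus "1 - exp (- 2 * pi * \<i> * (w - of_real x)) \<noteq> 0" by (simp add: g_def)
    qed
  qed
  have line: "integral {x - 1/2..x + 1/2} (\<lambda>u. \<Phi> (Complex u y)) = integral {0..1} (\<lambda>u. \<Phi> (Complex u y))"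
    if y: "\<bar>y\<bar> < R" "y \<noteq> 0" for y
  proof -
    have c: "continuous_on UNIV (\<lambda>u. \<Phi> (Complex u y))"
      by (rule continuous_on_compose2[OF \<Phi>cont]) (use y in \<open>auto intro!: continuous_intros simp: Complex_eq\<close>)
    have "\<Phi> (Complex (u + 1) y) = \<Phi> (Complex u y)" for u
      using \<Phi>per[of "Complex u y"] y by (simp add: Complex_eq algebra_simps)
    from integral_periodic[of "\<lambda>u. \<Phi> (Complex u y)", OF this c, of "x - 1/2"] show ?thesis by (simp add: add.commute)
  qed
  define a2 where "a2 = Complex (Re b) (Im a)"
  define a4 where "a4 = Complex (Re a) (Im b)"
  have Pe: "P = linepath a a2 +++ linepath a2 b +++ linepath b a4 +++ linepath a4 a"
    by (simp add: P_def rectpath_def a2_def a4_def Let_def)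
  have i: "\<Phi> contour_integrable_on P" using P by (rule has_contour_integral_integrable)
  have "f (of_real x) = contour_integral P \<Phi>" using P by (rule contour_integral_unique[symmetric])
  also have "\<dots> = contour_integral (linepath a a2) \<Phi> + contour_integral (linepath a2 b) \<Phi>
      + contour_integral (linepath b a4) \<Phi> + contour_integral (linepath a4 a) \<Phi>"
    using i unfolding Pe by (simp add: add.assoc)
  also have "contour_integral (linepath a a2) \<Phi> = integral {x - 1/2..x + 1/2} (\<lambda>u. \<Phi> (Complex u (- s)))"
    using contour_integral_horizontal[of "x - 1/2" "- s" \<Phi>] by (simp add: a_def a2_def b_def add.commute)
  also have "\<dots> = integral {0..1} (\<lambda>u. \<Phi> (Complex u (- s)))" by (rule line) (use s in auto)
  also have "contour_integral (linepath b a4) \<Phi> = - contour_integral (linepath a4 b) \<Phi>"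
    using contour_integral_reversepath[of "linepath a4 b" \<Phi>] by simp
  also have "contour_integral (linepath a4 b) \<Phi> = integral {x - 1/2..x + 1/2} (\<lambda>u. \<Phi> (Complex u s))"
    using contour_integral_horizontal[of "x - 1/2" s \<Phi>] by (simp add: a_def a4_def b_def add.commute)
  also have "\<dots> = integral {0..1} (\<lambda>u. \<Phi> (Complex u s))" by (rule line) (use s in auto)
  also have "contour_integral (linepath a4 a) \<Phi> = - contour_integral (linepath a a4) \<Phi>"
    using contour_integral_reversepath[of "linepath a a4" \<Phi>] by simp
  also have "contour_integral (linepath a a4) \<Phi> = \<i> * integral {- s..s} (\<lambda>u. \<Phi> (Complex (x - 1/2) u))"
    by (rule contour_integral_linepath_same_Re) (use s in \<open>auto simp: a_def a4_def b_def\<close>)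
  also have "contour_integral (linepath a2 b) \<Phi> = \<i> * integral {- s..s} (\<lambda>u. \<Phi> (Complex (x + 1/2) u))"
    by (rule contour_integral_linepath_same_Re) (use s in \<open>auto simp: a_def a2_def b_def\<close>)
  also have "integral {- s..s} (\<lambda>u. \<Phi> (Complex (x + 1/2) u)) = integral {- s..s} (\<lambda>u. \<Phi> (Complex (x - 1/2) u))"
  proof (rule Henstock_Kurzweil_Integration.integral_cong)
    fix u assume "u \<in> {- s..s}"
    hence "\<bar>Im (Complex (x - 1/2) u)\<bar> < R" using s by auto
    from \<Phi>per[OF this] show "\<Phi> (Complex (x + 1/2) u) = \<Phi> (Complex (x - 1/2) u)" by (simp add: Complex_eq algebra_simps)
  qed
  finally show ?thesis by simp
qed

text \<open>The partial sums of the geometric series have the explicit remainder F q^N / (1 - q),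
  bounded by M r^N / (1 - r), so integral and sum are exchanged by hand.\<close>

lemma geometric_integral:
  fixes F q :: "real \<Rightarrow> complex"
  assumes c: "continuous_on {0..1} F" "continuous_on {0..1} q"
    and F: "\<And>u. u \<in> {0..1} \<Longrightarrow> cmod (F u) \<le> M" and q: "\<And>u. u \<in> {0..1} \<Longrightarrow> cmod (q u) = r" and r: "r < 1"
  shows "(\<lambda>m. integral {0..1} (\<lambda>u. F u * q u ^ m)) sums integral {0..1} (\<lambda>u. F u / (1 - q u))"
proof -
  have r0: "0 \<le> r" using q[of 0] by (metis atLeastAtMost_iff norm_ge_zero order_refl zero_le_one)
  have M0: "0 \<le> M" using F[of 0] norm_ge_zero[of "F 0"] by (meson atLeastAtMost_iff order_refl order_trans zero_le_one)
  have ne: "1 - q u \<noteq> 0" and low: "1 - r \<le> cmod (1 - q u)" if "u \<in> {0..1}" for u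
  proof -
    have "cmod 1 - cmod (q u) \<le> cmod (1 - q u)" by (rule norm_triangle_ineq2)
    thus "1 - r \<le> cmod (1 - q u)" using q[OF that] by simp
    thus "1 - q u \<noteq> 0" using r by auto
  qed
  have ci: "(\<lambda>u. F u * q u ^ m) integrable_on {0..1}" for m
    by (intro integrable_continuous_real continuous_intros c)
  have cR: "continuous_on {0..1} (\<lambda>u. F u * q u ^ N / (1 - q u))" for N
    by (intro continuous_intros c) (use ne in auto)
  have part: "(\<Sum>m<N. integral {0..1} (\<lambda>u. F u * q u ^ m)) = integral {0..1} (\<lambda>u. F u / (1 - q u)) - integral {0..1} (\<lambda>u. F u * q u ^ N / (1 - q u))" for N
  proof -
    have "(\<Sum>m<N. integral {0..1} (\<lambda>u. F u * q u ^ m)) = integral {0..1} (\<lambda>u. \<Sum>m<N. F u * q u ^ m)"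
      by (rule integral_sum[symmetric]) (use ci in auto)
    also have "\<dots> = integral {0..1} (\<lambda>u. F u * q u ^ 0 / (1 - q u) - F u * q u ^ N / (1 - q u))"
    proof (rule Henstock_Kurzweil_Integration.integral_cong)
      fix u :: real assume u: "u \<in> {0..1}"
      have "(\<Sum>m<N. F u * q u ^ m) = F u * (\<Sum>m<N. q u ^ m)" by (simp add: sum_distrib_left)
      also have "(\<Sum>m<N. q u ^ m) = (1 - q u ^ N) / (1 - q u)" using ne[OF u] by (subst sum_gp_strict) auto
      finally show "(\<Sum>m<N. F u * q u ^ m) = F u * q u ^ 0 / (1 - q u) - F u * q u ^ N / (1 - q u)"
        by (simp add: diff_divide_distrib right_diff_distrib)
    qed
    also have "\<dots> = integral {0..1} (\<lambda>u. F u * q u ^ 0 / (1 - q u)) - integral {0..1} (\<lambda>u. F u * q u ^ N / (1 - q u))"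
      by (intro integral_diff integrable_continuous_real cR)
    finally show ?thesis by simp
  qed
  have "(\<lambda>N. integral {0..1} (\<lambda>u. F u * q u ^ N / (1 - q u))) \<longlonglongrightarrow> 0"
  proof (rule Lim_null_comparison)
    show "\<forall>\<^sub>F N in sequentially. norm (integral {0..1} (\<lambda>u. F u * q u ^ N / (1 - q u))) \<le> M / (1 - r) * r ^ N"
    proof (rule always_eventually, rule allI)
      fix N
      have "norm (integral {0..1} (\<lambda>u. F u * q u ^ N / (1 - q u))) \<le> (M * r ^ N / (1 - r)) * (1 - 0)"
      proof (rule integral_bound[OF _ cR])
        fix u :: real assume u: "u \<in> {0..1}"
        show "cmod (F u * q u ^ N / (1 - q u)) \<le> M * r ^ N / (1 - r)"
          unfolding norm_divide norm_mult norm_power q[OF u]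
          using F[OF u] low[OF u] M0 r0 r by (intro frac_le mult_right_mono) auto
      qed simp
      thus "norm (integral {0..1} (\<lambda>u. F u * q u ^ N / (1 - q u))) \<le> M / (1 - r) * r ^ N" by simp
    qed
    show "(\<lambda>N. M / (1 - r) * r ^ N) \<longlonglongrightarrow> 0"
      using tendsto_mult[OF tendsto_const LIMSEQ_realpow_zero[OF r0 r], of "M / (1 - r)"] by simp
  qed
  from tendsto_diff[OF tendsto_const this, of "integral {0..1} (\<lambda>u. F u / (1 - q u))"]
  show ?thesis unfolding sums_def part by simp
qed

text \<open>Taking the Fourier coefficient on the line \<open>Im w = - s\<close> for \<open>m \<ge> 0\<close> and on \<open>Im w = s\<close> for
  \<open>m < 0\<close> makes its exponential decay evident.\<close>

definition fourier_height :: "real \<Rightarrow> int \<Rightarrow> real" where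
  "fourier_height s m = (if m \<ge> 0 then - s else s)"

definition fourier_coeff :: "real \<Rightarrow> (complex \<Rightarrow> complex) \<Rightarrow> int \<Rightarrow> complex" where
  "fourier_coeff s f m = integral {0..1} (\<lambda>u. f (Complex u (fourier_height s m)) *
     exp (- 2 * pi * \<i> * of_int m * Complex u (fourier_height s m)))"

lemma fourier_coeff_bound:
  assumes "continuous_on {w. \<bar>Im w\<bar> < R} f" "\<And>w. \<bar>Im w\<bar> < R \<Longrightarrow> cmod (f w) \<le> M" "0 < s" "s < R"
  shows "cmod (fourier_coeff s f m) \<le> M * exp (- 2 * pi * s * \<bar>of_int m\<bar>)"
proof -
  define y where "y = fourier_height s m"
  have y: "\<bar>y\<bar> < R" "of_int m * y = - s * \<bar>of_int m\<bar>" using assms by (auto simp: y_def fourier_height_def)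
  have "cmod (fourier_coeff s f m) \<le> (M * exp (- 2 * pi * s * \<bar>of_int m\<bar>)) * (1 - 0)"
    unfolding fourier_coeff_def y_def[symmetric]
  proof (rule integral_bound)
    have "continuous_on {0..1} (\<lambda>u. f (Complex u y))"
      by (rule continuous_on_compose2[OF assms(1)]) (use y in \<open>auto intro!: continuous_intros simp: Complex_eq\<close>)
    thus "continuous_on {0..1} (\<lambda>u. f (Complex u y) * exp (- 2 * pi * \<i> * of_int m * Complex u y))"
      unfolding Complex_eq by (intro continuous_intros)
    fix u :: real
    have "cmod (exp (- 2 * pi * \<i> * of_int m * Complex u y)) = exp (2 * pi * (of_int m * y))" by (simp add: mult_ac)
    also have "\<dots> = exp (- 2 * pi * s * \<bar>of_int m\<bar>)" unfolding y(2) by (simp add: mult_ac)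
    finally have e: "cmod (exp (- 2 * pi * \<i> * of_int m * Complex u y)) = exp (- 2 * pi * s * \<bar>of_int m\<bar>)" .
    thus "cmod (f (Complex u y) * exp (- 2 * pi * \<i> * of_int m * Complex u y)) \<le> M * exp (- 2 * pi * s * \<bar>of_int m\<bar>)"
      unfolding norm_mult[of "f _"] e using assms(2)[of "Complex u y"] y by (intro mult_right_mono) auto
  qed simp
  thus ?thesis by simp
qed

lemma int_nonneg_Un_neg: "range int \<union> range (\<lambda>n. - 1 - int n) = UNIV"
proof -
  have "m \<in> range int \<union> range (\<lambda>n. - 1 - int n)" for m :: int
  proof (cases "m \<ge> 0")
    case True hence "m = int (nat m)" by simp thus ?thesis by blast
  next
    case False hence "m = - 1 - int (nat (- 1 - m))" by simp thus ?thesis by blast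
  qed
  thus ?thesis by blast
qed

lemma exp_decay_has_sum:
  fixes c :: real
  assumes "c > 0"
  obtains K where "((\<lambda>m::int. exp (- c * \<bar>of_int m\<bar>)) has_sum K) UNIV"
proof -
  define a where "a m = exp (- c * \<bar>of_int m\<bar>)" for m :: int
  have r: "norm (exp (- c)) < 1" using assms unfolding real_norm_def abs_exp_cancel by simp
  have e: "exp (- c) ^ n = exp (- c * real n)" for n by (simp flip: exp_of_nat_mult add: mult.commute)
  have 1: "(\<lambda>n. a (int n)) summable_on UNIV"
    by (rule norm_summable_imp_summable_on) (use summable_geometric[OF r] in \<open>simp add: a_def e\<close>)
  have "norm (a (- 1 - int n)) = exp (- c) ^ Suc n" for n
    unfolding e by (simp add: a_def)
  hence 2: "(\<lambda>n. a (- 1 - int n)) summable_on UNIV"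
    using summable_geometric[OF r] by (intro norm_summable_imp_summable_on) (simp only: summable_Suc_iff)
  have "a summable_on range int" using 1 by (subst summable_on_reindex) (auto simp: o_def)
  moreover have "a summable_on range (\<lambda>n. - 1 - int n)" using 2 by (subst summable_on_reindex) (auto simp: o_def inj_def)
  ultimately have "a summable_on (range int \<union> range (\<lambda>n. - 1 - int n))" by (rule summable_on_Un_disjoint) auto
  also have "range int \<union> range (\<lambda>n. - 1 - int n) = UNIV" by (rule int_nonneg_Un_neg)
  finally show ?thesis using that unfolding a_def summable_on_def by blast
qed

text \<open>The kernel 1 / (1 - q) of \<open>cauchy_periodic\<close> is expanded in powers of q on
  the lower line and in powers of 1 / q on the upper line; on both the ratio has modulus exp (- 2
  \<pi> s). The lower line yields the coefficients with m \<ge> 0, the upper one those with m < 0.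
  Their decay gives absolute summability, which joins the two series into one sum over all
  integers.\<close>

lemma fourier_series:
  assumes hol: "f holomorphic_on {w. \<bar>Im w\<bar> < R}"
    and per: "\<And>w. \<bar>Im w\<bar> < R \<Longrightarrow> f (w + 1) = f w"
    and bnd: "\<And>w. \<bar>Im w\<bar> < R \<Longrightarrow> cmod (f w) \<le> M"
    and s: "0 < s" "s < R"
  shows "((\<lambda>m. fourier_coeff s f m * cis (2 * pi * of_int m * x)) has_sum f (of_real x)) UNIV"
proof -
  define a where "a m = fourier_coeff s f m * cis (2 * pi * of_int m * x)" for m
  have cf: "continuous_on {w. \<bar>Im w\<bar> < R} f" by (rule holomorphic_on_imp_continuous_on[OF hol])
  have cl: "continuous_on {0..1} (\<lambda>u. f (Complex u y))" if "\<bar>y\<bar> < R" for y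
    by (rule continuous_on_compose2[OF cf]) (use that in \<open>auto intro!: continuous_intros simp: Complex_eq\<close>)
  define q where "q y u = exp (- 2 * pi * \<i> * (Complex u y - of_real x))" for y u
  have cq: "continuous_on {0..1} (q y)" "continuous_on {0..1} (\<lambda>u. inverse (q y u))" for y
    unfolding q_def Complex_eq by (intro continuous_intros, simp)+
  have nq: "cmod (q y u) = exp (2 * pi * y)" for y u by (simp add: q_def)
  have a: "a m = integral {0..1} (\<lambda>u. f (Complex u (fourier_height s m)) * exp (of_int m * (- 2 * pi * \<i> * (Complex u (fourier_height s m) - of_real x))))" for m
  proof -
    have e: "exp (- 2 * pi * \<i> * of_int m * w) * cis (2 * pi * of_int m * x) = exp (of_int m * (- 2 * pi * \<i> * (w - of_real x)))" for w
      unfolding cis_conv_exp exp_add[symmetric] by (rule arg_cong[of _ _ exp]) (simp add: algebra_simps)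
    have "a m = integral {0..1} (\<lambda>u. (f (Complex u (fourier_height s m)) * exp (- 2 * pi * \<i> * of_int m * Complex u (fourier_height s m))) * cis (2 * pi * of_int m * x))"
      unfolding a_def fourier_coeff_def by (rule integral_mult_left[symmetric])
    thus ?thesis unfolding mult.assoc[of "f _"] e .
  qed
  have a1: "a (int m) = integral {0..1} (\<lambda>u. f (Complex u (- s)) * q (- s) u ^ m)" for m
    unfolding a q_def exp_of_nat_mult[symmetric] by (simp add: fourier_height_def)
  \<comment> \<open>The negative indices start at - 1, that is at the first power of 1 / q; this is
    the extra factor in front of the geometric series.\<close>
  have a2: "a (- 1 - int m) = integral {0..1} (\<lambda>u. (f (Complex u s) * inverse (q s u)) * inverse (q s u) ^ m)" for m
  proof -
    have "exp (of_int (- 1 - int m) * z) = inverse (exp z) * inverse (exp z) ^ m" for z :: complex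
    proof -
      have "exp (of_int (- 1 - int m) * z) = exp (- z + of_nat m * (- z))" by (rule arg_cong[of _ _ exp]) (simp add: algebra_simps)
      thus ?thesis by (simp only: exp_add exp_of_nat_mult exp_minus)
    qed
    note e = this
    show ?thesis unfolding a e by (simp add: fourier_height_def q_def mult.assoc)
  qed
  have sum1: "(\<lambda>m. a (int m)) sums integral {0..1} (\<lambda>u. f (Complex u (- s)) / (1 - q (- s) u))"
    unfolding a1
    by (rule geometric_integral[where M = M and r = "exp (2 * pi * (- s))"])
       (use s in \<open>auto intro!: cl cq bnd simp: nq\<close>)
  have "(\<lambda>m. a (- 1 - int m)) sums integral {0..1} (\<lambda>u. (f (Complex u s) * inverse (q s u)) / (1 - inverse (q s u)))"
    unfolding a2
  proof (rule geometric_integral[where M = M and r = "exp (- (2 * pi * s))"])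
    show "cmod (f (Complex u s) * inverse (q s u)) \<le> M" if "u \<in> {0..1}" for u
    proof -
      have "cmod (f (Complex u s) * inverse (q s u)) \<le> M * 1"
        unfolding norm_mult by (rule mult_mono) (use s bnd[of "Complex u s"] in \<open>auto simp: norm_inverse nq exp_minus[symmetric] intro: order.trans[OF norm_ge_zero]\<close>)
      thus ?thesis by simp
    qed
    show "continuous_on {0..1} (\<lambda>u. f (Complex u s) * inverse (q s u))"
      using s by (intro continuous_on_mult cl cq) auto
    show "exp (- (2 * pi * s)) < 1" using s by simp
  qed (auto intro!: cq simp: norm_inverse nq exp_minus)
  also have "integral {0..1} (\<lambda>u. (f (Complex u s) * inverse (q s u)) / (1 - inverse (q s u))) = integral {0..1} (\<lambda>u. - (f (Complex u s) / (1 - q s u)))"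
  proof (rule Henstock_Kurzweil_Integration.integral_cong)
    fix u :: real
    have "q s u \<noteq> 0" by (simp add: q_def)
    moreover have "q s u \<noteq> 1"
    proof
      assume "q s u = 1"
      hence "exp (2 * pi * s) = 1" using nq[of s u] by simp
      thus False using s by simp
    qed
    ultimately show "(f (Complex u s) * inverse (q s u)) / (1 - inverse (q s u)) = - (f (Complex u s) / (1 - q s u))"
      by (simp add: divide_simps) (simp add: algebra_simps)?
  qed
  finally have sum2: "(\<lambda>m. a (- 1 - int m)) sums - integral {0..1} (\<lambda>u. f (Complex u s) / (1 - q s u))" by simp
  obtain K where K: "((\<lambda>m::int. exp (- (2 * pi * s) * \<bar>of_int m\<bar>)) has_sum K) UNIV"
    by (rule exp_decay_has_sum[of "2 * pi * s"]) (use s in auto)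
  have "(\<lambda>m. norm (a m)) summable_on UNIV"
  proof (rule summable_on_comparison_test)
    have "((\<lambda>m::int. M * exp (- (2 * pi * s) * \<bar>of_int m\<bar>)) has_sum M * K) UNIV" by (rule has_sum_cmult_right[OF K])
    thus "(\<lambda>m::int. M * exp (- (2 * pi * s) * \<bar>of_int m\<bar>)) summable_on UNIV" by (auto simp: summable_on_def)
    show "cmod (a m) \<le> M * exp (- (2 * pi * s) * \<bar>of_int m\<bar>)" for m
      using fourier_coeff_bound[OF cf bnd s, of m] by (simp add: a_def norm_mult)
  qed auto
  hence "a summable_on UNIV" by (rule Infinite_Sum.abs_summable_summable)
  hence sm: "a summable_on A" for A by (rule summable_on_subset_banach) auto
  have val: "(a has_sum S) (range g)" if "(\<lambda>m. a (g m)) sums S" "inj g" for g :: "nat \<Rightarrow> int" and S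
  proof -
    have h: "(a has_sum infsum a (range g)) (range g)" using sm by (rule has_sum_infsum)
    hence "((a \<circ> g) has_sum infsum a (range g)) UNIV" using that(2) by (simp add: has_sum_reindex)
    hence "(\<lambda>m. a (g m)) sums infsum a (range g)" unfolding o_def by (rule has_sum_imp_sums)
    hence "S = infsum a (range g)" using that(1) sums_unique2 by blast
    thus ?thesis using h by simp
  qed
  have "(a has_sum integral {0..1} (\<lambda>u. f (Complex u (- s)) / (1 - q (- s) u)) + - integral {0..1} (\<lambda>u. f (Complex u s) / (1 - q s u)))
     (range int \<union> range (\<lambda>n. - 1 - int n))"
    by (rule has_sum_Un_disjoint) (auto intro!: val sum1 sum2 simp: inj_def)
  thus ?thesis unfolding int_nonneg_Un_neg using cauchy_periodic[OF hol per s, of x] by (simp add: a_def[abs_def] q_def[abs_def])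
qed

section \<open>Fourier expansion in several variables\<close>

definition coord_upd :: "complex ^ 'd::finite \<Rightarrow> 'd \<Rightarrow> complex \<Rightarrow> complex ^ 'd" where
  "coord_upd z j w = (\<chi> i. if i = j then w else z $ i)"

lemma coord_upd_nth [simp]: "coord_upd z j w $ i = (if i = j then w else z $ i)"
  by (simp add: coord_upd_def)

lemma coord_upd_same [simp]: "coord_upd (coord_upd z j v) j w = coord_upd z j w"
  by (simp add: vec_eq_iff)

lemma coord_upd_swap: "i \<noteq> j \<Longrightarrow> coord_upd (coord_upd z i v) j w = coord_upd (coord_upd z j w) i v"
  by (auto simp: vec_eq_iff)

lemma coord_upd_strip: "z \<in> strip R \<Longrightarrow> \<bar>Im w\<bar> < R \<Longrightarrow> coord_upd z j w \<in> strip R"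
  by (auto simp: strip_def)

lemma continuous_on_coord_upd [continuous_intros]:
  assumes "continuous_on A f" "continuous_on A g"
  shows "continuous_on A (\<lambda>x. coord_upd (f x) j (g x))"
  unfolding coord_upd_def
proof (rule continuous_on_vec_lambda)
  show "continuous_on A (\<lambda>x. if i = j then g x else f x $ i)" for i
    using assms by (cases "i = j") (auto intro!: continuous_intros)
qed

text \<open>Separate analyticity together with continuity suffices to expand one coordinate at a time.\<close>

definition periodic_analytic :: "real \<Rightarrow> real \<Rightarrow> (complex ^ 'd::finite \<Rightarrow> complex) \<Rightarrow> bool" where
  "periodic_analytic R M F \<longleftrightarrow> continuous_on (strip R) F \<and> (\<forall>z\<in>strip R. cmod (F z) \<le> M) \<and>
     (\<forall>z\<in>strip R. \<forall>j. (\<lambda>w. F (coord_upd z j w)) holomorphic_on {w. \<bar>Im w\<bar> < R} \<and>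
        (\<forall>w. \<bar>Im w\<bar> < R \<longrightarrow> F (coord_upd z j (w + 1)) = F (coord_upd z j w)))"

lemma open_strip_1: "open {w. \<bar>Im w\<bar> < R}"
proof -
  have "{w. \<bar>Im w\<bar> < R} = {w. Im w < R} \<inter> {w. Im w > - R}" by auto
  thus ?thesis using open_Int[OF open_halfspace_Im_lt open_halfspace_Im_gt] by simp
qed

text \<open>A Fourier coefficient in coordinate j stays in the class and its bound gains exp (- 2
  \<pi> s |m|). It is constant in coordinate j, and holomorphic in the others as a parameter
  integral.\<close>

lemma periodic_analytic_coeff:
  fixes F :: "complex ^ 'd::finite \<Rightarrow> complex"
  assumes F: "periodic_analytic R M F" and s: "0 < s" "s < R"
  shows "periodic_analytic R (M * exp (- 2 * pi * s * \<bar>of_int m\<bar>)) (\<lambda>z. fourier_coeff s (\<lambda>w. F (coord_upd z j w)) m)"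
  unfolding periodic_analytic_def
proof (intro conjI ballI allI impI)
  define y where "y = fourier_height s m"
  have y: "\<bar>y\<bar> < R" using s by (auto simp: y_def fourier_height_def)
  have c: "continuous_on (strip R) F" and b: "\<And>z. z \<in> strip R \<Longrightarrow> cmod (F z) \<le> M"
    and h: "\<And>z i. z \<in> strip R \<Longrightarrow> (\<lambda>w. F (coord_upd z i w)) holomorphic_on {w. \<bar>Im w\<bar> < R}"
    and p: "\<And>z i w. z \<in> strip R \<Longrightarrow> \<bar>Im w\<bar> < R \<Longrightarrow> F (coord_upd z i (w + 1)) = F (coord_upd z i w)"
    using F unfolding periodic_analytic_def by blast+
  define H where "H z u = F (coord_upd z j (Complex u y)) * exp (- 2 * pi * \<i> * of_int m * Complex u y)" for z u
  have A: "fourier_coeff s (\<lambda>w. F (coord_upd z j w)) m = integral {0..1} (H z)" for z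
    by (simp add: fourier_coeff_def H_def[abs_def] y_def)
  have HC: "continuous_on (strip R \<times> {0..1}) (\<lambda>x. H (fst x) (snd x))"
  proof -
    have "continuous_on (strip R \<times> {0..1}) (\<lambda>x. F (coord_upd (fst x) j (Complex (snd x) y)))"
      by (rule continuous_on_compose2[OF c]) (auto intro!: continuous_intros coord_upd_strip y simp: Complex_eq)
    thus ?thesis unfolding H_def Complex_eq by (intro continuous_intros)
  qed
  show "continuous_on (strip R) (\<lambda>z. fourier_coeff s (\<lambda>w. F (coord_upd z j w)) m)"
    unfolding A using integral_continuous_on_param[of "strip R" 0 1 H] HC by (simp add: case_prod_beta)
  fix z :: "complex ^ 'd" assume z: "z \<in> strip R"
  show "cmod (fourier_coeff s (\<lambda>w. F (coord_upd z j w)) m) \<le> M * exp (- 2 * pi * s * \<bar>of_int m\<bar>)"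
    by (rule fourier_coeff_bound[OF holomorphic_on_imp_continuous_on[OF h[OF z]] _ s]) (intro b coord_upd_strip z)
  fix i
  have "(\<lambda>w. integral {0..1} (H (coord_upd z i w))) holomorphic_on {w. \<bar>Im w\<bar> < R}
    \<and> (\<forall>w. \<bar>Im w\<bar> < R \<longrightarrow> integral {0..1} (H (coord_upd z i (w + 1))) = integral {0..1} (H (coord_upd z i w)))"
  proof (cases "i = j")
    case True
    thus ?thesis by (simp add: H_def[abs_def])
  next
    case False
    have e: "H (coord_upd z i w) u = F (coord_upd (coord_upd z j (Complex u y)) i w) * exp (- 2 * pi * \<i> * of_int m * Complex u y)" for w u
      unfolding H_def coord_upd_swap[OF False] ..
    have "(\<lambda>w. integral {0..1} (H (coord_upd z i w))) holomorphic_on {w. \<bar>Im w\<bar> < R}"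
    proof (rule holomorphic_parameter_integral[OF _ open_strip_1])
      show "continuous_on ({w. \<bar>Im w\<bar> < R} \<times> {0..1}) (\<lambda>(w, u). H (coord_upd z i w) u)"
      proof -
        have "continuous_on ({w. \<bar>Im w\<bar> < R} \<times> {0..1}) (\<lambda>x. H (fst (coord_upd z i (fst x), snd x)) (snd (coord_upd z i (fst x), snd x)))"
          by (rule continuous_on_compose2[OF HC]) (auto intro!: continuous_intros coord_upd_strip z)
        thus ?thesis by (simp add: case_prod_beta)
      qed
      show "(\<lambda>w. H (coord_upd z i w) u) holomorphic_on {w. \<bar>Im w\<bar> < R}" for u
        unfolding e by (intro holomorphic_intros h coord_upd_strip z) (simp add: y)
    qed
    moreover have "integral {0..1} (H (coord_upd z i (w + 1))) = integral {0..1} (H (coord_upd z i w))" if "\<bar>Im w\<bar> < R" for w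
    proof -
      have "H (coord_upd z i (w + 1)) = H (coord_upd z i w)"
        unfolding fun_eq_iff e using p[OF coord_upd_strip[OF z] that] y by simp
      thus ?thesis by simp
    qed
    ultimately show ?thesis by blast
  qed
  thus "(\<lambda>w. fourier_coeff s (\<lambda>v. F (coord_upd (coord_upd z i w) j v)) m) holomorphic_on {w. \<bar>Im w\<bar> < R}"
    "\<And>w. \<bar>Im w\<bar> < R \<Longrightarrow> fourier_coeff s (\<lambda>v. F (coord_upd (coord_upd z i (w + 1)) j v)) m
       = fourier_coeff s (\<lambda>v. F (coord_upd (coord_upd z i w) j v)) m"
    unfolding A by blast+
qed

lemma l1_norm_axis: "l1_norm (axis j m) = \<bar>of_int m\<bar>"
proof -
  have "l1_norm (axis j m) = (\<Sum>i\<in>UNIV. if i = j then \<bar>of_int m\<bar> else 0)"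
    unfolding l1_norm_def by (intro sum.cong) (auto simp: axis_def)
  thus ?thesis by simp
qed

lemma int_inner_axis: "int_inner (axis j m) x = of_int m * x $ j"
proof -
  have "int_inner (axis j m) x = (\<Sum>i\<in>UNIV. if i = j then of_int m * x $ j else 0)"
    unfolding int_inner_def by (intro sum.cong) (auto simp: axis_def)
  thus ?thesis by simp
qed

text \<open>Induction over a set of coordinates that determines the value of F. Expanding in one
  coordinate leaves coefficients determined by fewer, each multiplied by a mode along that axis.
  Every coordinate contributes the factor K, the sum over m of exp (- (2 \<pi> s - \<rho>)
  |m|).\<close>

lemma periodic_analytic_wiener_aux:
  fixes F :: "complex ^ 'd::finite \<Rightarrow> complex"
  assumes "finite J" "periodic_analytic R M F"
    and "\<And>z z'. z \<in> strip R \<Longrightarrow> z' \<in> strip R \<Longrightarrow> (\<And>j. j \<in> J \<Longrightarrow> z $ j = z' $ j) \<Longrightarrow> F z = F z'"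
    and s: "0 < s" "s < R" and \<rho>: "0 \<le> \<rho>"
    and K: "((\<lambda>m::int. exp (- (2 * pi * s - \<rho>) * \<bar>of_int m\<bar>)) has_sum K) UNIV"
  shows "wiener \<omega> UNIV \<rho> (K ^ card J * M) (\<lambda>t. F (\<chi> j. of_real (t * \<omega> $ j)))"
  using assms(1-3)
proof (induction J arbitrary: F M)
  case empty
  have R: "0 < R" using s by simp
  have x: "(\<chi> j. of_real (t * \<omega> $ j)) \<in> strip R" for t using R by (simp add: strip_def)
  define c where "c = F 0"
  have "F (\<chi> j. of_real (t * \<omega> $ j)) = c" for t
    unfolding c_def by (rule empty(2)[OF x]) (use R in \<open>auto simp: strip_def\<close>)
  moreover have "cmod c \<le> M" unfolding c_def using empty(1) R by (auto simp: periodic_analytic_def strip_def)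
  ultimately show ?case
    using wiener_mono[OF wiener_mode[of \<omega> 0 \<rho> c], of UNIV M \<rho>] \<rho> by simp
next
  case (insert j J)
  have R: "0 < R" using s by simp
  define X where "X t = (\<chi> j. complex_of_real (t * \<omega> $ j))" for t
  have x: "X t \<in> strip R" for t using R by (simp add: strip_def X_def)
  define A where "A m z = fourier_coeff s (\<lambda>w. F (coord_upd z j w)) m" for m z
  have A: "periodic_analytic R (M * exp (- 2 * pi * s * \<bar>of_int m\<bar>)) (A m)" for m
    unfolding A_def[abs_def] by (rule periodic_analytic_coeff[OF insert.prems(1) s])
  have dep: "A m z = A m z'" if "z \<in> strip R" "z' \<in> strip R" "\<And>i. i \<in> J \<Longrightarrow> z $ i = z' $ i" for m z z'
  proof -
    have "F (coord_upd z j (Complex u (fourier_height s m))) = F (coord_upd z' j (Complex u (fourier_height s m)))" for u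
      by (rule insert.prems(2)) (use s that in \<open>auto intro!: coord_upd_strip simp: fourier_height_def\<close>)
    thus ?thesis by (simp add: A_def fourier_coeff_def)
  qed
  have "wiener \<omega> UNIV \<rho> (K ^ card J * (M * exp (- 2 * pi * s * \<bar>of_int m\<bar>))) (\<lambda>t. A m (X t))" for m
    unfolding X_def by (rule insert.IH[OF A]) (rule dep)
  from wiener_mult[OF this wiener_mono[OF wiener_mode[of \<omega> "axis j m" \<rho> 1 for m] subset_UNIV order_refl order_refl]]
  have "wiener \<omega> UNIV \<rho> (K ^ card J * (M * exp (- 2 * pi * s * \<bar>of_int m\<bar>)) * exp (\<rho> * \<bar>of_int m\<bar>)) (\<lambda>t. A m (X t) * mode \<omega> (axis j m) t)" for m
    using \<rho> by (simp add: l1_norm_axis)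
  also have "K ^ card J * (M * exp (- 2 * pi * s * \<bar>of_int m\<bar>)) * exp (\<rho> * \<bar>of_int m\<bar>)
     = K ^ card J * M * exp (- (2 * pi * s - \<rho>) * \<bar>of_int m\<bar>)" for m :: int
    by (simp add: algebra_simps flip: exp_add)
  finally have W: "wiener \<omega> UNIV \<rho> (K ^ card J * M * exp (- (2 * pi * s - \<rho>) * \<bar>of_int m\<bar>)) (\<lambda>t. A m (X t) * mode \<omega> (axis j m) t)" for m .
  have "wiener \<omega> UNIV \<rho> (K ^ card J * M * K) (\<lambda>t. F (X t))"
  proof (rule wiener_suminf[OF W has_sum_cmult_right[OF K] \<rho>])
    fix t
    have F: "(\<lambda>w. F (coord_upd (X t) j w)) holomorphic_on {w. \<bar>Im w\<bar> < R}"
      "\<And>w. \<bar>Im w\<bar> < R \<Longrightarrow> F (coord_upd (X t) j (w + 1)) = F (coord_upd (X t) j w)"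
      "\<And>w. \<bar>Im w\<bar> < R \<Longrightarrow> cmod (F (coord_upd (X t) j w)) \<le> M"
      using insert.prems(1) x[of t] coord_upd_strip[OF x] unfolding periodic_analytic_def by blast+
    have "coord_upd (X t) j (of_real (t * \<omega> $ j)) = X t" by (auto simp: vec_eq_iff X_def)
    with fourier_series[OF F s, of "t * \<omega> $ j"]
    show "((\<lambda>m. A m (X t) * mode \<omega> (axis j m) t) has_sum F (X t)) UNIV"
      by (simp add: A_def mode_def int_inner_axis mult_ac)
  qed
  thus ?case using insert.hyps by (simp add: X_def mult_ac)
qed

lemma periodic_analytic_wiener:
  fixes \<omega> :: "real ^ 'd::finite"
  assumes R: "0 < R"
  obtains C where "C > 0" "\<And>F M. periodic_analytic R M F \<Longrightarrow> wiener \<omega> UNIV (3 * R) (C * M) (\<lambda>t. F (\<chi> j. of_real (t * \<omega> $ j)))"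
proof -
  \<comment> \<open>A fraction of R with 2 \<pi> s > 3 R. The rate 3 R is aimed at because it
    exceeds the working width R + 2 / l as soon as 1 / l \<le> R.\<close>
  define s where "s = R * (49 / 50)"
  have s: "0 < s" "s < R" using R by (auto simp: s_def)
  have "3 * R < 2 * pi * s" using R pi_gt3 by (simp add: s_def)
  then obtain K where K: "((\<lambda>m::int. exp (- (2 * pi * s - 3 * R) * \<bar>of_int m\<bar>)) has_sum K) UNIV"
    by (metis exp_decay_has_sum diff_gt_0_iff_gt)
  have "((\<lambda>m::int. exp (- (2 * pi * s - 3 * R) * \<bar>of_int m\<bar>)) has_sum exp (- (2 * pi * s - 3 * R) * \<bar>of_int 0\<bar>)) {0}"
    by (rule has_sum_finiteI) auto
  from has_sum_mono2[OF this K] have "1 \<le> K" by simp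
  hence "K ^ CARD('d) > 0" by simp
  thus ?thesis
  proof (rule that)
    fix F :: "complex ^ 'd \<Rightarrow> complex" and M
    assume F: "periodic_analytic R M F"
    show "wiener \<omega> UNIV (3 * R) (K ^ CARD('d) * M) (\<lambda>t. F (\<chi> j. of_real (t * \<omega> $ j)))"
    proof (rule periodic_analytic_wiener_aux[OF finite F _ s _ K])
      fix z z' :: "complex ^ 'd" assume "\<And>j. j \<in> UNIV \<Longrightarrow> z $ j = z' $ j"
      hence "z = z'" by (simp add: vec_eq_iff)
      thus "F z = F z'" by simp
    qed (use R in auto)
  qed
qed

section \<open>Analytic potentials and their almost periodicity along the flow\<close>

lemma C_omega_extension:
  fixes V :: "real ^ 'd::finite \<Rightarrow> real"
  assumes V: "V \<in> C_omega r" and r: "0 < r"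
  obtains F where "periodic_analytic r (strip_norm r V) F" "\<And>x. F (\<chi> j. complex_of_real (x $ j)) = complex_of_real (V x)"
proof -
  \<comment> \<open>The choice made inside \<open>strip_norm\<close>, so that the supremum there
    bounds this very extension.\<close>
  define F where "F = (SOME F. is_bounded_analytic_ext r V F)"
  have F: "is_bounded_analytic_ext r V F"
    unfolding F_def using V by (auto simp: C_omega_def intro: someI_ex[of "is_bounded_analytic_ext r V"])
  have dif: "\<exists>D. (F has_derivative D) (at z) \<and> (\<forall>c v. D (c *s v) = c * D v)" if "z \<in> strip r" for z
    using F that by (auto simp: is_bounded_analytic_ext_def analytic_several_def)
  have "continuous_on (strip r) F"
    by (rule continuous_at_imp_continuous_on) (use dif has_derivative_continuous in blast)
  moreover have "cmod (F z) \<le> strip_norm r V" if "z \<in> strip r" for z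
  proof -
    have "bounded (F ` strip r)" using F by (simp add: is_bounded_analytic_ext_def)
    hence "bdd_above ((\<lambda>z. cmod (F z)) ` strip r)"
      by (auto simp: bounded_iff intro: bdd_aboveI2)
    thus ?thesis unfolding strip_norm_def F_def[symmetric] using that by (intro cSUP_upper)
  qed
  moreover have "(\<lambda>w. F (coord_upd z j w)) holomorphic_on {w. \<bar>Im w\<bar> < r}" if z: "z \<in> strip r" for z :: "complex ^ 'd" and j
  proof (subst holomorphic_on_open[OF open_strip_1], intro ballI)
    fix w assume "w \<in> {w. \<bar>Im w\<bar> < r}"
    hence "coord_upd z j w \<in> strip r" using coord_upd_strip[OF z] by simp
    from dif[OF this] obtain D where D: "(F has_derivative D) (at (coord_upd z j w))" "\<And>c v. D (c *s v) = c * D v" by blast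
    have "((\<lambda>w. coord_upd z j w) has_derivative (\<lambda>h. h *s axis j 1)) (at w)"
    proof -
      have e: "coord_upd z j w = coord_upd z j 0 + w *s axis j 1" for w by (auto simp: vec_eq_iff axis_def)
      have "bounded_linear (\<lambda>h::complex. h *s (axis j 1 :: complex ^ 'd))"
        by (rule linear_conv_bounded_linear[THEN iffD1])
           (auto intro!: linearI simp: vec_eq_iff algebra_simps)
      hence "((\<lambda>w. coord_upd z j 0 + w *s axis j 1) has_derivative (\<lambda>h. 0 + h *s axis j 1)) (at w)"
        by (intro has_derivative_add has_derivative_const bounded_linear_imp_has_derivative)
      thus ?thesis by (simp flip: e)
    qed
    from has_derivative_compose[OF this D(1)]
    have "((\<lambda>w. F (coord_upd z j w)) has_derivative (\<lambda>h. D (axis j 1) * h)) (at w)"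
      by (simp add: D(2) mult.commute)
    thus "\<exists>d. ((\<lambda>w. F (coord_upd z j w)) has_field_derivative d) (at w)"
      unfolding has_field_derivative_def by blast
  qed
  moreover have "F (coord_upd z j (w + 1)) = F (coord_upd z j w)" if "z \<in> strip r" "\<bar>Im w\<bar> < r" for z :: "complex ^ 'd" and j w
  proof -
    have "F (\<chi> i. coord_upd z j w $ i + of_int (axis j 1 $ i)) = F (coord_upd z j w)"
      using F coord_upd_strip[OF that] unfolding is_bounded_analytic_ext_def by blast
    moreover have "(\<chi> i. coord_upd z j w $ i + of_int (axis j 1 $ i)) = coord_upd z j (w + 1)"
      by (auto simp: vec_eq_iff axis_def)
    ultimately show ?thesis by simp
  qed
  ultimately have "periodic_analytic r (strip_norm r V) F" unfolding periodic_analytic_def by blast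
  thus ?thesis by (rule that) (use F in \<open>simp add: is_bounded_analytic_ext_def\<close>)
qed

lemma C_omega_bound:
  assumes "V \<in> C_omega r" "0 < r" shows "\<bar>V x\<bar> \<le> strip_norm r V"
proof -
  obtain F where F: "periodic_analytic r (strip_norm r V) F" "\<And>x. F (\<chi> j. complex_of_real (x $ j)) = complex_of_real (V x)"
    by (rule C_omega_extension[OF assms]) (rule that)
  have "(\<chi> j. complex_of_real (x $ j)) \<in> strip r" using assms by (simp add: strip_def)
  hence "cmod (F (\<chi> j. complex_of_real (x $ j))) \<le> strip_norm r V" using F(1) by (simp add: periodic_analytic_def)
  thus ?thesis by (simp add: F(2))
qed

lemma C_omega_continuous:
  assumes "V \<in> C_omega r" "0 < r" shows "continuous_on UNIV V"
proof -
  obtain F where F: "periodic_analytic r (strip_norm r V) F" "\<And>x. F (\<chi> j. complex_of_real (x $ j)) = complex_of_real (V x)"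
    by (rule C_omega_extension[OF assms]) (rule that)
  have "continuous_on UNIV (\<lambda>x. F (\<chi> j. complex_of_real (x $ j)))"
  proof (rule continuous_on_compose2[of "strip r" F UNIV "\<lambda>x. \<chi> j. complex_of_real (x $ j)"])
    show "continuous_on (strip r) F" using F(1) by (simp add: periodic_analytic_def)
    show "continuous_on UNIV (\<lambda>x. \<chi> j. complex_of_real (x $ j))"
      by (intro continuous_on_vec_lambda continuous_intros)
  qed (use assms in \<open>auto simp: strip_def\<close>)
  hence "continuous_on UNIV (\<lambda>x. Re (F (\<chi> j. complex_of_real (x $ j))))" by (intro continuous_intros)
  thus ?thesis by (simp add: F(2))
qed

text \<open>An integer translation brings x into the unit cube; a point at distance less than 1 then
  lies in the cube with sides [- 1, 2], where compactness gives uniform continuity.\<close>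

lemma periodic_uniformly_continuous:
  fixes V :: "real ^ 'd::finite \<Rightarrow> real"
  assumes per: "\<And>x (n :: int ^ 'd). V (\<chi> j. x $ j + of_int (n $ j)) = V x" and c: "continuous_on UNIV V" and e: "0 < e"
  obtains d where "0 < d" "\<And>x y. dist x y < d \<Longrightarrow> \<bar>V x - V y\<bar> < e"
proof -
  define K where "K = (cbox (\<chi> j. - 1) (\<chi> j. 2) :: (real ^ 'd) set)"
  have "uniformly_continuous_on K V"
    by (intro compact_uniformly_continuous continuous_on_subset[OF c]) (auto simp: K_def)
  then obtain d0 where d0: "0 < d0" "\<And>x y. x \<in> K \<Longrightarrow> y \<in> K \<Longrightarrow> dist y x < d0 \<Longrightarrow> dist (V y) (V x) < e"
    using e unfolding uniformly_continuous_on_def by meson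
  show ?thesis
  proof (rule that[of "min d0 1"])
    show "0 < min d0 1" using d0 by simp
    fix x y :: "real ^ 'd" assume xy: "dist x y < min d0 1"
    define n where "n = ((\<chi> j. - \<lfloor>x $ j\<rfloor>) :: int ^ 'd)"
    define x' where "x' = (\<chi> j. x $ j + of_int (n $ j))"
    define y' where "y' = (\<chi> j. y $ j + of_int (n $ j))"
    have V: "V x' = V x" "V y' = V y" by (auto simp: x'_def y'_def per)
    have "x' - y' = x - y" by (simp add: x'_def y'_def vec_eq_iff)
    hence dist: "dist x' y' = dist x y" by (simp add: dist_norm)
    have x'j: "0 \<le> x' $ j" "x' $ j \<le> 1" for j
      unfolding x'_def n_def by (simp_all) (linarith)+
    have y'j: "- 1 \<le> y' $ j" "y' $ j \<le> 2" for j
    proof -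
      have "\<bar>x' $ j - y' $ j\<bar> \<le> dist x' y'" using dist_vec_nth_le[of x' j y'] by (simp add: dist_real_def)
      thus "- 1 \<le> y' $ j" "y' $ j \<le> 2" using x'j[of j] xy dist by linarith+
    qed
    have "x' \<in> K" unfolding K_def mem_box_cart using x'j by (auto intro: order.trans[of "-1" 0] order.trans[of _ 1])
    moreover have "y' \<in> K" unfolding K_def mem_box_cart using y'j by auto
    ultimately have "dist (V x') (V y') < e" using d0(2)[of y' x'] dist xy by simp
    thus "\<bar>V x - V y\<bar> < e" by (simp add: V dist_real_def)
  qed
qed

text \<open>Finitely many balls of radius d / 2 cover the unit cube. For each ball that the orbit
  meets one visiting time is fixed, and s is replaced by the time of the ball containing its orbit
  point. The two points are less than d apart and keep their difference along the flow.\<close>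

lemma qp_almost_periodic:
  fixes V :: "real ^ 'd::finite \<Rightarrow> real"
  assumes per: "\<And>x (n :: int ^ 'd). V (\<chi> j. x $ j + of_int (n $ j)) = V x" and c: "continuous_on UNIV V" and e: "0 < e"
  shows "\<exists>l\<ge>0. \<forall>s\<ge>0. \<exists>s'. 0 \<le> s' \<and> s' \<le> l \<and>
     (\<forall>t\<ge>0. \<bar>qp_potential V \<omega> (s + t) - qp_potential V \<omega> (s' + t)\<bar> \<le> e)"
proof -
  obtain d where d: "0 < d" "\<And>x y. dist x y < d \<Longrightarrow> \<bar>V x - V y\<bar> < e"
    by (rule periodic_uniformly_continuous[OF per c e]) (rule that)
  define K where "K = (cbox 0 (\<chi> j. 1) :: (real ^ 'd) set)"
  define fr where "fr x = (\<chi> j. frac (x $ j))" for x :: "real ^ 'd"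
  have frK: "fr x \<in> K" for x unfolding K_def fr_def mem_box_cart by (auto simp: less_imp_le[OF frac_lt_1])
  have Vfr: "V (fr x + y) = V (x + y)" for x y
  proof -
    have "fr x + y = (\<chi> j. (x + y) $ j + of_int ((\<chi> j. - \<lfloor>x $ j\<rfloor>) $ j))"
      by (simp add: fr_def vec_eq_iff frac_def)
    thus ?thesis by (simp only: per)
  qed
  have "seq_compact K" unfolding K_def using compact_cbox by (simp add: compact_eq_seq_compact_metric)
  from seq_compact_imp_totally_bounded[OF this] obtain k where k: "finite k" "K \<subseteq> (\<Union>x\<in>k. ball x (d / 2))"
    using d(1) by (meson half_gt_zero)
  define P where "P x s \<longleftrightarrow> 0 \<le> s \<and> fr (s *\<^sub>R \<omega>) \<in> ball x (d / 2)" for x s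
  \<comment> \<open>Balls that are never met get the dummy time 0. All times are nonnegative, so
    their sum dominates each of them and serves as the bound l.\<close>
  define sx where "sx x = (if \<exists>s. P x s then SOME s. P x s else 0)" for x
  have sx: "P x (sx x)" if "P x s" for x s
    using someI[of "P x", OF that] that by (auto simp: sx_def)
  have sx0: "0 \<le> sx x" for x
  proof (cases "\<exists>s. P x s")
    case True thus ?thesis using sx by (auto simp: P_def)
  qed (simp add: sx_def)
  show ?thesis
  proof (rule exI[of _ "sum sx k"], intro conjI allI impI)
    show "0 \<le> sum sx k" by (rule sum_nonneg) (rule sx0)
    fix s :: real assume s: "0 \<le> s"
    obtain x where x: "x \<in> k" "fr (s *\<^sub>R \<omega>) \<in> ball x (d / 2)" using k(2) frK[of "s *\<^sub>R \<omega>"] by blast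
    have Px: "P x (sx x)" by (rule sx[of x s]) (use s x(2) in \<open>unfold P_def, blast\<close>)
    have "sx x \<le> sum sx k" by (rule member_le_sum) (use x k sx0 in auto)
    moreover have "\<bar>qp_potential V \<omega> (s + t) - qp_potential V \<omega> (sx x + t)\<bar> \<le> e" for t
    proof -
      have a: "dist x (fr (s *\<^sub>R \<omega>)) < d / 2" "dist x (fr (sx x *\<^sub>R \<omega>)) < d / 2"
        using x(2) Px unfolding P_def mem_ball by blast+
      have "dist (fr (s *\<^sub>R \<omega>) + t *\<^sub>R \<omega>) (fr (sx x *\<^sub>R \<omega>) + t *\<^sub>R \<omega>) < d"
        using dist_triangle_half_r[OF a] by simp
      from d(2)[OF this] show ?thesis unfolding Vfr qp_potential_def scaleR_left_distrib by simp
    qed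
    ultimately show "\<exists>s'\<ge>0. s' \<le> sum sx k \<and> (\<forall>t\<ge>0. \<bar>qp_potential V \<omega> (s + t) - qp_potential V \<omega> (s' + t)\<bar> \<le> e)"
      using sx0 by blast
  qed
qed

section \<open>Gap lengths\<close>

text \<open>Since v + b = 1 and v - b = 1 / k, the map keeps the real part and divides the imaginary
  part by k, sending y' + i k y to y' + i y. It turns vectors by less than \<pi> / 2, so the Pruefer
  angle, defined at scale 1, has the same rotation number at every scale.\<close>

lemma schr_rescale:
  assumes k: "0 < k"
  shows "conjugate (schr_f q 1 E) (schr_g q 1 E) (schr_f q k E) (schr_g q k E)
    (\<lambda>_. of_real ((1 + 1 / k) / 2)) (\<lambda>_. of_real ((1 - 1 / k) / 2)) 0"
proof (rule conjugateI[where \<kappa> = "\<lambda>_. 0"])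
  define v where "v = (1 + 1 / k) / 2"
  define b where "b = (1 - 1 / k) / 2"
  have "\<bar>b\<bar> < v" 
  proof -
    have "\<bar>(1 - x) / 2\<bar> < (1 + x) / 2" if "0 < x" for x :: real using that by (auto simp: abs_less_iff)
    from this[of "1 / k"] show ?thesis using k by (simp add: v_def b_def)
  qed
  thus "cmod (of_real ((1 - 1 / k) / 2)) < Re (of_real ((1 + 1 / k) / 2))"
    unfolding v_def b_def norm_of_real Re_complex_of_real .
  have vb: "v + b = 1" "v - b = 1 / k" by (auto simp: v_def b_def field_simps)
  fix t
  define X where "X = E - q t"
  have f: "schr_f q 1 E t = (1 + X) / 2" "schr_g q 1 E t = \<i> * of_real ((1 - X) / 2)"
    "schr_f q k E t = (k\<^sup>2 + X) / (2 * k)" "schr_g q k E t = \<i> * of_real ((k\<^sup>2 - X) / (2 * k))"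
    by (auto simp: schr_f_def schr_g_def X_def algebra_simps)
  have v1: "v = 1 - b" and b1: "b = (1 - 1 / k) / 2" using vb(1) by (auto simp: b_def)
  have e1: "(1 + X) / 2 * v + (1 - X) / 2 * b - (k\<^sup>2 + X) / (2 * k) * v + (k\<^sup>2 - X) / (2 * k) * b = 0"
    unfolding v1 unfolding b1 using k by (simp add: field_simps power2_eq_square)
  have e2: "(1 + X) / 2 * b + (1 - X) / 2 * v - v * ((k\<^sup>2 - X) / (2 * k)) + (k\<^sup>2 + X) / (2 * k) * b = 0"
    unfolding v1 unfolding b1 using k by (simp add: field_simps power2_eq_square)
  have "\<i> * of_real (schr_f q 1 E t) * of_real v + schr_g q 1 E t * cnj (of_real b)
     - \<i> * of_real (schr_f q k E t) * of_real v - of_real b * cnj (schr_g q k E t) + of_real 0 * of_real v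
     = \<i> * of_real ((1 + X) / 2 * v + (1 - X) / 2 * b - (k\<^sup>2 + X) / (2 * k) * v + (k\<^sup>2 - X) / (2 * k) * b)"
    unfolding f by (simp add: complex_eq_iff)
  hence 1: "\<i> * of_real (schr_f q 1 E t) * of_real v + schr_g q 1 E t * cnj (of_real b)
     - \<i> * of_real (schr_f q k E t) * of_real v - of_real b * cnj (schr_g q k E t) + of_real 0 * of_real v = 0"
    unfolding e1 by simp
  have "\<i> * of_real (schr_f q 1 E t) * of_real b + schr_g q 1 E t * cnj (of_real v)
     - of_real v * schr_g q k E t + \<i> * of_real (schr_f q k E t) * of_real b + of_real 0 * of_real b
     = \<i> * of_real ((1 + X) / 2 * b + (1 - X) / 2 * v - v * ((k\<^sup>2 - X) / (2 * k)) + (k\<^sup>2 + X) / (2 * k) * b)"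
    unfolding f by (simp add: complex_eq_iff)
  hence 2: "\<i> * of_real (schr_f q 1 E t) * of_real b + schr_g q 1 E t * cnj (of_real v)
     - of_real v * schr_g q k E t + \<i> * of_real (schr_f q k E t) * of_real b + of_real 0 * of_real b = 0"
    unfolding e2 by simp
  show "((\<lambda>_. of_real ((1 + 1 / k) / 2)) has_vector_derivative
      \<i> * of_real (schr_f q 1 E t) * of_real ((1 + 1 / k) / 2) + schr_g q 1 E t * cnj (of_real ((1 - 1 / k) / 2))
     - \<i> * of_real (schr_f q k E t) * of_real ((1 + 1 / k) / 2) - of_real ((1 - 1 / k) / 2) * cnj (schr_g q k E t) + of_real 0 * of_real ((1 + 1 / k) / 2)) (at t)"
    unfolding v_def[symmetric] b_def[symmetric] 1 by (rule has_vector_derivative_const)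
  show "((\<lambda>_. of_real ((1 - 1 / k) / 2)) has_vector_derivative
      \<i> * of_real (schr_f q 1 E t) * of_real ((1 - 1 / k) / 2) + schr_g q 1 E t * cnj (of_real ((1 + 1 / k) / 2))
     - of_real ((1 + 1 / k) / 2) * schr_g q k E t + \<i> * of_real (schr_f q k E t) * of_real ((1 - 1 / k) / 2) + of_real 0 * of_real ((1 - 1 / k) / 2)) (at t)"
    unfolding v_def[symmetric] b_def[symmetric] 2 by (rule has_vector_derivative_const)
qed

lemma (in pruefer) rot_schr:
  assumes "((\<lambda>t. \<theta> E t / t) \<longlongrightarrow> r) at_top" "0 < k"
  shows "has_rot (schr_f q k E) (schr_g q k E) r"
proof -
  have "has_rot (schr_f q 1 E) (schr_g q 1 E) r"
    unfolding has_rot_def phase_iff using assms(1) \<theta>_deriv by blast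
  from rot_conjugate[OF schr_rescale[OF assms(2)] this] show ?thesis by simp
qed

text \<open>With \<open>\<delta> = exp (- l\<^sup>2 / 6)\<close> and \<open>\<bar>q\<bar> \<le> \<delta> ^ 8\<close>, the choice \<open>\<kappa> = max (sqrt E) \<delta>\<close> makes the constant part
  of the system nearly a rotation at every energy, at the price of the factor \<open>1 / \<kappa> \<le> 1 / \<delta>\<close> in the
  perturbation.\<close>

lemma (in diophantine) rotation_strictly_grows:
  fixes q :: "real \<Rightarrow> real" and C r Q l k
  defines "\<delta> \<equiv> exp (- (l\<^sup>2 / 6))"
  assumes l0: "\<And>l'. l' \<ge> l \<Longrightarrow> large l'" and l: "l \<ge> 1" "1 / l \<le> R" "1 / l \<le> R - r"
    and C: "0 < C" "20 * (C * \<delta>) \<le> 1" "82 * \<delta> ^ 3 \<le> 1"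
    and w: "wiener \<omega> UNIV (3 * R) (C * \<delta> ^ 8) (\<lambda>t. of_real (q t))"
    and q: "\<And>t. \<bar>q t\<bar> < \<delta> ^ 8"
    and \<theta>: "pruefer q Q \<theta>" and rot: "\<And>E. ((\<lambda>t. \<theta> E t / t) \<longlongrightarrow> rot E) at_top"
    and k: "k \<noteq> 0" "0 < int_inner k \<omega>" "rot E = pi * int_inner k \<omega>"
    and E': "E + exp (- (8 / 9 * l\<^sup>2)) * exp (- r * l1_norm k) \<le> E'"
  shows "rot E < rot E'"
proof -
  interpret pruefer q Q \<theta> by fact
  have \<delta>: "0 < \<delta>" "\<delta> \<le> 1" by (auto simp: \<delta>_def)
  have \<delta>p: "\<delta> ^ m \<le> \<delta> ^ n" if "n \<le> m" for m n using \<delta> that by (intro power_decreasing) auto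
  \<comment> \<open>Below the potential the angle never exceeds \<pi> / 2, so the rotation number
    would be 0, whereas the label is positive.\<close>
  have E0: "- (\<delta> ^ 8) \<le> E"
  proof (rule ccontr)
    assume "\<not> - (\<delta> ^ 8) \<le> E"
    hence lt: "E < q t" for t using q[of t] by (simp add: abs_less_iff)
    have "\<bar>\<theta> E t\<bar> \<le> pi / 2" if "t \<ge> 0" for t
    proof -
      have "0 \<le> \<theta> E t" using \<theta>_pos[of t E] \<theta>_0[of E] that by (cases "t = 0") auto
      thus ?thesis using \<theta>_low[of E, OF lt that] by simp
    qed
    hence "((\<lambda>t. \<theta> E t / t) \<longlongrightarrow> 0) at_top" by (rule bounded_over_t)
    hence "rot E = 0" using rot[of E] tendsto_unique[OF trivial_limit_at_top_linorder] by blast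
    thus False using k by simp
  qed
  define \<kappa> where "\<kappa> = (if \<delta>\<^sup>2 \<le> E then sqrt E else \<delta>)"
  have \<kappa>\<delta>: "\<delta> \<le> \<kappa>" unfolding \<kappa>_def using real_le_rsqrt[of \<delta> E] by simp
  have \<kappa>0: "0 < \<kappa>" using \<kappa>\<delta> \<delta> by linarith
  have E0': "0 \<le> E" if "\<delta>\<^sup>2 \<le> E" using that zero_le_power2[of \<delta>] by linarith
  have \<kappa>E: "E \<le> \<kappa>\<^sup>2" "\<bar>\<kappa>\<^sup>2 - E\<bar> \<le> 2 * \<delta>\<^sup>2"
  proof -
    have "E \<le> \<kappa>\<^sup>2 \<and> \<bar>\<kappa>\<^sup>2 - E\<bar> \<le> 2 * \<delta>\<^sup>2"
    proof (cases "\<delta>\<^sup>2 \<le> E")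
      case True
      thus ?thesis using E0'[OF True] by (simp add: \<kappa>_def)
    next
      case False
      hence "\<kappa>\<^sup>2 = \<delta>\<^sup>2" by (simp add: \<kappa>_def)
      thus ?thesis using False E0 \<delta>p[of 2 8] by simp
    qed
    thus "E \<le> \<kappa>\<^sup>2" "\<bar>\<kappa>\<^sup>2 - E\<bar> \<le> 2 * \<delta>\<^sup>2" by blast+
  qed
  define a where "a = \<i> * complex_of_real ((\<kappa>\<^sup>2 - E) / (2 * \<kappa>))"
  define \<alpha> where "\<alpha> = (\<kappa>\<^sup>2 + E) / (2 * \<kappa>)"
  define f where "f t = - q t / (2 * \<kappa>)" for t
  define g where "g t = \<i> * complex_of_real (q t / (2 * \<kappa>))" for t
  \<comment> \<open>As exp (- l^2) = \<delta>^6, the rescaled perturbation C \<delta>^8 / (2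
    \<kappa>) equals \<beta> exp (- l^2). So \<beta> is the amplitude factor for \<open>kam\<close>;
    it is at most 1 because \<kappa> \<ge> \<delta> and C \<delta> is small.\<close>
  define \<beta> where "\<beta> = C * \<delta>\<^sup>2 / (2 * \<kappa>)"
  have fg: "schr_f q \<kappa> E = (\<lambda>t. \<alpha> + f t)" "schr_g q \<kappa> E = (\<lambda>t. a + g t)"
    by (auto simp: fun_eq_iff schr_f_def schr_g_def \<alpha>_def a_def f_def g_def diff_divide_distrib add_divide_distrib algebra_simps)
  have a1: "cmod a \<le> 1"
  proof -
    have "cmod a = \<bar>\<kappa>\<^sup>2 - E\<bar> / (2 * \<kappa>)" using \<kappa>0 unfolding a_def norm_mult norm_ii norm_of_real abs_divide by simp
    also have "\<dots> \<le> 2 * \<delta>\<^sup>2 / (2 * \<delta>)" using \<kappa>E(2) \<kappa>\<delta> \<delta> by (intro frac_le) auto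
    also have "\<dots> = \<delta>" using \<delta> by (simp add: power2_eq_square)
    finally show ?thesis using \<delta> by simp
  qed
  have \<beta>: "0 < \<beta>" "\<beta> \<le> 1"
  proof -
    show "0 < \<beta>" using C \<delta> \<kappa>0 by (simp add: \<beta>_def)
    have "\<beta> \<le> C * \<delta>\<^sup>2 / (2 * \<delta>)" unfolding \<beta>_def using C \<delta> \<kappa>\<delta> by (intro divide_left_mono) auto
    also have "\<dots> = C * \<delta> / 2" using \<delta> by (simp add: power2_eq_square)
    finally show "\<beta> \<le> 1" using C by simp
  qed
  have \<eta>: "exp (- l\<^sup>2) = \<delta> ^ 6" by (simp add: \<delta>_def flip: exp_of_nat_mult)
  have rate: "R + 2 / l \<le> 3 * R" using l by simp
  have W: "wiener \<omega> UNIV (R + 2 / l) (\<beta> * exp (- l\<^sup>2)) (\<lambda>t. c * of_real (q t))" if "cmod c = 1 / (2 * \<kappa>)" for c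
  proof (rule wiener_mono[OF wiener_cmult[OF w, of c] subset_UNIV _ rate])
    show "cmod c * (C * \<delta> ^ 8) \<le> \<beta> * exp (- l\<^sup>2)" unfolding that \<eta> \<beta>_def by (simp flip: power_add add: mult.assoc)
  qed
  have Wf: "wiener \<omega> UNIV (R + 2 / l) (\<beta> * exp (- l\<^sup>2)) (\<lambda>t. of_real (f t))"
    using W[of "of_real (- (1 / (2 * \<kappa>)))"] \<kappa>0 by (simp add: f_def norm_divide)
  have Wg: "wiener \<omega> UNIV (R + 2 / l) (\<beta> * exp (- l\<^sup>2)) g"
    using W[of "\<i> * of_real (1 / (2 * \<kappa>))"] \<kappa>0 by (simp add: g_def[abs_def] norm_divide norm_mult)
  have rE: "has_rot (schr_f q \<kappa> E) (schr_g q \<kappa> E) (rot E)" by (rule rot_schr[OF rot \<kappa>0])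
  have "almost_reducible l (\<lambda>t. \<alpha> + f t) (\<lambda>t. a + g t) k \<beta>"
    by (rule kam[OF l0 order_refl l(1) a1 \<beta> k(1) Wf Wg]) (use rE in \<open>simp_all add: fg k(3)\<close>)
  then obtain v b \<sigma> \<alpha>' e \<Gamma> f' g' where red: "conjugate (schr_f q \<kappa> E) (schr_g q \<kappa> E) (\<lambda>t. \<alpha>' + f' t) g' v b \<sigma>"
    "\<And>t. \<bar>f' t\<bar> \<le> e" "\<And>t. cmod (g' t) \<le> e" "0 < e" "1 \<le> \<Gamma>" "cond_le v b \<Gamma>"
    and e: "e * \<Gamma> ^ 4 \<le> \<beta> * exp (- (3 / 4 * l\<^sup>2)) * exp (- ((R - 1 / l) * l1_norm k))"
    unfolding almost_reducible_def fg by blast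
  define D where "D = exp (- ((R - 1 / l) * l1_norm k))"
  have "r \<le> R - 1 / l" using l by simp
  hence Dr: "D \<le> exp (- r * l1_norm k)"
    unfolding D_def using mult_right_mono[OF _ l1_norm_nonneg, of r "R - 1 / l" k] by simp
  have D1: "0 < D" "D \<le> 1"
    unfolding D_def using l l1_norm_nonneg[of k] by auto
  have x: "exp (- (3 / 4 * l\<^sup>2)) \<le> \<delta> ^ 4"
    by (simp add: \<delta>_def flip: exp_of_nat_mult)
  have small: "82 * (e * \<Gamma> ^ 4) \<le> \<kappa>"
  proof -
    have "e * \<Gamma> ^ 4 \<le> 1 * \<delta> ^ 4 * 1"
      using e unfolding D_def[symmetric]
      by (rule order_trans) (intro mult_mono \<beta> x D1, use \<beta> D1 \<delta> in auto)
    hence "82 * (e * \<Gamma> ^ 4) \<le> (82 * \<delta> ^ 3) * \<delta>" by (simp add: power_numeral_reduce)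
    also have "\<dots> \<le> 1 * \<delta>" using C(3) \<delta> by (intro mult_right_mono) auto
    finally show ?thesis using \<kappa>\<delta> by simp
  qed
  \<comment> \<open>The shift for which \<open>rotation_growth\<close> guarantees a gain. Its factor
    \<kappa> cancels the one in \<beta>, since 40 \<kappa> \<beta> = 20 C \<delta>^2, and the bound
    becomes uniform in the energy.\<close>
  define E1 where "E1 = E + \<kappa> * (40 * e * \<Gamma>)"
  have "E1 \<le> E'"
  proof -
    have "\<Gamma> * 1 \<le> \<Gamma> * \<Gamma> ^ 3" using red(5) by (intro mult_left_mono one_le_power) auto
    hence "\<Gamma> \<le> \<Gamma> ^ 4" by (simp add: power_numeral_reduce)
    hence "\<kappa> * (40 * e * \<Gamma>) \<le> \<kappa> * (40 * e * \<Gamma> ^ 4)" using \<kappa>0 red(4) by (intro mult_left_mono) auto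
    also have "\<dots> = 40 * \<kappa> * (e * \<Gamma> ^ 4)" by simp
    also have "\<dots> \<le> 40 * \<kappa> * (\<beta> * exp (- (3 / 4 * l\<^sup>2)) * D)"
      using e \<kappa>0 unfolding D_def by (intro mult_left_mono) auto
    also have "\<dots> = 20 * C * \<delta>\<^sup>2 * exp (- (3 / 4 * l\<^sup>2)) * D" using \<kappa>0 by (simp add: \<beta>_def)
    also have "\<dots> = 20 * (C * \<delta>) * (\<delta> * exp (- (3 / 4 * l\<^sup>2)) * D)" by (simp add: power2_eq_square)
    also have "\<dots> \<le> 1 * (\<delta> * exp (- (3 / 4 * l\<^sup>2)) * D)"
      using C(2) \<delta> D1 by (intro mult_right_mono) auto
    \<comment> \<open>One power of \<delta> has absorbed the constant 20 C; the other, with the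
      factor from \<open>kam\<close>, gives the exponent 1/6 + 3/4 = 11/12, which exceeds
      8/9.\<close>
    also have "\<dots> = exp (- (l\<^sup>2 / 6) + - (3 / 4 * l\<^sup>2)) * D" by (simp only: \<delta>_def exp_add mult_1_left)
    also have "\<dots> \<le> exp (- (8 / 9 * l\<^sup>2)) * exp (- r * l1_norm k)"
      using Dr D1 by (intro mult_mono) auto
    finally show ?thesis using E' by (simp add: E1_def)
  qed
  have "rot E < rot E1"
  proof (rule rotation_growth[OF red(1-4,6,5) \<kappa>0 small _ rE])
    show "has_rot (schr_f q \<kappa> (E + \<kappa> * (40 * e * \<Gamma>))) (schr_g q \<kappa> (E + \<kappa> * (40 * e * \<Gamma>))) (rot E1)"
      unfolding E1_def[symmetric] by (rule rot_schr[OF rot \<kappa>0])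
    fix t
    have "\<delta> ^ 8 \<le> \<kappa>\<^sup>2"
    proof -
      have "\<delta>\<^sup>2 \<le> \<kappa>\<^sup>2" using \<kappa>\<delta> \<delta> by (intro power_mono) auto
      thus ?thesis using \<delta>p[of 2 8] by simp
    qed
    thus "E - q t \<le> 2 * \<kappa>\<^sup>2" using \<kappa>E(1) q[of t] by (simp add: abs_less_iff)
  qed
  also have "rot E1 \<le> rot E'"
  proof (rule tendsto_le[OF trivial_limit_at_top_linorder rot rot])
    show "\<forall>\<^sub>F t in at_top. \<theta> E1 t / t \<le> \<theta> E' t / t"
      using eventually_gt_at_top[of 0]
      by eventually_elim (use \<theta>_mono[OF \<open>E1 \<le> E'\<close>] in \<open>simp add: divide_right_mono\<close>)
  qed
  finally show ?thesis .
qed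

lemma emeasure_le_diameter:
  fixes A :: "real set"
  assumes "\<And>x y. x \<in> A \<Longrightarrow> y \<in> A \<Longrightarrow> y \<le> x + B"
  shows "emeasure lborel A \<le> ennreal B"
proof (cases "A = {}")
  case False
  then obtain x where x: "x \<in> A" by blast
  have B: "0 \<le> B" using assms[OF x x] by simp
  have bdd: "bdd_below A" using assms[OF _ x] by (intro bdd_belowI[of _ "x - B"]) (simp add: algebra_simps)
  have "A \<subseteq> {Inf A..Inf A + B}"
  proof
    fix y assume y: "y \<in> A"
    have "y - B \<le> Inf A" using assms[OF _ y] False by (intro cInf_greatest) (auto simp: algebra_simps)
    moreover have "Inf A \<le> y" by (rule cInf_lower[OF y bdd])
    ultimately show "y \<in> {Inf A..Inf A + B}" by simp
  qed
  hence "emeasure lborel A \<le> emeasure lborel {Inf A..Inf A + B}" by (rule emeasure_mono) simp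
  thus ?thesis using B by simp
qed simp

lemma DC_diophantine:
  assumes "CARD('d::finite) \<ge> 2" "(\<omega> :: real ^ 'd) \<in> DC" "R > 0"
  obtains \<gamma> \<tau> where "diophantine \<omega> \<gamma> \<tau> R"
proof -
  from assms(2) obtain \<gamma> \<tau> where g: "\<gamma> > 0" "\<tau> > real CARD('d) - 1" "\<omega> \<in> DC_const \<gamma> \<tau>"
    unfolding DC_def by auto
  have "\<gamma> * l1_norm n powr (- \<tau>) \<le> \<bar>int_inner n \<omega>\<bar>" if "n \<noteq> 0" for n
  proof -
    have "\<gamma> * l1_norm n powr (- \<tau>) < (INF j::int. \<bar>int_inner n \<omega> - real_of_int j\<bar>)"
      using g(3) that by (simp add: DC_const_def)
    \<comment> \<open>For a flow the small divisors are \<langle>n, \<omega>\<rangle> itself, so the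
      infimum is evaluated at j = 0.\<close>
    also have "\<dots> \<le> \<bar>int_inner n \<omega> - real_of_int 0\<bar>"
      by (rule cINF_lower) (auto intro!: bdd_belowI2[of _ 0])
    finally show ?thesis by simp
  qed
  moreover have "\<tau> > 0" using g(2) assms(1) by linarith
  ultimately have "diophantine \<omega> \<gamma> \<tau> R" using g(1) assms(3) by unfold_locales
  thus ?thesis by (rule that)
qed

theorem theorem6p3:
  fixes \<omega> :: "real ^ 'd::finite" and r0 r :: real
  assumes "CARD('d) \<ge> 2"
    and "\<omega> \<in> DC"
    and "r0 > 0"
    and "0 < r" and "r < r0"
  shows "\<exists>\<epsilon>0 > 0. \<forall>V \<in> C_omega r0. strip_norm r0 V < \<epsilon>0 \<longrightarrow>
           (\<forall>k :: int ^ 'd. k \<noteq> 0 \<longrightarrow>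
              emeasure lborel (gap V \<omega> k) \<le> ennreal (\<epsilon>0 powr (2/3) * exp (- r * l1_norm k)))"
proof -
  obtain \<gamma> \<tau> where D: "diophantine \<omega> \<gamma> \<tau> r0" by (rule DC_diophantine[OF assms(1-3)]) (rule that)
  interpret diophantine \<omega> \<gamma> \<tau> r0 by (rule D)
  obtain C where C: "C > 0" "\<And>F M. periodic_analytic r0 M F \<Longrightarrow> wiener \<omega> UNIV (3 * r0) (C * M) (\<lambda>t. F (\<chi> j. of_real (t * \<omega> $ j)))"
    by (rule periodic_analytic_wiener[OF assms(3), of \<omega>]) (rule that)
  have lim: "((\<lambda>l::real. exp (- (l\<^sup>2 / 6))) \<longlongrightarrow> 0) at_top" by real_asymp
  have "((\<lambda>l::real. 20 * (C * exp (- (l\<^sup>2 / 6)))) \<longlongrightarrow> 20 * (C * 0)) at_top" by (intro tendsto_intros lim)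
  hence ev1: "\<forall>\<^sub>F l::real in at_top. 20 * (C * exp (- (l\<^sup>2 / 6))) \<le> 1"
    using order_tendstoD(2)[where a = 1] by (fastforce elim: eventually_mono)
  have "((\<lambda>l::real. 82 * exp (- (l\<^sup>2 / 6)) ^ 3) \<longlongrightarrow> 82 * 0 ^ 3) at_top" by (intro tendsto_intros lim)
  hence ev2: "\<forall>\<^sub>F l::real in at_top. 82 * exp (- (l\<^sup>2 / 6)) ^ 3 \<le> 1"
    using order_tendstoD(2)[where a = 1] by (fastforce elim: eventually_mono)
  have "\<forall>\<^sub>F l in at_top. large l \<and> 20 * (C * exp (- (l\<^sup>2 / 6))) \<le> 1 \<and> 82 * exp (- (l\<^sup>2 / 6)) ^ 3 \<le> 1
     \<and> 1 \<le> l \<and> 1 / r0 \<le> l \<and> 1 / (r0 - r) \<le> l"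
    by (intro eventually_conj eventually_large ev1 ev2 eventually_ge_at_top)
  then obtain l where l: "\<And>l'. l' \<ge> l \<Longrightarrow> large l' \<and> 20 * (C * exp (- (l'\<^sup>2 / 6))) \<le> 1 \<and> 82 * exp (- (l'\<^sup>2 / 6)) ^ 3 \<le> 1
     \<and> 1 \<le> l' \<and> 1 / r0 \<le> l' \<and> 1 / (r0 - r) \<le> l'"
    unfolding eventually_at_top_linorder by blast
  \<comment> \<open>This is \<delta>^8 for \<delta> = exp (- l^2 / 6), the size of potential that
    \<open>rotation_strictly_grows\<close> handles; its power 2/3 is the factor exp (- 8/9 l^2)
    obtained there.\<close>
  define \<epsilon>0 where "\<epsilon>0 = exp (- (4 / 3 * l\<^sup>2))"
  have \<epsilon>8: "\<epsilon>0 = exp (- (l\<^sup>2 / 6)) ^ 8" by (simp add: \<epsilon>0_def flip: exp_of_nat_mult)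
  have \<epsilon>23: "\<epsilon>0 powr (2 / 3) = exp (- (8 / 9 * l\<^sup>2))" by (simp add: \<epsilon>0_def powr_def)
  have l1: "l \<ge> 1" using l[of l] by simp
  have l2: "1 / l \<le> r0" "1 / l \<le> r0 - r"
    using l[of l] l1 assms by (auto simp: field_simps)
  show ?thesis
  proof (intro exI[of _ \<epsilon>0] conjI ballI impI allI)
    show "\<epsilon>0 > 0" by (simp add: \<epsilon>0_def)
    fix V :: "real ^ 'd \<Rightarrow> real" and k :: "int ^ 'd"
    assume V: "V \<in> C_omega r0" "strip_norm r0 V < \<epsilon>0" and k: "k \<noteq> 0"
    define q where "q = qp_potential V \<omega>"
    have per: "V (\<chi> j. x $ j + of_int (n $ j)) = V x" for x and n :: "int ^ 'd"
      using V(1) by (simp add: C_omega_def)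
    have Vc: "continuous_on UNIV V" by (rule C_omega_continuous[OF V(1) assms(3)])
    have qc: "continuous_on UNIV q"
      unfolding q_def qp_potential_def
      by (rule continuous_on_compose2[OF Vc]) (auto intro!: continuous_intros)
    have qb: "\<bar>q t\<bar> < \<epsilon>0" for t
      using C_omega_bound[OF V(1) assms(3), of "t *\<^sub>R \<omega>"] V(2) by (simp add: q_def qp_potential_def)
    obtain F where F: "periodic_analytic r0 (strip_norm r0 V) F" "\<And>x. F (\<chi> j. complex_of_real (x $ j)) = complex_of_real (V x)"
      by (rule C_omega_extension[OF V(1) assms(3)]) (rule that)
    have "F (\<chi> j. of_real (t * \<omega> $ j)) = of_real (q t)" for t
      using F(2)[of "t *\<^sub>R \<omega>"] by (simp add: q_def qp_potential_def)
    hence "wiener \<omega> UNIV (3 * r0) (C * strip_norm r0 V) (\<lambda>t. of_real (q t))" using C(2)[OF F(1)] by simp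
    hence w: "wiener \<omega> UNIV (3 * r0) (C * \<epsilon>0) (\<lambda>t. of_real (q t))"
      by (rule wiener_mono) (use V(2) C(1) in auto)
    obtain \<theta> where \<theta>: "pruefer q \<epsilon>0 \<theta>" using pruefer_exists[OF qc, of \<epsilon>0] qb less_imp_le by blast
    interpret P: pruefer q \<epsilon>0 \<theta> by (rule \<theta>)
    have "\<forall>E. \<exists>\<rho>. ((\<lambda>t. \<theta> E t / t) \<longlongrightarrow> \<rho>) at_top"
      by (intro allI P.limit_exists) (unfold q_def, rule qp_almost_periodic[OF per Vc])
    from choice[OF this] obtain rot where rot: "\<And>E. ((\<lambda>t. \<theta> E t / t) \<longlongrightarrow> rot E) at_top" by blast
    have IDS: "IDS V \<omega> E = rot E / pi" for E
      unfolding IDS_def q_def[symmetric]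
      by (rule tendsto_Lim[OF trivial_limit_at_top_linorder P.eigenvalue_density[OF rot]])
    show "emeasure lborel (gap V \<omega> k) \<le> ennreal (\<epsilon>0 powr (2/3) * exp (- r * l1_norm k))"
    proof (cases "int_inner k \<omega> > 0")
      case True
      show ?thesis
      \<comment> \<open>Two points of the gap farther apart than the bound would have strictly
        ordered rotation numbers, although both equal \<pi> \<langle>k, \<omega>\<rangle>.\<close>
      proof (rule emeasure_le_diameter, rule ccontr)
        fix x y assume xy: "x \<in> gap V \<omega> k" "y \<in> gap V \<omega> k"
          and "\<not> y \<le> x + \<epsilon>0 powr (2/3) * exp (- r * l1_norm k)"
        hence le: "x + exp (- (8 / 9 * l\<^sup>2)) * exp (- r * l1_norm k) \<le> y" by (simp add: \<epsilon>23)
        have g: "rot z = pi * int_inner k \<omega>" if "z \<in> gap V \<omega> k" for z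
        proof -
          have "z \<in> {E. IDS V \<omega> E = int_inner k \<omega>}" using that True interior_subset unfolding gap_def by auto
          thus ?thesis by (simp add: IDS field_simps)
        qed
        have "rot x < rot y"
        proof (rule rotation_strictly_grows[OF _ l1 l2 C(1) _ _ _ _ \<theta> rot k True g[OF xy(1)] le])
          show "large l'" if "l' \<ge> l" for l' using l[OF that] by blast
          show "20 * (C * exp (- (l\<^sup>2 / 6))) \<le> 1" "82 * exp (- (l\<^sup>2 / 6)) ^ 3 \<le> 1" using l[of l] by auto
        qed (use w qb in \<open>simp_all add: \<epsilon>8\<close>)
        thus False using g[OF xy(1)] g[OF xy(2)] by simp
      qed
    qed (simp add: gap_def)
  qed
qed

end
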